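(* Let $\mathcal{G}=(S,E)$ be a graph with set of coherent components $\Lambda$ and quotient graph edge set $\overline{E}$, let $c>1$ be an integer and $\mathfrak{n}^{\mathbb{Q}}_{\mathcal{G},c}$ the associated rational $c$-step nilpotent Lie algebra. Then $\mathfrak{n}^{\mathbb{Q}}_{\mathcal{G},c}$ is Anosov if and only if $|\lambda|>1$ for any $\lambda\in\Lambda$ and for any edge $e\in\overline{E}$ of the quotient graph we have $\sum_{\lambda\in e}|\lambda|>c$.
   Context: A graph $\mathcal{G}=(S,E)$ is simple and undirected: $S$ is a finite set of vertices and $E$ is a set of 2-element subsets of $S$. Two vertices are equivalent if the transposition exchanging them and fixing all other vertices is a graph automorphism (a vertex is equivalent to itself). The equivalence classes are the coherent components; $\Lambda$ is the set of them. The edge set of the quotient graph is $\overline{E}=\{\{\lambda,\mu\}\mid \lambda,\mu\in\Lambda,\ \exists\alpha\in\lambda,\beta\in\mu:\{\alpha,\beta\}\in E\}$; loops are allowed, a loop being the one-element set $e=\{\lambda\}$, for which $\sum_{\mu\in e}|\mu|=|\lambda|$. Let $\mathfrak{f}^{\mathbb{Q}}(S)$ be the free rational Lie algebra on $S$, $\mathfrak{g}^{\mathbb{Q}}_{\mathcal{G}}$ its quotient by the ideal generated by all $[\alpha,\beta]$ with $\alpha,\beta\in S$, $\{\alpha,\beta\}\notin E$, and $\mathfrak{n}^{\mathbb{Q}}_{\mathcal{G},c}=\mathfrak{g}^{\mathbb{Q}}_{\mathcal{G}}/\gamma_{c+1}(\mathfrak{g}^{\mathbb{Q}}_{\mathcal{G}})$,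 where $\gamma_1(\mathfrak g)=\mathfrak g$, $\gamma_{i+1}(\mathfrak g)=[\mathfrak g,\gamma_i(\mathfrak g)]$. A finite dimensional rational Lie algebra is Anosov if it admits a Lie algebra automorphism that is hyperbolic (no complex eigenvalue of absolute value 1) and integer-like (characteristic polynomial has integer coefficients and constant term $\pm1$). *)

theory Defs
  imports
    "Jordan_Normal_Form.VS_Connect"
    "Jordan_Normal_Form.Char_Poly"
    "HOL-Algebra.AbelCoset"
    "HOL-Library.Poly_Mapping"
    "HOL-Combinatorics.Transposition"
begin

hide_const (open) Multiset.mult Polynomial.smult

section \<open>Graphs, coherent components and the quotient graph\<close>

definition simple_graph :: "'v set \<Rightarrow> 'v set set \<Rightarrow> bool" where
  "simple_graph S E \<longleftrightarrow> finite S \<and> (\<forall>e\<in>E. e \<subseteq> S \<and> card e = 2)"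

definition graph_automorphism :: "'v set \<Rightarrow> 'v set set \<Rightarrow> ('v \<Rightarrow> 'v) \<Rightarrow> bool" where
  "graph_automorphism S E \<pi> \<longleftrightarrow>
     bij_betw \<pi> S S \<and> (\<forall>\<alpha>\<in>S. \<forall>\<beta>\<in>S. {\<pi> \<alpha>, \<pi> \<beta>} \<in> E \<longleftrightarrow> {\<alpha>, \<beta>} \<in> E)"

definition coherent_rel :: "'v set \<Rightarrow> 'v set set \<Rightarrow> ('v \<times> 'v) set" where
  "coherent_rel S E =
     {(\<alpha>, \<beta>). \<alpha> \<in> S \<and> \<beta> \<in> S \<and> graph_automorphism S E (Transposition.transpose \<alpha> \<beta>)}"

definition coherent_components :: "'v set \<Rightarrow> 'v set set \<Rightarrow> 'v set set" where
  "coherent_components S E = S // coherent_rel S E"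

text \<open>A loop at \<open>\<lambda>\<close> is the singleton \<open>{\<lambda>, \<lambda>} = {\<lambda>}\<close>.\<close>

definition quotient_edges :: "'v set \<Rightarrow> 'v set set \<Rightarrow> 'v set set set" where
  "quotient_edges S E =
     {{l, m} | l m. l \<in> coherent_components S E \<and> m \<in> coherent_components S E \<and>
                    (\<exists>\<alpha>\<in>l. \<exists>\<beta>\<in>m. {\<alpha>, \<beta>} \<in> E)}"


section \<open>Rational Lie algebras\<close>

text \<open>Algebras are \<open>module\<close> records with an additional product \<open>bracket\<close>. The fields \<open>mult\<close>
  and \<open>one\<close> inherited from \<open>ring\<close> play no role and are left \<open>undefined\<close>.\<close>

record ('a, 'b) bracket_algebra = "('a, 'b) module" +
  bracket :: "'b \<Rightarrow> 'b \<Rightarrow> 'b"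

abbreviation rat_field :: "rat ring" where
  "rat_field \<equiv> class_ring"

locale lie_algebra = vectorspace rat_field L
  for L :: "(rat, 'b, 'm) bracket_algebra_scheme" (structure) +
  assumes bracket_closed:
      "\<lbrakk>x \<in> carrier L; y \<in> carrier L\<rbrakk> \<Longrightarrow> bracket L x y \<in> carrier L"
    and bracket_add_left:
      "\<lbrakk>x \<in> carrier L; y \<in> carrier L; z \<in> carrier L\<rbrakk>
        \<Longrightarrow> bracket L (x \<oplus> y) z = bracket L x z \<oplus> bracket L y z"
    and bracket_add_right:
      "\<lbrakk>x \<in> carrier L; y \<in> carrier L; z \<in> carrier L\<rbrakk>
        \<Longrightarrow> bracket L x (y \<oplus> z) = bracket L x y \<oplus> bracket L x z"
    and bracket_smult_left:
      "\<lbrakk>x \<in> carrier L; y \<in> carrier L\<rbrakk>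
        \<Longrightarrow> bracket L (r \<odot>\<^bsub>L\<^esub> x) y = r \<odot>\<^bsub>L\<^esub> bracket L x y"
    and bracket_smult_right:
      "\<lbrakk>x \<in> carrier L; y \<in> carrier L\<rbrakk>
        \<Longrightarrow> bracket L x (r \<odot>\<^bsub>L\<^esub> y) = r \<odot>\<^bsub>L\<^esub> bracket L x y"
    and bracket_self: "x \<in> carrier L \<Longrightarrow> bracket L x x = \<zero>"
    and jacobi:
      "\<lbrakk>x \<in> carrier L; y \<in> carrier L; z \<in> carrier L\<rbrakk>
        \<Longrightarrow> bracket L x (bracket L y z) \<oplus> bracket L y (bracket L z x)
             \<oplus> bracket L z (bracket L x y) = \<zero>"

text \<open>Two-sided, since the notion is also applied to an algebra that is not yet a Lie algebra.\<close>

definition bracket_ideal :: "(rat, 'b, 'm) bracket_algebra_scheme \<Rightarrow> 'b set \<Rightarrow> bool" where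
  "bracket_ideal L I \<longleftrightarrow>
     LinearCombinations.submodule rat_field I L \<and>
     (\<forall>x\<in>carrier L. \<forall>y\<in>I. bracket L x y \<in> I \<and> bracket L y x \<in> I)"

definition ideal_generated :: "(rat, 'b, 'm) bracket_algebra_scheme \<Rightarrow> 'b set \<Rightarrow> 'b set" where
  "ideal_generated L X = \<Inter> {I. bracket_ideal L I \<and> X \<subseteq> I}"

definition quotient_algebra ::
  "(rat, 'b, 'm) bracket_algebra_scheme \<Rightarrow> 'b set \<Rightarrow> (rat, 'b set) bracket_algebra" where
  "quotient_algebra L I =
     \<lparr>carrier = a_rcosets\<^bsub>L\<^esub> I, mult = undefined, one = undefined,
      zero = I, add = (<+>\<^bsub>L\<^esub>),
      smult = (\<lambda>r X. \<Union>x\<in>X. I +>\<^bsub>L\<^esub> (r \<odot>\<^bsub>L\<^esub> x)),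
      bracket = (\<lambda>X Y. \<Union>x\<in>X. \<Union>y\<in>Y. I +>\<^bsub>L\<^esub> bracket L x y)\<rparr>"

text \<open>\<open>lower_central L i\<close> is \<open>\<gamma>\<^sub>i(L)\<close>, indexed from \<open>1\<close>; the value at \<open>0\<close> is a dummy. The
  bracket of two subspaces is the span of the brackets of their elements.\<close>

fun lower_central :: "(rat, 'b, 'm) bracket_algebra_scheme \<Rightarrow> nat \<Rightarrow> 'b set" where
  "lower_central L 0 = carrier L"
| "lower_central L (Suc 0) = carrier L"
| "lower_central L (Suc (Suc i)) =
     LinearCombinations.module.span rat_field L
       {bracket L x y | x y. x \<in> carrier L \<and> y \<in> lower_central L (Suc i)}"


section \<open>The free Lie algebra and the Lie algebra of a graph\<close>

text \<open>The free Lie algebra is the free non-associative algebra (finitely supported functions on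
  the free magma, that is, on binary trees with leaves in \<open>S\<close>) modulo the ideal generated by the
  squares and the Jacobi sums.\<close>

datatype 'v magma = Gen 'v | Prod "'v magma" "'v magma"

definition free_nonassoc :: "'v set \<Rightarrow> (rat, 'v magma \<Rightarrow>\<^sub>0 rat) bracket_algebra" where
  "free_nonassoc S =
     \<lparr>carrier = {p. \<forall>t\<in>Poly_Mapping.keys p. set_magma t \<subseteq> S},
      mult = undefined, one = undefined, zero = 0, add = (+),
      smult = (\<lambda>r. Poly_Mapping.map ((*) r)),
      bracket = (\<lambda>p q. \<Sum>s\<in>Poly_Mapping.keys p. \<Sum>t\<in>Poly_Mapping.keys q.
        Poly_Mapping.single (Prod s t) (Poly_Mapping.lookup p s * Poly_Mapping.lookup q t))\<rparr>"

definition lie_relators :: "'v set \<Rightarrow> ('v magma \<Rightarrow>\<^sub>0 rat) set" where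
  "lie_relators S = (let A = free_nonassoc S in
     {bracket A x x | x. x \<in> carrier A} \<union>
     {bracket A x (bracket A y z) + bracket A y (bracket A z x) + bracket A z (bracket A x y)
       | x y z. x \<in> carrier A \<and> y \<in> carrier A \<and> z \<in> carrier A})"

definition free_lie_ideal :: "'v set \<Rightarrow> ('v magma \<Rightarrow>\<^sub>0 rat) set" where
  "free_lie_ideal S = ideal_generated (free_nonassoc S) (lie_relators S)"

definition free_lie :: "'v set \<Rightarrow> (rat, ('v magma \<Rightarrow>\<^sub>0 rat) set) bracket_algebra" where
  "free_lie S = quotient_algebra (free_nonassoc S) (free_lie_ideal S)"

definition free_lie_gen :: "'v set \<Rightarrow> 'v \<Rightarrow> ('v magma \<Rightarrow>\<^sub>0 rat) set" where
  "free_lie_gen S \<alpha> =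
     free_lie_ideal S +>\<^bsub>free_nonassoc S\<^esub> Poly_Mapping.single (Gen \<alpha>) 1"

definition graph_lie ::
  "'v set \<Rightarrow> 'v set set \<Rightarrow> (rat, ('v magma \<Rightarrow>\<^sub>0 rat) set set) bracket_algebra" where
  "graph_lie S E = quotient_algebra (free_lie S) (ideal_generated (free_lie S)
     {bracket (free_lie S) (free_lie_gen S \<alpha>) (free_lie_gen S \<beta>)
       | \<alpha> \<beta>. \<alpha> \<in> S \<and> \<beta> \<in> S \<and> {\<alpha>, \<beta>} \<notin> E})"

definition nilpotent_graph_lie ::
  "'v set \<Rightarrow> 'v set set \<Rightarrow> nat \<Rightarrow> (rat, ('v magma \<Rightarrow>\<^sub>0 rat) set set set) bracket_algebra" where
  "nilpotent_graph_lie S E c =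
     quotient_algebra (graph_lie S E) (lower_central (graph_lie S E) (c + 1))"


section \<open>Anosov Lie algebras\<close>

definition lie_automorphism ::
  "(rat, 'b, 'm) bracket_algebra_scheme \<Rightarrow> ('b \<Rightarrow> 'b) \<Rightarrow> bool" where
  "lie_automorphism L f \<longleftrightarrow>
     f \<in> LinearCombinations.module_hom rat_field L L \<and> bij_betw f (carrier L) (carrier L) \<and>
     (\<forall>x\<in>carrier L. \<forall>y\<in>carrier L. f (bracket L x y) = bracket L (f x) (f y))"

definition matrix_of ::
  "(rat, 'b, 'm) bracket_algebra_scheme \<Rightarrow> ('b \<Rightarrow> 'b) \<Rightarrow> rat mat \<Rightarrow> bool" where
  "matrix_of L f A \<longleftrightarrow>
     (\<exists>bs. distinct bs \<and> vectorspace.basis rat_field L (set bs) \<and>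
           A \<in> carrier_mat (length bs) (length bs) \<and>
           (\<forall>j<length bs. f (bs ! j) =
              (\<Oplus>\<^bsub>L\<^esub> i\<in>{..<length bs}. A $$ (i, j) \<odot>\<^bsub>L\<^esub> (bs ! i))))"

text \<open>All matrices of a given endomorphism of a finite dimensional space are similar, so the
  choice of the matrix in the next two definitions is immaterial.\<close>

definition hyperbolic :: "(rat, 'b, 'm) bracket_algebra_scheme \<Rightarrow> ('b \<Rightarrow> 'b) \<Rightarrow> bool" where
  "hyperbolic L f \<longleftrightarrow>
     (\<exists>A. matrix_of L f A \<and>
          (\<forall>z::complex. eigenvalue (map_mat of_rat A) z \<longrightarrow> cmod z \<noteq> 1))"

definition integer_like :: "(rat, 'b, 'm) bracket_algebra_scheme \<Rightarrow> ('b \<Rightarrow> 'b) \<Rightarrow> bool" where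
  "integer_like L f \<longleftrightarrow>
     (\<exists>A. matrix_of L f A \<and>
          (\<forall>i. coeff (char_poly A) i \<in> \<int>) \<and> coeff (char_poly A) 0 \<in> {1, - 1})"

definition anosov :: "(rat, 'b, 'm) bracket_algebra_scheme \<Rightarrow> bool" where
  "anosov L \<longleftrightarrow>
     lie_algebra L \<and> vectorspace.fin_dim rat_field L \<and>
     (\<exists>f. lie_automorphism L f \<and> hyperbolic L f \<and> integer_like L f)"

end

theory Submission
  imports
    Defs
    "HOL-Combinatorics.Cycles"
    "HOL-Computational_Algebra.Fundamental_Theorem_Algebra"
begin

text \<open>
  Necessity. Comparing dimensions of centralizers shows that a power \<open>f\<^sup>m\<close> of an automorphism acts on
  the span of the vertices block-triangularly with respect to the coherent components, ordered by
  vertex degree. The eigenvalues of a diagonal block are algebraic units with product of modulus \<open>1\<close>,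
  so a component with one vertex yields an eigenvalue of modulus \<open>1\<close>. If an edge of the quotient graph
  covers at most \<open>c\<close> vertices, then the right-normed bracket of eigenvectors for all eigenvalues of
  its blocks is an eigenvector in the Lie algebra, with eigenvalue of modulus \<open>1\<close>; it is seen to be
  nonzero by mapping to a metabelian Lie algebra of dimension two over its derived algebra.

  Sufficiency. On each component take an integer matrix with characteristic polynomial
  \<open>\<Prod>(x - a\<^sub>v) + 1\<close>. For suitable integers \<open>a\<^sub>v\<close> its roots \<open>r\<^sub>v\<close> are real units whose only short
  multiplicative relations, up to sign, come from the products over whole components. The matrix
  respects nonadjacency and hence extends to an automorphism. Each of its eigenvalues is a product of
  roots \<open>r\<^sub>v\<close> taken from the components of the letters of a nonzero right-normed word of length at
  most \<open>c\<close>. If its modulus were \<open>1\<close>, the product would run over all vertices of these components,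
  among them the two components of the last two letters, which are adjacent; that is more than \<open>c\<close>
  factors.
\<close>

section \<open>Polynomials in linear operators and algebraic units\<close>

text \<open>Two obstacles shape the proof. The Lie algebra is a quotient of a quotient of a
  quotient, with no explicit basis, so an element is proved nonzero only by a functional that
  vanishes on all relations. Such functionals come from a metabelian algebra with just two
  degree-one coordinates \<open>u\<close> and \<open>w\<close>: there a right-normed word becomes
  one 2x2 determinant times a product of linear polynomials, and the graph asks only that
  \<open>u\<close> and \<open>w\<close> have vanishing minors on nonedges. Secondly, the algebra is
  rational while eigenvalues are complex. Scalars are never extended. Eigenvectors of blocks are
  replaced by complex combinations of the sequences \<open>n \<mapsto> \<phi> ((f ^^ n) X)\<close>,
  which all satisfy the recurrence of the characteristic polynomial; a geometric progression among
  them exhibits a root. Conversely, an eigenvalue is turned into a complex-valued functional and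
  then into a function on words. On such functions \<open>f\<close> splits into commuting operators,
  one per letter, although a single one of them need not act on the Lie algebra.\<close>

definition lin_op :: "(('w \<Rightarrow> complex) \<Rightarrow> ('w \<Rightarrow> complex)) \<Rightarrow> bool" where
  "lin_op T \<longleftrightarrow> (\<forall>g h. T (\<lambda>w. g w + h w) = (\<lambda>w. T g w + T h w)) \<and>
                 (\<forall>a g. T (\<lambda>w. a * g w) = (\<lambda>w. a * T g w))"

lemma lin_op_add: "lin_op T \<Longrightarrow> T (\<lambda>w. g w + h w) = (\<lambda>w. T g w + T h w)"
  and lin_op_scale: "lin_op T \<Longrightarrow> T (\<lambda>w. a * g w) = (\<lambda>w. a * T g w)"
  by (auto simp: lin_op_def)

lemma lin_op_zero: "lin_op T \<Longrightarrow> T (\<lambda>w. 0) = (\<lambda>w. 0)"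
  using lin_op_scale[of T 0 "\<lambda>w. 0"] by simp

lemma lin_op_sum:
  assumes "lin_op T" shows "T (\<lambda>w. \<Sum>i\<in>I. g i w) = (\<lambda>w. \<Sum>i\<in>I. T (g i) w)"
  by (induction I rule: infinite_finite_induct)
    (simp_all add: lin_op_zero[OF assms] lin_op_add[OF assms])

text \<open>This is \<open>p(T) g\<close>, evaluated by Horner's scheme. Operators act on arbitrary
  complex-valued functions, so that one calculus serves both for the shift of sequences and for
  operators on functions of words.\<close>

definition pact :: "(('w \<Rightarrow> complex) \<Rightarrow> ('w \<Rightarrow> complex)) \<Rightarrow> complex poly \<Rightarrow> ('w \<Rightarrow> complex) \<Rightarrow> ('w \<Rightarrow> complex)"
  where "pact T p g = fold_coeffs (\<lambda>a h w. a * g w + T h w) p (\<lambda>w. 0)"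

lemma pact_0 [simp]: "pact T 0 g = (\<lambda>w. 0)"
  by (simp add: pact_def)

lemma pact_pCons:
  assumes "lin_op T" shows "pact T (pCons a p) g = (\<lambda>w. a * g w + T (pact T p g) w)"
  using lin_op_zero[OF assms] by (cases "p = 0 \<and> a = 0") (auto simp: pact_def)

lemma pact_add:
  assumes "lin_op T" shows "pact T (p + q) g = (\<lambda>w. pact T p g w + pact T q g w)"
  by (induction p q rule: poly_induct2)
     (simp_all add: pact_pCons[OF assms] lin_op_add[OF assms] algebra_simps)

lemma pact_smult:
  assumes "lin_op T" shows "pact T (Polynomial.smult a p) g = (\<lambda>w. a * pact T p g w)"
  by (induction p) (simp_all add: pact_pCons[OF assms] lin_op_scale[OF assms] algebra_simps)

lemma pact_mult:
  assumes "lin_op T" shows "pact T (p * q) g = pact T p (pact T q g)"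
  by (induction p)
     (simp_all add: pact_pCons[OF assms] pact_add[OF assms] pact_smult[OF assms])

lemma pact_1: "lin_op T \<Longrightarrow> pact T 1 g = g"
  by (simp add: one_pCons pact_pCons lin_op_zero)

lemma pact_sum:
  assumes "lin_op T" shows "pact T (\<Sum>i\<in>I. p i) g = (\<lambda>w. \<Sum>i\<in>I. pact T (p i) g w)"
  by (induction I rule: infinite_finite_induct) (simp_all add: pact_add assms)

lemma lin_op_pact:
  assumes "lin_op T" shows "lin_op (pact T p)"
proof -
  have "pact T p (\<lambda>w. g w + h w) = (\<lambda>w. pact T p g w + pact T p h w)" for g h
    by (induction p) (simp_all add: pact_pCons[OF assms] lin_op_add[OF assms] algebra_simps)
  moreover have "pact T p (\<lambda>w. a * g w) = (\<lambda>w. a * pact T p g w)" for a g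
    by (induction p) (simp_all add: pact_pCons[OF assms] lin_op_scale[OF assms] algebra_simps)
  ultimately show ?thesis by (simp add: lin_op_def)
qed

lemma pact_commute:
  assumes "lin_op T" "lin_op U" "\<And>g. U (T g) = T (U g)"
  shows "pact T p (U g) = U (pact T p g)"
  by (induction p)
    (simp_all add: pact_pCons[OF assms(1)] lin_op_zero[OF assms(2)] lin_op_add[OF assms(2)]
      lin_op_scale[OF assms(2)] assms(3))

definition shift :: "(nat \<Rightarrow> complex) \<Rightarrow> nat \<Rightarrow> complex" where
  "shift s n = s (Suc n)"

lemma lin_op_shift: "lin_op shift"
  by (simp add: lin_op_def shift_def fun_eq_iff)

text \<open>The determinant trick. With \<open>x\<close> acting as the shift, the matrix
  \<open>x I - M\<close> kills the vector of the sequences \<open>s j\<close>; multiplying by its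
  adjugate leaves the scalar operator \<open>char_poly M\<close>, which therefore kills each
  sequence separately.\<close>

lemma cayley_hamilton_recurrence:
  fixes M :: "complex mat"
  assumes M: "M \<in> carrier_mat n n"
    and rec: "\<And>j t. j < n \<Longrightarrow> s j (Suc t) = (\<Sum>k<n. M $$ (j, k) * s k t)"
    and i: "i < n"
  shows "pact shift (char_poly M) (s i) = (\<lambda>_. 0)"
proof -
  note l = lin_op_shift
  define C where "C = char_poly_matrix M"
  define B where "B = adj_mat C"
  have C: "C \<in> carrier_mat n n" using M by (simp add: C_def)
  have B: "B \<in> carrier_mat n n" and BC: "B * C = char_poly M \<cdot>\<^sub>m 1\<^sub>m n"
    using adj_mat[OF C] by (simp_all add: B_def char_poly_def C_def)
  have Cjk: "C $$ (j, k) = (if j = k then [:0, 1:] else 0) - [:M $$ (j, k):]" if "j < n" "k < n" for j k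
    using that M by (simp add: C_def char_poly_matrix_def)
  have z: "(\<Sum>k<n. pact shift (C $$ (j, k)) (s k) w) = 0" if j: "j < n" for j w
  proof -
    have "pact shift (C $$ (j, k)) (s k) w = (if k = j then s j (Suc w) else 0) - M $$ (j, k) * s k w"
      if "k < n" for k
    proof -
      have "C $$ (j, k) = [:- M $$ (j, k), if j = k then 1 else 0:]"
        using Cjk[OF j that] by simp
      then show ?thesis
        by (auto simp: pact_pCons[OF l] lin_op_zero[OF l] shift_def)
    qed
    then have "(\<Sum>k<n. pact shift (C $$ (j, k)) (s k) w)
        = (\<Sum>k<n. if k = j then s j (Suc w) else 0) - (\<Sum>k<n. M $$ (j, k) * s k w)"
      by (simp add: sum_subtractf)
    with rec[OF j] j show ?thesis by simp
  qed
  have e: "(\<Sum>j<n. B $$ (i, j) * C $$ (j, k)) = (if i = k then char_poly M else 0)" if "k < n" for k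
  proof -
    have "(B * C) $$ (i, k) = (\<Sum>j<n. B $$ (i, j) * C $$ (j, k))"
      using B C i that by (simp add: scalar_prod_def atLeast0LessThan)
    with BC i that show ?thesis by (cases "i = k") simp_all
  qed
  have "pact shift (char_poly M) (s i) w = 0" for w
  proof -
    have "pact shift (char_poly M) (s i) w = (\<Sum>k<n. pact shift (if i = k then char_poly M else 0) (s k) w)"
      using i by (simp add: if_distrib[of "\<lambda>p. pact shift p _ w"] cong: if_cong)
    also have "\<dots> = (\<Sum>k<n. \<Sum>j<n. pact shift (B $$ (i, j)) (pact shift (C $$ (j, k)) (s k)) w)"
      by (intro sum.cong refl) (simp add: e[symmetric] pact_sum[OF l] pact_mult[OF l])
    also have "\<dots> = (\<Sum>j<n. \<Sum>k<n. pact shift (B $$ (i, j)) (pact shift (C $$ (j, k)) (s k)) w)"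
      by (rule sum.swap)
    also have "\<dots> = (\<Sum>j<n. pact shift (B $$ (i, j)) (\<lambda>v. \<Sum>k<n. pact shift (C $$ (j, k)) (s k) v) w)"
      by (simp add: lin_op_sum[OF lin_op_pact[OF l]])
    also have "\<dots> = 0"
      by (intro sum.neutral ballI) (simp add: z lin_op_zero[OF lin_op_pact[OF l]])
    finally show ?thesis .
  qed
  then show ?thesis by auto
qed

section \<open>Sums and products of algebraic integers\<close>

lemma algebraic_int_eigenvector:
  fixes z :: complex and v :: "'i \<Rightarrow> complex" and M :: "'i \<Rightarrow> 'i \<Rightarrow> int"
  assumes "finite I" "i0 \<in> I" "v i0 \<noteq> 0"
    and ev: "\<And>i. i \<in> I \<Longrightarrow> z * v i = (\<Sum>j\<in>I. of_int (M i j) * v j)"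
  shows "algebraic_int z"
proof -
  obtain h where h: "bij_betw h {0..<card I} I"
    using ex_bij_betw_nat_finite[OF assms(1)] by auto
  define n where "n = card I"
  define A :: "int mat" where "A = mat n n (\<lambda>(i, j). M (h i) (h j))"
  have A: "A \<in> carrier_mat n n" by (simp add: A_def)
  define w where "w = vec n (\<lambda>i. v (h i))"
  have hI: "h i \<in> I" if "i < n" for i
    using h that by (auto simp: bij_betw_def n_def)
  obtain k where k: "k < n" "h k = i0"
    using h assms(2) by (force simp: bij_betw_def n_def)
  have "w \<noteq> 0\<^sub>v n"
  proof
    assume "w = 0\<^sub>v n"
    then have "w $ k = 0" using k by simp
    with k assms(3) show False by (simp add: w_def)
  qed
  moreover have "map_mat of_int A *\<^sub>v w = z \<cdot>\<^sub>v w"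
  proof (rule eq_vecI)
    fix i assume "i < dim_vec (z \<cdot>\<^sub>v w)"
    then have i: "i < n" by (simp add: w_def)
    have "(map_mat of_int A *\<^sub>v w) $ i = (\<Sum>j<n. of_int (M (h i) (h j)) * v (h j))"
      using i by (simp add: A_def w_def scalar_prod_def atLeast0LessThan)
    also have "\<dots> = (\<Sum>j\<in>I. of_int (M (h i) j) * v j)"
      using sum.reindex_bij_betw[OF h, of "\<lambda>j. of_int (M (h i) j) * v j"]
      by (simp add: n_def atLeast0LessThan)
    also have "\<dots> = (z \<cdot>\<^sub>v w) $ i" using ev[OF hI[OF i]] i by (simp add: w_def)
    finally show "(map_mat of_int A *\<^sub>v w) $ i = (z \<cdot>\<^sub>v w) $ i" .
  qed (simp add: A_def w_def)
  ultimately have "eigenvalue (map_mat of_int A) z"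
    unfolding eigenvalue_def eigenvector_def by (intro exI[of _ w]) (simp add: A_def w_def)
  then have "poly (char_poly (map_mat of_int A)) z = 0"
    using eigenvalue_root_char_poly[of "map_mat of_int A" n z] A by simp
  then have "poly (map_poly of_int (char_poly A)) z = 0"
    using of_int_hom.char_poly_hom[OF A, where 'a = complex] by simp
  moreover have "lead_coeff (char_poly A) = 1"
    using degree_monic_char_poly[OF A] by simp
  ultimately show ?thesis
    unfolding algebraic_int_altdef_ipoly by blast
qed

text \<open>A monic relation makes the integer span of the powers \<open>x ^ k\<close> with
  \<open>k < n\<close> stable under multiplication by \<open>x\<close>; \<open>a\<close> is the
  companion matrix.\<close>

lemma algebraic_int_power_relations:
  fixes x :: complex assumes "algebraic_int x"
  obtains n :: nat and a :: "nat \<Rightarrow> nat \<Rightarrow> int"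
    where "n > 0" "\<And>i. i < n \<Longrightarrow> x * x ^ i = (\<Sum>k<n. of_int (a i k) * x ^ k)"
proof -
  obtain p :: "int poly" where p: "poly (map_poly of_int p) x = 0" "lead_coeff p = 1"
    using assms unfolding algebraic_int_altdef_ipoly by blast
  define n where "n = degree p"
  have n: "n > 0"
  proof (rule ccontr)
    assume "\<not> n > 0"
    then obtain c where "p = [:c:]" using degree_eq_zeroE[of p] by (auto simp: n_def)
    then show False using p by simp
  qed
  have xn: "x ^ n = (\<Sum>k<n. of_int (- coeff p k) * x ^ k)"
  proof -
    have "poly (map_poly of_int p) x = (\<Sum>k\<le>n. of_int (coeff p k) * x ^ k)"
      by (simp add: poly_altdef n_def)
    also have "\<dots> = (\<Sum>k<n. of_int (coeff p k) * x ^ k) + x ^ n"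
      using p(2) by (simp add: n_def lessThan_Suc_atMost[symmetric])
    finally show ?thesis using p(1) by (simp add: sum_negf eq_neg_iff_add_eq_0 add.commute)
  qed
  show ?thesis
  proof
    show "n > 0" by (rule n)
    fix i assume i: "i < n"
    show "x * x ^ i = (\<Sum>k<n. of_int (if Suc i < n then (if k = Suc i then 1 else 0) else - coeff p k) * x ^ k)"
    proof (cases "Suc i < n")
      case True
      have "(\<Sum>k<n. of_int (if k = Suc i then 1 else 0) * x ^ k) = (\<Sum>k<n. if k = Suc i then x ^ k else 0)"
        by (intro sum.cong) auto
      with True show ?thesis by simp
    next
      case False
      with i have "Suc i = n" by simp
      then have "x * x ^ i = x ^ n" by auto
      with xn False show ?thesis by simp
    qed
  qed
qed

text \<open>The monomials \<open>x ^ i * y ^ j\<close> with \<open>i < n\<close>,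
  \<open>j < m\<close> form a vector that multiplication by \<open>x\<close> or by \<open>y\<close>
  transforms by an integer matrix. So \<open>x + y\<close> and \<open>x * y\<close> are eigenvalues
  of integer matrices; the entry 1 at \<open>(0, 0)\<close> shows that the eigenvector is
  nonzero.\<close>

lemma
  fixes x y :: complex
  assumes "algebraic_int x" "algebraic_int y"
  shows algebraic_int_add_complex: "algebraic_int (x + y)"
    and algebraic_int_mult_complex: "algebraic_int (x * y)"
proof -
  obtain n a where n: "n > 0" and a: "\<And>i. i < n \<Longrightarrow> x * x ^ i = (\<Sum>k<n. of_int (a i k) * x ^ k)"
    using algebraic_int_power_relations[OF assms(1)] by metis
  obtain m b where m: "m > 0" and b: "\<And>i. i < m \<Longrightarrow> y * y ^ i = (\<Sum>k<m. of_int (b i k) * y ^ k)"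
    using algebraic_int_power_relations[OF assms(2)] by metis
  define v where "v = (\<lambda>(i, j). x ^ i * y ^ j)"
  let ?I = "{..<n} \<times> {..<m}"
  have mx: "x * v (i, j) = (\<Sum>(k, l)\<in>?I. of_int (a i k * (if l = j then 1 else 0)) * v (k, l))"
    if "i < n" "j < m" for i j
  proof -
    have "(\<Sum>(k, l)\<in>?I. of_int (a i k * (if l = j then 1 else 0)) * v (k, l))
       = (\<Sum>k<n. \<Sum>l<m. if l = j then of_int (a i k) * v (k, l) else 0)"
      unfolding sum.cartesian_product by (intro sum.cong) auto
    also have "\<dots> = (\<Sum>k<n. of_int (a i k) * v (k, j))" using that by simp
    also have "\<dots> = (x * x ^ i) * y ^ j"
      using a[OF that(1)] by (simp add: v_def sum_distrib_right mult.assoc)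
    finally show ?thesis by (simp add: v_def)
  qed
  have my: "y * v (i, j) = (\<Sum>(k, l)\<in>?I. of_int (b j l * (if k = i then 1 else 0)) * v (k, l))"
    if "i < n" "j < m" for i j
  proof -
    have "(\<Sum>(k, l)\<in>?I. of_int (b j l * (if k = i then 1 else 0)) * v (k, l))
       = (\<Sum>k<n. \<Sum>l<m. if k = i then of_int (b j l) * v (k, l) else 0)"
      unfolding sum.cartesian_product by (intro sum.cong) auto
    also have "\<dots> = (\<Sum>l<m. \<Sum>k<n. if k = i then of_int (b j l) * v (k, l) else 0)"
      by (rule sum.swap)
    also have "\<dots> = (\<Sum>l<m. of_int (b j l) * v (i, l))" using that by simp
    also have "\<dots> = x ^ i * (y * y ^ j)"
      using b[OF that(2)] by (simp add: v_def sum_distrib_left mult_ac)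
    finally show ?thesis by (simp add: v_def)
  qed
  have fin: "finite ?I" and z: "(0, 0) \<in> ?I" "v (0, 0) \<noteq> 0" using n m by (auto simp: v_def)
  show "algebraic_int (x + y)"
  proof (rule algebraic_int_eigenvector[of ?I "(0, 0)" v, OF fin z])
    fix p assume "p \<in> ?I"
    then obtain i j where p: "p = (i, j)" "i < n" "j < m" by auto
    show "(x + y) * v p = (\<Sum>q\<in>?I. of_int ((\<lambda>(i, j) (k, l). a i k * (if l = j then 1 else 0)
        + b j l * (if k = i then 1 else 0)) p q) * v q)"
      using mx[OF p(2,3)] my[OF p(2,3)]
      by (simp add: p(1) distrib_right case_prod_unfold sum.distrib)
  qed
  show "algebraic_int (x * y)"
  proof (rule algebraic_int_eigenvector[of ?I "(0, 0)" v, OF fin z])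
    fix p assume "p \<in> ?I"
    then obtain i j where p: "p = (i, j)" "i < n" "j < m" by auto
    have "x * y * v p = (x * x ^ i) * (y * y ^ j)" by (simp add: p v_def)
    also have "\<dots> = (\<Sum>q\<in>?I. of_int ((\<lambda>(i, j) (k, l). a i k * b j l) p q) * v q)"
      unfolding a[OF p(2)] b[OF p(3)] sum_product sum.cartesian_product
      by (intro sum.cong) (auto simp: p v_def)
    finally show "x * y * v p = (\<Sum>q\<in>?I. of_int ((\<lambda>(i, j) (k, l). a i k * b j l) p q) * v q)" .
  qed
qed

section \<open>Algebraic units and polynomials with unit roots\<close>

definition alg_unit :: "complex \<Rightarrow> bool" where
  "alg_unit z \<longleftrightarrow> z \<noteq> 0 \<and> algebraic_int z \<and> algebraic_int (1 / z)"

lemma alg_unit_1: "alg_unit 1"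
  by (simp add: alg_unit_def int_imp_algebraic_int)

lemma alg_unit_mult: "alg_unit x \<Longrightarrow> alg_unit y \<Longrightarrow> alg_unit (x * y)"
  using algebraic_int_mult_complex[of "1/x" "1/y"]
  by (auto simp: alg_unit_def algebraic_int_mult_complex)

lemma alg_unit_prod: "(\<And>i. i \<in> I \<Longrightarrow> alg_unit (f i)) \<Longrightarrow> alg_unit (\<Prod>i\<in>I. f i)"
  by (induction I rule: infinite_finite_induct) (auto simp: alg_unit_1 alg_unit_mult)

lemma alg_unit_power: "alg_unit x \<Longrightarrow> alg_unit (x ^ n)"
  by (induction n) (auto simp: alg_unit_1 alg_unit_mult)

lemma alg_unit_root_monic_int:
  fixes p :: "complex poly"
  assumes "\<And>i. coeff p i \<in> \<int>" "lead_coeff p = 1" "coeff p 0 \<in> {1, - 1}" "poly p z = 0"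
  shows "alg_unit z"
proof -
  have p0: "p \<noteq> 0" using assms(2) by auto
  have z0: "z \<noteq> 0" using assms(3,4) by (auto simp: poly_0_coeff_0)
  have "algebraic_int z" using assms by (intro algebraic_int.intros[of p]) auto
  \<comment> \<open>The reflected polynomial vanishes at \<open>1 / z\<close>. Its leading
    coefficient is \<open>coeff p 0\<close>, a sign, and scaling by that sign makes it
    monic.\<close>
  moreover have "algebraic_int (1 / z)"
  proof (rule algebraic_int.intros[of "Polynomial.smult (coeff p 0) (reflect_poly p)"])
    show "lead_coeff (Polynomial.smult (coeff p 0) (reflect_poly p)) = 1"
      using assms(3) p0 by (auto simp: degree_reflect_poly_eq coeff_reflect_poly)
    show "\<forall>i. coeff (Polynomial.smult (coeff p 0) (reflect_poly p)) i \<in> \<int>"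
      using assms(1) by (auto simp: coeff_reflect_poly)
    show "poly (Polynomial.smult (coeff p 0) (reflect_poly p)) (1 / z) = 0"
      using z0 assms(4) by (simp add: poly_reflect_poly_nz inverse_eq_divide)
  qed
  ultimately show ?thesis using z0 by (simp add: alg_unit_def)
qed

lemma complex_monic_factorization:
  fixes p :: "complex poly" assumes "lead_coeff p = 1"
  obtains as where "p = (\<Prod>a\<leftarrow>as. [:- a, 1:])"
proof -
  have "\<exists>as. Polynomial.smult (coeff p (degree p)) (\<Prod>a\<leftarrow>as. [:- a, 1:]) = p \<and> length as = degree p"
    using fundamental_theorem_algebra_factorized[of p] by blast
  then show ?thesis using that assms by auto
qed

lemma algebraic_int_coeff_prod_linear:
  assumes "\<And>a. a \<in> set as \<Longrightarrow> algebraic_int (a :: complex)"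
  shows "algebraic_int (coeff (\<Prod>a\<leftarrow>as. [:- a, 1:]) i)"
  using assms
proof (induction as arbitrary: i)
  case Nil
  then show ?case by (cases "i = 0") (auto simp: int_imp_algebraic_int)
next
  case (Cons a as)
  let ?q = "\<Prod>a\<leftarrow>as. [:- a, 1:]"
  have "coeff ([:- a, 1:] * ?q) i = - a * coeff ?q i + (case i of 0 \<Rightarrow> 0 | Suc j \<Rightarrow> coeff ?q j)"
    by (cases i) (simp_all add: mult_pCons_left)
  moreover have "algebraic_int (- a * coeff ?q i)"
    using Cons by (intro algebraic_int_mult_complex algebraic_int_minus) auto
  moreover have "algebraic_int (case i of 0 \<Rightarrow> 0 | Suc j \<Rightarrow> coeff ?q j)"
    using Cons by (auto split: nat.split)
  ultimately show ?case by (simp only: list.map prod_list.Cons algebraic_int_add_complex)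
qed

text \<open>The coefficients are polynomials in the roots, hence algebraic integers, and being
  rational they are integers. Up to sign the constant coefficient is the product of the roots, so
  its inverse is an integer as well.\<close>

lemma rat_poly_unit_roots:
  fixes q :: "rat poly"
  assumes monic: "lead_coeff q = 1"
    and roots: "\<And>z. poly (map_poly of_rat q) z = 0 \<Longrightarrow> alg_unit z"
  shows "coeff q i \<in> \<int>" "coeff q 0 \<in> {1, - 1}"
proof -
  let ?Q = "map_poly of_rat q :: complex poly"
  have lc: "lead_coeff ?Q = 1" using monic by simp
  then obtain as where as: "?Q = (\<Prod>a\<leftarrow>as. [:- a, 1:])"
    using complex_monic_factorization by blast
  have ua: "alg_unit a" if "a \<in> set as" for a
    using that by (intro roots) (auto simp: as poly_prod_list o_def prod_list_zero_iff)
  have int: "r \<in> \<int>" if "algebraic_int (of_rat r :: complex)" for r :: rat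
  proof -
    have "(of_rat r :: complex) \<in> \<int>"
      using rational_algebraic_int_is_int[OF that] by (auto simp: Rats_of_rat)
    then obtain k where "(of_rat r :: complex) = of_int k" by (auto elim: Ints_cases)
    then have "of_rat r = (of_rat (of_int k) :: complex)" by simp
    then have "r = of_int k" by (simp only: of_rat_eq_iff)
    then show ?thesis by simp
  qed
  have ai: "algebraic_int (coeff ?Q i)" for i
    unfolding as by (rule algebraic_int_coeff_prod_linear) (use ua in \<open>auto simp: alg_unit_def\<close>)
  have cint: "coeff q i \<in> \<int>" for i using ai[of i] by (intro int) simp
  show "coeff q i \<in> \<int>" by (rule cint)
  have "coeff ?Q 0 = (\<Prod>a\<leftarrow>as. - a)"
    by (simp add: poly_0_coeff_0[symmetric] as poly_prod_list o_def)
  moreover have "alg_unit (\<Prod>a\<leftarrow>as. - a)"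
    using ua
  proof (induction as)
    case (Cons a as)
    then have "alg_unit (- a)" by (auto simp: alg_unit_def)
    with Cons show ?case using alg_unit_mult[of "- a" "\<Prod>a\<leftarrow>as. - a"] by simp
  qed (simp add: alg_unit_1)
  ultimately have u: "alg_unit (of_rat (coeff q 0))" by simp
  then have "algebraic_int (of_rat (1 / coeff q 0) :: complex)"
    by (simp add: alg_unit_def of_rat_divide)
  then have "1 / coeff q 0 \<in> \<int>" by (rule int)
  then obtain k where k: "1 / coeff q 0 = of_int k" by (auto elim: Ints_cases)
  obtain l where l: "coeff q 0 = of_int l" using cint[of 0] by (auto elim: Ints_cases)
  have "coeff q 0 \<noteq> 0" using u by (simp add: alg_unit_def)
  with k l have "of_int (l * k) = (1 :: rat)" by (simp add: field_simps)
  then have "l * k = 1" by (simp only: of_int_eq_1_iff)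
  then have "l = 1 \<or> l = - 1" using zmult_eq_1_iff by auto
  with l show "coeff q 0 \<in> {1, - 1}" by auto
qed

section \<open>Real units without short multiplicative relations\<close>

text \<open>Within 1/2 of \<open>a i\<close> each other factor keeps its sign and has modulus at
  least \<open>3 - 1/2\<close>, so their product \<open>h\<close> has modulus above 2. At the
  endpoints the factor of \<open>a i\<close> is -1/2 or 1/2, and half of \<open>h\<close> outweighs
  the added 1: the polynomial changes sign. The bound \<open>card J \<ge> 2\<close> ensures that
  \<open>h\<close> is not the empty product.\<close>

lemma perturbed_product_splits:
  fixes a :: "'v \<Rightarrow> int"
  assumes fin: "finite J" and card: "card J \<ge> 2"
    and sep: "\<And>i j. i \<in> J \<Longrightarrow> j \<in> J \<Longrightarrow> i \<noteq> j \<Longrightarrow> \<bar>a i - a j\<bar> \<ge> 3"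
  obtains r :: "'v \<Rightarrow> real" where "\<And>i. i \<in> J \<Longrightarrow> \<bar>r i - of_int (a i)\<bar> \<le> 1/2"
    and "(\<Prod>i\<in>J. [:- of_int (a i), 1:]) + 1 = (\<Prod>i\<in>J. [:- r i, 1:])"
proof -
  define p :: "real poly" where "p = (\<Prod>i\<in>J. [:- of_int (a i), 1:]) + 1"
  have pp: "poly p x = (\<Prod>i\<in>J. x - of_int (a i)) + 1" for x
    by (simp add: p_def poly_prod)
  have ex: "\<exists>x. \<bar>x - of_int (a i)\<bar> \<le> 1/2 \<and> poly p x = 0" if i: "i \<in> J" for i
  proof -
    define x y h where "x = of_int (a i) - (1/2::real)" and "y = of_int (a i) + (1/2::real)"
      and "h = (\<lambda>z. \<Prod>j\<in>J - {i}. z - (of_int (a j) :: real))"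
    have far: "\<bar>of_int (a i) - (of_int (a j) :: real)\<bar> \<ge> 3" if "j \<in> J - {i}" for j
    proof -
      have "3 \<le> \<bar>a i - a j\<bar>" using sep[of i j] i that by auto
      then have "(of_int 3 :: real) \<le> of_int \<bar>a i - a j\<bar>" by (simp only: of_int_le_iff)
      then show ?thesis by simp
    qed
    have "1 \<le> card (J - {i})" using card i fin by simp
    have big: "\<bar>h z\<bar> > 2" if "\<bar>z - of_int (a i)\<bar> \<le> 1/2" for z
    proof -
      have "2 < (5/2 :: real) ^ 1" by simp
      also have "\<dots> \<le> (5/2) ^ card (J - {i})" using \<open>1 \<le> card (J - {i})\<close> by (intro power_increasing) auto
      also have "\<dots> = (\<Prod>j\<in>J - {i}. 5/2)" by simp
      also have "\<dots> \<le> (\<Prod>j\<in>J - {i}. \<bar>z - of_int (a j)\<bar>)"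
      proof (rule prod_mono)
        fix j assume "j \<in> J - {i}"
        from far[OF this] that show "0 \<le> (5/2::real) \<and> 5/2 \<le> \<bar>z - of_int (a j)\<bar>" by linarith
      qed
      finally show ?thesis by (simp add: h_def abs_prod)
    qed
    have hxy: "h x * h y > 0"
      unfolding h_def prod.distrib[symmetric]
    proof (rule prod_pos)
      fix j assume "j \<in> J - {i}"
      from far[OF this] show "0 < (x - of_int (a j)) * (y - of_int (a j))"
        unfolding x_def y_def by (auto simp: zero_less_mult_iff abs_if split: if_splits)
    qed
    have q: "poly p z = (z - of_int (a i)) * h z + 1" for z
      using fin i by (simp add: pp h_def prod.remove)
    have "\<bar>h x\<bar> > 2" "\<bar>h y\<bar> > 2" by (auto intro!: big simp: x_def y_def)
    moreover have "poly p x = - (h x / 2) + 1" "poly p y = h y / 2 + 1"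
      unfolding q by (simp_all add: x_def y_def)
    ultimately have "poly p x * poly p y < 0"
      using hxy by (auto simp: zero_less_mult_iff mult_less_0_iff abs_if split: if_splits)
    moreover have "x < y" by (simp add: x_def y_def)
    ultimately obtain z where "x < z" "z < y" "poly p z = 0"
      using poly_IVT[of x y p] by blast
    then show ?thesis by (intro exI[of _ z]) (auto simp: x_def y_def abs_if)
  qed
  then obtain r where r: "\<And>i. i \<in> J \<Longrightarrow> \<bar>r i - of_int (a i)\<bar> \<le> 1/2 \<and> poly p (r i) = 0"
    by metis
  have inj: "inj_on r J"
  proof (rule inj_onI, rule ccontr)
    fix i j assume ij: "i \<in> J" "j \<in> J" "r i = r j" "i \<noteq> j"
    have "3 \<le> \<bar>a i - a j\<bar>" using sep ij by blast
    then have "(of_int 3 :: real) \<le> of_int \<bar>a i - a j\<bar>" by (simp only: of_int_le_iff)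
    with r[OF ij(1)] r[OF ij(2)] ij(3) show False by (auto simp: abs_if split: if_splits)
  qed
  have "(\<Prod>i\<in>J. [:- r i, 1:]) = p"
  proof -
    let ?q = "\<Prod>i\<in>J. [:- of_int (a i), 1:] :: real poly" and ?R = "\<Prod>i\<in>J. [:- r i, 1:]"
    have lc: "lead_coeff ?q = 1" "lead_coeff ?R = 1" by (simp_all add: lead_coeff_prod)
    have "degree ?q = card J" "degree ?R = card J" by (auto simp: degree_prod_sum_eq)
    with lc have dq: "degree ?q = card J" "lead_coeff ?q = 1"
      and dR: "degree ?R = card J" "lead_coeff ?R = 1" by simp_all
    have "degree p = card J \<and> lead_coeff p = 1"
      using dq card by (auto simp: p_def degree_add_eq_left)
    then have cp: "coeff p (card J) = 1" "degree p \<le> card J" by auto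
    have "card J \<noteq> 0" using card by simp
    \<comment> \<open>Both polynomials are monic of degree \<open>card J\<close>, so a nonzero
      difference has smaller degree, yet it vanishes at the \<open>card J\<close> distinct points
      \<open>r i\<close>.\<close>
    show ?thesis
    proof (rule ccontr)
      assume "?R \<noteq> p"
      then have nz: "?R - p \<noteq> 0" by simp
      have "degree (?R - p) < card J"
      proof (rule degree_lessI)
        show "?R - p \<noteq> 0 \<or> 0 < card J" using nz by simp
        show "\<forall>k\<ge>card J. coeff (?R - p) k = 0"
        proof (intro allI impI)
          fix k assume "card J \<le> k"
          then show "coeff (?R - p) k = 0"
            using cp dR by (cases "k = card J") (auto simp: coeff_eq_0)
        qed
      qed
      moreover have "card J \<le> card {x. poly (?R - p) x = 0}"
      proof -
        have "r ` J \<subseteq> {x. poly (?R - p) x = 0}"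
          using r fin by (auto simp: poly_prod intro!: prod_zero)
        then have "card (r ` J) \<le> card {x. poly (?R - p) x = 0}"
          using poly_roots_finite[OF nz] by (intro card_mono)
        then show ?thesis using card_image[OF inj] by simp
      qed
      moreover have "card {x. poly (?R - p) x = 0} \<le> degree (?R - p)"
        using poly_roots_degree[OF nz] .
      ultimately show False by simp
    qed
  qed
  with r that[of r] show thesis by (simp add: p_def)
qed

text \<open>The term of largest index with \<open>d w \<noteq> 0\<close> dominates: it is at least
  \<open>l * K ^ m / 2\<close>, while the others contribute at most \<open>3 * l * c / 2\<close>
  times a geometric sum with value below \<open>K ^ m / (K - 1)\<close>. The choice of
  \<open>K\<close> makes \<open>K - 1\<close> exceed \<open>3 * c\<close>.\<close>

lemma separated_logs_independent:
  fixes L :: "'v \<Rightarrow> real" and d :: "'v \<Rightarrow> int" and idx :: "'v \<Rightarrow> nat"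
  assumes fin: "finite V" and inj: "inj_on idx V" and l: "l > 0"
    and K: "K = 3 * real c + 2"
    and lo: "\<And>v. v \<in> V \<Longrightarrow> l * K ^ idx v / 2 \<le> L v"
    and hi: "\<And>v. v \<in> V \<Longrightarrow> L v \<le> 3 * l * K ^ idx v / 2"
    and d: "\<And>v. v \<in> V \<Longrightarrow> \<bar>d v\<bar> \<le> int c"
    and sum: "(\<Sum>v\<in>V. of_int (d v) * L v) = 0"
    and v: "v \<in> V"
  shows "d v = 0"
proof (rule ccontr)
  assume dv: "d v \<noteq> 0"
  define W where "W = {w \<in> V. d w \<noteq> 0}"
  have W: "finite W" "W \<noteq> {}" using fin v dv by (auto simp: W_def)
  define m where "m = Max (idx ` W)"
  have "m \<in> idx ` W" unfolding m_def using W by (intro Max_in) auto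
  then obtain w where w: "w \<in> W" "idx w = m" by auto
  have wV: "w \<in> V" "d w \<noteq> 0" using w by (auto simp: W_def)
  have below: "idx u < m" if "u \<in> W - {w}" for u
  proof -
    have "idx u \<le> m" unfolding m_def using W that by (intro Max_ge) auto
    moreover have "idx u \<noteq> m" using that w inj unfolding W_def inj_on_def by auto
    ultimately show ?thesis by simp
  qed
  have K1: "K \<ge> 2" using K by simp
  have Lpos: "L u > 0" if "u \<in> V" for u
  proof -
    have "0 < l * K ^ idx u / 2" using l K1 by simp
    with lo[OF that] show ?thesis by linarith
  qed
  have "(\<Sum>u\<in>W. of_int (d u) * L u) = 0"
    using sum.mono_neutral_left[of V W "\<lambda>u. of_int (d u) * L u"] fin sum by (auto simp: W_def)
  then have "of_int (d w) * L w = - (\<Sum>u\<in>W - {w}. of_int (d u) * L u)"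
    using W w by (simp add: sum.remove)
  then have "\<bar>of_int (d w) * L w\<bar> = \<bar>\<Sum>u\<in>W - {w}. of_int (d u) * L u\<bar>" by simp
  also have "\<dots> \<le> (\<Sum>u\<in>W - {w}. \<bar>of_int (d u) * L u\<bar>)" by (rule sum_abs)
  also have "\<dots> \<le> (\<Sum>u\<in>W - {w}. (3 * l * c / 2) * K ^ idx u)"
  proof (rule sum_mono)
    fix u assume "u \<in> W - {w}"
    then have u: "u \<in> V" by (auto simp: W_def)
    have "\<bar>of_int (d u) * L u\<bar> = of_int \<bar>d u\<bar> * L u" using Lpos[OF u] by (simp add: abs_mult)
    also have "\<dots> \<le> real c * (3 * l * K ^ idx u / 2)"
    proof (rule mult_mono)
      have "of_int \<bar>d u\<bar> \<le> (of_int (int c) :: real)" using d[OF u] by (simp only: of_int_le_iff)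
      then show "of_int \<bar>d u\<bar> \<le> real c" by simp
    qed (use hi[OF u] Lpos[OF u] in auto)
    finally show "\<bar>of_int (d u) * L u\<bar> \<le> (3 * l * c / 2) * K ^ idx u" by (simp add: mult_ac)
  qed
  also have "\<dots> = (3 * l * c / 2) * (\<Sum>i\<in>idx ` (W - {w}). K ^ i)"
    using inj by (subst sum.reindex) (auto simp: sum_distrib_left W_def intro: inj_on_subset)
  also have "\<dots> \<le> (3 * l * c / 2) * (\<Sum>i<m. K ^ i)"
    using below l K1 by (intro mult_left_mono sum_mono2) auto
  also have "(\<Sum>i<m. K ^ i) = (K ^ m - 1) / (K - 1)"
    using K1 by (intro geometric_sum) auto
  also have "(3 * l * c / 2) * ((K ^ m - 1) / (K - 1)) < l * K ^ m / 2"
  proof -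
    have "3 * real c * (K ^ m - 1) < (K - 1) * K ^ m"
    proof -
      have "3 * real c * (K ^ m - 1) \<le> 3 * real c * K ^ m" by (intro mult_left_mono) auto
      also have "\<dots> < (K - 1) * K ^ m" using K1 K by (intro mult_strict_right_mono) auto
      finally show ?thesis .
    qed
    then have "3 * real c * (K ^ m - 1) / (K - 1) < K ^ m"
      using K1 by (simp add: field_simps)
    then have "l / 2 * (3 * real c * (K ^ m - 1) / (K - 1)) < l / 2 * K ^ m"
      using l by (intro mult_strict_left_mono) auto
    then show ?thesis by (simp add: field_simps)
  qed
  also have "\<dots> \<le> L w" using lo[OF wV(1)] w by simp
  also have "\<dots> \<le> \<bar>of_int (d w) * L w\<bar>"
  proof -
    have "1 \<le> \<bar>d w\<bar>" using wV by simp
    then have "(of_int 1 :: real) \<le> of_int \<bar>d w\<bar>" by (simp only: of_int_le_iff)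
    then have "1 * L w \<le> \<bar>of_int (d w)\<bar> * L w" using Lpos[OF wV(1)] by (intro mult_right_mono) auto
    then show ?thesis using Lpos[OF wV(1)] by (simp add: abs_mult)
  qed
  finally show False by simp
qed

lemma power4_gap:
  fixes m n :: nat assumes "m \<noteq> n" shows "\<bar>4 ^ m - (4 :: int) ^ n\<bar> \<ge> 3"
proof -
  have *: "(4 :: int) ^ n - 4 ^ m \<ge> 3" if "m < n" for m n :: nat
  proof -
    have "4 * 4 ^ m = (4 :: int) ^ Suc m" by simp
    also have "\<dots> \<le> 4 ^ n" using that by (intro power_increasing) auto
    finally have "4 * 4 ^ m \<le> (4 :: int) ^ n" .
    moreover have "(1 :: int) \<le> 4 ^ m" by simp
    ultimately show ?thesis by linarith
  qed
  from assms consider "m < n" | "n < m" by linarith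
  then show ?thesis using *[of m n] *[of n m] by cases linarith+
qed

text \<open>In each component one base point \<open>b l\<close> gets the value 0. This forces the
  roots of the component to have product 1 or -1, which is the one intended relation. The other
  roots lie near numbers whose logarithms are spread over a geometric scale; there no relation with
  coefficients of modulus at most \<open>c\<close> exists, and differences of two exponents bounded
  by \<open>c\<close> are such coefficients.\<close>

lemma multiplicatively_independent_units:
  fixes S :: "'v set" and c :: nat
  assumes fin: "finite S" and part: "partition_on S P" and big: "\<And>l. l \<in> P \<Longrightarrow> card l > 1"
  obtains a :: "'v \<Rightarrow> int" and r :: "'v \<Rightarrow> real" and b :: "'v set \<Rightarrow> 'v"
  where "\<And>l. l \<in> P \<Longrightarrow> b l \<in> l \<and> a (b l) = 0"
    and "\<And>l. l \<in> P \<Longrightarrow> (\<Prod>i\<in>l. [:- of_int (a i), 1:]) + 1 = (\<Prod>i\<in>l. [:- r i, 1:])"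
    and "\<And>e l i j. \<lbrakk>(\<Sum>i\<in>S. e i) \<le> c; \<bar>\<Prod>i\<in>S. r i ^ e i\<bar> = 1; l \<in> P; i \<in> l; j \<in> l\<rbrakk>
           \<Longrightarrow> (e i :: nat) = e j"
proof -
  have PS: "l \<subseteq> S" "finite l" "l \<noteq> {}" if "l \<in> P" for l
    using part that fin by (auto simp: partition_on_def intro: finite_subset)
  have disj: "l = l'" if "l \<in> P" "l' \<in> P" "x \<in> l" "x \<in> l'" for l l' x
    using part that unfolding partition_on_def disjoint_def by blast
  obtain b where b: "\<And>l. l \<in> P \<Longrightarrow> b l \<in> l" using PS(3) by (metis all_not_in_conv)
  define V where "V = S - b ` P"
  have finV: "finite V" using fin by (simp add: V_def)
  obtain idx :: "'v \<Rightarrow> nat" where idx: "inj_on idx V"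
    using finite_imp_inj_to_nat_seg[OF finV] by blast
  define k :: nat where "k = 3 * c + 2"
  \<comment> \<open>Doubly exponential, because it is the logarithms of the roots that must grow
    with ratio \<open>k\<close>, the constant of \<open>separated_logs_independent\<close>. Base 4
    keeps distinct values, 0 included, at distance at least 3.\<close>
  define a :: "'v \<Rightarrow> int" where "a = (\<lambda>v. if v \<in> V then 4 ^ (k ^ idx v) else 0)"
  have ab: "a (b l) = 0" if "l \<in> P" for l using that by (simp add: a_def V_def)
  have lV: "v \<in> V" if "l \<in> P" "v \<in> l" "v \<noteq> b l" for l v
  proof -
    have "v \<noteq> b l'" if "l' \<in> P" for l'
      using disj[OF \<open>l \<in> P\<close> \<open>l' \<in> P\<close>, of v] b[OF \<open>l' \<in> P\<close>] \<open>v \<in> l\<close> \<open>v \<noteq> b l\<close> by auto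
    then show ?thesis using that PS(1)[OF that(1)] by (auto simp: V_def)
  qed
  have "\<exists>r :: 'v \<Rightarrow> real. (\<forall>i\<in>l. \<bar>r i - of_int (a i)\<bar> \<le> 1/2) \<and>
      (\<Prod>i\<in>l. [:- of_int (a i), 1:]) + 1 = (\<Prod>i\<in>l. [:- r i, 1:])" if l: "l \<in> P" for l
  proof -
    have sep: "\<bar>a i - a j\<bar> \<ge> 3" if ij: "i \<in> l" "j \<in> l" "i \<noteq> j" for i j
    proof -
      have p4: "(4 :: int) ^ m \<ge> 4" if "m > 0" for m :: nat
        using power_increasing[of 1 m "4 :: int"] that by simp
      have kp: "k ^ n > 0" for n by (simp add: k_def)
      consider "i \<in> V" "j \<in> V" | "i \<in> V" "j = b l" | "j \<in> V" "i = b l"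
        using lV[OF l ij(1)] lV[OF l ij(2)] ij(3) by auto
      then show ?thesis
      proof cases
        case 1
        then have "idx i \<noteq> idx j" using idx ij(3) by (auto simp: inj_on_def)
        then have "k ^ idx i \<noteq> k ^ idx j" by (simp add: k_def power_inject_exp)
        then show ?thesis using 1 power4_gap by (simp add: a_def)
      next
        case 2
        then show ?thesis using ab[OF l] p4[OF kp, of "idx i"] by (simp add: a_def)
      next
        case 3
        then show ?thesis using ab[OF l] p4[OF kp, of "idx j"] by (simp add: a_def)
      qed
    qed
    have "card l \<ge> 2" using big[OF l] by simp
    then obtain r :: "'v \<Rightarrow> real" where "\<And>i. i \<in> l \<Longrightarrow> \<bar>r i - of_int (a i)\<bar> \<le> 1/2"
      "(\<Prod>i\<in>l. [:- of_int (a i), 1:]) + 1 = (\<Prod>i\<in>l. [:- r i, 1:])"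
      using perturbed_product_splits[OF PS(2)[OF l], of a] sep by metis
    then show ?thesis by (intro exI[of _ r]) simp
  qed
  then obtain rr :: "'v set \<Rightarrow> 'v \<Rightarrow> real" where rr: "\<And>l i. l \<in> P \<Longrightarrow> i \<in> l \<Longrightarrow> \<bar>rr l i - of_int (a i)\<bar> \<le> 1/2"
    "\<And>l. l \<in> P \<Longrightarrow> (\<Prod>i\<in>l. [:- of_int (a i), 1:]) + 1 = (\<Prod>i\<in>l. [:- rr l i, 1:])"
    by metis
  define r where "r = (\<lambda>i. rr (THE l. l \<in> P \<and> i \<in> l) i)"
  have r_eq: "r i = rr l i" if "l \<in> P" "i \<in> l" for l i
  proof -
    have "(THE l. l \<in> P \<and> i \<in> l) = l" using that disj by (intro the_equality) auto
    then show ?thesis by (simp add: r_def)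
  qed
  have near: "\<bar>r i - of_int (a i)\<bar> \<le> 1/2" if "l \<in> P" "i \<in> l" for l i
    using rr(1)[OF that] r_eq[OF that] by simp
  have split: "(\<Prod>i\<in>l. [:- of_int (a i), 1:]) + 1 = (\<Prod>i\<in>l. [:- r i, 1:])" if "l \<in> P" for l
    using rr(2)[OF that] r_eq[OF that] by (simp cong: prod.cong)
  have prod1: "\<bar>\<Prod>i\<in>l. r i\<bar> = 1" if l: "l \<in> P" for l
  proof -
    have "poly ((\<Prod>i\<in>l. [:- of_int (a i), 1:]) + 1) 0 = (1::real)"
      using b[OF l] ab[OF l] PS(2)[OF l] by (auto simp: poly_prod intro!: prod_zero)
    then have "(\<Prod>i\<in>l. - r i) = 1" unfolding split[OF l] by (simp add: poly_prod)
    then have "\<bar>\<Prod>i\<in>l. - r i\<bar> = 1" by simp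
    then show ?thesis by (simp add: abs_prod)
  qed
  have r0: "r i \<noteq> 0" if "l \<in> P" "i \<in> l" for l i
    using prod1[OF that(1)] that PS(2)[OF that(1)] by (metis abs_zero prod_zero_iff zero_neq_one)
  have SP: "S = \<Union> P" using part by (simp add: partition_on_def)
  define L where "L = (\<lambda>i. ln \<bar>r i\<bar>)"
  have cov: "\<exists>l\<in>P. i \<in> l" if "i \<in> S" for i using that SP by auto
  have sumL: "(\<Sum>i\<in>l. L i) = 0" if l: "l \<in> P" for l
  proof -
    have "ln \<bar>\<Prod>i\<in>l. r i\<bar> = (\<Sum>i\<in>l. ln \<bar>r i\<bar>)"
      unfolding abs_prod using PS(2)[OF l] r0[OF l] by (intro ln_prod) auto
    then show ?thesis using prod1[OF l] by (simp add: L_def)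
  qed
  have bounds: "ln 4 * real k ^ idx v / 2 \<le> L v \<and> L v \<le> 3 * ln 4 * real k ^ idx v / 2" if v: "v \<in> V" for v
  proof -
    define A where "A = (4 :: real) ^ (k ^ idx v)"
    have aA: "of_int (a v) = A" using v by (simp add: a_def A_def)
    have kp: "k ^ idx v > 0" by (simp add: k_def)
    have A4: "A \<ge> 4" unfolding A_def using power_increasing[of 1 "k ^ idx v" "4::real"] kp by simp
    have lnA: "ln A = ln 4 * real k ^ idx v" by (simp add: A_def ln_realpow)
    obtain l where l: "l \<in> P" "v \<in> l" using cov v by (auto simp: V_def)
    have n: "\<bar>r v - A\<bar> \<le> 1/2" using near[OF l] aA by simp
    then have rv: "A - 1/2 \<le> r v" "r v \<le> A + 1/2" by (auto simp: abs_if split: if_splits)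
    \<comment> \<open>For \<open>A \<ge> 4\<close> the interval of radius 1/2 around
      \<open>A\<close> lies between \<open>A\<close> to the power 1/2 and \<open>A\<close> to the
      power 3/2; these exponents are the factors on the logarithms.\<close>
    have s2: "2 \<le> sqrt A" using A4 by (intro real_le_rsqrt) auto
    have A0: "A \<ge> 0" using A4 by linarith
    then have sA: "sqrt A * sqrt A = A" by simp
    have "sqrt A * 2 \<le> sqrt A * sqrt A" using s2 A0 by (intro mult_left_mono) auto
    then have s1: "sqrt A \<le> A - 1/2" using A4 s2 sA by linarith
    have "A * 2 \<le> A * sqrt A" using A4 s2 by (intro mult_left_mono) auto
    then have s3: "A + 1/2 \<le> A * sqrt A" using A4 by linarith
    have ls: "ln (sqrt A) = ln A / 2" using A4 by (simp add: ln_sqrt)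
    have "ln A / 2 \<le> ln (r v)" unfolding ls[symmetric]
      using rv s1 A4 s2 by (intro ln_mono) auto
    moreover have "ln (r v) \<le> ln (A * sqrt A)" using rv s3 A4 by (intro ln_mono) auto
    moreover have "ln (A * sqrt A) = 3 * ln A / 2" using A4 ls by (simp add: ln_mult)
    moreover have "L v = ln (r v)" using rv A4 by (simp add: L_def)
    ultimately show ?thesis by (simp add: lnA)
  qed
  have indep: "e i = e j"
    if e: "(\<Sum>i\<in>S. e i) \<le> c" "\<bar>\<Prod>i\<in>S. r i ^ e i\<bar> = 1" "l \<in> P" "i \<in> l" "j \<in> l"
    for e :: "'v \<Rightarrow> nat" and l i j
  proof -
    have ec: "e i \<le> c" if "i \<in> S" for i
      using member_le_sum[OF that _ fin, of e] e(1) by simp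
    have "ln \<bar>\<Prod>i\<in>S. r i ^ e i\<bar> = (\<Sum>i\<in>S. ln \<bar>r i ^ e i\<bar>)"
      unfolding abs_prod using fin cov r0 by (intro ln_prod) auto
    also have "\<dots> = (\<Sum>i\<in>S. e i * L i)"
      using cov r0 by (intro sum.cong refl) (auto simp: L_def power_abs ln_realpow)
    finally have "(\<Sum>i\<in>S. e i * L i) = 0" using e(2) by simp
    moreover have "(\<Sum>i\<in>S. e i * L i) = (\<Sum>l\<in>P. \<Sum>i\<in>l. e i * L i)"
      unfolding SP using PS(2) disj by (subst sum.Union_disjoint) auto
    \<comment> \<open>The logarithms sum to zero over \<open>l\<close>, so the exponent of the base
      point may be subtracted throughout. This eliminates \<open>L (b l)\<close>, for which there
      are no bounds.\<close>
    moreover have "(\<Sum>i\<in>l. e i * L i) = (\<Sum>i\<in>l. of_int (int (e i) - int (e (b l))) * L i)"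
      if "l \<in> P" for l
      using sumL[OF that] by (simp add: left_diff_distrib sum_subtractf sum_distrib_left[symmetric])
    ultimately have z: "(\<Sum>l\<in>P. \<Sum>i\<in>l. of_int (int (e i) - int (e (b l))) * L i) = 0" by simp
    define d where "d = (\<lambda>i. int (e i) - int (e (b (THE l. l \<in> P \<and> i \<in> l))))"
    have d_eq: "d i = int (e i) - int (e (b l))" if "l \<in> P" "i \<in> l" for l i
    proof -
      have "(THE l. l \<in> P \<and> i \<in> l) = l" using that disj by (intro the_equality) auto
      then show ?thesis by (simp add: d_def)
    qed
    have "(\<Sum>i\<in>S. of_int (d i) * L i) = (\<Sum>l\<in>P. \<Sum>i\<in>l. of_int (d i) * L i)"
      unfolding SP using PS(2) disj by (subst sum.Union_disjoint) auto
    also have "\<dots> = 0" using z d_eq by (simp cong: sum.cong)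
    finally have "(\<Sum>i\<in>S. of_int (d i) * L i) = 0" .
    moreover have "(\<Sum>i\<in>S. of_int (d i) * L i) = (\<Sum>i\<in>V. of_int (d i) * L i)"
      using fin b d_eq by (intro sum.mono_neutral_right) (auto simp: V_def)
    ultimately have dV: "(\<Sum>i\<in>V. of_int (d i) * L i) = 0" by simp
    have d0: "d v = 0" if "v \<in> V" for v
    proof (rule separated_logs_independent[OF finV idx _ _ _ _ _ dV that])
      show "real k = 3 * real c + 2" by (simp add: k_def)
      fix u assume u: "u \<in> V"
      then show "ln 4 * real k ^ idx u / 2 \<le> L u" "L u \<le> 3 * ln 4 * real k ^ idx u / 2"
        using bounds by auto
      obtain l where l: "l \<in> P" "u \<in> l" using cov u by (auto simp: V_def)
      then have "u \<in> S" "b l \<in> S" using PS(1) b by auto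
      then show "\<bar>d u\<bar> \<le> int c" using ec[of u] ec[of "b l"] by (simp add: d_eq[OF l])
    qed simp
    have "e u = e (b l)" if "u \<in> l" for u
      using d0 lV[OF e(3) that] d_eq[OF e(3) that] by (cases "u = b l") auto
    then show ?thesis using e by metis
  qed
  show thesis
    by (rule that[of b a r]) (use b ab split indep in auto)
qed

section \<open>Algebras with a bracket\<close>

declare lower_central.simps(3) [simp del]

text \<open>The bilinear part of \<open>lie_algebra\<close>. Anticommutativity and the Jacobi
  identity are left out so that the free nonassociative algebra and its quotients share one set of
  lemmas.\<close>

locale bracket_alg = vectorspace rat_field L
  for L :: "(rat, 'b, 'm) bracket_algebra_scheme" (structure) +
  assumes bracket_closed:
      "\<lbrakk>x \<in> carrier L; y \<in> carrier L\<rbrakk> \<Longrightarrow> bracket L x y \<in> carrier L"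
    and bracket_add_left:
      "\<lbrakk>x \<in> carrier L; y \<in> carrier L; z \<in> carrier L\<rbrakk>
        \<Longrightarrow> bracket L (x \<oplus> y) z = bracket L x z \<oplus> bracket L y z"
    and bracket_add_right:
      "\<lbrakk>x \<in> carrier L; y \<in> carrier L; z \<in> carrier L\<rbrakk>
        \<Longrightarrow> bracket L x (y \<oplus> z) = bracket L x y \<oplus> bracket L x z"
    and bracket_smult_left:
      "\<lbrakk>x \<in> carrier L; y \<in> carrier L\<rbrakk>
        \<Longrightarrow> bracket L (r \<odot>\<^bsub>L\<^esub> x) y = r \<odot>\<^bsub>L\<^esub> bracket L x y"
    and bracket_smult_right:
      "\<lbrakk>x \<in> carrier L; y \<in> carrier L\<rbrakk>
        \<Longrightarrow> bracket L x (r \<odot>\<^bsub>L\<^esub> y) = r \<odot>\<^bsub>L\<^esub> bracket L x y"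
begin

lemma smult_zero_rat [simp]: "x \<in> carrier L \<Longrightarrow> (0::rat) \<odot>\<^bsub>L\<^esub> x = \<zero>"
  using lmult_0[of x] by simp

lemma smult_minus_one: "x \<in> carrier L \<Longrightarrow> (- 1 :: rat) \<odot>\<^bsub>L\<^esub> x = \<ominus> x"
proof -
  assume x: "x \<in> carrier L"
  have "(- 1 :: rat) \<odot>\<^bsub>L\<^esub> x \<oplus> (1 :: rat) \<odot>\<^bsub>L\<^esub> x = ((- 1 :: rat) + 1) \<odot>\<^bsub>L\<^esub> x"
    using smult_l_distr[of "- 1 :: rat" 1 x] x by simp
  also have "\<dots> = \<zero>" using x by simp
  finally have "(- 1 :: rat) \<odot>\<^bsub>L\<^esub> x \<oplus> x = \<zero>" using smult_one[OF x] by simp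
  then show ?thesis using x smult_closed[of "-1" x] by (metis UNIV_I minus_equality partial_object.select_convs(1))
qed

lemma bracket_zero_right: "x \<in> carrier L \<Longrightarrow> bracket L x \<zero> = \<zero>"
  using bracket_smult_right[of x \<zero> 0] by (simp add: bracket_closed)

lemma bracket_zero_left: "x \<in> carrier L \<Longrightarrow> bracket L \<zero> x = \<zero>"
  using bracket_smult_left[of \<zero> x 0] by (simp add: bracket_closed)

lemma submodule_iff:
  "LinearCombinations.submodule rat_field N L \<longleftrightarrow>
     N \<subseteq> carrier L \<and> \<zero> \<in> N \<and> (\<forall>v\<in>N. \<forall>w\<in>N. v \<oplus> w \<in> N) \<and> (\<forall>(r::rat). \<forall>v\<in>N. r \<odot>\<^bsub>L\<^esub> v \<in> N)"
  unfolding LinearCombinations.submodule_def using module_axioms by auto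

lemma span_minimal:
  assumes "LinearCombinations.submodule rat_field N L" "X \<subseteq> N" shows "span X \<subseteq> N"
  using assms by (metis span_is_subset)

lemma span_submodule: "X \<subseteq> carrier L \<Longrightarrow> LinearCombinations.submodule rat_field (span X) L"
  by (rule span_is_submodule)

lemma span_superset: "X \<subseteq> carrier L \<Longrightarrow> X \<subseteq> span X"
  by (rule in_own_span)

lemma ideal_carrier: "bracket_ideal L (carrier L)"
  unfolding bracket_ideal_def submodule_iff by (auto intro: bracket_closed)

lemma
  assumes "bracket_ideal L I"
  shows ideal_subset: "I \<subseteq> carrier L"
    and ideal_zero: "\<zero> \<in> I"
    and ideal_add: "\<lbrakk>v \<in> I; w \<in> I\<rbrakk> \<Longrightarrow> v \<oplus> w \<in> I"
    and ideal_smult: "v \<in> I \<Longrightarrow> (r :: rat) \<odot>\<^bsub>L\<^esub> v \<in> I"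
    and ideal_bracket_right: "\<lbrakk>x \<in> carrier L; v \<in> I\<rbrakk> \<Longrightarrow> bracket L x v \<in> I"
    and ideal_bracket_left: "\<lbrakk>x \<in> carrier L; v \<in> I\<rbrakk> \<Longrightarrow> bracket L v x \<in> I"
  using assms by (simp_all add: bracket_ideal_def submodule_iff)

lemma ideal_generated_ideal:
  assumes "X \<subseteq> carrier L" shows "bracket_ideal L (ideal_generated L X)"
proof -
  have mem: "x \<in> ideal_generated L X \<longleftrightarrow> (\<forall>I. bracket_ideal L I \<longrightarrow> X \<subseteq> I \<longrightarrow> x \<in> I)" for x
    by (auto simp: ideal_generated_def)
  show ?thesis
    unfolding bracket_ideal_def submodule_iff
  proof (intro conjI ballI allI subsetI)
    fix x assume "x \<in> ideal_generated L X"
    then show "x \<in> carrier L" using ideal_carrier assms by (simp add: mem)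
  qed (simp_all add: mem ideal_zero ideal_add ideal_smult ideal_bracket_left ideal_bracket_right)
qed

lemma ideal_generated_superset: "X \<subseteq> ideal_generated L X"
  by (auto simp: ideal_generated_def)

lemma ideal_generated_least: "\<lbrakk>bracket_ideal L I; X \<subseteq> I\<rbrakk> \<Longrightarrow> ideal_generated L X \<subseteq> I"
  by (auto simp: ideal_generated_def)

lemma lower_central_Suc:
  "n > 0 \<Longrightarrow> lower_central L (Suc n) = span {bracket L x y | x y. x \<in> carrier L \<and> y \<in> lower_central L n}"
  by (cases n) (auto simp: lower_central.simps(3))

lemma lower_central_submodule: "LinearCombinations.submodule rat_field (lower_central L n) L"
proof (induction n rule: less_induct)
  case (less n)
  have c: "LinearCombinations.submodule rat_field (carrier L) L"
    using ideal_carrier by (simp add: bracket_ideal_def)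
  show ?case
  proof (cases "n < 2")
    case True
    then have "n = 0 \<or> n = Suc 0" by auto
    then show ?thesis using c by auto
  next
    case False
    then obtain m where m: "n = Suc m" "m > 0" by (cases n) auto
    have "lower_central L m \<subseteq> carrier L" using less[of m] m submodule_iff by auto
    then show ?thesis unfolding m(1) lower_central_Suc[OF m(2)]
      by (intro span_submodule) (auto intro: bracket_closed)
  qed
qed

lemma lower_central_carrier: "lower_central L n \<subseteq> carrier L"
  using lower_central_submodule submodule_iff by auto

lemma bracket_in_lower_central:
  assumes "n > 0" "x \<in> carrier L" "y \<in> lower_central L n"
  shows "bracket L x y \<in> lower_central L (Suc n)"
proof -
  let ?X = "{bracket L x y | x y. x \<in> carrier L \<and> y \<in> lower_central L n}"
  have "?X \<subseteq> carrier L" using lower_central_carrier by (auto intro: bracket_closed)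
  then have "?X \<subseteq> span ?X" by (rule span_superset)
  then show ?thesis unfolding lower_central_Suc[OF assms(1)] using assms by blast
qed

lemma lower_central_least:
  assumes "n > 0" "LinearCombinations.submodule rat_field N L"
    and "\<And>x y. x \<in> carrier L \<Longrightarrow> y \<in> lower_central L n \<Longrightarrow> bracket L x y \<in> N"
  shows "lower_central L (Suc n) \<subseteq> N"
  unfolding lower_central_Suc[OF assms(1)] using assms(2,3) by (intro span_minimal) auto

lemma lower_central_antimono: "lower_central L (Suc n) \<subseteq> lower_central L n"
proof (induction n)
  case 0
  then show ?case by simp
next
  case (Suc n)
  show ?case
  proof (cases "n = 0")
    case True
    then show ?thesis using lower_central_carrier[of "Suc (Suc 0)"] by simp
  next
    case False
    then show ?thesis
      using Suc by (intro lower_central_least lower_central_submodule bracket_in_lower_central) auto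
  qed
qed

end

lemma lie_algebra_bracket_alg: assumes "lie_algebra L" shows "bracket_alg L"
proof -
  interpret lie_algebra L by fact
  show ?thesis
    by unfold_locales (fact bracket_closed bracket_add_left bracket_add_right
        bracket_smult_left bracket_smult_right)+
qed

text \<open>Nothing is assumed about the structure of \<open>Q\<close>. Its axioms are transported
  along the surjection, so that the records built by \<open>quotient_algebra\<close> need no
  verification of their own.\<close>

locale bracket_epi = bracket_alg L
  for L :: "(rat, 'b, 'm) bracket_algebra_scheme" (structure)
  and Q :: "(rat, 'c, 'n) bracket_algebra_scheme" and \<pi> :: "'b \<Rightarrow> 'c" +
  assumes surj: "\<pi> ` carrier L = carrier Q"
    and hom_add: "\<lbrakk>x \<in> carrier L; y \<in> carrier L\<rbrakk> \<Longrightarrow> \<pi> (x \<oplus> y) = \<pi> x \<oplus>\<^bsub>Q\<^esub> \<pi> y"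
    and hom_zero: "\<pi> \<zero> = \<zero>\<^bsub>Q\<^esub>"
    and hom_smult: "x \<in> carrier L \<Longrightarrow> \<pi> (r \<odot>\<^bsub>L\<^esub> x) = r \<odot>\<^bsub>Q\<^esub> \<pi> x"
    and hom_bracket: "\<lbrakk>x \<in> carrier L; y \<in> carrier L\<rbrakk> \<Longrightarrow> \<pi> (bracket L x y) = bracket Q (\<pi> x) (\<pi> y)"
begin

lemma hom_closed: "x \<in> carrier L \<Longrightarrow> \<pi> x \<in> carrier Q"
  using surj by blast

lemma target_elim: assumes "y \<in> carrier Q" obtains x where "x \<in> carrier L" "y = \<pi> x"
  using assms surj by blast

lemma target_abelian_group: "abelian_group Q"
proof (rule abelian_groupI)
  fix x y assume "x \<in> carrier Q" "y \<in> carrier Q"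
  then obtain a b where ab: "a \<in> carrier L" "b \<in> carrier L" "x = \<pi> a" "y = \<pi> b"
    by (metis target_elim)
  show "x \<oplus>\<^bsub>Q\<^esub> y \<in> carrier Q" using ab hom_closed[of "a \<oplus> b"] by (simp add: hom_add)
  show "x \<oplus>\<^bsub>Q\<^esub> y = y \<oplus>\<^bsub>Q\<^esub> x" using ab by (simp add: hom_add[symmetric] a_comm)
next
  show "\<zero>\<^bsub>Q\<^esub> \<in> carrier Q" using hom_closed[of \<zero>] by (simp add: hom_zero)
next
  fix x y z assume "x \<in> carrier Q" "y \<in> carrier Q" "z \<in> carrier Q"
  then obtain a b d where "a \<in> carrier L" "b \<in> carrier L" "d \<in> carrier L" "x = \<pi> a" "y = \<pi> b" "z = \<pi> d"
    by (metis target_elim)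
  then show "x \<oplus>\<^bsub>Q\<^esub> y \<oplus>\<^bsub>Q\<^esub> z = x \<oplus>\<^bsub>Q\<^esub> (y \<oplus>\<^bsub>Q\<^esub> z)"
    by (simp add: hom_add[symmetric] a_assoc)
next
  fix x assume "x \<in> carrier Q"
  then obtain a where a: "a \<in> carrier L" "x = \<pi> a" by (metis target_elim)
  then show "\<zero>\<^bsub>Q\<^esub> \<oplus>\<^bsub>Q\<^esub> x = x" by (simp add: hom_zero[symmetric] hom_add[symmetric])
  have "\<pi> (\<ominus> a) \<oplus>\<^bsub>Q\<^esub> x = \<zero>\<^bsub>Q\<^esub>" using a by (simp add: hom_add[symmetric] hom_zero[symmetric] l_neg)
  then show "\<exists>y\<in>carrier Q. y \<oplus>\<^bsub>Q\<^esub> x = \<zero>\<^bsub>Q\<^esub>" using a hom_closed[of "\<ominus> a"] by auto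
qed

lemma target_module: "Module.module rat_field Q"
proof (rule moduleI)
  show "cring (rat_field)" by (rule is_cring)
  show "abelian_group Q" by (rule target_abelian_group)
next
  fix r :: rat and x assume "x \<in> carrier Q"
  then obtain a where a: "a \<in> carrier L" "x = \<pi> a" by (metis target_elim)
  show "r \<odot>\<^bsub>Q\<^esub> x \<in> carrier Q" using a hom_closed[of "r \<odot>\<^bsub>L\<^esub> a"] by (simp add: hom_smult)
  show "\<one>\<^bsub>rat_field\<^esub> \<odot>\<^bsub>Q\<^esub> x = x" using a smult_one[of a] by (simp add: hom_smult[symmetric])
  fix s :: rat
  show "(r \<oplus>\<^bsub>rat_field\<^esub> s) \<odot>\<^bsub>Q\<^esub> x = r \<odot>\<^bsub>Q\<^esub> x \<oplus>\<^bsub>Q\<^esub> s \<odot>\<^bsub>Q\<^esub> x"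
    using a smult_l_distr[of r s a] by (simp add: hom_smult[symmetric] hom_add[symmetric])
  show "(r \<otimes>\<^bsub>rat_field\<^esub> s) \<odot>\<^bsub>Q\<^esub> x = r \<odot>\<^bsub>Q\<^esub> (s \<odot>\<^bsub>Q\<^esub> x)"
    using a smult_assoc1[of r s a] by (simp add: hom_smult[symmetric])
  fix y assume "y \<in> carrier Q"
  then obtain b where b: "b \<in> carrier L" "y = \<pi> b" by (metis target_elim)
  show "r \<odot>\<^bsub>Q\<^esub> (x \<oplus>\<^bsub>Q\<^esub> y) = r \<odot>\<^bsub>Q\<^esub> x \<oplus>\<^bsub>Q\<^esub> r \<odot>\<^bsub>Q\<^esub> y"
    using a b smult_r_distr[of r a b] by (simp add: hom_smult[symmetric] hom_add[symmetric])
qed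

lemma target_bracket_alg: "bracket_alg Q"
proof -
  interpret Q: vectorspace rat_field Q
    using target_module field_axioms by (simp add: vectorspace_def)
  show ?thesis
  proof
    fix x y assume "x \<in> carrier Q" "y \<in> carrier Q"
    then obtain a b where ab: "a \<in> carrier L" "b \<in> carrier L" "x = \<pi> a" "y = \<pi> b"
      by (metis target_elim)
    show "bracket Q x y \<in> carrier Q"
      using ab hom_closed[OF bracket_closed[of a b]] by (simp add: hom_bracket)
    fix r
    show "bracket Q (r \<odot>\<^bsub>Q\<^esub> x) y = r \<odot>\<^bsub>Q\<^esub> bracket Q x y"
      using ab by (simp add: hom_smult[symmetric] hom_bracket[symmetric] bracket_smult_left bracket_closed)
    show "bracket Q x (r \<odot>\<^bsub>Q\<^esub> y) = r \<odot>\<^bsub>Q\<^esub> bracket Q x y"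
      using ab by (simp add: hom_smult[symmetric] hom_bracket[symmetric] bracket_smult_right bracket_closed)
    fix z assume "z \<in> carrier Q"
    then obtain d where d: "d \<in> carrier L" "z = \<pi> d" by (metis target_elim)
    show "bracket Q (x \<oplus>\<^bsub>Q\<^esub> y) z = bracket Q x z \<oplus>\<^bsub>Q\<^esub> bracket Q y z"
      using ab d by (simp add: hom_add[symmetric] hom_bracket[symmetric] bracket_add_left bracket_closed)
    show "bracket Q x (y \<oplus>\<^bsub>Q\<^esub> z) = bracket Q x y \<oplus>\<^bsub>Q\<^esub> bracket Q x z"
      using ab d by (simp add: hom_add[symmetric] hom_bracket[symmetric] bracket_add_right bracket_closed)
  qed
qed

lemma target_lie_algebra:
  assumes self: "\<And>x. x \<in> carrier L \<Longrightarrow> \<pi> (bracket L x x) = \<zero>\<^bsub>Q\<^esub>"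
    and jac: "\<And>x y z. \<lbrakk>x \<in> carrier L; y \<in> carrier L; z \<in> carrier L\<rbrakk> \<Longrightarrow>
      \<pi> (bracket L x (bracket L y z) \<oplus> bracket L y (bracket L z x) \<oplus> bracket L z (bracket L x y)) = \<zero>\<^bsub>Q\<^esub>"
  shows "lie_algebra Q"
proof -
  interpret Q: bracket_alg Q by (rule target_bracket_alg)
  show ?thesis
  proof
    fix x y z assume "x \<in> carrier Q" "y \<in> carrier Q" "z \<in> carrier Q"
    then obtain a b d where abd: "a \<in> carrier L" "b \<in> carrier L" "d \<in> carrier L" "x = \<pi> a" "y = \<pi> b" "z = \<pi> d"
      by (metis target_elim)
    show "bracket Q x (bracket Q y z) \<oplus>\<^bsub>Q\<^esub> bracket Q y (bracket Q z x)
             \<oplus>\<^bsub>Q\<^esub> bracket Q z (bracket Q x y) = \<zero>\<^bsub>Q\<^esub>"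
      using abd jac[of a b d] by (simp add: hom_add hom_bracket bracket_closed)
  next
    fix x assume "x \<in> carrier Q"
    then obtain a where "a \<in> carrier L" "x = \<pi> a" by (metis target_elim)
    then show "bracket Q x x = \<zero>\<^bsub>Q\<^esub>" using self[of a] by (simp add: hom_bracket)
  qed (fact Q.bracket_closed Q.bracket_add_left Q.bracket_add_right Q.bracket_smult_left
      Q.bracket_smult_right)+
qed

lemma image_submodule:
  assumes "LinearCombinations.submodule rat_field N L"
  shows "LinearCombinations.submodule rat_field (\<pi> ` N) Q"
proof -
  interpret Q: bracket_alg Q by (rule target_bracket_alg)
  note N = assms[unfolded submodule_iff]
  have s: "x \<in> carrier L" if "x \<in> N" for x using N that by blast
  have "\<pi> x \<oplus>\<^bsub>Q\<^esub> \<pi> y \<in> \<pi> ` N" if "x \<in> N" "y \<in> N" for x y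
    using that N by (metis hom_add image_eqI s)
  moreover have "r \<odot>\<^bsub>Q\<^esub> \<pi> x \<in> \<pi> ` N" if "x \<in> N" for x and r :: rat
    using that N by (metis hom_smult image_eqI s)
  moreover have "\<zero>\<^bsub>Q\<^esub> \<in> \<pi> ` N" using N hom_zero by (metis image_eqI)
  ultimately show ?thesis unfolding Q.submodule_iff using s hom_closed by blast
qed

lemma image_ideal:
  assumes "bracket_ideal L N" shows "bracket_ideal Q (\<pi> ` N)"
proof -
  have s: "x \<in> carrier L" if "x \<in> N" for x
    using assms that by (auto simp: bracket_ideal_def submodule_iff)
  have "bracket Q x (\<pi> y) \<in> \<pi> ` N \<and> bracket Q (\<pi> y) x \<in> \<pi> ` N" if x: "x \<in> carrier Q" and y: "y \<in> N" for x y
  proof -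
    obtain a where a: "a \<in> carrier L" "x = \<pi> a" using target_elim[OF x] .
    then have "bracket L a y \<in> N" "bracket L y a \<in> N" using assms y by (auto simp: bracket_ideal_def)
    then show ?thesis using a s[OF y] by (metis hom_bracket image_eqI)
  qed
  then show ?thesis using image_submodule assms unfolding bracket_ideal_def by blast
qed

lemma preimage_submodule:
  assumes "LinearCombinations.submodule rat_field N Q"
  shows "LinearCombinations.submodule rat_field {x \<in> carrier L. \<pi> x \<in> N} L"
proof -
  interpret Q: bracket_alg Q by (rule target_bracket_alg)
  show ?thesis using assms unfolding Q.submodule_iff submodule_iff
    by (auto simp: hom_add hom_zero hom_smult)
qed

text \<open>This moves the term \<open>\<gamma>\<close> of index \<open>c + 1\<close> of the graph
  Lie algebra back to the free nonassociative algebra, where all three quotients can then be treated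
  at once.\<close>

lemma lower_central_image: "\<pi> ` lower_central L n = lower_central Q n"
proof -
  interpret Q: bracket_alg Q by (rule target_bracket_alg)
  have "\<pi> ` lower_central L (Suc n) = lower_central Q (Suc n)" for n
  proof (induction n)
    case 0
    show ?case using surj by simp
  next
    case (Suc n)
    show ?case
    proof
      have "lower_central L (Suc (Suc n)) \<subseteq> {x \<in> carrier L. \<pi> x \<in> lower_central Q (Suc (Suc n))}"
      proof (rule lower_central_least)
        fix x y assume xy: "x \<in> carrier L" "y \<in> lower_central L (Suc n)"
        then have y: "y \<in> carrier L" "\<pi> y \<in> lower_central Q (Suc n)"
          using lower_central_carrier Suc by auto
        then show "bracket L x y \<in> {x \<in> carrier L. \<pi> x \<in> lower_central Q (Suc (Suc n))}"
          using xy Q.bracket_in_lower_central[of "Suc n" "\<pi> x" "\<pi> y"] hom_closed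
          by (auto simp: hom_bracket bracket_closed)
      qed (auto intro!: preimage_submodule Q.lower_central_submodule)
      then show "\<pi> ` lower_central L (Suc (Suc n)) \<subseteq> lower_central Q (Suc (Suc n))" by blast
    next
      show "lower_central Q (Suc (Suc n)) \<subseteq> \<pi> ` lower_central L (Suc (Suc n))"
      proof (rule Q.lower_central_least)
        fix x y assume xy: "x \<in> carrier Q" "y \<in> lower_central Q (Suc n)"
        obtain a where a: "a \<in> carrier L" "x = \<pi> a" using target_elim[OF xy(1)] .
        obtain b where b: "b \<in> lower_central L (Suc n)" "y = \<pi> b" using xy(2) Suc by auto
        have "bracket L a b \<in> lower_central L (Suc (Suc n))"
          using bracket_in_lower_central[OF _ a(1) b(1)] by simp
        moreover have "bracket Q x y = \<pi> (bracket L a b)"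
          using a b lower_central_carrier[of "Suc n"] by (auto simp: hom_bracket)
        ultimately show "bracket Q x y \<in> \<pi> ` lower_central L (Suc (Suc n))" by blast
      qed (auto intro!: image_submodule lower_central_submodule)
    qed
  qed
  then show ?thesis using surj by (cases n) auto
qed

end

context lie_algebra
begin

sublocale bracket_alg L
  by (rule lie_algebra_bracket_alg) (rule lie_algebra_axioms)

lemma bracket_anticomm:
  assumes x: "x \<in> carrier L" and y: "y \<in> carrier L"
  shows "bracket L y x = (- 1) \<odot>\<^bsub>L\<^esub> bracket L x y"
proof -
  have c: "bracket L x y \<in> carrier L" "bracket L y x \<in> carrier L"
    using x y by (auto intro: bracket_closed)
  have xy: "x \<oplus> y \<in> carrier L" using x y by (rule a_closed)
  have "\<zero> = bracket L (x \<oplus> y) (x \<oplus> y)" using bracket_self[OF xy] by (rule sym)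
  also have "\<dots> = bracket L x (x \<oplus> y) \<oplus> bracket L y (x \<oplus> y)"
    by (rule bracket_add_left[OF x y xy])
  also have "bracket L x (x \<oplus> y) = bracket L x y"
    by (simp only: bracket_add_right[OF x x y] bracket_self[OF x] l_zero[OF c(1)])
  also have "bracket L y (x \<oplus> y) = bracket L y x"
    by (simp only: bracket_add_right[OF y x y] bracket_self[OF y] r_zero[OF c(2)])
  finally have "bracket L y x \<oplus> bracket L x y = \<zero>"
    by (simp only: a_comm[OF c(2) c(1)])
  then have "bracket L y x = \<ominus> bracket L x y"
    using minus_equality[OF _ c(1) c(2)] by metis
  then show ?thesis by (simp only: smult_minus_one[OF c(1)])
qed

text \<open>The series is built with left brackets only. Anticommutativity supplies the other side,
  so a Lie algebra is required here and not just a \<open>bracket_alg\<close>.\<close>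

lemma lower_central_ideal:
  assumes n: "n > 0" shows "bracket_ideal L (lower_central L n)"
  unfolding bracket_ideal_def
proof (intro conjI ballI)
  show "LinearCombinations.submodule rat_field (lower_central L n) L"
    by (rule lower_central_submodule)
  fix x y assume x: "x \<in> carrier L" and y: "y \<in> lower_central L n"
  have yc: "y \<in> carrier L" using y lower_central_carrier by blast
  have "bracket L x y \<in> lower_central L (Suc n)"
    by (rule bracket_in_lower_central[OF n x y])
  then show xy: "bracket L x y \<in> lower_central L n"
    by (rule subsetD[OF lower_central_antimono])
  have "(- 1 :: rat) \<odot>\<^bsub>L\<^esub> bracket L x y \<in> lower_central L n"
    by (rule LinearCombinations.submodule.smult_closed[OF lower_central_submodule _ xy]) simp
  then show "bracket L y x \<in> lower_central L n"
    by (simp only: bracket_anticomm[OF x yc])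
qed

end

text \<open>The operations of \<open>quotient_algebra\<close> are unions over all representatives;
  each union collapses to one coset because changing the representatives changes the result by terms
  that have an argument in the ideal.\<close>

lemma quotient_epi:
  assumes "bracket_alg L" "bracket_ideal L I"
  shows "bracket_epi L (quotient_algebra L I) (\<lambda>x. I +>\<^bsub>L\<^esub> x)"
    and "\<And>x. x \<in> carrier L \<Longrightarrow> I +>\<^bsub>L\<^esub> x = \<zero>\<^bsub>quotient_algebra L I\<^esub> \<longleftrightarrow> x \<in> I"
proof -
  interpret bracket_alg L by fact
  have sub: "I \<subseteq> carrier L" "\<zero>\<^bsub>L\<^esub> \<in> I" "\<And>v w. v \<in> I \<Longrightarrow> w \<in> I \<Longrightarrow> v \<oplus>\<^bsub>L\<^esub> w \<in> I"
    "\<And>(r::rat) v. v \<in> I \<Longrightarrow> r \<odot>\<^bsub>L\<^esub> v \<in> I"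
    and br: "\<And>x y. x \<in> carrier L \<Longrightarrow> y \<in> I \<Longrightarrow> bracket L x y \<in> I \<and> bracket L y x \<in> I"
    using assms(2) by (auto simp: bracket_ideal_def submodule_iff)
  have neg: "\<ominus>\<^bsub>L\<^esub> v \<in> I" if "v \<in> I" for v
    using sub(4)[OF that, of "- 1"] sub(1) that by (auto simp: smult_minus_one)
  have "additive_subgroup I L"
    unfolding additive_subgroup_def
    using sub neg by (intro group.subgroupI a_group) (auto simp: a_inv_def[symmetric])
  then interpret I: abelian_subgroup I L
    using abelian_group_axioms by (intro abelian_subgroupI3)
  have eq: "I +>\<^bsub>L\<^esub> x = I +>\<^bsub>L\<^esub> y" if "x \<in> I +>\<^bsub>L\<^esub> y" "y \<in> carrier L" for x y
    using I.a_repr_independence'[of x y] that by simp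
  have mem: "x \<in> I +>\<^bsub>L\<^esub> y \<longleftrightarrow> (\<exists>h\<in>I. x = h \<oplus>\<^bsub>L\<^esub> y)" for x y
    by (auto simp: a_r_coset_def')
  show zero: "I +>\<^bsub>L\<^esub> x = \<zero>\<^bsub>quotient_algebra L I\<^esub> \<longleftrightarrow> x \<in> I" if "x \<in> carrier L" for x
    using that I.a_rcos_const[of x] I.a_rcos_self[of x] by (auto simp: quotient_algebra_def)
  have self: "x \<in> I +>\<^bsub>L\<^esub> x" if "x \<in> carrier L" for x using I.a_rcos_self[OF that] .
  show "bracket_epi L (quotient_algebra L I) (\<lambda>x. I +>\<^bsub>L\<^esub> x)"
  proof (intro bracket_epi.intro bracket_epi_axioms.intro)
    show "bracket_alg L" by fact
    show "(+>\<^bsub>L\<^esub>) I ` carrier L = carrier (quotient_algebra L I)"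
      by (auto simp: quotient_algebra_def A_RCOSETS_def')
    show "I +>\<^bsub>L\<^esub> \<zero>\<^bsub>L\<^esub> = \<zero>\<^bsub>quotient_algebra L I\<^esub>" using zero[of "\<zero>\<^bsub>L\<^esub>"] sub by simp
  next
    fix x y assume x: "x \<in> carrier L" and y: "y \<in> carrier L"
    show "I +>\<^bsub>L\<^esub> (x \<oplus>\<^bsub>L\<^esub> y) = (I +>\<^bsub>L\<^esub> x) \<oplus>\<^bsub>quotient_algebra L I\<^esub> (I +>\<^bsub>L\<^esub> y)"
      using I.a_rcos_sum[OF x y, symmetric] unfolding quotient_algebra_def
      by (simp only: ring_record_simps)
    have b: "bracket L u v \<in> I +>\<^bsub>L\<^esub> bracket L x y" if uv: "u \<in> I +>\<^bsub>L\<^esub> x" "v \<in> I +>\<^bsub>L\<^esub> y" for u v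
    proof -
      obtain h k where h: "h \<in> I" "u = h \<oplus>\<^bsub>L\<^esub> x" and k: "k \<in> I" "v = k \<oplus>\<^bsub>L\<^esub> y"
        using uv(1)[unfolded mem] uv(2)[unfolded mem] by blast
      have hk: "h \<in> carrier L" "k \<in> carrier L" using h k sub by auto
      have "bracket L u v = (bracket L h k \<oplus>\<^bsub>L\<^esub> bracket L x k \<oplus>\<^bsub>L\<^esub> bracket L h y) \<oplus>\<^bsub>L\<^esub> bracket L x y"
      proof -
        have c: "bracket L h k \<in> carrier L" "bracket L h y \<in> carrier L"
          "bracket L x k \<in> carrier L" "bracket L x y \<in> carrier L"
          using bracket_closed[OF hk(1) hk(2)] bracket_closed[OF hk(1) y]
            bracket_closed[OF x hk(2)] bracket_closed[OF x y] by blast+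
        have "bracket L u v = bracket L (h \<oplus>\<^bsub>L\<^esub> x) k \<oplus>\<^bsub>L\<^esub> bracket L (h \<oplus>\<^bsub>L\<^esub> x) y"
          unfolding h(2) k(2) by (rule bracket_add_right[OF a_closed[OF hk(1) x] hk(2) y])
        also have "\<dots> = (bracket L h k \<oplus>\<^bsub>L\<^esub> bracket L x k) \<oplus>\<^bsub>L\<^esub> (bracket L h y \<oplus>\<^bsub>L\<^esub> bracket L x y)"
          by (simp only: bracket_add_left[OF hk(1) x hk(2)] bracket_add_left[OF hk(1) x y])
        finally have "bracket L u v = (bracket L h k \<oplus>\<^bsub>L\<^esub> bracket L x k) \<oplus>\<^bsub>L\<^esub> (bracket L h y \<oplus>\<^bsub>L\<^esub> bracket L x y)" .
        then show ?thesis
          by (simp only: a_assoc[OF a_closed[OF c(1,3)] c(2,4)])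
      qed
      moreover have "bracket L h k \<oplus>\<^bsub>L\<^esub> bracket L x k \<oplus>\<^bsub>L\<^esub> bracket L h y \<in> I"
        using br[OF hk(1) k(1)] br[OF x k(1)] br[OF y h(1)] by (intro sub(3)) blast+
      ultimately show ?thesis unfolding mem by (intro bexI)
    qed
    have "(\<Union>u\<in>I +>\<^bsub>L\<^esub> x. \<Union>v\<in>I +>\<^bsub>L\<^esub> y. I +>\<^bsub>L\<^esub> bracket L u v) = I +>\<^bsub>L\<^esub> bracket L x y"
    proof -
      have "I +>\<^bsub>L\<^esub> bracket L u v = I +>\<^bsub>L\<^esub> bracket L x y"
        if "u \<in> I +>\<^bsub>L\<^esub> x" "v \<in> I +>\<^bsub>L\<^esub> y" for u v
        using eq[OF b[OF that] bracket_closed[OF x y]] .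
      then show ?thesis using self[OF x] self[OF y] by blast
    qed
    then show "I +>\<^bsub>L\<^esub> bracket L x y = bracket (quotient_algebra L I) (I +>\<^bsub>L\<^esub> x) (I +>\<^bsub>L\<^esub> y)"
      by (simp add: quotient_algebra_def)
  next
    fix x and r :: rat assume x: "x \<in> carrier L"
    have b: "r \<odot>\<^bsub>L\<^esub> u \<in> I +>\<^bsub>L\<^esub> (r \<odot>\<^bsub>L\<^esub> x)" if u: "u \<in> I +>\<^bsub>L\<^esub> x" for u
    proof -
      obtain h where h: "h \<in> I" "u = h \<oplus>\<^bsub>L\<^esub> x"
        using iffD1[OF mem u] by (rule bexE)
      then have "r \<odot>\<^bsub>L\<^esub> u = r \<odot>\<^bsub>L\<^esub> h \<oplus>\<^bsub>L\<^esub> r \<odot>\<^bsub>L\<^esub> x"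
        using smult_r_distr[of r h x] sub(1) x by auto
      then show ?thesis using sub(4)[OF h(1)] unfolding mem by (intro bexI)
    qed
    have "(\<Union>u\<in>I +>\<^bsub>L\<^esub> x. I +>\<^bsub>L\<^esub> (r \<odot>\<^bsub>L\<^esub> u)) = I +>\<^bsub>L\<^esub> (r \<odot>\<^bsub>L\<^esub> x)"
    proof -
      have "I +>\<^bsub>L\<^esub> (r \<odot>\<^bsub>L\<^esub> u) = I +>\<^bsub>L\<^esub> (r \<odot>\<^bsub>L\<^esub> x)" if "u \<in> I +>\<^bsub>L\<^esub> x" for u
        using eq[OF b[OF that]] x by simp
      then show ?thesis using self[OF x] by blast
    qed
    then show "I +>\<^bsub>L\<^esub> (r \<odot>\<^bsub>L\<^esub> x) = r \<odot>\<^bsub>quotient_algebra L I\<^esub> (I +>\<^bsub>L\<^esub> x)"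
      by (simp add: quotient_algebra_def)
  qed
qed

section \<open>The nilpotent Lie algebra of a graph as a quotient of the free algebra\<close>

definition fmul :: "('v magma \<Rightarrow>\<^sub>0 rat) \<Rightarrow> ('v magma \<Rightarrow>\<^sub>0 rat) \<Rightarrow> ('v magma \<Rightarrow>\<^sub>0 rat)" where
  "fmul p q = (\<Sum>s\<in>Poly_Mapping.keys p. \<Sum>t\<in>Poly_Mapping.keys q.
     Poly_Mapping.single (Prod s t) (Poly_Mapping.lookup p s * Poly_Mapping.lookup q t))"

definition fscale :: "rat \<Rightarrow> ('v magma \<Rightarrow>\<^sub>0 rat) \<Rightarrow> ('v magma \<Rightarrow>\<^sub>0 rat)" where
  "fscale r = Poly_Mapping.map ((*) r)"

lemma free_nonassoc_simps_op [simp]: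
  "zero (free_nonassoc S) = 0" "add (free_nonassoc S) = (+)"
  "smult (free_nonassoc S) = fscale" "bracket (free_nonassoc S) = fmul"
  by (auto simp: free_nonassoc_def fscale_def fmul_def fun_eq_iff)

lemma lookup_fscale [simp]: "Poly_Mapping.lookup (fscale r p) t = r * Poly_Mapping.lookup p t"
  by (simp add: fscale_def Poly_Mapping.map.rep_eq when_def)

text \<open>A tree splits into two factors in only one way, so a coefficient of a product is a
  single product and not a convolution.\<close>

lemma lookup_fmul [simp]:
  "Poly_Mapping.lookup (fmul p q) (Gen a) = 0"
  "Poly_Mapping.lookup (fmul p q) (Prod s t) = Poly_Mapping.lookup p s * Poly_Mapping.lookup q t"
proof -
  show "Poly_Mapping.lookup (fmul p q) (Gen a) = 0"
    by (simp add: fmul_def lookup_sum lookup_single when_def)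
  have "Poly_Mapping.lookup (fmul p q) (Prod s t) = (\<Sum>s'\<in>Poly_Mapping.keys p. \<Sum>t'\<in>Poly_Mapping.keys q.
      if s' = s then if t' = t then Poly_Mapping.lookup p s * Poly_Mapping.lookup q t else 0 else 0)"
    unfolding fmul_def lookup_sum by (intro sum.cong) (auto simp: lookup_single when_def)
  also have "\<dots> = (\<Sum>s'\<in>Poly_Mapping.keys p. if s' = s then
      (\<Sum>t'\<in>Poly_Mapping.keys q. if t' = t then Poly_Mapping.lookup p s * Poly_Mapping.lookup q t else 0) else 0)"
    by (intro sum.cong) auto
  also have "\<dots> = Poly_Mapping.lookup p s * Poly_Mapping.lookup q t"
    by (simp add: in_keys_iff)
  finally show "Poly_Mapping.lookup (fmul p q) (Prod s t) = Poly_Mapping.lookup p s * Poly_Mapping.lookup q t" .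
qed

lemma in_carrier_iff:
  "p \<in> carrier (free_nonassoc S) \<longleftrightarrow> (\<forall>t. \<not> set_magma t \<subseteq> S \<longrightarrow> Poly_Mapping.lookup p t = 0)"
  by (auto simp: free_nonassoc_def in_keys_iff)

lemma fpoly_eqI:
  assumes "\<And>a. Poly_Mapping.lookup p (Gen a) = Poly_Mapping.lookup q (Gen a)"
    and "\<And>s t. Poly_Mapping.lookup p (Prod s t) = Poly_Mapping.lookup q (Prod s t)"
  shows "p = q"
proof (rule poly_mapping_eqI)
  fix t show "Poly_Mapping.lookup p t = Poly_Mapping.lookup q t"
    by (cases t) (simp_all add: assms)
qed

lemma fmul_closed:
  assumes "p \<in> carrier (free_nonassoc S)" "q \<in> carrier (free_nonassoc S)"
  shows "fmul p q \<in> carrier (free_nonassoc S)"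
  unfolding in_carrier_iff
proof (intro allI impI)
  fix t assume t: "\<not> set_magma t \<subseteq> S"
  show "Poly_Mapping.lookup (fmul p q) t = 0"
    using t assms by (cases t) (auto simp: in_carrier_iff)
qed

lemma single_closed: "set_magma t \<subseteq> S \<Longrightarrow> Poly_Mapping.single t r \<in> carrier (free_nonassoc S)"
  by (auto simp: in_carrier_iff lookup_single when_def)

lemma fmul_single: "fmul (Poly_Mapping.single s a) (Poly_Mapping.single t b) = Poly_Mapping.single (Prod s t) (a * b)"
  by (rule fpoly_eqI) (auto simp: lookup_single when_def)

lemma free_nonassoc_bracket_alg: "bracket_alg (free_nonassoc S)"
proof -
  let ?F = "free_nonassoc S"
  have cl: "p + q \<in> carrier ?F" if "p \<in> carrier ?F" "q \<in> carrier ?F" for p q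
    using that unfolding in_carrier_iff by (simp add: lookup_add)
  have sc: "fscale r p \<in> carrier ?F" if "p \<in> carrier ?F" for p r
    using that unfolding in_carrier_iff by simp
  have 1: "abelian_group ?F"
  proof (rule abelian_groupI)
    fix x y assume "x \<in> carrier ?F" "y \<in> carrier ?F"
    then show "x \<oplus>\<^bsub>?F\<^esub> y \<in> carrier ?F" unfolding free_nonassoc_simps_op by (rule cl)
  next
    fix x assume x: "x \<in> carrier ?F"
    have "fscale (- 1) x \<in> carrier ?F" using sc[OF x] .
    moreover have "fscale (- 1) x = - x" by (rule poly_mapping_eqI) simp
    ultimately have "- x \<in> carrier ?F" by simp
    then show "\<exists>y\<in>carrier ?F. y \<oplus>\<^bsub>?F\<^esub> x = \<zero>\<^bsub>?F\<^esub>" by (intro bexI[of _ "- x"]) auto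
  qed (simp_all add: add_ac in_carrier_iff)
  interpret abelian_group ?F by (rule 1)
  have 2: "Module.module rat_field ?F"
  proof (rule moduleI)
    show "cring (rat_field)" by (rule domain.axioms(1)[OF field.axioms(1)[OF class_field]])
    show "abelian_group ?F" by (rule 1)
  next
    fix a :: rat and x assume "x \<in> carrier ?F"
    then show "a \<odot>\<^bsub>?F\<^esub> x \<in> carrier ?F" unfolding free_nonassoc_simps_op by (rule sc)
  qed (simp_all, (rule poly_mapping_eqI, simp add: lookup_add algebra_simps)+)
  interpret vectorspace rat_field ?F
    using 2 class_field by (simp add: vectorspace_def)
  show ?thesis
  proof
    fix x y assume "x \<in> carrier ?F" "y \<in> carrier ?F"
    then show "bracket ?F x y \<in> carrier ?F"
      unfolding free_nonassoc_simps_op by (rule fmul_closed)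
  qed (simp_all, (rule fpoly_eqI, simp_all add: lookup_add algebra_simps)+)
qed

lemma bracket_epi_comp:
  assumes "bracket_epi A B f" "bracket_epi B C g" shows "bracket_epi A C (\<lambda>x. g (f x))"
proof -
  interpret f: bracket_epi A B f by fact
  interpret g: bracket_epi B C g by fact
  show ?thesis
  proof (intro bracket_epi.intro bracket_epi_axioms.intro)
    show "bracket_alg A" by (rule f.bracket_alg_axioms)
    show "(\<lambda>x. g (f x)) ` carrier A = carrier C"
      by (simp only: image_image[symmetric] f.surj g.surj)
  qed (simp_all add: f.hom_add g.hom_add f.hom_zero g.hom_zero f.hom_smult g.hom_smult
      f.hom_bracket g.hom_bracket f.hom_closed)
qed

text \<open>An ideal that contains the kernel is recovered from its image. This lifts membership
  through one quotient at a time.\<close>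

lemma (in bracket_epi) preimage_image_ideal:
  assumes "\<And>x. x \<in> carrier L \<Longrightarrow> \<pi> x = \<zero>\<^bsub>Q\<^esub> \<Longrightarrow> x \<in> J" "bracket_ideal L J"
    and x: "x \<in> carrier L" "\<pi> x \<in> \<pi> ` J"
  shows "x \<in> J"
proof -
  obtain j where j: "j \<in> J" "\<pi> x = \<pi> j" using x(2) by blast
  have jc: "j \<in> carrier L" using j(1) ideal_subset[OF assms(2)] by blast
  have mc: "\<ominus> j \<in> carrier L" using jc by (rule a_inv_closed)
  have d: "x \<oplus> \<ominus> j \<in> carrier L" using x(1) mc by (rule a_closed)
  have "\<pi> (x \<oplus> \<ominus> j) = \<pi> (j \<oplus> \<ominus> j)" by (simp only: hom_add[OF x(1) mc] hom_add[OF jc mc] j(2))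
  also have "\<dots> = \<zero>\<^bsub>Q\<^esub>" by (simp only: r_neg[OF jc] hom_zero)
  finally have "x \<oplus> \<ominus> j \<in> J" using assms(1)[OF d] by blast
  then have "(x \<oplus> \<ominus> j) \<oplus> j \<in> J" using ideal_add[OF assms(2)] j(1) by blast
  then show ?thesis by (simp only: a_assoc[OF x(1) mc jc] l_neg[OF jc] r_zero[OF x(1)])
qed

definition proj_free where "proj_free S p = free_lie_ideal S +>\<^bsub>free_nonassoc S\<^esub> p"

definition graph_ideal where
  "graph_ideal S E = ideal_generated (free_lie S)
     {bracket (free_lie S) (free_lie_gen S \<alpha>) (free_lie_gen S \<beta>)
       | \<alpha> \<beta>. \<alpha> \<in> S \<and> \<beta> \<in> S \<and> {\<alpha>, \<beta>} \<notin> E}"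

definition proj_graph where "proj_graph S E x = graph_ideal S E +>\<^bsub>free_lie S\<^esub> x"

definition proj_nilp where
  "proj_nilp S E c x = lower_central (graph_lie S E) (c + 1) +>\<^bsub>graph_lie S E\<^esub> x"

text \<open>All later work uses this composite from the free nonassociative algebra, so that the
  nested cosets never have to be opened.\<close>

definition nproj where "nproj S E c p = proj_nilp S E c (proj_graph S E (proj_free S p))"

definition fgen :: "'v \<Rightarrow> 'v magma \<Rightarrow>\<^sub>0 rat" where "fgen \<alpha> = Poly_Mapping.single (Gen \<alpha>) 1"

lemma fgen_closed: "\<alpha> \<in> S \<Longrightarrow> fgen \<alpha> \<in> carrier (free_nonassoc S)"
  unfolding fgen_def by (rule single_closed) simp

lemma lie_relators_carrier: "lie_relators S \<subseteq> carrier (free_nonassoc S)"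
proof -
  interpret F: bracket_alg "free_nonassoc S" by (rule free_nonassoc_bracket_alg)
  have 1: "fmul x y \<in> carrier (free_nonassoc S)"
    if "x \<in> carrier (free_nonassoc S)" "y \<in> carrier (free_nonassoc S)" for x y
    using fmul_closed[OF that] .
  have 2: "x + y \<in> carrier (free_nonassoc S)"
    if "x \<in> carrier (free_nonassoc S)" "y \<in> carrier (free_nonassoc S)" for x y
    using F.a_closed[OF that] by simp
  show ?thesis
    unfolding lie_relators_def Let_def free_nonassoc_simps_op(4)
    using 1 2 by (auto)
qed

lemma free_lie_ideal_ideal: "bracket_ideal (free_nonassoc S) (free_lie_ideal S)"
  unfolding free_lie_ideal_def
  by (rule bracket_alg.ideal_generated_ideal[OF free_nonassoc_bracket_alg lie_relators_carrier])

lemma proj_free_epi: "bracket_epi (free_nonassoc S) (free_lie S) (proj_free S)"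
  using quotient_epi(1)[OF free_nonassoc_bracket_alg free_lie_ideal_ideal]
  unfolding proj_free_def[abs_def] free_lie_def .

lemma proj_free_zero_iff:
  "p \<in> carrier (free_nonassoc S) \<Longrightarrow> proj_free S p = \<zero>\<^bsub>free_lie S\<^esub> \<longleftrightarrow> p \<in> free_lie_ideal S"
  using quotient_epi(2)[OF free_nonassoc_bracket_alg free_lie_ideal_ideal]
  unfolding proj_free_def[abs_def] free_lie_def .

lemma free_lie_lie_algebra: "lie_algebra (free_lie S)"
proof -
  let ?F = "free_nonassoc S"
  interpret F: bracket_epi ?F "free_lie S" "proj_free S" by (rule proj_free_epi)
  have z: "proj_free S p = \<zero>\<^bsub>free_lie S\<^esub>" if "p \<in> lie_relators S" for p
  proof -
    have "p \<in> carrier ?F" using that lie_relators_carrier by blast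
    moreover have "p \<in> free_lie_ideal S"
      using that F.ideal_generated_superset unfolding free_lie_ideal_def by blast
    ultimately show ?thesis by (simp only: proj_free_zero_iff)
  qed
  show ?thesis
  proof (rule F.target_lie_algebra)
    fix x assume "x \<in> carrier ?F"
    then show "proj_free S (bracket ?F x x) = \<zero>\<^bsub>free_lie S\<^esub>"
      by (intro z) (auto simp: lie_relators_def Let_def simp del: free_nonassoc_simps_op(4))
  next
    fix x y t assume "x \<in> carrier ?F" "y \<in> carrier ?F" "t \<in> carrier ?F"
    then show "proj_free S (bracket ?F x (bracket ?F y t) \<oplus>\<^bsub>?F\<^esub> bracket ?F y (bracket ?F t x)
        \<oplus>\<^bsub>?F\<^esub> bracket ?F t (bracket ?F x y)) = \<zero>\<^bsub>free_lie S\<^esub>"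
      unfolding free_nonassoc_simps_op(2)
      by (intro z) (unfold lie_relators_def Let_def, blast)
  qed
qed

lemma free_lie_gen_eq: "free_lie_gen S \<alpha> = proj_free S (fgen \<alpha>)"
  by (simp add: free_lie_gen_def proj_free_def fgen_def)

lemma graph_relators_carrier:
  "{bracket (free_lie S) (free_lie_gen S \<alpha>) (free_lie_gen S \<beta>)
       | \<alpha> \<beta>. \<alpha> \<in> S \<and> \<beta> \<in> S \<and> {\<alpha>, \<beta>} \<notin> E} \<subseteq> carrier (free_lie S)"
proof -
  interpret F: bracket_epi "free_nonassoc S" "free_lie S" "proj_free S" by (rule proj_free_epi)
  interpret L: lie_algebra "free_lie S" by (rule free_lie_lie_algebra)
  show ?thesis
  proof clarify
    fix \<alpha> \<beta> assume "\<alpha> \<in> S" "\<beta> \<in> S"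
    then show "bracket (free_lie S) (free_lie_gen S \<alpha>) (free_lie_gen S \<beta>) \<in> carrier (free_lie S)"
      unfolding free_lie_gen_eq by (intro L.bracket_closed F.hom_closed fgen_closed)
  qed
qed

lemma graph_ideal_ideal: "bracket_ideal (free_lie S) (graph_ideal S E)"
  unfolding graph_ideal_def
  by (rule bracket_alg.ideal_generated_ideal[OF lie_algebra_bracket_alg[OF free_lie_lie_algebra]
        graph_relators_carrier])

lemma proj_graph_epi: "bracket_epi (free_lie S) (graph_lie S E) (proj_graph S E)"
  using quotient_epi(1)[OF lie_algebra_bracket_alg[OF free_lie_lie_algebra] graph_ideal_ideal]
  unfolding proj_graph_def[abs_def] graph_lie_def graph_ideal_def[symmetric] .

lemma proj_graph_zero_iff:
  "x \<in> carrier (free_lie S) \<Longrightarrow> proj_graph S E x = \<zero>\<^bsub>graph_lie S E\<^esub> \<longleftrightarrow> x \<in> graph_ideal S E"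
  using quotient_epi(2)[OF lie_algebra_bracket_alg[OF free_lie_lie_algebra] graph_ideal_ideal]
  unfolding proj_graph_def[abs_def] graph_lie_def graph_ideal_def[symmetric] .

lemma epi_lie_algebra:
  assumes "lie_algebra A" "bracket_epi A B f" shows "lie_algebra B"
proof -
  interpret A: lie_algebra A by fact
  interpret f: bracket_epi A B f by fact
  show ?thesis
    by (rule f.target_lie_algebra) (simp_all only: A.bracket_self A.jacobi f.hom_zero)
qed

lemma graph_lie_lie_algebra: "lie_algebra (graph_lie S E)"
  by (rule epi_lie_algebra[OF free_lie_lie_algebra proj_graph_epi])

lemma proj_nilp_epi: "bracket_epi (graph_lie S E) (nilpotent_graph_lie S E c) (proj_nilp S E c)"
  and proj_nilp_zero_iff: "x \<in> carrier (graph_lie S E) \<Longrightarrow>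
    proj_nilp S E c x = \<zero>\<^bsub>nilpotent_graph_lie S E c\<^esub> \<longleftrightarrow> x \<in> lower_central (graph_lie S E) (c + 1)"
proof -
  interpret L: lie_algebra "graph_lie S E" by (rule graph_lie_lie_algebra)
  have i: "bracket_ideal (graph_lie S E) (lower_central (graph_lie S E) (c + 1))"
    by (rule L.lower_central_ideal) simp
  show "bracket_epi (graph_lie S E) (nilpotent_graph_lie S E c) (proj_nilp S E c)"
    using quotient_epi(1)[OF L.bracket_alg_axioms i]
    unfolding proj_nilp_def[abs_def] nilpotent_graph_lie_def .
  show "x \<in> carrier (graph_lie S E) \<Longrightarrow>
    proj_nilp S E c x = \<zero>\<^bsub>nilpotent_graph_lie S E c\<^esub> \<longleftrightarrow> x \<in> lower_central (graph_lie S E) (c + 1)"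
    using quotient_epi(2)[OF L.bracket_alg_axioms i]
    unfolding proj_nilp_def[abs_def] nilpotent_graph_lie_def .
qed

lemma nilpotent_lie_algebra: "lie_algebra (nilpotent_graph_lie S E c)"
  by (rule epi_lie_algebra[OF graph_lie_lie_algebra proj_nilp_epi])

lemma nproj_epi: "bracket_epi (free_nonassoc S) (nilpotent_graph_lie S E c) (nproj S E c)"
  using bracket_epi_comp[OF bracket_epi_comp[OF proj_free_epi proj_graph_epi] proj_nilp_epi]
  unfolding nproj_def[abs_def] .

lemma nilpotent_lower_central:
  "lower_central (nilpotent_graph_lie S E c) (c + 1) = {\<zero>\<^bsub>nilpotent_graph_lie S E c\<^esub>}"
proof -
  interpret p: bracket_epi "graph_lie S E" "nilpotent_graph_lie S E c" "proj_nilp S E c"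
    by (rule proj_nilp_epi)
  have "proj_nilp S E c x = \<zero>\<^bsub>nilpotent_graph_lie S E c\<^esub>" if "x \<in> lower_central (graph_lie S E) (c + 1)" for x
  proof -
    have "x \<in> carrier (graph_lie S E)" using that p.lower_central_carrier by blast
    then show ?thesis using proj_nilp_zero_iff that by blast
  qed
  moreover have "\<zero>\<^bsub>graph_lie S E\<^esub> \<in> lower_central (graph_lie S E) (c + 1)"
    using p.lower_central_submodule[of "c + 1"] unfolding p.submodule_iff by blast
  ultimately have "proj_nilp S E c ` lower_central (graph_lie S E) (c + 1) = {\<zero>\<^bsub>nilpotent_graph_lie S E c\<^esub>}"
    by blast
  then show ?thesis by (simp only: p.lower_central_image)
qed

lemma nproj_nonedge:
  assumes "\<alpha> \<in> S" "\<beta> \<in> S" "{\<alpha>, \<beta>} \<notin> E"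
  shows "nproj S E c (fmul (fgen \<alpha>) (fgen \<beta>)) = \<zero>\<^bsub>nilpotent_graph_lie S E c\<^esub>"
proof -
  interpret f: bracket_epi "free_nonassoc S" "free_lie S" "proj_free S" by (rule proj_free_epi)
  interpret g: bracket_epi "free_lie S" "graph_lie S E" "proj_graph S E" by (rule proj_graph_epi)
  interpret p: bracket_epi "graph_lie S E" "nilpotent_graph_lie S E c" "proj_nilp S E c"
    by (rule proj_nilp_epi)
  let ?b = "bracket (free_lie S) (free_lie_gen S \<alpha>) (free_lie_gen S \<beta>)"
  have "?b \<in> graph_ideal S E"
    unfolding graph_ideal_def
    by (rule subsetD[OF g.ideal_generated_superset])
      (intro CollectI exI[of _ \<alpha>] exI[of _ \<beta>] conjI refl assms)
  moreover have "?b \<in> carrier (free_lie S)"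
    by (rule subsetD[OF graph_relators_carrier[of S E]])
      (intro CollectI exI[of _ \<alpha>] exI[of _ \<beta>] conjI refl assms)
  ultimately have "proj_graph S E ?b = \<zero>\<^bsub>graph_lie S E\<^esub>" by (simp only: proj_graph_zero_iff)
  moreover have "?b = proj_free S (fmul (fgen \<alpha>) (fgen \<beta>))"
    using f.hom_bracket[OF fgen_closed[OF assms(1)] fgen_closed[OF assms(2)]]
    by (simp add: free_lie_gen_eq)
  ultimately show ?thesis by (simp add: nproj_def p.hom_zero)
qed

text \<open>The universal property of \<open>nilpotent_graph_lie\<close>, phrased by ideals. To make
  a map on the free algebra descend, it suffices that the elements it kills contain an ideal
  \<open>J\<close> with the three kinds of relations. The proof pushes \<open>J\<close> down to the
  graph Lie algebra and lifts back.\<close>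

lemma nproj_kernel_least:
  assumes J: "bracket_ideal (free_nonassoc S) J" and rel: "lie_relators S \<subseteq> J"
    and ne: "\<And>\<alpha> \<beta>. \<lbrakk>\<alpha> \<in> S; \<beta> \<in> S; {\<alpha>, \<beta>} \<notin> E\<rbrakk> \<Longrightarrow> fmul (fgen \<alpha>) (fgen \<beta>) \<in> J"
    and lc: "lower_central (free_nonassoc S) (c + 1) \<subseteq> J"
    and p: "p \<in> carrier (free_nonassoc S)" "nproj S E c p = \<zero>\<^bsub>nilpotent_graph_lie S E c\<^esub>"
  shows "p \<in> J"
proof -
  interpret f: bracket_epi "free_nonassoc S" "free_lie S" "proj_free S" by (rule proj_free_epi)
  interpret g: bracket_epi "free_lie S" "graph_lie S E" "proj_graph S E" by (rule proj_graph_epi)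
  let ?J1 = "proj_free S ` J"
  have J1: "bracket_ideal (free_lie S) ?J1" by (rule f.image_ideal[OF J])
  have k1: "free_lie_ideal S \<subseteq> J"
    unfolding free_lie_ideal_def by (rule f.ideal_generated_least[OF J rel])
  have k2: "graph_ideal S E \<subseteq> ?J1"
    unfolding graph_ideal_def
  proof (rule g.ideal_generated_least[OF J1], clarify)
    fix \<alpha> \<beta> assume a: "\<alpha> \<in> S" "\<beta> \<in> S" "{\<alpha>, \<beta>} \<notin> E"
    have "bracket (free_lie S) (free_lie_gen S \<alpha>) (free_lie_gen S \<beta>) = proj_free S (fmul (fgen \<alpha>) (fgen \<beta>))"
      using f.hom_bracket[OF fgen_closed[OF a(1)] fgen_closed[OF a(2)]]
      by (simp add: free_lie_gen_eq)
    then show "bracket (free_lie S) (free_lie_gen S \<alpha>) (free_lie_gen S \<beta>) \<in> ?J1"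
      using ne[OF a] by blast
  qed
  have c1: "proj_free S p \<in> carrier (free_lie S)" by (rule f.hom_closed[OF p(1)])
  have c2: "proj_graph S E (proj_free S p) \<in> carrier (graph_lie S E)" by (rule g.hom_closed[OF c1])
  have "proj_graph S E (proj_free S p) \<in> lower_central (graph_lie S E) (c + 1)"
    using p(2) unfolding nproj_def by (simp only: proj_nilp_zero_iff[OF c2])
  also have "lower_central (graph_lie S E) (c + 1) = proj_graph S E ` proj_free S ` lower_central (free_nonassoc S) (c + 1)"
    by (simp only: f.lower_central_image g.lower_central_image)
  also have "\<dots> \<subseteq> proj_graph S E ` ?J1" using lc by blast
  finally have m: "proj_graph S E (proj_free S p) \<in> proj_graph S E ` ?J1" .
  have "proj_free S p \<in> ?J1"
    by (rule g.preimage_image_ideal[OF _ J1 c1 m]) (use subsetD[OF k2] in \<open>simp only: proj_graph_zero_iff\<close>)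
  then show ?thesis
    by (rule f.preimage_image_ideal[OF _ J p(1), rotated]) (use subsetD[OF k1] in \<open>simp only: proj_free_zero_iff\<close>)
qed

section \<open>Functionals with values in a metabelian Lie algebra\<close>

definition lin_ext :: "('v magma \<Rightarrow> rat) \<Rightarrow> ('v magma \<Rightarrow>\<^sub>0 rat) \<Rightarrow> rat" where
  "lin_ext h p = (\<Sum>t\<in>Poly_Mapping.keys p. Poly_Mapping.lookup p t * h t)"

lemma lin_ext_superset:
  assumes "finite T" "Poly_Mapping.keys p \<subseteq> T"
  shows "lin_ext h p = (\<Sum>t\<in>T. Poly_Mapping.lookup p t * h t)"
  unfolding lin_ext_def using assms by (intro sum.mono_neutral_left) (auto simp: in_keys_iff)

lemma lin_ext_add: "lin_ext h (p + q) = lin_ext h p + lin_ext h q"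
proof -
  let ?T = "Poly_Mapping.keys p \<union> Poly_Mapping.keys q"
  have "Poly_Mapping.keys (p + q) \<subseteq> ?T" by (rule Poly_Mapping.keys_add)
  then show ?thesis
    by (simp add: lin_ext_superset[of ?T] lookup_add algebra_simps sum.distrib)
qed

lemma lin_ext_scale: "lin_ext h (fscale r p) = r * lin_ext h p"
proof -
  have "Poly_Mapping.keys (fscale r p) \<subseteq> Poly_Mapping.keys p" by (auto simp: in_keys_iff)
  then show ?thesis
    by (simp add: lin_ext_superset[of "Poly_Mapping.keys p"] sum_distrib_left mult.assoc)
qed

lemma lin_ext_zero [simp]: "lin_ext h 0 = 0"
  by (simp add: lin_ext_def)

lemma lin_ext_single [simp]: "lin_ext h (Poly_Mapping.single t r) = r * h t"
  by (simp add: lin_ext_def)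

lemma lin_ext_sum: "lin_ext h (\<Sum>i\<in>I. p i) = (\<Sum>i\<in>I. lin_ext h (p i))"
  by (induction I rule: infinite_finite_induct) (simp_all add: lin_ext_add)

lemma lin_ext_fmul:
  "lin_ext h (fmul p q) = (\<Sum>s\<in>Poly_Mapping.keys p. \<Sum>t\<in>Poly_Mapping.keys q.
     Poly_Mapping.lookup p s * Poly_Mapping.lookup q t * h (Prod s t))"
  by (simp add: fmul_def lin_ext_sum)

text \<open>With \<open>m i j\<close> read as the coefficient of \<open>s^i t^j\<close>,
  \<open>shl\<close> is multiplication by \<open>s\<close> and \<open>shr\<close> is multiplication
  by \<open>t\<close>.\<close>

definition shl :: "(nat \<Rightarrow> nat \<Rightarrow> rat) \<Rightarrow> nat \<Rightarrow> nat \<Rightarrow> rat" where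
  "shl m i j = (case i of 0 \<Rightarrow> 0 | Suc i' \<Rightarrow> m i' j)"

definition shr :: "(nat \<Rightarrow> nat \<Rightarrow> rat) \<Rightarrow> nat \<Rightarrow> nat \<Rightarrow> rat" where
  "shr m i j = (case j of 0 \<Rightarrow> 0 | Suc j' \<Rightarrow> m i j')"

fun tree_lin :: "('v \<Rightarrow> rat) \<Rightarrow> 'v magma \<Rightarrow> rat" where
  "tree_lin u (Gen a) = u a"
| "tree_lin u (Prod s t) = 0"

text \<open>Coordinates of the metabelian Lie algebra \<open>\<rat>\<^sup>2 \<oplus> \<rat>[s, t]\<close>, in which
  \<open>x\<close> acts on the polynomial part as multiplication by \<open>u(x) s + w(x) t\<close>; \<open>(i, j)\<close> is the
  exponent of \<open>s\<^sup>i t\<^sup>j\<close>.\<close>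

fun tree_met :: "('v \<Rightarrow> rat) \<Rightarrow> ('v \<Rightarrow> rat) \<Rightarrow> 'v magma \<Rightarrow> nat \<Rightarrow> nat \<Rightarrow> rat" where
  "tree_met u w (Gen a) i j = 0"
| "tree_met u w (Prod x y) i j =
     tree_lin u x * shl (tree_met u w y) i j + tree_lin w x * shr (tree_met u w y) i j
     - (tree_lin u y * shl (tree_met u w x) i j + tree_lin w y * shr (tree_met u w x) i j)
     + (if i = 0 \<and> j = 0 then tree_lin u x * tree_lin w y - tree_lin w x * tree_lin u y else 0)"

definition fl where "fl u p = lin_ext (tree_lin u) p"
definition fm where "fm u w p i j = lin_ext (\<lambda>t. tree_met u w t i j) p"

lemma fl_fmul [simp]: "fl u (fmul p q) = 0"
  by (simp add: fl_def lin_ext_fmul)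

lemma fl_gen [simp]: "fl u (fgen a) = u a"
  by (simp add: fl_def fgen_def)

lemma fm_gen [simp]: "fm u w (fgen a) i j = 0"
  by (simp add: fm_def fgen_def)

lemma shl_lin_ext: "lin_ext (\<lambda>t. shl (tree_met u w t) i j) p = shl (fm u w p) i j"
  by (cases i) (simp_all add: shl_def fm_def lin_ext_def)

lemma shr_lin_ext: "lin_ext (\<lambda>t. shr (tree_met u w t) i j) p = shr (fm u w p) i j"
  by (cases j) (simp_all add: shr_def fm_def lin_ext_def)

lemma fm_fmul:
  "fm u w (fmul p q) i j = fl u p * shl (fm u w q) i j + fl w p * shr (fm u w q) i j
     - (fl u q * shl (fm u w p) i j + fl w q * shr (fm u w p) i j)
     + (if i = 0 \<and> j = 0 then fl u p * fl w q - fl w p * fl u q else 0)"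
proof -
  have p: "(\<Sum>s\<in>Poly_Mapping.keys p. \<Sum>t\<in>Poly_Mapping.keys q.
     Poly_Mapping.lookup p s * Poly_Mapping.lookup q t * (a s * b t)) = lin_ext a p * lin_ext b q" for a b
    by (simp add: lin_ext_def sum_product algebra_simps)
  have "fm u w (fmul p q) i j = (\<Sum>s\<in>Poly_Mapping.keys p. \<Sum>t\<in>Poly_Mapping.keys q.
      Poly_Mapping.lookup p s * Poly_Mapping.lookup q t * (tree_lin u s * shl (tree_met u w t) i j)
    + Poly_Mapping.lookup p s * Poly_Mapping.lookup q t * (tree_lin w s * shr (tree_met u w t) i j)
    - (Poly_Mapping.lookup p s * Poly_Mapping.lookup q t * (shl (tree_met u w s) i j * tree_lin u t)
    + Poly_Mapping.lookup p s * Poly_Mapping.lookup q t * (shr (tree_met u w s) i j * tree_lin w t))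
    + (if i = 0 \<and> j = 0 then
        Poly_Mapping.lookup p s * Poly_Mapping.lookup q t * (tree_lin u s * tree_lin w t)
      - Poly_Mapping.lookup p s * Poly_Mapping.lookup q t * (tree_lin w s * tree_lin u t) else 0))"
    unfolding fm_def lin_ext_fmul by (intro sum.cong refl) (simp add: algebra_simps)
  also have "\<dots> = lin_ext (tree_lin u) p * lin_ext (\<lambda>t. shl (tree_met u w t) i j) q
    + lin_ext (tree_lin w) p * lin_ext (\<lambda>t. shr (tree_met u w t) i j) q
    - (lin_ext (\<lambda>t. shl (tree_met u w t) i j) p * lin_ext (tree_lin u) q
     + lin_ext (\<lambda>t. shr (tree_met u w t) i j) p * lin_ext (tree_lin w) q)
    + (if i = 0 \<and> j = 0 then lin_ext (tree_lin u) p * lin_ext (tree_lin w) q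
       - lin_ext (tree_lin w) p * lin_ext (tree_lin u) q else 0)"
    by (cases "i = 0 \<and> j = 0") (simp_all only: p[symmetric] sum.distrib sum_subtractf if_True if_False simp_thms add_0_right)
  finally show ?thesis by (simp add: shl_lin_ext shr_lin_ext fl_def mult_ac)
qed

lemma fl_add: "fl u (p + q) = fl u p + fl u q"
  and fl_scale: "fl u (fscale r p) = r * fl u p"
  and fl_zero [simp]: "fl u 0 = 0"
  and fm_add: "fm u w (p + q) i j = fm u w p i j + fm u w q i j"
  and fm_scale: "fm u w (fscale r p) i j = r * fm u w p i j"
  and fm_zero [simp]: "fm u w 0 i j = 0"
  by (simp_all add: fl_def fm_def lin_ext_add lin_ext_scale)

lemma fl_coordinates:
  assumes "finite S" "p \<in> carrier (free_nonassoc S)"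
  shows "fl u p = (\<Sum>b\<in>S. u b * fl (\<lambda>a. if a = b then 1 else 0) p)"
proof -
  have "(\<Sum>b\<in>S. u b * fl (\<lambda>a. if a = b then 1 else 0) p)
      = (\<Sum>t\<in>Poly_Mapping.keys p. \<Sum>b\<in>S. Poly_Mapping.lookup p t * (u b * tree_lin (\<lambda>a. if a = b then 1 else 0) t))"
    unfolding fl_def lin_ext_def sum_distrib_left by (subst sum.swap) (simp add: algebra_simps)
  also have "\<dots> = (\<Sum>t\<in>Poly_Mapping.keys p. Poly_Mapping.lookup p t * tree_lin u t)"
  proof (intro sum.cong refl)
    fix t assume t: "t \<in> Poly_Mapping.keys p"
    show "(\<Sum>b\<in>S. Poly_Mapping.lookup p t * (u b * tree_lin (\<lambda>a. if a = b then 1 else 0) t))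
        = Poly_Mapping.lookup p t * tree_lin u t"
    proof (cases t)
      case (Gen a)
      then have "a \<in> S" using t assms(2) by (auto simp: free_nonassoc_def)
      have "(\<Sum>b\<in>S. Poly_Mapping.lookup p t * (u b * (if a = b then 1 else 0)))
          = (\<Sum>b\<in>S. if a = b then Poly_Mapping.lookup p t * u b else 0)"
        by (intro sum.cong) auto
      then show ?thesis using Gen \<open>a \<in> S\<close> assms(1) by simp
    qed simp
  qed
  finally show ?thesis by (simp add: fl_def lin_ext_def)
qed

text \<open>The hypothesis on \<open>u\<close> and \<open>w\<close> says that nonadjacent vertices
  have commuting images in the metabelian algebra. A word of length \<open>n\<close> has a
  polynomial part of degree \<open>n - 2\<close>, so dividing by words longer than \<open>c\<close>
  leaves exactly the coefficients with \<open>i + j + 2 \<le> c\<close> well defined.\<close>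

lemma metabelian_kernel:
  assumes ne: "\<And>\<alpha> \<beta>. \<lbrakk>\<alpha> \<in> S; \<beta> \<in> S; {\<alpha>, \<beta>} \<notin> E\<rbrakk> \<Longrightarrow> u \<alpha> * w \<beta> = w \<alpha> * u \<beta>"
    and c: "c > 0"
    and p: "p \<in> carrier (free_nonassoc S)" "nproj S E c p = \<zero>\<^bsub>nilpotent_graph_lie S E c\<^esub>"
  shows "fl u p = 0" "fl w p = 0" "i + j + 2 \<le> c \<Longrightarrow> fm u w p i j = 0"
proof -
  let ?F = "free_nonassoc S"
  interpret F: bracket_alg ?F by (rule free_nonassoc_bracket_alg)
  have add0: "v + v' \<in> carrier ?F" if "v \<in> carrier ?F" "v' \<in> carrier ?F" for v v'
    using F.a_closed[OF that] by simp
  have sc0: "fscale r v \<in> carrier ?F" if "v \<in> carrier ?F" for v r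
    using F.smult_closed[of r, OF _ that] by simp
  have z0: "0 \<in> carrier ?F" by (simp add: in_carrier_iff)
  \<comment> \<open>Truncating by total degree still gives an ideal: a bracket only shifts the
    polynomial part upwards.\<close>
  define J where "J = {p \<in> carrier ?F. fl u p = 0 \<and> fl w p = 0 \<and> (\<forall>i j. i + j + 2 \<le> c \<longrightarrow> fm u w p i j = 0)}"
  have J: "bracket_ideal ?F J"
    unfolding bracket_ideal_def F.submodule_iff free_nonassoc_simps_op
  proof (intro conjI ballI allI)
    show "J \<subseteq> carrier ?F" by (auto simp: J_def)
    show "0 \<in> J" using z0 by (simp add: J_def)
    fix x y assume "x \<in> J" "y \<in> J"
    then show "x + y \<in> J" using add0[of x y] by (simp add: J_def fl_add fm_add)
  next
    fix x and r :: rat assume "x \<in> J"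
    then show "fscale r x \<in> J" using sc0[of x r] by (simp add: J_def fl_scale fm_scale)
  next
    fix x y assume x: "x \<in> carrier ?F" and y: "y \<in> J"
    have yc: "y \<in> carrier ?F" using y by (simp add: J_def)
    have s: "shl (fm u w y) i j = 0" "shr (fm u w y) i j = 0" if "i + j + 2 \<le> c" for i j
      using y that by (auto simp: J_def shl_def shr_def split: nat.split)
    show "fmul x y \<in> J" using fmul_closed[OF x yc] y s by (simp add: J_def fm_fmul)
    show "fmul y x \<in> J" using fmul_closed[OF yc x] y s by (simp add: J_def fm_fmul)
  qed
  have rel: "lie_relators S \<subseteq> J"
  proof
    fix x assume x: "x \<in> lie_relators S"
    then have xc: "x \<in> carrier ?F" using lie_relators_carrier by blast
    have "fl u x = 0 \<and> fl w x = 0 \<and> (\<forall>i j. fm u w x i j = 0)"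
      using x unfolding lie_relators_def Let_def free_nonassoc_simps_op
    proof (elim UnE CollectE exE conjE)
      fix y assume "x = fmul y y"
      then show ?thesis by (simp add: fm_fmul)
    next
      fix a b d assume x: "x = fmul a (fmul b d) + fmul b (fmul d a) + fmul d (fmul a b)"
      have "fm u w x i j = 0" for i j
      proof (cases i)
        case 0
        then show ?thesis unfolding x fm_add fm_fmul
          by (cases j) (simp_all add: shl_def shr_def fm_fmul algebra_simps split: nat.split)
      next
        case (Suc i')
        then show ?thesis unfolding x fm_add fm_fmul
          by (cases j) (simp_all add: shl_def shr_def fm_fmul algebra_simps split: nat.split)
      qed
      then show ?thesis by (simp add: x fl_add)
    qed
    then show "x \<in> J" using xc by (simp add: J_def)
  qed
  have nonedge: "fmul (fgen \<alpha>) (fgen \<beta>) \<in> J" if "\<alpha> \<in> S" "\<beta> \<in> S" "{\<alpha>, \<beta>} \<notin> E" for \<alpha> \<beta>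
  proof -
    have "shl (fm u w (fgen a)) i j = 0" "shr (fm u w (fgen a)) i j = 0" for a i j
      by (auto simp: shl_def shr_def split: nat.split)
    then show ?thesis
      using ne[OF that] fmul_closed[OF fgen_closed[OF that(1)] fgen_closed[OF that(2)]]
      by (simp add: J_def fm_fmul)
  qed
  \<comment> \<open>The first bracket consumes two letters and lands in degree 0, and every further
    letter raises the degree by one; hence the offset of two.\<close>
  have lc: "lower_central ?F (Suc (Suc n)) \<subseteq> {p \<in> carrier ?F. fl u p = 0 \<and> fl w p = 0 \<and> (\<forall>i j. i + j < n \<longrightarrow> fm u w p i j = 0)}"
    (is "_ \<subseteq> ?D n") for n
  proof (induction n)
    case 0
    show ?case
    proof (rule F.lower_central_least)
      show "LinearCombinations.submodule rat_field (?D 0) ?F"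
        unfolding F.submodule_iff free_nonassoc_simps_op
        using add0 sc0 z0 by (auto simp: fl_add fl_scale)
      fix x y assume x: "x \<in> carrier ?F" and "y \<in> lower_central ?F (Suc 0)"
      then have "y \<in> carrier ?F" by simp
      then show "bracket ?F x y \<in> ?D 0" using fmul_closed[OF x] by simp
    qed simp
  next
    case (Suc n)
    show ?case
    proof (rule F.lower_central_least)
      show "LinearCombinations.submodule rat_field (?D (Suc n)) ?F"
        unfolding F.submodule_iff free_nonassoc_simps_op
        using add0 sc0 z0 by (auto simp: fl_add fl_scale fm_add fm_scale)
      fix x y assume x: "x \<in> carrier ?F" and "y \<in> lower_central ?F (Suc (Suc n))"
      then have y: "y \<in> ?D n" using Suc by blast
      then have s: "shl (fm u w y) i j = 0" "shr (fm u w y) i j = 0" if "i + j < Suc n" for i j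
        using that by (auto simp: shl_def shr_def split: nat.split)
      show "bracket ?F x y \<in> ?D (Suc n)"
        using fmul_closed[OF x, of y] y s by (auto simp: fm_fmul)
    qed simp
  qed
  have lcJ: "lower_central ?F (c + 1) \<subseteq> J"
  proof -
    obtain n where n: "c = Suc n" using c by (cases c) auto
    have "lower_central ?F (Suc (Suc n)) \<subseteq> J" using lc[of n] unfolding J_def n by auto
    then show ?thesis by (simp add: n)
  qed
  have "p \<in> J" by (rule nproj_kernel_least[OF J rel _ lcJ p]) (rule nonedge)
  then show "fl u p = 0" "fl w p = 0" "i + j + 2 \<le> c \<Longrightarrow> fm u w p i j = 0"
    by (auto simp: J_def)
qed

section \<open>Eigenvalues and orbits\<close>

lemma pact_shift_monom: "pact shift (Polynomial.monom 1 m) l = (\<lambda>k. l (k + m))"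
proof (induction m)
  case 0
  have "Polynomial.monom (1 :: complex) 0 = 1" by (simp add: monom_0 one_pCons)
  then show ?case by (simp add: pact_1[OF lin_op_shift])
next
  case (Suc m)
  then show ?case
    by (simp add: monom_Suc pact_pCons[OF lin_op_shift]) (simp add: shift_def fun_eq_iff)
qed

lemma pact_shift_geometric:
  assumes "\<And>i. l (k + m * i) = \<epsilon> ^ i * t"
  shows "pact shift (pcompose R (Polynomial.monom 1 m)) l k = poly R \<epsilon> * t"
  using assms
proof (induction R arbitrary: k t)
  case (pCons a R)
  have "l (k + m + m * i) = \<epsilon> ^ i * (\<epsilon> * t)" for i
    using pCons.prems[of "Suc i"] by (simp add: algebra_simps)
  then have "pact shift (pcompose R (Polynomial.monom 1 m)) l (k + m) = poly R \<epsilon> * (\<epsilon> * t)"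
    by (rule pCons.IH)
  moreover have "pact shift (pcompose (pCons a R) (Polynomial.monom 1 m)) l k
      = a * l k + pact shift (pcompose R (Polynomial.monom 1 m)) l (k + m)"
    by (simp add: pcompose_pCons pact_add[OF lin_op_shift] pact_mult[OF lin_op_shift]
        pact_shift_monom pact_pCons[OF lin_op_shift] lin_op_zero[OF lin_op_shift])
  moreover have "l k = t" using pCons.prems[of 0] by simp
  ultimately show ?case by (simp add: algebra_simps)
qed simp

text \<open>If \<open>\<chi>\<close> is the product of the factors \<open>x - a\<close>, it divides
  the product of the \<open>x^m - a^m\<close>, which is \<open>R(x^m)\<close>. So \<open>R\<close>
  of the \<open>m\<close>-th power of the shift kills the sequence too; at index 0 this reads
  \<open>poly R \<epsilon> * t = 0\<close>, and the roots of \<open>R\<close> are the powers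
  \<open>a ^ m\<close>.\<close>

lemma recurrence_root_power:
  fixes \<chi> :: "complex poly"
  assumes monic: "lead_coeff \<chi> = 1" and rec: "pact shift \<chi> l = (\<lambda>_. 0)"
    and geo: "\<And>i. l (m * i) = \<epsilon> ^ i * t" and t: "t \<noteq> 0"
  obtains w where "poly \<chi> w = 0" "w ^ m = \<epsilon>"
proof -
  obtain as where as: "\<chi> = (\<Prod>a\<leftarrow>as. [:- a, 1:])"
    using complex_monic_factorization[OF monic] .
  define R where "R = (\<Prod>a\<leftarrow>as. [:- (a ^ m), 1:])"
  have "(\<Prod>a\<leftarrow>as. [:- a, 1:]) dvd pcompose R (Polynomial.monom 1 m)"
    unfolding R_def
  proof (induction as)
    case (Cons a as)
    have "[:- a, 1:] dvd pcompose [:- (a ^ m), 1:] (Polynomial.monom 1 m)"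
      by (simp add: poly_eq_0_iff_dvd[symmetric] pcompose_pCons poly_monom)
    then show ?case
      using Cons unfolding list.map prod_list.Cons pcompose_mult by (rule mult_dvd_mono)
  qed simp
  then obtain Q where "pcompose R (Polynomial.monom 1 m) = Q * \<chi>"
    unfolding as by (metis dvd_def mult.commute)
  then have "pact shift (pcompose R (Polynomial.monom 1 m)) l = (\<lambda>_. 0)"
    by (simp add: pact_mult[OF lin_op_shift] rec lin_op_zero[OF lin_op_pact[OF lin_op_shift]])
  moreover have "pact shift (pcompose R (Polynomial.monom 1 m)) l 0 = poly R \<epsilon> * t"
    by (rule pact_shift_geometric) (simp add: geo)
  ultimately have "poly R \<epsilon> = 0" using t by simp
  then obtain a where "a \<in> set as" "\<epsilon> = a ^ m"
    by (auto simp: R_def poly_prod_list o_def prod_list_zero_iff)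
  then show thesis using that[of a] by (auto simp: as poly_prod_list o_def prod_list_zero_iff)
qed

text \<open>Rational-linear functionals with complex values. They play the part of the dual of the
  complexified space.\<close>

definition clin :: "(rat, 'b, 'm) bracket_algebra_scheme \<Rightarrow> ('b \<Rightarrow> complex) \<Rightarrow> bool" where
  "clin L \<phi> \<longleftrightarrow> (\<forall>x\<in>carrier L. \<forall>y\<in>carrier L. \<phi> (x \<oplus>\<^bsub>L\<^esub> y) = \<phi> x + \<phi> y) \<and>
     (\<forall>x\<in>carrier L. \<forall>r. \<phi> (r \<odot>\<^bsub>L\<^esub> x) = of_rat r * \<phi> x)"

context bracket_alg
begin

lemma clin_zero: "clin L \<phi> \<Longrightarrow> \<phi> \<zero> = 0"
  using smult_zero_rat[of \<zero>] unfolding clin_def by (metis mult_zero_left of_rat_0 zero_closed)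

lemma clin_finsum:
  assumes "clin L \<phi>" "finite I" "\<And>i. i \<in> I \<Longrightarrow> h i \<in> carrier L"
  shows "\<phi> (\<Oplus>i\<in>I. h i) = (\<Sum>i\<in>I. \<phi> (h i))"
  using assms(2,3)
proof (induction I)
  case empty
  then show ?case using clin_zero[OF assms(1)] by simp
next
  case (insert i I)
  then have "(\<Oplus>i\<in>insert i I. h i) = h i \<oplus> (\<Oplus>i\<in>I. h i)" by (intro finsum_insert) auto
  moreover have "h i \<in> carrier L" "(\<Oplus>i\<in>I. h i) \<in> carrier L" using insert by (auto intro!: finsum_closed)
  ultimately show ?case using assms(1) insert unfolding clin_def by simp
qed

lemma clin_comp_funpow:
  assumes f: "f \<in> LinearCombinations.module_hom rat_field L L" and \<phi>: "clin L \<phi>"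
  shows "clin L (\<lambda>x. \<phi> ((f ^^ n) x)) \<and> (\<forall>x\<in>carrier L. (f ^^ n) x \<in> carrier L)"
proof (induction n)
  case 0
  then show ?case using \<phi> by simp
next
  case (Suc n)
  have fc: "f x \<in> carrier L" "f (x \<oplus> y) = f x \<oplus> f y" "f (r \<odot>\<^bsub>L\<^esub> x) = r \<odot>\<^bsub>L\<^esub> f x"
    if "x \<in> carrier L" "y \<in> carrier L" for x y r
    using f that unfolding LinearCombinations.module_hom_def by auto
  show ?case using Suc unfolding clin_def funpow_Suc_right o_def by (auto simp: fc)
qed

text \<open>On basis vectors the numbers \<open>\<phi> ((f ^^ n) b)\<close> satisfy the linear
  recurrence of the transposed matrix, so \<open>cayley_hamilton_recurrence\<close> applies, and
  linearity extends it to all \<open>x\<close>. The result holds for every matrix of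
  \<open>f\<close>: the witnesses of \<open>hyperbolic\<close> and \<open>integer_like\<close> may
  differ, and no similarity argument is required.\<close>

lemma matrix_recurrence:
  assumes f: "f \<in> LinearCombinations.module_hom rat_field L L" and A: "matrix_of L f A"
    and \<phi>: "clin L \<phi>" and x: "x \<in> carrier L"
  shows "pact shift (map_poly of_rat (char_poly A)) (\<lambda>n. \<phi> ((f ^^ n) x)) = (\<lambda>_. 0)"
proof -
  obtain bs where bs: "distinct bs" "basis (set bs)" "A \<in> carrier_mat (length bs) (length bs)"
    and fb: "\<And>j. j < length bs \<Longrightarrow> f (bs ! j) = (\<Oplus>i\<in>{..<length bs}. A $$ (i, j) \<odot>\<^bsub>L\<^esub> (bs ! i))"
    using A unfolding matrix_of_def by blast
  let ?n = "length bs"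
  have bc: "set bs \<subseteq> carrier L" and sp: "span (set bs) = carrier L" using bs(2) by (auto simp: basis_def)
  define s where "s = (\<lambda>j n. \<phi> ((f ^^ n) (bs ! j)))"
  define M where "M = transpose_mat (map_mat of_rat A :: complex mat)"
  have M: "M \<in> carrier_mat ?n ?n" using bs(3) by (simp add: M_def)
  have cM: "char_poly M = map_poly of_rat (char_poly A)"
    using bs(3) char_poly_transpose_mat[of "map_mat of_rat A :: complex mat" ?n]
      of_rat_hom.char_poly_hom[OF bs(3), where 'a = complex] by (simp add: M_def)
  have cl: "clin L (\<lambda>x. \<phi> ((f ^^ n) x))" for n using clin_comp_funpow[OF f \<phi>] by blast
  have rec: "s j (Suc t) = (\<Sum>k<?n. M $$ (j, k) * s k t)" if j: "j < ?n" for j t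
  proof -
    have bi: "bs ! i \<in> carrier L" if "i < ?n" for i using bc that by auto
    have "s j (Suc t) = \<phi> ((f ^^ t) (f (bs ! j)))" by (simp add: s_def funpow_swap1)
    also have "\<dots> = (\<Sum>i<?n. \<phi> ((f ^^ t) (A $$ (i, j) \<odot>\<^bsub>L\<^esub> (bs ! i))))"
      unfolding fb[OF j] by (rule clin_finsum[OF cl]) (auto intro!: smult_closed bi)
    also have "\<dots> = (\<Sum>k<?n. M $$ (j, k) * s k t)"
      using cl[of t] bi bs(3) j unfolding clin_def by (intro sum.cong) (auto simp: s_def M_def)
    finally show ?thesis .
  qed
  have z: "pact shift (char_poly M) (s j) = (\<lambda>_. 0)" if "j < ?n" for j
    by (rule cayley_hamilton_recurrence[where s = s, OF M rec that])
  obtain a T where a: "x = lincomb a T" "finite T" "T \<subseteq> set bs"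
    using x sp unfolding span_def by blast
  have Tc: "T \<subseteq> carrier L" using a(3) bc by blast
  have "\<phi> ((f ^^ n) x) = (\<Sum>v\<in>T. of_rat (a v) * \<phi> ((f ^^ n) v))" for n
  proof -
    have "\<phi> ((f ^^ n) x) = (\<Sum>v\<in>T. \<phi> ((f ^^ n) (a v \<odot>\<^bsub>L\<^esub> v)))"
      unfolding a(1) lincomb_def using Tc
      by (intro clin_finsum[OF cl]) (auto intro!: smult_closed a(2))
    also have "\<dots> = (\<Sum>v\<in>T. of_rat (a v) * \<phi> ((f ^^ n) v))"
      using cl[of n] Tc unfolding clin_def by (intro sum.cong) auto
    finally show ?thesis .
  qed
  then have e: "(\<lambda>n. \<phi> ((f ^^ n) x)) = (\<lambda>n. \<Sum>v\<in>T. of_rat (a v) * \<phi> ((f ^^ n) v))" by auto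
  have zv: "pact shift (char_poly M) (\<lambda>n. of_rat (a v) * \<phi> ((f ^^ n) v)) = (\<lambda>_. 0)" if v: "v \<in> T" for v
  proof -
    obtain j where "j < ?n" "v = bs ! j" using v a(3) by (metis in_set_conv_nth subsetD)
    then show ?thesis using z[of j]
      by (simp add: lin_op_scale[OF lin_op_pact[OF lin_op_shift]] s_def)
  qed
  show ?thesis
    unfolding e cM[symmetric] lin_op_sum[OF lin_op_pact[OF lin_op_shift]] by (simp add: zv)
qed

text \<open>An eigenvector of the transposed matrix, used as the list of values on the basis,
  defines a functional that \<open>f\<close> scales by \<open>z\<close>. Values of a functional,
  unlike eigenvectors, may be complex.\<close>

lemma eigenvalue_functional:
  assumes f: "f \<in> LinearCombinations.module_hom rat_field L L" and A: "matrix_of L f A"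
    and ev: "eigenvalue (map_mat of_rat A :: complex mat) z"
  obtains \<phi> x where "clin L \<phi>" "x \<in> carrier L" "\<phi> x \<noteq> 0" "\<And>x. x \<in> carrier L \<Longrightarrow> \<phi> (f x) = z * \<phi> x"
proof -
  obtain bs where bs: "distinct bs" "basis (set bs)" "A \<in> carrier_mat (length bs) (length bs)"
    and fb: "\<And>j. j < length bs \<Longrightarrow> f (bs ! j) = (\<Oplus>i\<in>{..<length bs}. A $$ (i, j) \<odot>\<^bsub>L\<^esub> (bs ! i))"
    using A unfolding matrix_of_def by blast
  let ?n = "length bs"
  have bc: "set bs \<subseteq> carrier L" using bs(2) by (auto simp: basis_def)
  define M where "M = transpose_mat (map_mat of_rat A :: complex mat)"
  have M: "M \<in> carrier_mat ?n ?n" using bs(3) by (simp add: M_def)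
  have "char_poly M = char_poly (map_mat of_rat A)"
    using bs(3) char_poly_transpose_mat[of "map_mat of_rat A :: complex mat" ?n] by (simp add: M_def)
  then have "eigenvalue M z"
    using ev bs(3) eigenvalue_root_char_poly[OF M, of z]
      eigenvalue_root_char_poly[of "map_mat of_rat A :: complex mat" ?n z] by simp
  then obtain v where v: "v \<in> carrier_vec ?n" "v \<noteq> 0\<^sub>v ?n" "M *\<^sub>v v = z \<cdot>\<^sub>v v"
    using M unfolding eigenvalue_def eigenvector_def by auto
  obtain k where k: "k < ?n" "v $ k \<noteq> 0"
    using v(1,2) by (metis carrier_vecD eq_vecI index_zero_vec(1) index_zero_vec(2))
  have eig: "(\<Sum>i<?n. of_rat (A $$ (i, j)) * v $ i) = z * v $ j" if j: "j < ?n" for j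
  proof -
    have "(M *\<^sub>v v) $ j = (\<Sum>i<?n. of_rat (A $$ (i, j)) * v $ i)"
      using j v(1) bs(3) M by (simp add: M_def scalar_prod_def atLeast0LessThan)
    then show ?thesis using v j by simp
  qed
  have crit: "\<exists>!a. a \<in> set bs \<rightarrow>\<^sub>E UNIV \<and> lincomb a (set bs) = x" if "x \<in> carrier L" for x
    using basis_criterion[of "set bs"] bc bs(2) that by simp
  define co where "co = (\<lambda>x. THE a. a \<in> set bs \<rightarrow>\<^sub>E UNIV \<and> lincomb a (set bs) = x)"
  have co: "co x \<in> set bs \<rightarrow>\<^sub>E UNIV" "lincomb (co x) (set bs) = x" if "x \<in> carrier L" for x
    using theI'[OF crit[OF that]] by (auto simp: co_def)
  have lc: "lincomb (restrict a (set bs)) (set bs) = lincomb a (set bs)" for a :: "'b \<Rightarrow> rat"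
    unfolding lincomb_def using bc by (intro finsum_cong') (auto intro!: smult_closed)
  have couniq: "co (lincomb a (set bs)) v = a v" if "v \<in> set bs" for a v
  proof -
    have c: "lincomb a (set bs) \<in> carrier L" using bc by (intro lincomb_closed) auto
    have "co (lincomb a (set bs)) = restrict a (set bs)"
      using crit[OF c] co[OF c] lc[of a] by (metis (no_types, lifting) UNIV_I restrict_PiE_iff)
    then show ?thesis using that by simp
  qed
  define \<phi> where "\<phi> = (\<lambda>x. \<Sum>j<?n. v $ j * of_rat (co x (bs ! j)))"
  have c: "clin L \<phi>"
    unfolding clin_def
  proof (intro conjI ballI allI)
    fix x y assume x: "x \<in> carrier L" and y: "y \<in> carrier L"
    have "lincomb (\<lambda>v. co x v + co y v) (set bs) = x \<oplus> y"
      using lincomb_sum[of "set bs" "co x" "co y"] bc co[OF x] co[OF y] by simp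
    then have "co (x \<oplus> y) v = co x v + co y v" if "v \<in> set bs" for v using couniq[OF that] by metis
    then show "\<phi> (x \<oplus> y) = \<phi> x + \<phi> y"
      by (simp add: \<phi>_def of_rat_add algebra_simps sum.distrib)
  next
    fix x and r :: rat assume x: "x \<in> carrier L"
    have "lincomb (\<lambda>v. r * co x v) (set bs) = r \<odot>\<^bsub>L\<^esub> x"
      using lincomb_smult[of "set bs" "co x" r] bc co[OF x] by simp
    then have "co (r \<odot>\<^bsub>L\<^esub> x) v = r * co x v" if "v \<in> set bs" for v using couniq[OF that] by metis
    then show "\<phi> (r \<odot>\<^bsub>L\<^esub> x) = of_rat r * \<phi> x"
      by (simp add: \<phi>_def of_rat_mult algebra_simps sum_distrib_left)
  qed
  have bi: "bs ! i \<in> carrier L" if "i < ?n" for i using bc that by auto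
  have \<phi>b: "\<phi> (bs ! j) = v $ j" if j: "j < ?n" for j
  proof -
    have "lincomb (\<lambda>v. if v = bs ! j then 1 else 0) (set bs) = bs ! j"
    proof -
      have "lincomb (\<lambda>v. if v = bs ! j then (1::rat) else 0) (set bs) = (\<Oplus>v\<in>set bs. if bs ! j = v then v else \<zero>)"
        unfolding lincomb_def using bc smult_one by (intro finsum_cong') auto
      also have "\<dots> = bs ! j" using j bc by (intro finsum_singleton) auto
      finally show ?thesis .
    qed
    then have "co (bs ! j) (bs ! i) = (if bs ! i = bs ! j then 1 else 0)" if "i < ?n" for i
      using couniq[of "bs ! i" "\<lambda>v. if v = bs ! j then 1 else 0"] that by simp
    then have "\<phi> (bs ! j) = (\<Sum>i<?n. if i = j then v $ i else 0)"
      unfolding \<phi>_def using j bs(1) by (intro sum.cong) (auto simp: nth_eq_iff_index_eq)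
    then show ?thesis using j by simp
  qed
  have ff: "f x \<in> carrier L" "f (x \<oplus> y) = f x \<oplus> f y" "f (r \<odot>\<^bsub>L\<^esub> x) = r \<odot>\<^bsub>L\<^esub> f x"
    if "x \<in> carrier L" "y \<in> carrier L" for x y r
    using f that unfolding LinearCombinations.module_hom_def by auto
  have cf: "clin L (\<lambda>x. \<phi> (f x))" using c ff unfolding clin_def by auto
  have fb': "\<phi> (f (bs ! j)) = z * \<phi> (bs ! j)" if j: "j < ?n" for j
  proof -
    have "\<phi> (f (bs ! j)) = (\<Sum>i<?n. \<phi> (A $$ (i, j) \<odot>\<^bsub>L\<^esub> (bs ! i)))"
      unfolding fb[OF j] by (rule clin_finsum[OF c]) (auto intro!: smult_closed bi)
    also have "\<dots> = (\<Sum>i<?n. of_rat (A $$ (i, j)) * v $ i)"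
      using c bi \<phi>b unfolding clin_def by (intro sum.cong) auto
    finally show ?thesis using eig[OF j] \<phi>b[OF j] by simp
  qed
  have "\<phi> (f x) = z * \<phi> x" if x: "x \<in> carrier L" for x
  proof -
    have sm: "co x v \<odot>\<^bsub>L\<^esub> v \<in> carrier L" if "v \<in> set bs" for v using bc that by (intro smult_closed) auto
    have xx: "x = (\<Oplus>v\<in>set bs. co x v \<odot>\<^bsub>L\<^esub> v)" using co(2)[OF x] unfolding lincomb_def by simp
    have "\<phi> (f x) = (\<Sum>v\<in>set bs. \<phi> (f (co x v \<odot>\<^bsub>L\<^esub> v)))"
      by (subst xx, rule clin_finsum[OF cf]) (auto intro: sm)
    also have "\<dots> = (\<Sum>v\<in>set bs. z * \<phi> (co x v \<odot>\<^bsub>L\<^esub> v))"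
    proof (rule sum.cong[OF refl])
      fix v assume v: "v \<in> set bs"
      then obtain j where j: "j < ?n" "v = bs ! j" by (metis in_set_conv_nth)
      show "\<phi> (f (co x v \<odot>\<^bsub>L\<^esub> v)) = z * \<phi> (co x v \<odot>\<^bsub>L\<^esub> v)"
        using c cf fb'[OF j(1)] bi[OF j(1)] unfolding clin_def j(2) by simp
    qed
    also have "\<dots> = z * \<phi> x"
      by (subst (2) xx, subst clin_finsum[OF c]) (auto intro: sm simp: sum_distrib_left)
    finally show ?thesis .
  qed
  moreover have "\<phi> (bs ! k) \<noteq> 0" using \<phi>b[OF k(1)] k(2) by simp
  ultimately show thesis using that[of \<phi> "bs ! k"] c bi[OF k(1)] by blast
qed

end

text \<open>The 2x2 minors over the edges vanish. As nonadjacent vertices commute anyway, this is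
  the condition for two linear combinations of vertices to commute in the Lie algebra.\<close>

definition commuting :: "'v set \<Rightarrow> 'v set set \<Rightarrow> ('v \<Rightarrow> rat) \<Rightarrow> ('v \<Rightarrow> rat) \<Rightarrow> bool" where
  "commuting S E x y \<longleftrightarrow> (\<forall>\<gamma>\<in>S. \<forall>\<delta>\<in>S. {\<gamma>, \<delta>} \<in> E \<longrightarrow> x \<gamma> * y \<delta> = x \<delta> * y \<gamma>)"

text \<open>The dual condition on functionals, with minors over the nonedges: it makes the
  metabelian map respect the graph relations.\<close>

definition compatible :: "'v set \<Rightarrow> 'v set set \<Rightarrow> ('v \<Rightarrow> rat) \<Rightarrow> ('v \<Rightarrow> rat) \<Rightarrow> bool" where
  "compatible S E u w \<longleftrightarrow> (\<forall>\<alpha>\<in>S. \<forall>\<beta>\<in>S. {\<alpha>, \<beta>} \<notin> E \<longrightarrow> u \<alpha> * w \<beta> = w \<alpha> * u \<beta>)"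

definition mat_app :: "'v set \<Rightarrow> ('v \<Rightarrow> 'v \<Rightarrow> rat) \<Rightarrow> ('v \<Rightarrow> rat) \<Rightarrow> 'v \<Rightarrow> rat" where
  "mat_app S A x \<beta> = (\<Sum>\<alpha>\<in>S. A \<beta> \<alpha> * x \<alpha>)"

fun mat_pow :: "'v set \<Rightarrow> ('v \<Rightarrow> 'v \<Rightarrow> rat) \<Rightarrow> nat \<Rightarrow> 'v \<Rightarrow> 'v \<Rightarrow> rat" where
  "mat_pow S A 0 \<beta> \<alpha> = (if \<alpha> = \<beta> then 1 else 0)"
| "mat_pow S A (Suc n) \<beta> \<alpha> = (\<Sum>\<gamma>\<in>S. A \<beta> \<gamma> * mat_pow S A n \<gamma> \<alpha>)"

definition coord :: "'v \<Rightarrow> 'v \<Rightarrow> rat" where "coord \<beta> \<alpha> = (if \<alpha> = \<beta> then 1 else 0)"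

definition lie_endo :: "(rat, 'b, 'm) bracket_algebra_scheme \<Rightarrow> ('b \<Rightarrow> 'b) \<Rightarrow> bool" where
  "lie_endo L f \<longleftrightarrow> f \<in> LinearCombinations.module_hom rat_field L L \<and>
     (\<forall>x\<in>carrier L. \<forall>y\<in>carrier L. f (bracket L x y) = bracket L (f x) (f y))"

lemma lie_endoD:
  assumes "lie_endo L f"
  shows "x \<in> carrier L \<Longrightarrow> f x \<in> carrier L"
    and "\<lbrakk>x \<in> carrier L; y \<in> carrier L\<rbrakk> \<Longrightarrow> f (x \<oplus>\<^bsub>L\<^esub> y) = f x \<oplus>\<^bsub>L\<^esub> f y"
    and "x \<in> carrier L \<Longrightarrow> f (r \<odot>\<^bsub>L\<^esub> x) = r \<odot>\<^bsub>L\<^esub> f x"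
    and "\<lbrakk>x \<in> carrier L; y \<in> carrier L\<rbrakk> \<Longrightarrow> f (bracket L x y) = bracket L (f x) (f y)"
  using assms by (auto simp: lie_endo_def LinearCombinations.module_hom_def)

lemma lie_endo_comp:
  assumes "lie_endo L f" "lie_endo L g" shows "lie_endo L (\<lambda>x. f (g x))"
  using lie_endoD[OF assms(1)] lie_endoD[OF assms(2)]
  by (auto simp: lie_endo_def LinearCombinations.module_hom_def)

lemma lie_endo_funpow: "lie_endo L f \<Longrightarrow> lie_endo L (f ^^ n)"
proof (induction n)
  case 0
  then show ?case by (auto simp: lie_endo_def LinearCombinations.module_hom_def)
next
  case (Suc n)
  then show ?case using lie_endo_comp[of L f "f ^^ n"] by (simp add: o_def)
qed

section \<open>Metabelian coordinates and the linear part of an endomorphism\<close>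

locale graph_nilpotent =
  fixes S :: "'v set" and E :: "'v set set" and c :: nat
  assumes graph: "simple_graph S E" and c: "c > 1"
begin

abbreviation "L \<equiv> nilpotent_graph_lie S E c"
abbreviation "F \<equiv> free_nonassoc S"
abbreviation "q \<equiv> nproj S E c"

sublocale q: bracket_epi F L q by (rule nproj_epi)
sublocale L: lie_algebra L by (rule nilpotent_lie_algebra)

lemma finS: "finite S" using graph by (simp add: simple_graph_def)

definition gen where "gen \<alpha> = q (fgen \<alpha>)"

lemma gen_closed: "\<alpha> \<in> S \<Longrightarrow> gen \<alpha> \<in> carrier L"
  unfolding gen_def by (intro q.hom_closed fgen_closed)

lemma gen_nonedge: "\<lbrakk>\<alpha> \<in> S; \<beta> \<in> S; {\<alpha>, \<beta>} \<notin> E\<rbrakk> \<Longrightarrow> bracket L (gen \<alpha>) (gen \<beta>) = \<zero>\<^bsub>L\<^esub>"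
  using nproj_nonedge[of \<alpha> S \<beta> E c] q.hom_bracket[of "fgen \<alpha>" "fgen \<beta>"]
  by (simp add: gen_def fgen_closed)

lemma F_add: "\<lbrakk>p \<in> carrier F; p' \<in> carrier F\<rbrakk> \<Longrightarrow> p + p' \<in> carrier F"
  using q.a_closed[of p p'] by simp

lemma F_scale: "p \<in> carrier F \<Longrightarrow> fscale r p \<in> carrier F"
  using q.smult_closed[of r p] by simp

lemma F_zero: "0 \<in> carrier F"
  using q.zero_closed by simp

lemma F_sum: "(\<And>i. i \<in> I \<Longrightarrow> p i \<in> carrier F) \<Longrightarrow> (\<Sum>i\<in>I. p i) \<in> carrier F"
  by (induction I rule: infinite_finite_induct) (auto intro: F_zero F_add)

lemma q_add: "\<lbrakk>p \<in> carrier F; p' \<in> carrier F\<rbrakk> \<Longrightarrow> q (p + p') = q p \<oplus>\<^bsub>L\<^esub> q p'"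
  using q.hom_add[of p p'] by simp

lemma q_scale: "p \<in> carrier F \<Longrightarrow> q (fscale r p) = r \<odot>\<^bsub>L\<^esub> q p"
  using q.hom_smult[of p r] by simp

lemma q_zero: "q 0 = \<zero>\<^bsub>L\<^esub>"
  using q.hom_zero by simp

lemma q_fmul: "\<lbrakk>p \<in> carrier F; p' \<in> carrier F\<rbrakk> \<Longrightarrow> q (fmul p p') = bracket L (q p) (q p')"
  using q.hom_bracket[of p p'] by simp

lemma kernel_difference:
  assumes "p \<in> carrier F" "p' \<in> carrier F" "q p = q p'"
  shows "p + fscale (- 1) p' \<in> carrier F" "q (p + fscale (- 1) p') = \<zero>\<^bsub>L\<^esub>"
proof -
  have c: "fscale (- 1) p' \<in> carrier F" using assms(2) by (rule F_scale)
  show "p + fscale (- 1) p' \<in> carrier F" using assms(1) c by (rule F_add)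
  have "q (p + fscale (- 1) p') = q p' \<oplus>\<^bsub>L\<^esub> (- 1) \<odot>\<^bsub>L\<^esub> q p'"
    by (simp only: q_add[OF assms(1) c] q_scale[OF assms(2)] assms(3))
  also have "\<dots> = \<zero>\<^bsub>L\<^esub>"
    using q.hom_closed[OF assms(2)] by (simp only: L.smult_minus_one L.r_neg)
  finally show "q (p + fscale (- 1) p') = \<zero>\<^bsub>L\<^esub>" .
qed

text \<open>The metabelian coordinates evaluated at an arbitrary lift. Independence of the lift is
  \<open>metabelian_kernel\<close>, so \<open>MM\<close> is meaningful only for compatible
  \<open>u\<close>, \<open>w\<close> and \<open>i + j + 2 \<le> c\<close>.\<close>

definition UL where "UL u X = fl u (SOME p. p \<in> carrier F \<and> q p = X)"
definition MM where "MM u w X i j = fm u w (SOME p. p \<in> carrier F \<and> q p = X) i j"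

lemma some_lift:
  assumes "p \<in> carrier F"
  defines "p' \<equiv> SOME p'. p' \<in> carrier F \<and> q p' = q p"
  shows "p + fscale (- 1) p' \<in> carrier F" "q (p + fscale (- 1) p') = \<zero>\<^bsub>L\<^esub>"
proof -
  have "p' \<in> carrier F \<and> q p' = q p"
    unfolding p'_def by (rule someI[of _ p]) (simp add: assms(1))
  then show "p + fscale (- 1) p' \<in> carrier F" "q (p + fscale (- 1) p') = \<zero>\<^bsub>L\<^esub>"
    using kernel_difference[OF assms(1), of p'] by auto
qed

lemma UL_q: assumes "p \<in> carrier F" shows "UL u (q p) = fl u p"
  \<comment> \<open>With second functional 0 the compatibility condition is trivial; hence
    \<open>UL u\<close> is available for every \<open>u\<close>.\<close>
  using metabelian_kernel(1)[of S E u "\<lambda>_. 0", OF _ _ some_lift[OF assms]] c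
  by (simp add: UL_def fl_add fl_scale)

lemma MM_q:
  assumes "compatible S E u w" "i + j + 2 \<le> c" "p \<in> carrier F"
  shows "MM u w (q p) i j = fm u w p i j"
  using metabelian_kernel(3)[of S E u w, OF _ _ some_lift[OF assms(3)] assms(2)] assms(1) c
  by (simp add: MM_def fm_add fm_scale compatible_def)

lemma L_elim: assumes "X \<in> carrier L" obtains p where "p \<in> carrier F" "X = q p"
  using q.target_elim[OF assms] .

lemma UL_add: assumes "X \<in> carrier L" "Y \<in> carrier L" shows "UL u (X \<oplus>\<^bsub>L\<^esub> Y) = UL u X + UL u Y"
proof -
  obtain p p' where "p \<in> carrier F" "X = q p" "p' \<in> carrier F" "Y = q p'"
    using assms L_elim by metis
  then show ?thesis by (simp add: q_add[symmetric] UL_q F_add fl_add)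
qed

lemma UL_scale: assumes "X \<in> carrier L" shows "UL u (r \<odot>\<^bsub>L\<^esub> X) = r * UL u X"
proof -
  obtain p where "p \<in> carrier F" "X = q p" using assms L_elim by metis
  then show ?thesis by (simp add: q_scale[symmetric] UL_q F_scale fl_scale)
qed

lemma UL_bracket: assumes "X \<in> carrier L" "Y \<in> carrier L" shows "UL u (bracket L X Y) = 0"
proof -
  obtain p p' where "p \<in> carrier F" "X = q p" "p' \<in> carrier F" "Y = q p'"
    using assms L_elim by metis
  then show ?thesis by (simp add: q_fmul[symmetric] UL_q fmul_closed)
qed

lemma UL_zero: "UL u \<zero>\<^bsub>L\<^esub> = 0"
  using UL_q[OF F_zero] by (simp add: q_zero)

lemma UL_gen: "\<alpha> \<in> S \<Longrightarrow> UL u (gen \<alpha>) = u \<alpha>"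
  by (simp add: gen_def UL_q fgen_closed)

lemma UL_coord:
  assumes "X \<in> carrier L" shows "UL u X = (\<Sum>b\<in>S. u b * UL (coord b) X)"
proof -
  obtain p where "p \<in> carrier F" "X = q p" using assms L_elim by metis
  then show ?thesis using fl_coordinates[OF finS, of p u] by (simp add: UL_q coord_def[abs_def])
qed

lemma MM_add:
  assumes "compatible S E u w" "i + j + 2 \<le> c" "X \<in> carrier L" "Y \<in> carrier L"
  shows "MM u w (X \<oplus>\<^bsub>L\<^esub> Y) i j = MM u w X i j + MM u w Y i j"
proof -
  obtain p p' where "p \<in> carrier F" "X = q p" "p' \<in> carrier F" "Y = q p'"
    using assms(3,4) L_elim by metis
  then show ?thesis using assms(1,2) by (simp add: q_add[symmetric] MM_q F_add fm_add)
qed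

lemma MM_scale:
  assumes "compatible S E u w" "i + j + 2 \<le> c" "X \<in> carrier L"
  shows "MM u w (r \<odot>\<^bsub>L\<^esub> X) i j = r * MM u w X i j"
proof -
  obtain p where "p \<in> carrier F" "X = q p" using assms(3) L_elim by metis
  then show ?thesis using assms(1,2) by (simp add: q_scale[symmetric] MM_q F_scale fm_scale)
qed

lemma MM_bracket:
  assumes "compatible S E u w" "i + j + 2 \<le> c" "X \<in> carrier L" "Y \<in> carrier L"
  shows "MM u w (bracket L X Y) i j =
     UL u X * shl (MM u w Y) i j + UL w X * shr (MM u w Y) i j
     - (UL u Y * shl (MM u w X) i j + UL w Y * shr (MM u w X) i j)
     + (if i = 0 \<and> j = 0 then UL u X * UL w Y - UL w X * UL u Y else 0)"
proof -
  obtain p p' where p: "p \<in> carrier F" "X = q p" "p' \<in> carrier F" "Y = q p'"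
    using assms(3,4) L_elim by metis
  have s: "shl (MM u w (q r)) i j = shl (fm u w r) i j" "shr (MM u w (q r)) i j = shr (fm u w r) i j"
    if "r \<in> carrier F" for r
    using assms(1,2) that by (auto simp: shl_def shr_def MM_q split: nat.split)
  show ?thesis
    using p assms(1,2) by (simp add: q_fmul[symmetric] MM_q fmul_closed fm_fmul UL_q s)
qed

text \<open>Trees map to iterated brackets of vertices, and every element is the image of a finite
  combination of trees.\<close>

lemma L_induct [consumes 1, case_names gen bracket add smult zero]:
  assumes X: "X \<in> carrier L"
    and g: "\<And>\<alpha>. \<alpha> \<in> S \<Longrightarrow> P (gen \<alpha>)"
    and b: "\<And>X Y. \<lbrakk>X \<in> carrier L; Y \<in> carrier L; P X; P Y\<rbrakk> \<Longrightarrow> P (bracket L X Y)"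
    and a: "\<And>X Y. \<lbrakk>X \<in> carrier L; Y \<in> carrier L; P X; P Y\<rbrakk> \<Longrightarrow> P (X \<oplus>\<^bsub>L\<^esub> Y)"
    and s: "\<And>X r. \<lbrakk>X \<in> carrier L; P X\<rbrakk> \<Longrightarrow> P (r \<odot>\<^bsub>L\<^esub> X)"
    and z: "P \<zero>\<^bsub>L\<^esub>"
  shows "P X"
proof -
  have t: "set_magma t \<subseteq> S \<Longrightarrow> P (q (Poly_Mapping.single t 1))" for t
  proof (induction t)
    case (Gen x)
    then show ?case using g[of x] by (simp add: gen_def fgen_def)
  next
    case (Prod t1 t2)
    then have "Poly_Mapping.single t1 1 \<in> carrier F" "Poly_Mapping.single t2 1 \<in> carrier F"
      by (auto intro: single_closed)
    moreover from this have "q (Poly_Mapping.single (Prod t1 t2) 1)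
        = bracket L (q (Poly_Mapping.single t1 1)) (q (Poly_Mapping.single t2 1))"
      using q_fmul[of "Poly_Mapping.single t1 1" "Poly_Mapping.single t2 1"] fmul_single[of t1 1 t2 1]
      by simp
    ultimately show ?case using Prod b q.hom_closed by simp
  qed
  obtain p where p: "p \<in> carrier F" "X = q p" using L_elim[OF X] .
  have ps: "p = (\<Sum>t\<in>Poly_Mapping.keys p. fscale (Poly_Mapping.lookup p t) (Poly_Mapping.single t 1))"
  proof (rule poly_mapping_eqI)
    fix k
    have "(\<Sum>t\<in>Poly_Mapping.keys p. Poly_Mapping.lookup p t * (1 when t = k)) =
      (\<Sum>t\<in>Poly_Mapping.keys p. if t = k then Poly_Mapping.lookup p t else 0)"
      by (intro sum.cong) (auto simp: when_def)
    then show "Poly_Mapping.lookup p k = Poly_Mapping.lookup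
        (\<Sum>t\<in>Poly_Mapping.keys p. fscale (Poly_Mapping.lookup p t) (Poly_Mapping.single t 1)) k"
      by (simp add: lookup_sum lookup_single in_keys_iff)
  qed
  have H: "P (q (\<Sum>t\<in>T. fscale (a t) (Poly_Mapping.single t 1)))
      \<and> (\<Sum>t\<in>T. fscale (a t) (Poly_Mapping.single t 1)) \<in> carrier F"
    if "finite T" "\<forall>t\<in>T. set_magma t \<subseteq> S" for T and a :: "'v magma \<Rightarrow> rat"
    using that
  proof (induction T)
    case empty
    then show ?case using z q_zero F_zero by simp
  next
    case (insert t T)
    have m: "Poly_Mapping.single t 1 \<in> carrier F" using insert by (auto intro: single_closed)
    have "P (a t \<odot>\<^bsub>L\<^esub> q (Poly_Mapping.single t 1))"
      using insert t q.hom_closed[OF m] by (intro s) auto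
    moreover have sc: "fscale (a t) (Poly_Mapping.single t 1) \<in> carrier F" by (rule F_scale[OF m])
    ultimately show ?case
      using insert assms(4) q.hom_closed[OF m] q.hom_closed[OF sc]
      by (simp add: q_add q_scale[OF m, symmetric] F_add a q.hom_closed)
  qed
  have "\<forall>t\<in>Poly_Mapping.keys p. set_magma t \<subseteq> S" using p(1) by (simp add: free_nonassoc_def)
  from conjunct1[OF H[OF finite_keys this, of "Poly_Mapping.lookup p"]] show ?thesis
    by (simp only: ps[symmetric] p(2))
qed

definition cf where "cf f \<beta> \<alpha> = UL (coord \<beta>) (f (gen \<alpha>))"

text \<open>Degree-one functionals vanish on brackets and \<open>f\<close> sends brackets to
  brackets, so modulo brackets \<open>f\<close> is given by its values on the vertices.\<close>

lemma UL_endo: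
  assumes f: "lie_endo L f" and X: "X \<in> carrier L"
  shows "UL u (f X) = (\<Sum>\<alpha>\<in>S. UL u (f (gen \<alpha>)) * UL (coord \<alpha>) X)"
  using X
proof (induction rule: L_induct)
  case (gen \<alpha>)
  then have "(\<Sum>\<gamma>\<in>S. UL u (f (gen \<gamma>)) * UL (coord \<gamma>) (gen \<alpha>)) = (\<Sum>\<gamma>\<in>S. if \<gamma> = \<alpha> then UL u (f (gen \<gamma>)) else 0)"
    by (intro sum.cong) (auto simp: UL_gen coord_def)
  then show ?case using gen finS by simp
next
  case (bracket X Y)
  then show ?case using lie_endoD[OF f] by (simp add: UL_bracket)
next
  case (add X Y)
  then show ?case using lie_endoD[OF f] by (simp add: UL_add algebra_simps sum.distrib)
next
  case (smult X r)
  then show ?case using lie_endoD[OF f] by (simp add: UL_scale algebra_simps sum_distrib_left)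
next
  case zero
  have "f \<zero>\<^bsub>L\<^esub> = \<zero>\<^bsub>L\<^esub>" using lie_endoD(3)[OF f L.zero_closed, of 0] lie_endoD(1)[OF f L.zero_closed] by simp
  then show ?case by (simp add: UL_zero)
qed

lemma cf_comp:
  assumes "lie_endo L f" "lie_endo L g" "\<alpha> \<in> S"
  shows "cf (\<lambda>x. f (g x)) \<beta> \<alpha> = (\<Sum>\<gamma>\<in>S. cf f \<beta> \<gamma> * cf g \<gamma> \<alpha>)"
  unfolding cf_def using UL_endo[OF assms(1) lie_endoD(1)[OF assms(2) gen_closed[OF assms(3)]]] by simp

lemma cf_funpow:
  assumes "lie_endo L f" "\<alpha> \<in> S"
  shows "cf (f ^^ n) \<beta> \<alpha> = mat_pow S (cf f) n \<beta> \<alpha>"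
proof (induction n arbitrary: \<beta>)
  case 0
  then show ?case using assms(2) by (simp add: cf_def UL_gen coord_def)
next
  case (Suc n)
  have "cf (f ^^ Suc n) \<beta> \<alpha> = cf (\<lambda>x. f ((f ^^ n) x)) \<beta> \<alpha>" by (simp add: o_def cf_def)
  then show ?case using Suc cf_comp[OF assms(1) lie_endo_funpow[OF assms(1)] assms(2)] by simp
qed

definition pvec where "pvec x = (\<Sum>\<alpha>\<in>S. Poly_Mapping.single (Gen \<alpha>) (x \<alpha>))"

lemma pvec_closed: "pvec x \<in> carrier F"
  unfolding pvec_def by (intro F_sum single_closed) auto

lemma UL_pvec: "UL u (q (pvec x)) = (\<Sum>\<alpha>\<in>S. u \<alpha> * x \<alpha>)"
  unfolding UL_q[OF pvec_closed] by (simp add: pvec_def fl_def lin_ext_sum mult.commute)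

lemma UL_coord_pvec: "\<alpha> \<in> S \<Longrightarrow> UL (coord \<alpha>) (q (pvec x)) = x \<alpha>"
  using finS by (simp add: UL_pvec coord_def if_distrib[of "\<lambda>z. z * _"] cong: if_cong)

text \<open>Expand \<open>[X, Y] - [Y, X]\<close> over ordered pairs of vertices. The coefficients
  are the minors of \<open>x\<close> and \<open>y\<close>, zero on edges by hypothesis, while on
  nonedges the bracket itself is zero. So \<open>[X, Y] = [Y, X] = - [X, Y]\<close>, and 2 is
  invertible.\<close>

lemma bracket_commuting:
  assumes "commuting S E x y"
  shows "bracket L (q (pvec x)) (q (pvec y)) = \<zero>\<^bsub>L\<^esub>"
proof -
  have fm: "fmul (pvec x) (pvec y) = (\<Sum>\<alpha>\<in>S. \<Sum>\<beta>\<in>S. Poly_Mapping.single (Prod (Gen \<alpha>) (Gen \<beta>)) (x \<alpha> * y \<beta>))"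
    for x y
  proof (rule fpoly_eqI)
    fix a show "Poly_Mapping.lookup (fmul (pvec x) (pvec y)) (Gen a) = Poly_Mapping.lookup
       (\<Sum>\<alpha>\<in>S. \<Sum>\<beta>\<in>S. Poly_Mapping.single (Prod (Gen \<alpha>) (Gen \<beta>)) (x \<alpha> * y \<beta>)) (Gen a)"
      by (simp add: lookup_sum lookup_single)
  next
    fix s t
    show "Poly_Mapping.lookup (fmul (pvec x) (pvec y)) (Prod s t) = Poly_Mapping.lookup
       (\<Sum>\<alpha>\<in>S. \<Sum>\<beta>\<in>S. Poly_Mapping.single (Prod (Gen \<alpha>) (Gen \<beta>)) (x \<alpha> * y \<beta>)) (Prod s t)"
      unfolding lookup_fmul pvec_def lookup_sum sum_product
      by (intro sum.cong refl) (auto simp: lookup_single when_def)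
  qed
  let ?X = "q (pvec x)" and ?Y = "q (pvec y)"
  have Xc: "?X \<in> carrier L" and Yc: "?Y \<in> carrier L" using q.hom_closed[OF pvec_closed] by auto
  have bc: "bracket L ?X ?Y \<in> carrier L" using Xc Yc by (rule L.bracket_closed)
  let ?D = "\<Sum>\<alpha>\<in>S. \<Sum>\<beta>\<in>S. Poly_Mapping.single (Prod (Gen \<alpha>) (Gen \<beta>)) (x \<alpha> * y \<beta> - y \<alpha> * x \<beta>)"
  have "fmul (pvec x) (pvec y) = ?D + fmul (pvec y) (pvec x)"
    unfolding fm sum.distrib[symmetric] single_add[symmetric] by simp
  moreover have D: "?D \<in> carrier F"
    by (intro F_sum single_closed) auto
  ultimately have e: "bracket L ?X ?Y = q ?D \<oplus>\<^bsub>L\<^esub> bracket L ?Y ?X"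
    by (simp only: q_fmul[OF pvec_closed pvec_closed, symmetric] q_add[OF D fmul_closed[OF pvec_closed pvec_closed]])
  have t: "q (Poly_Mapping.single (Prod (Gen \<alpha>) (Gen \<beta>)) (x \<alpha> * y \<beta> - y \<alpha> * x \<beta>)) = \<zero>\<^bsub>L\<^esub>"
    if ab: "\<alpha> \<in> S" "\<beta> \<in> S" for \<alpha> \<beta>
  proof (cases "{\<alpha>, \<beta>} \<in> E")
    case True
    then have "x \<alpha> * y \<beta> = x \<beta> * y \<alpha>" using assms ab unfolding commuting_def by blast
    then have "x \<alpha> * y \<beta> - y \<alpha> * x \<beta> = 0" by (simp add: mult.commute)
    then show ?thesis by (simp add: q_zero)
  next
    case False
    have "Poly_Mapping.single (Prod (Gen \<alpha>) (Gen \<beta>)) r = fscale r (fmul (fgen \<alpha>) (fgen \<beta>))" for r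
      unfolding fgen_def fmul_single by (rule poly_mapping_eqI) (simp add: lookup_single when_def)
    then show ?thesis
      using nproj_nonedge[OF ab False, of c] ab
      by (simp add: q_scale[OF fmul_closed[OF fgen_closed fgen_closed]])
  qed
  have q0: "q (\<Sum>i\<in>I. p i) = \<zero>\<^bsub>L\<^esub>" if "\<And>i. i \<in> I \<Longrightarrow> p i \<in> carrier F" "\<And>i. i \<in> I \<Longrightarrow> q (p i) = \<zero>\<^bsub>L\<^esub>"
    for I :: "'v set" and p
    using that by (induction I rule: infinite_finite_induct) (simp_all add: q_zero q_add F_sum)
  have "q ?D = \<zero>\<^bsub>L\<^esub>" by (intro q0 F_sum single_closed t) auto
  then have "bracket L ?X ?Y = bracket L ?Y ?X"
    using e L.bracket_closed[OF Yc Xc] by simp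
  also have "\<dots> = (- 1) \<odot>\<^bsub>L\<^esub> bracket L ?X ?Y" by (rule L.bracket_anticomm[OF Xc Yc])
  finally have m: "bracket L ?X ?Y = (- 1) \<odot>\<^bsub>L\<^esub> bracket L ?X ?Y" .
  have "(2 :: rat) \<odot>\<^bsub>L\<^esub> bracket L ?X ?Y = ((1 :: rat) + 1) \<odot>\<^bsub>L\<^esub> bracket L ?X ?Y" by simp
  also have "\<dots> = (1 :: rat) \<odot>\<^bsub>L\<^esub> bracket L ?X ?Y \<oplus>\<^bsub>L\<^esub> (1 :: rat) \<odot>\<^bsub>L\<^esub> bracket L ?X ?Y"
    using L.smult_l_distr[of "1 :: rat" "1 :: rat", OF _ _ bc] by simp
  also have "\<dots> = bracket L ?X ?Y \<oplus>\<^bsub>L\<^esub> (- 1) \<odot>\<^bsub>L\<^esub> bracket L ?X ?Y"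
    using m L.smult_one[OF bc] by simp
  also have "\<dots> = \<zero>\<^bsub>L\<^esub>" using bc by (simp only: L.smult_minus_one L.r_neg)
  finally have "(1/2 :: rat) \<odot>\<^bsub>L\<^esub> ((2 :: rat) \<odot>\<^bsub>L\<^esub> bracket L ?X ?Y) = \<zero>\<^bsub>L\<^esub>"
    using L.smult_r_null[of "1/2 :: rat"] by simp
  moreover have "(1/2 :: rat) \<odot>\<^bsub>L\<^esub> ((2 :: rat) \<odot>\<^bsub>L\<^esub> bracket L ?X ?Y) = (1/2 * 2 :: rat) \<odot>\<^bsub>L\<^esub> bracket L ?X ?Y"
    using L.smult_assoc1[of "1/2 :: rat" "2 :: rat", OF _ _ bc] by simp
  ultimately show ?thesis using L.smult_one[OF bc] by simp
qed

text \<open>\<open>f\<close> preserves the vanishing of a bracket. To recover the minor at an edge,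
  take the constant metabelian coefficient for the two coordinate functionals of its endpoints;
  these are compatible precisely because the endpoints are adjacent.\<close>

lemma endo_commuting:
  assumes f: "lie_endo L f" and com: "commuting S E x y"
  shows "commuting S E (mat_app S (cf f) x) (mat_app S (cf f) y)"
proof -
  let ?X = "q (pvec x)" and ?Y = "q (pvec y)"
  have Xc: "?X \<in> carrier L" and Yc: "?Y \<in> carrier L" using q.hom_closed[OF pvec_closed] by auto
  have f0: "f \<zero>\<^bsub>L\<^esub> = \<zero>\<^bsub>L\<^esub>" using lie_endoD(3)[OF f L.zero_closed, of 0] lie_endoD(1)[OF f L.zero_closed] by simp
  have z: "bracket L (f ?X) (f ?Y) = \<zero>\<^bsub>L\<^esub>"
    using lie_endoD(4)[OF f Xc Yc] bracket_commuting[OF com] f0 by simp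
  have app: "UL (coord \<beta>) (f (q (pvec v))) = mat_app S (cf f) v \<beta>" for \<beta> v
    using UL_endo[OF f q.hom_closed[OF pvec_closed], of "coord \<beta>" v]
    by (simp add: mat_app_def cf_def UL_coord_pvec)
  show ?thesis
    unfolding commuting_def
  proof (intro ballI impI)
    fix \<gamma> \<delta> assume gd: "\<gamma> \<in> S" "\<delta> \<in> S" "{\<gamma>, \<delta>} \<in> E"
    have comp: "compatible S E (coord \<gamma>) (coord \<delta>)"
      unfolding compatible_def using gd(3) by (auto simp: coord_def insert_commute)
    have "MM (coord \<gamma>) (coord \<delta>) \<zero>\<^bsub>L\<^esub> 0 0 = 0"
      using MM_q[OF comp _ F_zero, of 0 0] c by (simp add: q_zero)
    moreover have "MM (coord \<gamma>) (coord \<delta>) (bracket L (f ?X) (f ?Y)) 0 0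
        = UL (coord \<gamma>) (f ?X) * UL (coord \<delta>) (f ?Y) - UL (coord \<delta>) (f ?X) * UL (coord \<gamma>) (f ?Y)"
      using MM_bracket[OF comp _ lie_endoD(1)[OF f Xc] lie_endoD(1)[OF f Yc], of 0 0] c
      by (simp add: shl_def shr_def)
    ultimately show "mat_app S (cf f) x \<gamma> * mat_app S (cf f) y \<delta> = mat_app S (cf f) x \<delta> * mat_app S (cf f) y \<gamma>"
      using z by (simp add: app)
  qed
qed

end

section \<open>Coherent components and centralizers\<close>

lemma homogeneous_system_solution:
  fixes M :: "'j \<Rightarrow> 'i \<Rightarrow> rat"
  assumes "finite J" "finite I" "card J < card I"
  shows "\<exists>x. (\<exists>i\<in>I. x i \<noteq> 0) \<and> (\<forall>j\<in>J. (\<Sum>i\<in>I. M j i * x i) = 0)"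
  using assms
proof (induction J arbitrary: I M rule: finite_induct)
  case empty
  then obtain i where "i \<in> I" by (metis card.empty equals0I less_numeral_extra(3))
  then show ?case by (intro exI[of _ "\<lambda>_. 1"]) auto
next
  case (insert j J)
  show ?case
  proof (cases "\<forall>i\<in>I. M j i = 0")
    case True
    have "card J < card I" using insert by simp
    then obtain x where "\<exists>i\<in>I. x i \<noteq> 0" "\<forall>j\<in>J. (\<Sum>i\<in>I. M j i * x i) = 0"
      using insert.IH[OF insert.prems(1)] by blast
    then show ?thesis using True by (intro exI[of _ x]) auto
  next
    case False
    then obtain i0 where i0: "i0 \<in> I" "M j i0 \<noteq> 0" by blast
    let ?I = "I - {i0}"
    have "card J < card ?I" using insert i0 by simp
    then obtain x where x: "\<exists>i\<in>?I. x i \<noteq> 0"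
      "\<forall>k\<in>J. (\<Sum>i\<in>?I. (M k i - M k i0 * M j i / M j i0) * x i) = 0"
      using insert.IH[of ?I "\<lambda>k i. M k i - M k i0 * M j i / M j i0"] insert.prems by auto
    define s where "s = (\<Sum>i\<in>?I. M j i * x i)"
    define y where "y = x(i0 := - s / M j i0)"
    have sp: "(\<Sum>i\<in>I. M k i * y i) = M k i0 * (- s / M j i0) + (\<Sum>i\<in>?I. M k i * x i)" for k
      using insert.prems i0 by (simp add: sum.remove[of I i0] y_def)
    have "(\<Sum>i\<in>I. M k i * y i) = 0" if k: "k \<in> insert j J" for k
    proof (cases "k = j")
      case True
      then show ?thesis using sp[of j] i0 by (simp add: s_def)
    next
      case False
      then have "0 = (\<Sum>i\<in>?I. (M k i - M k i0 * M j i / M j i0) * x i)" using x(2) k by simp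
      also have "\<dots> = (\<Sum>i\<in>?I. M k i * x i) - M k i0 / M j i0 * s"
      proof -
        have "(M k i - M k i0 * M j i / M j i0) * x i = M k i * x i - M k i0 / M j i0 * (M j i * x i)" for i
          by (simp add: left_diff_distrib)
        then show ?thesis by (simp only: s_def sum_subtractf sum_distrib_left)
      qed
      finally show ?thesis using sp[of k] by simp
    qed
    moreover have "\<exists>i\<in>I. y i \<noteq> 0" using x(1) by (auto simp: y_def)
    ultimately show ?thesis by blast
  qed
qed

definition nbhd :: "'v set \<Rightarrow> 'v set set \<Rightarrow> 'v \<Rightarrow> 'v set" where
  "nbhd S E \<alpha> = {\<gamma> \<in> S. {\<alpha>, \<gamma>} \<in> E}"

text \<open>The functionals \<open>l k\<close> cut out a subspace of the centralizer of \<open>x\<close>; so \<open>card K\<close> bounds the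
  codimension of the centralizer.\<close>

definition centralizer_bound ::
  "'v set \<Rightarrow> 'v set set \<Rightarrow> ('v \<Rightarrow> rat) \<Rightarrow> 'k set \<Rightarrow> ('k \<Rightarrow> 'v \<Rightarrow> rat) \<Rightarrow> bool" where
  "centralizer_bound S E x K l \<longleftrightarrow> finite K \<and>
     (\<forall>y. (\<forall>k\<in>K. (\<Sum>\<delta>\<in>S. l k \<delta> * y \<delta>) = 0) \<longrightarrow> commuting S E x y)"

definition right_inverse :: "'v set \<Rightarrow> ('v \<Rightarrow> 'v \<Rightarrow> rat) \<Rightarrow> ('v \<Rightarrow> 'v \<Rightarrow> rat) \<Rightarrow> bool" where
  "right_inverse S A A' \<longleftrightarrow>
     (\<forall>\<beta>\<in>S. \<forall>\<alpha>\<in>S. (\<Sum>\<gamma>\<in>S. A \<beta> \<gamma> * A' \<gamma> \<alpha>) = (if \<alpha> = \<beta> then 1 else 0))"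

definition preserves_commuting :: "'v set \<Rightarrow> 'v set set \<Rightarrow> ('v \<Rightarrow> 'v \<Rightarrow> rat) \<Rightarrow> bool" where
  "preserves_commuting S E A \<longleftrightarrow>
     (\<forall>x y. commuting S E x y \<longrightarrow> commuting S E (mat_app S A x) (mat_app S A y))"

definition deg where "deg S E \<alpha> = card (nbhd S E \<alpha>)"

context
  fixes S :: "'v set" and E :: "'v set set"
  assumes graph: "simple_graph S E"
begin

lemma finite_vertices: "finite S" and no_loop: "{\<alpha>} \<notin> E" and not_self_nbhd: "\<alpha> \<notin> nbhd S E \<alpha>"
  and finite_nbhd: "finite (nbhd S E \<alpha>)"
proof -
  show f: "finite S" using graph by (simp add: simple_graph_def)
  show "{\<alpha>} \<notin> E"
  proof
    assume "{\<alpha>} \<in> E"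
    then have "card {\<alpha>} = 2" using graph by (auto simp: simple_graph_def)
    then show False by simp
  qed
  then show "\<alpha> \<notin> nbhd S E \<alpha>" by (simp add: nbhd_def)
  show "finite (nbhd S E \<alpha>)" using f by (simp add: nbhd_def)
qed

text \<open>The transposition preserves the pair \<open>{\<alpha>, \<beta>}\<close> itself and there
  are no loops, so only adjacencies with third vertices can change.\<close>

lemma coherent_iff:
  "(\<alpha>, \<beta>) \<in> coherent_rel S E \<longleftrightarrow> \<alpha> \<in> S \<and> \<beta> \<in> S \<and> (\<forall>\<gamma>\<in>S - {\<alpha>, \<beta>}. {\<alpha>, \<gamma>} \<in> E \<longleftrightarrow> {\<beta>, \<gamma>} \<in> E)"
proof -
  let ?t = "Transposition.transpose \<alpha> \<beta>"
  have bij: "bij_betw ?t S S" if "\<alpha> \<in> S" "\<beta> \<in> S"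
    using permutes_imp_bij[OF permutes_swap_id[OF that]] .
  have "graph_automorphism S E ?t \<longleftrightarrow> (\<forall>\<gamma>\<in>S - {\<alpha>, \<beta>}. {\<alpha>, \<gamma>} \<in> E \<longleftrightarrow> {\<beta>, \<gamma>} \<in> E)"
    if ab: "\<alpha> \<in> S" "\<beta> \<in> S"
  proof
    assume "graph_automorphism S E ?t"
    then have a: "\<And>x y. x \<in> S \<Longrightarrow> y \<in> S \<Longrightarrow> {?t x, ?t y} \<in> E \<longleftrightarrow> {x, y} \<in> E"
      by (auto simp: graph_automorphism_def)
    show "\<forall>\<gamma>\<in>S - {\<alpha>, \<beta>}. {\<alpha>, \<gamma>} \<in> E \<longleftrightarrow> {\<beta>, \<gamma>} \<in> E"
    proof
      fix \<gamma> assume g: "\<gamma> \<in> S - {\<alpha>, \<beta>}"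
      then show "{\<alpha>, \<gamma>} \<in> E \<longleftrightarrow> {\<beta>, \<gamma>} \<in> E"
        using a[of \<alpha> \<gamma>] ab by (auto simp: transpose_def)
    qed
  next
    assume h: "\<forall>\<gamma>\<in>S - {\<alpha>, \<beta>}. {\<alpha>, \<gamma>} \<in> E \<longleftrightarrow> {\<beta>, \<gamma>} \<in> E"
    have "{?t x, ?t y} \<in> E \<longleftrightarrow> {x, y} \<in> E" if xy: "x \<in> S" "y \<in> S" for x y
    proof (cases "x = y")
      case True
      then show ?thesis using no_loop by simp
    next
      case False
      define e where "e = (\<lambda>a b. {a, b} \<in> E)"
      have h1: "e \<alpha> \<gamma> = e \<beta> \<gamma>" and h2: "e \<gamma> \<alpha> = e \<gamma> \<beta>"
        if "\<gamma> \<in> S" "\<gamma> \<noteq> \<alpha>" "\<gamma> \<noteq> \<beta>" for \<gamma>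
        using h that by (auto simp: e_def insert_commute)
      have c: "e \<beta> \<alpha> = e \<alpha> \<beta>" by (simp add: e_def insert_commute)
      have "e (?t x) (?t y) = e x y"
      proof (cases "\<alpha> = \<beta>")
        case ne: False
        consider "x = \<alpha>" "y = \<beta>" | "x = \<beta>" "y = \<alpha>" | "x = \<alpha>" "y \<noteq> \<alpha>" "y \<noteq> \<beta>" | "x = \<beta>" "y \<noteq> \<alpha>" "y \<noteq> \<beta>"
          | "x \<noteq> \<alpha>" "x \<noteq> \<beta>" "y = \<alpha>" | "x \<noteq> \<alpha>" "x \<noteq> \<beta>" "y = \<beta>" | "x \<noteq> \<alpha>" "x \<noteq> \<beta>" "y \<noteq> \<alpha>" "y \<noteq> \<beta>"
          using False by blast
        then show ?thesis
          using c ne h1[OF xy(2)] h2[OF xy(1)] by cases (simp_all add: transpose_def)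
      qed simp
      then show ?thesis by (simp add: e_def)
    qed
    then show "graph_automorphism S E ?t" using bij[OF ab] by (simp add: graph_automorphism_def)
  qed
  then show ?thesis by (auto simp: coherent_rel_def)
qed

lemma coherent_equiv: "equiv S (coherent_rel S E)"
proof (rule equivI)
  show "coherent_rel S E \<subseteq> S \<times> S" by (auto simp: coherent_rel_def)
  show "refl_on S (coherent_rel S E)" unfolding refl_on_def by (auto simp: coherent_iff)
  show "sym (coherent_rel S E)" unfolding sym_def by (auto simp: coherent_iff)
  show "trans (coherent_rel S E)"
    unfolding trans_def
  proof (intro allI impI)
    fix x y z assume xy: "(x, y) \<in> coherent_rel S E" and yz: "(y, z) \<in> coherent_rel S E"
    have s: "x \<in> S" "y \<in> S" "z \<in> S" using xy yz by (auto simp: coherent_iff)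
    have "{x, g} \<in> E \<longleftrightarrow> {z, g} \<in> E" if g: "g \<in> S" "g \<noteq> x" "g \<noteq> z" for g
    proof (cases "g = y")
      case False
      then have "{x, g} \<in> E \<longleftrightarrow> {y, g} \<in> E" "{y, g} \<in> E \<longleftrightarrow> {z, g} \<in> E"
        using xy yz g by (auto simp: coherent_iff)
      then show ?thesis by simp
    next
      case True
      \<comment> \<open>Here the third vertex is the intermediate one, about which neither
        hypothesis speaks directly. Both sides are compared with the adjacency of \<open>x\<close>
        and \<open>z\<close>.\<close>
      show ?thesis
      proof (cases "x = z")
        case False
        have "{x, z} \<in> E \<longleftrightarrow> {y, z} \<in> E" using xy False True g s by (auto simp: coherent_iff)
        moreover have "{y, x} \<in> E \<longleftrightarrow> {z, x} \<in> E" using yz False True g s by (auto simp: coherent_iff)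
        ultimately show ?thesis using True by (simp add: insert_commute)
      qed simp
    qed
    then show "(x, z) \<in> coherent_rel S E" using s by (auto simp: coherent_iff)
  qed
qed

lemma coherent_sym: "(x, y) \<in> coherent_rel S E \<Longrightarrow> (y, x) \<in> coherent_rel S E"
  using coherent_equiv by (meson equivE symE)

lemma coherent_trans:
  "(x, y) \<in> coherent_rel S E \<Longrightarrow> (y, z) \<in> coherent_rel S E \<Longrightarrow> (x, z) \<in> coherent_rel S E"
  using coherent_equiv by (meson equivE transE)

lemma coherent_deg:
  assumes "(\<alpha>, \<beta>) \<in> coherent_rel S E" shows "deg S E \<alpha> = deg S E \<beta>"
proof (cases "\<alpha> = \<beta>")
  case False
  have h: "\<And>\<gamma>. \<gamma> \<in> S \<Longrightarrow> \<gamma> \<noteq> \<alpha> \<Longrightarrow> \<gamma> \<noteq> \<beta> \<Longrightarrow> {\<alpha>, \<gamma>} \<in> E \<longleftrightarrow> {\<beta>, \<gamma>} \<in> E" and s: "\<alpha> \<in> S" "\<beta> \<in> S"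
    using assms by (auto simp: coherent_iff)
  let ?X = "{\<gamma> \<in> S - {\<alpha>, \<beta>}. {\<alpha>, \<gamma>} \<in> E}"
  have fx: "finite ?X" using finite_vertices by simp
  have "nbhd S E \<alpha> = ?X \<union> (if {\<alpha>, \<beta>} \<in> E then {\<beta>} else {})"
    using s no_loop[of \<alpha>] by (auto simp: nbhd_def)
  moreover have "nbhd S E \<beta> = ?X \<union> (if {\<alpha>, \<beta>} \<in> E then {\<alpha>} else {})"
  proof (rule Set.set_eqI)
    fix x
    show "x \<in> nbhd S E \<beta> \<longleftrightarrow> x \<in> ?X \<union> (if {\<alpha>, \<beta>} \<in> E then {\<alpha>} else {})"
      using s h[of x] no_loop[of \<beta>] insert_commute[of \<beta> \<alpha> "{}"] False
      by (cases "x = \<alpha>"; cases "x = \<beta>") (auto simp: nbhd_def)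
  qed
  ultimately show ?thesis using fx by (simp add: deg_def)
qed simp

section \<open>Vertex degree and the codimension of centralizers\<close>

context
  fixes x :: "'v \<Rightarrow> rat" and K :: "'k set" and l :: "'k \<Rightarrow> 'v \<Rightarrow> rat"
  assumes bound: "centralizer_bound S E x K l"
begin

lemma finK: "finite K"
  and central: "(\<And>k. k \<in> K \<Longrightarrow> (\<Sum>\<delta>\<in>S. l k \<delta> * y \<delta>) = 0) \<Longrightarrow> commuting S E x y"
  using bound by (auto simp: centralizer_bound_def)

text \<open>Fewer than \<open>deg S E \<alpha>\<close> equations have a nonzero solution supported
  on the neighbours of \<open>\<alpha>\<close>. It would commute with \<open>x\<close>, but the
  minor at an edge from \<open>\<alpha>\<close> to a neighbour \<open>\<gamma>\<close> is
  \<open>x \<alpha> * y \<gamma>\<close>.\<close>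

lemma centralizer_deg:
  assumes "\<alpha> \<in> S" "x \<alpha> \<noteq> 0" shows "deg S E \<alpha> \<le> card K"
proof (rule ccontr)
  assume "\<not> ?thesis"
  then have "card K < card (nbhd S E \<alpha>)" by (simp add: deg_def)
  then obtain v where v: "\<exists>i\<in>nbhd S E \<alpha>. v i \<noteq> 0" "\<forall>k\<in>K. (\<Sum>i\<in>nbhd S E \<alpha>. l k i * v i) = 0"
    using homogeneous_system_solution[OF finK finite_nbhd] by blast
  define y where "y = (\<lambda>i. if i \<in> nbhd S E \<alpha> then v i else 0)"
  have "(\<Sum>\<delta>\<in>S. l k \<delta> * y \<delta>) = (\<Sum>i\<in>nbhd S E \<alpha>. l k i * v i)" for k
    using finite_vertices by (intro sum.mono_neutral_cong_right) (auto simp: y_def nbhd_def)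
  then have "commuting S E x y" using v(2) by (intro central) simp
  moreover obtain \<gamma> where g: "\<gamma> \<in> nbhd S E \<alpha>" "v \<gamma> \<noteq> 0" using v(1) by blast
  ultimately have "x \<alpha> * y \<gamma> = x \<gamma> * y \<alpha>" using assms by (auto simp: commuting_def nbhd_def)
  then show False using g assms(2) not_self_nbhd by (simp add: y_def)
qed

text \<open>Equality in \<open>centralizer_deg\<close> leaves no room: modulo vectors supported on
  the neighbours of \<open>\<alpha>\<close>, every \<open>y\<close> can be corrected into the
  centralizer. If \<open>y\<close> vanishes on the closed neighbourhood, the minors at
  \<open>\<alpha>\<close> force the correction to be zero.\<close>

lemma centralizer_star:
  assumes a: "\<alpha> \<in> S" "x \<alpha> \<noteq> 0" "deg S E \<alpha> = card K"
    and y: "\<And>\<gamma>. \<gamma> \<in> insert \<alpha> (nbhd S E \<alpha>) \<Longrightarrow> y \<gamma> = 0"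
  shows "commuting S E x y"
proof -
  let ?I = "insert \<alpha> (nbhd S E \<alpha>)"
  \<comment> \<open>The unknown with index \<open>\<alpha>\<close> is the coefficient of
    \<open>y\<close>, the others are the entries of the correction; this makes one unknown more than
    there are equations.\<close>
  define M where "M = (\<lambda>k i. if i = \<alpha> then (\<Sum>\<delta>\<in>S. l k \<delta> * y \<delta>) else l k i)"
  have "card K < card ?I" using a(3) not_self_nbhd finite_nbhd by (simp add: deg_def)
  then obtain v where v: "\<exists>i\<in>?I. v i \<noteq> 0" "\<forall>k\<in>K. (\<Sum>i\<in>?I. M k i * v i) = 0"
    using homogeneous_system_solution[OF finK, of ?I M] finite_nbhd by auto
  define z where "z = (\<lambda>i. v \<alpha> * y i + (if i \<in> nbhd S E \<alpha> then v i else 0))"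
  have "(\<Sum>\<delta>\<in>S. l k \<delta> * z \<delta>) = 0" if k: "k \<in> K" for k
  proof -
    have "(\<Sum>\<delta>\<in>S. l k \<delta> * z \<delta>) = v \<alpha> * (\<Sum>\<delta>\<in>S. l k \<delta> * y \<delta>)
        + (\<Sum>\<delta>\<in>S. l k \<delta> * (if \<delta> \<in> nbhd S E \<alpha> then v \<delta> else 0))"
      by (simp add: z_def algebra_simps sum.distrib sum_distrib_left)
    also have "(\<Sum>\<delta>\<in>S. l k \<delta> * (if \<delta> \<in> nbhd S E \<alpha> then v \<delta> else 0)) = (\<Sum>i\<in>nbhd S E \<alpha>. l k i * v i)"
      using finite_vertices by (intro sum.mono_neutral_cong_right) (auto simp: nbhd_def)
    also have "\<dots> = (\<Sum>i\<in>nbhd S E \<alpha>. M k i * v i)"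
      using not_self_nbhd by (intro sum.cong) (auto simp: M_def)
    also have "v \<alpha> * (\<Sum>\<delta>\<in>S. l k \<delta> * y \<delta>) + \<dots> = (\<Sum>i\<in>?I. M k i * v i)"
      using not_self_nbhd finite_nbhd by (simp add: M_def mult.commute)
    finally show ?thesis using v(2) k by simp
  qed
  then have z: "commuting S E x z" by (rule central)
  have "v \<gamma> = 0" if g: "\<gamma> \<in> nbhd S E \<alpha>" for \<gamma>
  proof -
    have "x \<alpha> * z \<gamma> = x \<gamma> * z \<alpha>" using z g a(1) by (auto simp: commuting_def nbhd_def)
    then show ?thesis using g y a(2) not_self_nbhd by (simp add: z_def)
  qed
  then have "z = (\<lambda>i. v \<alpha> * y i)" "v \<alpha> \<noteq> 0" using v(1) by (auto simp: z_def fun_eq_iff)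
  then show ?thesis using z by (auto simp: commuting_def)
qed

text \<open>A neighbour \<open>\<delta>\<close> of \<open>\<beta>\<close> outside the closed
  neighbourhood of \<open>\<alpha>\<close> would give a unit vector that commutes with
  \<open>x\<close> by \<open>centralizer_star\<close>, contradicting the minor at the edge from
  \<open>\<beta>\<close> to \<open>\<delta>\<close>. By symmetry the neighbourhoods agree away from
  the two vertices.\<close>

lemma centralizer_coherent:
  assumes a: "\<alpha> \<in> S" "x \<alpha> \<noteq> 0" "deg S E \<alpha> = card K"
    and b: "\<beta> \<in> S" "x \<beta> \<noteq> 0" "deg S E \<beta> = card K"
  shows "(\<alpha>, \<beta>) \<in> coherent_rel S E"
proof -
  have sub: "nbhd S E \<beta>' \<subseteq> insert \<alpha>' (nbhd S E \<alpha>')"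
    if a': "\<alpha>' \<in> S" "x \<alpha>' \<noteq> 0" "deg S E \<alpha>' = card K" and b': "\<beta>' \<in> S" "x \<beta>' \<noteq> 0" for \<alpha>' \<beta>'
  proof
    fix \<delta> assume d: "\<delta> \<in> nbhd S E \<beta>'"
    show "\<delta> \<in> insert \<alpha>' (nbhd S E \<alpha>')"
    proof (rule ccontr)
      assume n: "\<delta> \<notin> insert \<alpha>' (nbhd S E \<alpha>')"
      define y :: "'v \<Rightarrow> rat" where "y = (\<lambda>i. if i = \<delta> then 1 else 0)"
      have "commuting S E x y" using n by (intro centralizer_star[OF a']) (auto simp: y_def)
      then have "x \<beta>' * y \<delta> = x \<delta> * y \<beta>'" using d b' by (auto simp: commuting_def nbhd_def)
      moreover have "\<beta>' \<noteq> \<delta>" using d not_self_nbhd by auto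
      ultimately show False using b' by (simp add: y_def)
    qed
  qed
  have "{\<alpha>, \<gamma>} \<in> E \<longleftrightarrow> {\<beta>, \<gamma>} \<in> E" if "\<gamma> \<in> S" "\<gamma> \<noteq> \<alpha>" "\<gamma> \<noteq> \<beta>" for \<gamma>
    using sub[OF a b(1,2)] sub[OF b a(1,2)] that by (auto simp: nbhd_def)
  then show ?thesis using a b by (auto simp: coherent_iff)
qed

end

lemma mat_app_inverse:
  assumes "right_inverse S A A'" "\<beta> \<in> S"
  shows "mat_app S A (mat_app S A' y) \<beta> = y \<beta>"
proof -
  have "mat_app S A (mat_app S A' y) \<beta> = (\<Sum>\<alpha>\<in>S. (\<Sum>\<gamma>\<in>S. A \<beta> \<gamma> * A' \<gamma> \<alpha>) * y \<alpha>)"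
    unfolding mat_app_def sum_distrib_left sum_distrib_right by (subst sum.swap) (simp add: mult_ac)
  also have "\<dots> = (\<Sum>\<alpha>\<in>S. if \<alpha> = \<beta> then y \<alpha> else 0)"
    using assms by (intro sum.cong) (auto simp: right_inverse_def)
  finally show ?thesis using finite_vertices assms(2) by simp
qed

lemma commuting_cong:
  "(\<And>\<gamma>. \<gamma> \<in> S \<Longrightarrow> y \<gamma> = y' \<gamma>) \<Longrightarrow> commuting S E x y \<longleftrightarrow> commuting S E x y'"
  by (simp add: commuting_def)

text \<open>The number of columns \<open>A \<alpha>, A \<beta>\<close> involved is what forces the classes to be permuted: if
  \<open>\<alpha>, \<beta>\<close> are coherent then \<open>\<alpha> + \<beta>\<close> has a centralizer as large as that of \<open>\<alpha>\<close>.\<close>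

lemma column_support:
  assumes inv: "right_inverse S A A'"
    and com: "preserves_commuting S E A"
    and a: "\<alpha> \<in> S"
  shows "\<beta> \<in> S \<Longrightarrow> A \<beta> \<alpha> \<noteq> 0 \<Longrightarrow> deg S E \<beta> \<le> deg S E \<alpha>"
    and "\<lbrakk>\<beta> \<in> S; \<beta>' \<in> S; (\<alpha>, \<alpha>') \<in> coherent_rel S E; A \<beta> \<alpha> \<noteq> 0; A \<beta>' \<alpha>' \<noteq> 0;
          deg S E \<beta> = deg S E \<alpha>; deg S E \<beta>' = deg S E \<alpha>\<rbrakk> \<Longrightarrow> (\<beta>, \<beta>') \<in> coherent_rel S E"
proof -
  have app_unit: "mat_app S A (\<lambda>i. if i = \<alpha> then 1 else 0) = (\<lambda>\<beta>. A \<beta> \<alpha>)" if "\<alpha> \<in> S" for \<alpha>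
    using finite_vertices that by (simp add: mat_app_def fun_eq_iff if_distrib[of "\<lambda>z. _ * z"] cong: if_cong)
  note com = com[unfolded preserves_commuting_def, rule_format]
  \<comment> \<open>\<open>A\<close> carries the centralizer of the vertex \<open>\<alpha>\<close>,
    which contains all vectors vanishing on its neighbours, into that of column
    \<open>\<alpha>\<close>. Hence \<open>deg S E \<alpha>\<close> equations suffice, expressed
    through the inverse \<open>A'\<close>.\<close>
  have central1: "centralizer_bound S E (\<lambda>\<beta>. A \<beta> \<alpha>) (nbhd S E \<alpha>) A'" if al: "\<alpha> \<in> S" for \<alpha>
    unfolding centralizer_bound_def
  proof (intro conjI finite_nbhd allI impI)
    fix y assume y: "\<forall>k\<in>nbhd S E \<alpha>. (\<Sum>\<delta>\<in>S. A' k \<delta> * y \<delta>) = 0"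
    let ?z = "mat_app S A' y"
    have "?z k = 0" if "k \<in> nbhd S E \<alpha>" for k using y that by (simp add: mat_app_def)
    then have "commuting S E (\<lambda>i. if i = \<alpha> then 1 else 0) ?z"
      by (auto simp: commuting_def nbhd_def insert_commute)
    then have "commuting S E (\<lambda>\<beta>. A \<beta> \<alpha>) (mat_app S A ?z)" using com app_unit[OF al] by metis
    then show "commuting S E (\<lambda>\<beta>. A \<beta> \<alpha>) y"
      using commuting_cong[of "mat_app S A ?z" y] mat_app_inverse[OF inv] by blast
  qed
  show d: "\<beta> \<in> S \<Longrightarrow> A \<beta> \<alpha> \<noteq> 0 \<Longrightarrow> deg S E \<beta> \<le> deg S E \<alpha>" for \<beta>
    using centralizer_deg[OF central1[OF a]] by (simp add: deg_def)
  have one: "(\<beta>, \<beta>') \<in> coherent_rel S E"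
    if "\<alpha> \<in> S" "\<beta> \<in> S" "\<beta>' \<in> S" "A \<beta> \<alpha> \<noteq> 0" "A \<beta>' \<alpha> \<noteq> 0" "deg S E \<beta> = deg S E \<alpha>" "deg S E \<beta>' = deg S E \<alpha>"
    for \<alpha> \<beta> \<beta>'
    using centralizer_coherent[OF central1[OF that(1)] that(2,4) _ that(3,5)] that(6,7)
    by (simp add: deg_def)
  assume b: "\<beta> \<in> S" "\<beta>' \<in> S" and coh: "(\<alpha>, \<alpha>') \<in> coherent_rel S E"
    and nz: "A \<beta> \<alpha> \<noteq> 0" "A \<beta>' \<alpha>' \<noteq> 0" and dg: "deg S E \<beta> = deg S E \<alpha>" "deg S E \<beta>' = deg S E \<alpha>"
  have a': "\<alpha>' \<in> S" "deg S E \<alpha>' = deg S E \<alpha>" using coh coherent_deg[OF coh] by (auto simp: coherent_iff)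
  show "(\<beta>, \<beta>') \<in> coherent_rel S E"
  proof (cases "\<alpha> = \<alpha>'")
    case True
    then show ?thesis using one[OF a b] nz dg by simp
  next
    case ne: False
    let ?x = "\<lambda>\<beta>. A \<beta> \<alpha> + A \<beta> \<alpha>'"
    \<comment> \<open>A vector \<open>z\<close> commutes with \<open>\<alpha> + \<alpha>'\<close> if
      it vanishes on the common neighbours and, should the two be adjacent, takes equal values at
      them. The latter is one equation, in place of vanishing at \<open>\<alpha>'\<close>, so the
      number stays \<open>deg S E \<alpha>\<close>.\<close>
    let ?l = "\<lambda>k \<delta>. A' k \<delta> - (if k = \<alpha>' then A' \<alpha> \<delta> else 0)"
    have central2: "centralizer_bound S E ?x (nbhd S E \<alpha>) ?l"
      unfolding centralizer_bound_def
    proof (intro conjI finite_nbhd allI impI)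
      fix y assume y: "\<forall>k\<in>nbhd S E \<alpha>. (\<Sum>\<delta>\<in>S. ?l k \<delta> * y \<delta>) = 0"
      let ?z = "mat_app S A' y"
      have zk: "?z k = (if k = \<alpha>' then ?z \<alpha> else 0)" if "k \<in> nbhd S E \<alpha>" for k
        using bspec[OF y that] by (cases "k = \<alpha>'") (simp_all add: mat_app_def left_diff_distrib sum_subtractf)
      have nb: "k \<in> nbhd S E \<alpha>" if "k \<in> nbhd S E \<alpha>'" "k \<noteq> \<alpha>" for k
        using that coh not_self_nbhd by (cases "k = \<alpha>'") (auto simp: coherent_iff nbhd_def)
      have "commuting S E (\<lambda>i. (if i = \<alpha> then 1 else 0) + (if i = \<alpha>' then 1 else 0)) ?z"
        unfolding commuting_def
      proof (intro ballI impI)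
        fix \<gamma> \<delta> assume g: "\<gamma> \<in> S" "\<delta> \<in> S" "{\<gamma>, \<delta>} \<in> E"
        have gd: "\<gamma> \<noteq> \<delta>" using g(3) no_loop by auto
        have e: "\<delta> \<in> nbhd S E \<gamma>" "\<gamma> \<in> nbhd S E \<delta>" using g by (auto simp: nbhd_def insert_commute)
        show "((if \<gamma> = \<alpha> then 1 else 0) + (if \<gamma> = \<alpha>' then 1 else 0)) * ?z \<delta>
            = ((if \<delta> = \<alpha> then 1 else 0) + (if \<delta> = \<alpha>' then 1 else 0)) * ?z \<gamma>"
          using e gd ne zk[of \<delta>] zk[of \<gamma>] nb[of \<delta>] nb[of \<gamma>] by (cases "\<gamma> = \<alpha>"; cases "\<gamma> = \<alpha>'"; cases "\<delta> = \<alpha>"; cases "\<delta> = \<alpha>'") auto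
      qed
      then have "commuting S E (mat_app S A (\<lambda>i. (if i = \<alpha> then 1 else 0) + (if i = \<alpha>' then 1 else 0))) (mat_app S A ?z)"
        by (rule com)
      moreover have "mat_app S A (\<lambda>i. (if i = \<alpha> then 1 else 0) + (if i = \<alpha>' then 1 else 0)) = ?x"
        using app_unit[OF a] app_unit[OF a'(1)]
        by (simp add: mat_app_def fun_eq_iff distrib_left sum.distrib)
      ultimately show "commuting S E ?x y"
        using commuting_cong[of "mat_app S A ?z" y] mat_app_inverse[OF inv] by auto
    qed
    \<comment> \<open>If the two columns cancel at one of the vertices, both of them are nonzero
      there, and a single column already meets both \<open>\<beta>\<close> and
      \<open>\<beta>'\<close>.\<close>
    show ?thesis
    proof (cases "?x \<beta> = 0")
      case True
      then have "A \<beta> \<alpha>' \<noteq> 0" using nz by auto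
      then show ?thesis using one[OF a'(1) b] nz dg a'(2) by simp
    next
      case xb: False
      show ?thesis
      proof (cases "?x \<beta>' = 0")
        case True
        then have "A \<beta>' \<alpha> \<noteq> 0" using nz by auto
        then show ?thesis using one[OF a b] nz dg by simp
      next
        case False
        then show ?thesis
          using centralizer_coherent[OF central2 b(1) xb _ b(2) False] dg
          by (simp add: deg_def)
      qed
    qed
  qed
qed

text \<open>A diagonal entry of \<open>A' A\<close> is 1, so each \<open>\<alpha>\<close> has a
  \<open>p \<alpha>\<close> at which both \<open>A\<close> and \<open>A'\<close> are nonzero;
  \<open>column_support\<close> for both matrices shows equal degrees and that \<open>p\<close> is
  well defined and injective on classes. It thus permutes the finitely many classes, and
  \<open>m\<close> is an exponent at which this permutation is trivial.\<close>

lemma power_preserves_components: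
  assumes inv: "right_inverse S A A'"
    and inv': "right_inverse S A' A"
    and com: "preserves_commuting S E A"
    and com': "preserves_commuting S E A'"
  obtains m where "m > 0" "\<And>\<alpha> \<beta>. \<lbrakk>\<alpha> \<in> S; \<beta> \<in> S; mat_pow S A m \<beta> \<alpha> \<noteq> 0\<rbrakk>
      \<Longrightarrow> (\<alpha>, \<beta>) \<in> coherent_rel S E \<or> deg S E \<beta> < deg S E \<alpha>"
proof -
  let ?R = "coherent_rel S E"
  note cs = column_support[OF inv com] and cs' = column_support[OF inv' com']
  have "\<exists>\<gamma>\<in>S. A \<gamma> \<alpha> \<noteq> 0 \<and> A' \<alpha> \<gamma> \<noteq> 0 \<and> deg S E \<gamma> = deg S E \<alpha>" if a: "\<alpha> \<in> S" for \<alpha>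
  proof -
    have "(\<Sum>\<gamma>\<in>S. A' \<alpha> \<gamma> * A \<gamma> \<alpha>) \<noteq> 0" using inv' a by (simp add: right_inverse_def)
    then obtain \<gamma> where g: "\<gamma> \<in> S" "A' \<alpha> \<gamma> * A \<gamma> \<alpha> \<noteq> 0" by (meson sum.neutral)
    then have "deg S E \<gamma> \<le> deg S E \<alpha>" "deg S E \<alpha> \<le> deg S E \<gamma>"
      using cs(1)[OF a g(1)] cs'(1)[OF g(1) a] by auto
    then show ?thesis using g by auto
  qed
  then obtain p where p: "\<And>\<alpha>. \<alpha> \<in> S \<Longrightarrow> p \<alpha> \<in> S \<and> A (p \<alpha>) \<alpha> \<noteq> 0 \<and> A' \<alpha> (p \<alpha>) \<noteq> 0 \<and> deg S E (p \<alpha>) = deg S E \<alpha>"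
    by metis
  have pcoh: "(\<alpha>, \<beta>) \<in> ?R \<longleftrightarrow> (p \<alpha>, p \<beta>) \<in> ?R" if ab: "\<alpha> \<in> S" "\<beta> \<in> S" for \<alpha> \<beta>
  proof
    assume r: "(\<alpha>, \<beta>) \<in> ?R"
    show "(p \<alpha>, p \<beta>) \<in> ?R"
      using cs(2)[OF ab(1) _ _ r, of "p \<alpha>" "p \<beta>"] p[OF ab(1)] p[OF ab(2)] coherent_deg[OF r] by auto
  next
    assume r: "(p \<alpha>, p \<beta>) \<in> ?R"
    show "(\<alpha>, \<beta>) \<in> ?R"
      using cs'(2)[OF _ ab r] p[OF ab(1)] p[OF ab(2)] coherent_deg[OF r] by auto
  qed
  define \<Lambda> where "\<Lambda> = S // ?R"
  define cl where "cl = (\<lambda>\<alpha>. ?R `` {\<alpha>})"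
  have cl: "cl \<alpha> = cl \<beta> \<longleftrightarrow> (\<alpha>, \<beta>) \<in> ?R" if "\<alpha> \<in> S" "\<beta> \<in> S" for \<alpha> \<beta>
    unfolding cl_def using eq_equiv_class_iff[OF coherent_equiv that] .
  have \<Lambda>: "\<Lambda> = cl ` S" by (auto simp: \<Lambda>_def quotient_def cl_def)
  define rep where "rep = (\<lambda>C. SOME \<alpha>. \<alpha> \<in> S \<and> cl \<alpha> = C)"
  have rep: "rep C \<in> S \<and> cl (rep C) = C" if "C \<in> \<Lambda>" for C
    using someI_ex[of "\<lambda>\<alpha>. \<alpha> \<in> S \<and> cl \<alpha> = C"] that unfolding rep_def \<Lambda> by blast
  \<comment> \<open>Extended by the identity outside the set of classes, so that it is a permutation
    in the sense of \<open>permutes\<close>.\<close>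
  define P where "P = (\<lambda>C. if C \<in> \<Lambda> then cl (p (rep C)) else C)"
  have Pcl: "P (cl \<alpha>) = cl (p \<alpha>)" if a: "\<alpha> \<in> S" for \<alpha>
  proof -
    have c: "cl \<alpha> \<in> \<Lambda>" using a by (simp add: \<Lambda>)
    have "(rep (cl \<alpha>), \<alpha>) \<in> ?R" using rep[OF c] cl[of "rep (cl \<alpha>)" \<alpha>] a by simp
    then have "cl (p (rep (cl \<alpha>))) = cl (p \<alpha>)"
      using pcoh[of "rep (cl \<alpha>)" \<alpha>] cl[of "p (rep (cl \<alpha>))" "p \<alpha>"] rep[OF c] a p by simp
    then show ?thesis using c by (simp add: P_def)
  qed
  have "inj_on P \<Lambda>"
    unfolding \<Lambda>
  proof (rule inj_onI, clarify)
    fix x y assume xy: "x \<in> S" "y \<in> S" and eq: "P (cl x) = P (cl y)"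
    then have "cl (p x) = cl (p y)" by (simp only: Pcl)
    then have "(p x, p y) \<in> ?R" using cl[of "p x" "p y"] p[OF xy(1)] p[OF xy(2)] by blast
    then show "cl x = cl y" using pcoh[OF xy] cl[OF xy] by blast
  qed
  moreover have "P ` \<Lambda> \<subseteq> \<Lambda>" unfolding \<Lambda> using Pcl p by auto
  moreover have fin: "finite \<Lambda>" using finite_vertices by (simp add: \<Lambda>)
  ultimately have "bij_betw P \<Lambda> \<Lambda>" by (simp add: bij_betw_def endo_inj_surj)
  then have "P permutes \<Lambda>" by (intro bij_imp_permutes) (auto simp: P_def)
  then have "permutation P" using fin by (auto simp: permutation_permutes)
  then obtain m where m: "m > 0" "P ^^ m = id" using permutation_is_nilpotent by metis
  have pS: "(p ^^ n) \<alpha> \<in> S" if "\<alpha> \<in> S" for n \<alpha> using that p by (induction n) auto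
  have Pn: "(P ^^ n) (cl \<alpha>) = cl ((p ^^ n) \<alpha>)" if "\<alpha> \<in> S" for n \<alpha>
    using that by (induction n) (auto simp: Pcl pS)
  have pm: "(\<alpha>, (p ^^ m) \<alpha>) \<in> ?R" if "\<alpha> \<in> S" for \<alpha>
    using Pn[OF that, of m] m cl[OF that pS[OF that, of m]] by simp
  \<comment> \<open>Along a chain of nonzero entries the degree never increases. If it is the same
    at both ends it is constant, and then each step moves the class as \<open>p\<close>
    does.\<close>
  have pw: "deg S E \<beta> \<le> deg S E \<alpha> \<and> (deg S E \<beta> = deg S E \<alpha> \<longrightarrow> ((p ^^ n) \<alpha>, \<beta>) \<in> ?R)"
    if "\<alpha> \<in> S" "\<beta> \<in> S" "mat_pow S A n \<beta> \<alpha> \<noteq> 0" for n \<alpha> \<beta>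
    using that
  proof (induction n arbitrary: \<beta>)
    case 0
    then show ?case by (auto simp: coherent_iff split: if_splits)
  next
    case (Suc n)
    then have "(\<Sum>\<gamma>\<in>S. A \<beta> \<gamma> * mat_pow S A n \<gamma> \<alpha>) \<noteq> 0" by simp
    then obtain \<gamma> where g: "\<gamma> \<in> S" "A \<beta> \<gamma> \<noteq> 0" "mat_pow S A n \<gamma> \<alpha> \<noteq> 0"
      by (metis (no_types, lifting) mult_eq_0_iff sum.neutral)
    have d1: "deg S E \<beta> \<le> deg S E \<gamma>" using cs(1)[OF g(1) Suc.prems(2) g(2)] .
    have IH: "deg S E \<gamma> \<le> deg S E \<alpha>" "deg S E \<gamma> = deg S E \<alpha> \<Longrightarrow> ((p ^^ n) \<alpha>, \<gamma>) \<in> ?R"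
      using Suc.IH[OF Suc.prems(1) g(1,3)] by auto
    have "((p ^^ Suc n) \<alpha>, \<beta>) \<in> ?R" if e: "deg S E \<beta> = deg S E \<alpha>"
    proof -
      have eq: "deg S E \<gamma> = deg S E \<alpha>" "deg S E \<beta> = deg S E \<gamma>" using d1 IH(1) e by auto
      have "(p ((p ^^ n) \<alpha>), p \<gamma>) \<in> ?R"
        using IH(2)[OF eq(1)] pcoh[OF pS[OF Suc.prems(1)] g(1)] by simp
      moreover have "(\<gamma>, \<gamma>) \<in> ?R" using g(1) by (simp add: coherent_iff)
      then have "(p \<gamma>, \<beta>) \<in> ?R"
        using cs(2)[OF g(1) _ Suc.prems(2), of "p \<gamma>" \<gamma>] p[OF g(1)] g(2) eq by simp
      ultimately show ?thesis using coherent_trans by (metis comp_apply funpow.simps(2))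
    qed
    then show ?case using d1 IH(1) by auto
  qed
  show thesis
  proof (rule that[OF m(1)])
    fix \<alpha> \<beta> assume ab: "\<alpha> \<in> S" "\<beta> \<in> S" "mat_pow S A m \<beta> \<alpha> \<noteq> 0"
    show "(\<alpha>, \<beta>) \<in> ?R \<or> deg S E \<beta> < deg S E \<alpha>"
      using pw[OF ab] pm[OF ab(1)] coherent_trans by (metis le_neq_implies_less)
  qed
qed

end

section \<open>Anosov automorphisms and short words\<close>

text \<open>Take for \<open>u\<close> a point \<open>N ^ idx \<beta>\<close> on the moment curve.
  Each \<open>v\<close> turns into a nonzero polynomial in \<open>N\<close>, and finitely many
  polynomials have a common natural number that is a root of none. The form has to be rational
  although the vectors are complex, because only rational functionals enter
  \<open>UL\<close>.\<close>

lemma generic_rational_form: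
  fixes V :: "('v \<Rightarrow> complex) set"
  assumes fin: "finite l" and V: "finite V" and nz: "\<And>v. v \<in> V \<Longrightarrow> \<exists>\<beta>\<in>l. v \<beta> \<noteq> 0"
  shows "\<exists>u :: 'v \<Rightarrow> rat. (\<forall>v\<in>V. (\<Sum>\<beta>\<in>l. of_rat (u \<beta>) * v \<beta>) \<noteq> 0) \<and> (\<forall>\<beta>. \<beta> \<notin> l \<longrightarrow> u \<beta> = 0)"
proof -
  obtain idx :: "'v \<Rightarrow> nat" where idx: "inj_on idx l"
    using finite_imp_inj_to_nat_seg[OF fin] by blast
  define p where "p = (\<lambda>v :: 'v \<Rightarrow> complex. \<Sum>\<beta>\<in>l. Polynomial.monom (v \<beta>) (idx \<beta>))"
  have p0: "p v \<noteq> 0" if v: "v \<in> V" for v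
  proof -
    obtain \<beta> where b: "\<beta> \<in> l" "v \<beta> \<noteq> 0" using nz[OF v] by blast
    have "coeff (p v) (idx \<beta>) = (\<Sum>\<gamma>\<in>l. if \<gamma> = \<beta> then v \<gamma> else 0)"
      unfolding p_def coeff_sum coeff_monom using idx b(1) by (intro sum.cong) (auto simp: inj_on_def)
    then have "coeff (p v) (idx \<beta>) \<noteq> 0" using b fin by simp
    then show ?thesis by auto
  qed
  have "(\<Prod>v\<in>V. p v) \<noteq> 0" using p0 V by (simp add: prod_zero_iff)
  then have "finite {z. poly (\<Prod>v\<in>V. p v) z = 0}" by (rule poly_roots_finite)
  moreover have "infinite (range (of_nat :: nat \<Rightarrow> complex))"
    by (intro range_inj_infinite injI) simp
  ultimately have "\<not> range (of_nat :: nat \<Rightarrow> complex) \<subseteq> {z. poly (\<Prod>v\<in>V. p v) z = 0}"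
    using finite_subset by blast
  then obtain N :: nat where "poly (\<Prod>v\<in>V. p v) (of_nat N) \<noteq> 0" by auto
  then have N: "poly (p v) (of_nat N) \<noteq> 0" if "v \<in> V" for v
    using that V by (auto simp: poly_prod prod_zero_iff)
  define u :: "'v \<Rightarrow> rat" where "u = (\<lambda>\<beta>. if \<beta> \<in> l then of_nat N ^ idx \<beta> else 0)"
  have "(\<Sum>\<beta>\<in>l. of_rat (u \<beta>) * v \<beta>) = poly (p v) (of_nat N)" for v
    unfolding p_def poly_sum poly_monom by (intro sum.cong) (simp_all add: u_def of_rat_power mult.commute)
  then show ?thesis using N by (intro exI[of _ u]) (simp add: u_def)
qed

text \<open>Eigenvalues are listed with multiplicity, so that their product is the determinant.\<close>

lemma unit_block_eigenvalues:
  fixes M :: "'v \<Rightarrow> 'v \<Rightarrow> rat"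
  assumes fin: "finite l"
    and unit: "\<And>a x. \<lbrakk>\<And>\<beta>. \<beta> \<in> l \<Longrightarrow> (\<Sum>\<alpha>\<in>l. of_rat (M \<beta> \<alpha>) * x \<alpha>) = a * x \<beta>; \<exists>\<beta>\<in>l. x \<beta> \<noteq> 0\<rbrakk> \<Longrightarrow> alg_unit a"
  obtains as :: "complex list" where "length as = card l" "cmod (prod_list as) = 1"
    "\<And>a. a \<in> set as \<Longrightarrow> \<exists>x. (\<forall>\<beta>\<in>l. (\<Sum>\<alpha>\<in>l. of_rat (M \<beta> \<alpha>) * x \<alpha>) = a * x \<beta>) \<and> (\<exists>\<beta>\<in>l. x \<beta> \<noteq> 0)"
proof -
  define n where "n = card l"
  obtain h where h: "bij_betw h {0..<n} l"
    using ex_bij_betw_nat_finite[OF fin] by (auto simp: n_def)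
  define A :: "rat mat" where "A = mat n n (\<lambda>(i, j). M (h i) (h j))"
  have A: "A \<in> carrier_mat n n" and Ac: "(map_mat of_rat A :: complex mat) \<in> carrier_mat n n" by (simp_all add: A_def)
  have cp: "char_poly (map_mat of_rat A :: complex mat) = map_poly of_rat (char_poly A)"
    using of_rat_hom.char_poly_hom[OF A, where 'a = complex] by simp
  have monic: "lead_coeff (char_poly A) = 1" "degree (char_poly A) = n"
    using degree_monic_char_poly[OF A] by simp_all
  have ev: "\<exists>x. (\<forall>\<beta>\<in>l. (\<Sum>\<alpha>\<in>l. of_rat (M \<beta> \<alpha>) * x \<alpha>) = a * x \<beta>) \<and> (\<exists>\<beta>\<in>l. x \<beta> \<noteq> 0)"
    if a: "poly (map_poly of_rat (char_poly A)) a = 0" for a :: complex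
  proof -
    have "eigenvalue (map_mat of_rat A) a" using eigenvalue_root_char_poly[OF Ac] a cp by simp
    then obtain v where v: "v \<in> carrier_vec n" "v \<noteq> 0\<^sub>v n" "map_mat of_rat A *\<^sub>v v = a \<cdot>\<^sub>v v"
      using A unfolding eigenvalue_def eigenvector_def by auto
    obtain k where k: "k < n" "v $ k \<noteq> 0"
      using v(1,2) by (metis carrier_vecD eq_vecI index_zero_vec(1) index_zero_vec(2))
    define x where "x = (\<lambda>\<beta>. v $ (inv_into {0..<n} h \<beta>))"
    have xh: "x (h i) = v $ i" if "i < n" for i
      using h that by (simp add: x_def bij_betw_def inv_into_f_f)
    have "(\<Sum>\<alpha>\<in>l. of_rat (M \<beta> \<alpha>) * x \<alpha>) = a * x \<beta>" if b: "\<beta> \<in> l" for \<beta>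
    proof -
      obtain i where i: "i < n" "\<beta> = h i" using b h by (force simp: bij_betw_def)
      have "(\<Sum>\<alpha>\<in>l. of_rat (M \<beta> \<alpha>) * x \<alpha>) = (\<Sum>j\<in>{0..<n}. of_rat (M \<beta> (h j)) * x (h j))"
        using sum.reindex_bij_betw[OF h, of "\<lambda>\<alpha>. of_rat (M \<beta> \<alpha>) * x \<alpha>"] by simp
      also have "\<dots> = (map_mat of_rat A *\<^sub>v v) $ i"
        using i v(1) by (simp add: A_def scalar_prod_def xh)
      also have "\<dots> = a * x \<beta>" using v i by (simp add: xh)
      finally show ?thesis .
    qed
    moreover have "h k \<in> l" "x (h k) \<noteq> 0" using k xh h by (auto simp: bij_betw_def)
    ultimately show ?thesis by blast
  qed
  have u: "alg_unit a" if "poly (map_poly of_rat (char_poly A)) a = 0" for a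
    using ev[OF that] unit by blast
  have c0: "coeff (char_poly A) 0 \<in> {1, - 1}" by (rule rat_poly_unit_roots(2)[OF monic(1) u])
  have lc: "lead_coeff (map_poly of_rat (char_poly A) :: complex poly) = 1" using monic by simp
  obtain as :: "complex list" where as: "map_poly of_rat (char_poly A) = (\<Prod>a\<leftarrow>as. [:- a, 1:])"
    using complex_monic_factorization[OF lc] .
  have "degree (\<Prod>a\<leftarrow>as. [:- a, 1:]) = length as"
    by (rule degree_linear_factors)
  moreover have "degree (map_poly of_rat (char_poly A) :: complex poly) = n" using monic(2) by simp
  ultimately have len: "length as = card l" unfolding as n_def by simp
  have "coeff (map_poly of_rat (char_poly A) :: complex poly) 0 = (\<Prod>a\<leftarrow>as. - a)"
    by (simp add: poly_0_coeff_0[symmetric] as poly_prod_list o_def)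
  then have "(\<Prod>a\<leftarrow>as. - a) = 1 \<or> (\<Prod>a\<leftarrow>as. - a) = - 1" using c0 by auto
  then have "cmod (\<Prod>a\<leftarrow>as. - a) = 1" by (elim disjE) (simp_all only: norm_one norm_minus_cancel)
  moreover have "cmod (\<Prod>a\<leftarrow>as. - a) = cmod (prod_list as)" by (induction as) (simp_all add: norm_mult)
  ultimately have "cmod (prod_list as) = 1" by simp
  then show thesis
    by (rule that[OF len]) (auto intro!: ev simp: as poly_prod_list o_def prod_list_zero_iff)
qed

section \<open>Metabelian coefficients of right-normed words\<close>

context graph_nilpotent
begin

lemma foldr_bracket_closed:
  "set Xs \<subseteq> carrier L \<Longrightarrow> Z \<in> carrier L \<Longrightarrow> foldr (bracket L) Xs Z \<in> carrier L"
  by (induction Xs) (auto intro: L.bracket_closed)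

lemma UL_foldr:
  assumes "set Xs \<subseteq> carrier L" "Z \<in> carrier L" "UL u Z = 0" shows "UL u (foldr (bracket L) Xs Z) = 0"
  using assms by (induction Xs) (auto simp: UL_bracket foldr_bracket_closed)

text \<open>Each \<open>Y\<close> multiplies the polynomial part by \<open>UL w Y\<close> times
  \<open>t\<close>, as its \<open>s\<close>-component is zero. Only the constant coefficient of
  \<open>Z\<close> is known; the others are pushed beyond total degree
  \<open>length Ys\<close>.\<close>

lemma MM_iterated_right:
  assumes comp: "compatible S E u w" and Z: "Z \<in> carrier L" "UL u Z = 0" "UL w Z = 0"
    and base: "MM u w Z 0 0 = t"
    and Ys: "set Ys \<subseteq> carrier L" "\<And>Y. Y \<in> set Ys \<Longrightarrow> UL u Y = 0"
    and ij: "i + j \<le> length Ys" "length Ys + 2 \<le> c"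
  shows "MM u w (foldr (bracket L) Ys Z) i j =
     (if i = 0 \<and> j = length Ys then (\<Prod>Y\<leftarrow>Ys. UL w Y) * t else 0)"
  using Ys ij
proof (induction Ys arbitrary: i j)
  case Nil
  then show ?case by (simp add: base)
next
  case (Cons Y Ys)
  let ?Z = "foldr (bracket L) Ys Z"
  have c: "Y \<in> carrier L" "?Z \<in> carrier L" using Cons.prems Z by (auto intro: foldr_bracket_closed)
  have z: "UL u ?Z = 0" "UL w ?Z = 0" using Cons.prems Z by (auto intro: UL_foldr)
  have "MM u w (bracket L Y ?Z) i j = UL w Y * shr (MM u w ?Z) i j"
    using MM_bracket[OF comp _ c, of i j] z Cons.prems by simp
  moreover have "MM u w ?Z i j' = (if i = 0 \<and> j' = length Ys then (\<Prod>Y\<leftarrow>Ys. UL w Y) * t else 0)"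
    if "j = Suc j'" for j'
    using Cons.prems that by (intro Cons.IH) auto
  ultimately show ?case by (cases j) (auto simp: shr_def)
qed

text \<open>The letters of \<open>Xs\<close> may have both components. In the stated range of
  degrees, however, an exponent of \<open>s\<close> that reaches \<open>length Xs\<close> requires
  every letter to contribute its \<open>s\<close>-component, since the lowest part of
  \<open>Z\<close> is a multiple of \<open>t^k\<close>.\<close>

lemma MM_iterated:
  assumes comp: "compatible S E u w" and Z: "Z \<in> carrier L" "UL u Z = 0" "UL w Z = 0"
    and base: "\<And>i j. i + j \<le> k \<Longrightarrow> MM u w Z i j = (if i = 0 \<and> j = k then t else 0)"
    and Xs: "set Xs \<subseteq> carrier L" and ij: "i + j \<le> length Xs + k" "i \<ge> length Xs" "length Xs + k + 2 \<le> c"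
  shows "MM u w (foldr (bracket L) Xs Z) i j =
     (if i = length Xs \<and> j = k then (\<Prod>X\<leftarrow>Xs. UL u X) * t else 0)"
  using Xs ij
proof (induction Xs arbitrary: i j)
  case Nil
  then show ?case by (simp add: base)
next
  case (Cons X Xs)
  let ?Z = "foldr (bracket L) Xs Z"
  have c: "X \<in> carrier L" "?Z \<in> carrier L" using Cons.prems Z by (auto intro: foldr_bracket_closed)
  have z: "UL u ?Z = 0" "UL w ?Z = 0" using Cons.prems Z by (auto intro: UL_foldr)
  obtain i' where i': "i = Suc i'" using Cons.prems(3) by (cases i) auto
  have "MM u w (bracket L X ?Z) i j = UL u X * MM u w ?Z i' j + UL w X * shr (MM u w ?Z) i j"
    using MM_bracket[OF comp _ c, of i j] z i' Cons.prems by (simp add: shl_def)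
  moreover have "MM u w ?Z i' j = (if i' = length Xs \<and> j = k then (\<Prod>X\<leftarrow>Xs. UL u X) * t else 0)"
    using Cons.prems i' by (intro Cons.IH) auto
  moreover have "MM u w ?Z i j' = 0" if "j = Suc j'" for j'
    using Cons.IH[of i j'] Cons.prems i' that by auto
  ultimately show ?case using i' by (cases j) (auto simp: shr_def)
qed

lemma MM_word:
  assumes comp: "compatible S E u w" and XY: "X \<in> carrier L" "Y \<in> carrier L"
    and Xs: "set Xs \<subseteq> carrier L" and Ys: "set Ys \<subseteq> carrier L" "\<And>Y. Y \<in> set Ys \<Longrightarrow> UL u Y = 0"
    and len: "length Xs + length Ys + 2 \<le> c"
  shows "MM u w (foldr (bracket L) Xs (foldr (bracket L) Ys (bracket L X Y))) (length Xs) (length Ys)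
    = (\<Prod>X\<leftarrow>Xs. UL u X) * ((\<Prod>Y\<leftarrow>Ys. UL w Y) * (UL u X * UL w Y - UL w X * UL u Y))"
proof -
  let ?Z = "bracket L X Y" and ?t = "UL u X * UL w Y - UL w X * UL u Y"
  let ?W = "foldr (bracket L) Ys ?Z"
  have Z: "?Z \<in> carrier L" "UL u ?Z = 0" "UL w ?Z = 0" using XY by (auto simp: UL_bracket L.bracket_closed)
  have "MM u w ?Z 0 0 = ?t" using MM_bracket[OF comp _ XY, of 0 0] c by (simp add: shl_def shr_def)
  then have W: "MM u w ?W i j = (if i = 0 \<and> j = length Ys then (\<Prod>Y\<leftarrow>Ys. UL w Y) * ?t else 0)"
    if "i + j \<le> length Ys" for i j
    using MM_iterated_right[OF comp Z _ Ys that, of ?t] len by simp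
  show ?thesis
    using MM_iterated[OF comp _ _ _ W Xs, of "length Xs" "length Ys"] len Z Ys
    by (simp add: UL_foldr foldr_bracket_closed)
qed

text \<open>\<open>\<epsilon>\<close> is an eigenvalue of \<open>f ^^ m\<close> as soon as some complex combination of the sequences
  \<open>n \<mapsto> \<phi> (f ^^ n X)\<close> is geometric along the multiples of \<open>m\<close>.\<close>

definition orbit_sequence :: "(_ \<Rightarrow> _) \<Rightarrow> (nat \<Rightarrow> complex) \<Rightarrow> bool" where
  "orbit_sequence f s \<longleftrightarrow> (\<forall>A. matrix_of L f A \<longrightarrow> pact shift (map_poly of_rat (char_poly A)) s = (\<lambda>_. 0))"

lemma orbit_sequence_functional:
  assumes "lie_endo L f" "clin L \<phi>" "X \<in> carrier L"
  shows "orbit_sequence f (\<lambda>n. \<phi> ((f ^^ n) X))"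
  using assms L.matrix_recurrence unfolding orbit_sequence_def lie_endo_def by blast

text \<open>The recurrence is linear over the complex numbers. This is what permits eigenvectors
  with complex entries although the elements of \<open>L\<close> are rational.\<close>

lemma orbit_sequence_sum:
  assumes "\<And>i. i \<in> I \<Longrightarrow> orbit_sequence f (s i)"
  shows "orbit_sequence f (\<lambda>n. \<Sum>i\<in>I. a i * s i n)"
  using assms unfolding orbit_sequence_def
  by (simp add: lin_op_sum[OF lin_op_pact[OF lin_op_shift]] lin_op_scale[OF lin_op_pact[OF lin_op_shift]])

text \<open>For every matrix of \<open>f\<close> some root \<open>w\<close> of its characteristic
  polynomial has \<open>w ^ m = \<epsilon>\<close>. With the matrix from \<open>integer_like\<close>
  this makes \<open>\<epsilon>\<close> a unit; with the one from \<open>hyperbolic\<close> it keeps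
  its modulus away from 1.\<close>

lemma geometric_orbit_sequence:
  assumes hyp: "hyperbolic L f" and int: "integer_like L f"
    and s: "orbit_sequence f s" and geo: "\<And>i. s (m * i) = \<epsilon> ^ i * t" and t: "t \<noteq> 0" and m: "m > 0"
  shows "alg_unit \<epsilon>" "cmod \<epsilon> \<noteq> 1"
proof -
  have cmat: "A \<in> carrier_mat n n" if "matrix_of L f A" "dim_row A = n" for A n
    using that unfolding matrix_of_def by auto
  have root: "\<exists>w. poly (map_poly of_rat (char_poly A)) w = 0 \<and> w ^ m = \<epsilon>" if A: "matrix_of L f A" for A
  proof -
    have "lead_coeff (map_poly of_rat (char_poly A) :: complex poly) = 1"
      using degree_monic_char_poly[OF cmat[OF A refl]] by simp
    then show ?thesis
      using recurrence_root_power[OF _ _ geo t, of "map_poly of_rat (char_poly A)"] s A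
      unfolding orbit_sequence_def by metis
  qed
  show "alg_unit \<epsilon>"
  proof -
    obtain A where A: "matrix_of L f A" "\<And>i. coeff (char_poly A) i \<in> \<int>" "coeff (char_poly A) 0 \<in> {1, - 1}"
      using int unfolding integer_like_def by blast
    obtain w where w: "poly (map_poly of_rat (char_poly A)) w = 0" "w ^ m = \<epsilon>" using root[OF A(1)] by blast
    have "alg_unit w"
    proof (rule alg_unit_root_monic_int[OF _ _ _ w(1)])
      show "lead_coeff (map_poly of_rat (char_poly A) :: complex poly) = 1"
        using degree_monic_char_poly[OF cmat[OF A(1) refl]] by simp
      show "coeff (map_poly of_rat (char_poly A) :: complex poly) 0 \<in> {1, - 1}" using A(3) by auto
      show "coeff (map_poly of_rat (char_poly A) :: complex poly) i \<in> \<int>" for i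
        using A(2)[of i] by (auto elim!: Ints_cases)
    qed
    then show ?thesis using alg_unit_power[of w m] w(2) by simp
  qed
  show "cmod \<epsilon> \<noteq> 1"
  proof
    assume e: "cmod \<epsilon> = 1"
    obtain A where A: "matrix_of L f A" "\<And>z :: complex. eigenvalue (map_mat of_rat A) z \<Longrightarrow> cmod z \<noteq> 1"
      using hyp unfolding hyperbolic_def by blast
    obtain w where w: "poly (map_poly of_rat (char_poly A)) w = 0" "w ^ m = \<epsilon>" using root[OF A(1)] by blast
    obtain n where Ac: "A \<in> carrier_mat n n" using cmat[OF A(1) refl] by blast
    have cp: "char_poly (map_mat of_rat A :: complex mat) = map_poly of_rat (char_poly A)"
      by (rule of_rat_hom.char_poly_hom[OF Ac])
    have "(map_mat of_rat A :: complex mat) \<in> carrier_mat n n" using Ac by simp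
    from eigenvalue_root_char_poly[OF this, of w] have "eigenvalue (map_mat of_rat A) w"
      unfolding cp using w(1) by blast
    moreover have "cmod w ^ m = 1" using e w(2) by (metis norm_power)
    then have "cmod w = 1" using m power_eq_imp_eq_base[of "cmod w" m 1] by simp
    ultimately show False using A(2) by blast
  qed
qed

text \<open>A word of length \<open>N\<close> in eigenvectors \<open>v i\<close> of the blocks with eigenvalues \<open>e i\<close>; letter \<open>i\<close>
  is detected by the functional \<open>u\<close> for \<open>2 \<le> i < b\<close> and by \<open>w\<close> for \<open>b \<le> i < N\<close>.\<close>

lemma eigenvector_word:
  fixes v :: "nat \<Rightarrow> 'v \<Rightarrow> complex" and e s :: "nat \<Rightarrow> complex"
  assumes f: "lie_endo L f" and hyp: "hyperbolic L f" and int: "integer_like L f" and m: "m > 0"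
    and comp: "compatible S E u w" and N: "2 \<le> b" "b \<le> N" "N \<le> c"
    and C: "\<And>i. i < N \<Longrightarrow> C i \<subseteq> S"
    and ev: "\<And>i k. i < N \<Longrightarrow> (\<Sum>\<alpha>\<in>C i. v i \<alpha> * of_rat (UL (if i = 0 \<or> 2 \<le> i \<and> i < b then u else w)
        ((f ^^ (m * k)) (gen \<alpha>)))) = e i ^ k * s i"
    and ev': "\<And>k. (\<Sum>\<alpha>\<in>C 0. v 0 \<alpha> * of_rat (UL w ((f ^^ (m * k)) (gen \<alpha>)))) *
      (\<Sum>\<alpha>\<in>C 1. v 1 \<alpha> * of_rat (UL u ((f ^^ (m * k)) (gen \<alpha>)))) = (e 0 * e 1) ^ k * s'"
    and van: "\<And>i \<alpha> k. \<lbrakk>b \<le> i; i < N; \<alpha> \<in> C i\<rbrakk> \<Longrightarrow> UL u ((f ^^ (m * k)) (gen \<alpha>)) = 0"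
    and nz: "(s 0 * s 1 - s') * (\<Prod>i\<in>{2..<N}. s i) \<noteq> 0"
  shows "cmod (\<Prod>i<N. e i) \<noteq> 1"
proof -
  define word where "word = (\<lambda>g. foldr (bracket L) (map (\<lambda>i. gen (g i)) [2..<b])
    (foldr (bracket L) (map (\<lambda>i. gen (g i)) [b..<N]) (bracket L (gen (g 0)) (gen (g 1)))))"
  define W where "W = PiE {..<N} C"
  have finC: "finite (C i)" if "i < N" for i using C[OF that] finS by (rule finite_subset)
  have gS: "gen (g i) \<in> carrier L" if "g \<in> W" "i < N" for g i
    using that C gen_closed by (auto simp: W_def PiE_def Pi_def)
  have wc: "word g \<in> carrier L" if g: "g \<in> W" for g
    unfolding word_def using gS[OF g] N
    by (intro foldr_bracket_closed L.bracket_closed) auto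
  have cl: "clin L (\<lambda>X. of_rat (MM u w X (b - 2) (N - b)))"
    unfolding clin_def using MM_add[OF comp] MM_scale[OF comp] N by (auto simp: of_rat_add of_rat_mult)
  \<comment> \<open>The metabelian coefficient of the word in the vectors \<open>v i\<close>,
    expanded multilinearly over all choices \<open>g\<close> of vertices. The indices
    \<open>b - 2\<close> and \<open>N - b\<close> count the letters to be read by \<open>u\<close>
    and by \<open>w\<close> outside the innermost bracket.\<close>
  define sq where "sq = (\<lambda>n. \<Sum>g\<in>W. (\<Prod>i<N. v i (g i)) * of_rat (MM u w ((f ^^ n) (word g)) (b - 2) (N - b)))"
  have "orbit_sequence f sq"
    unfolding sq_def by (intro orbit_sequence_sum orbit_sequence_functional[OF f cl] wc)
  moreover have "sq (m * k) = (\<Prod>i<N. e i) ^ k * ((s 0 * s 1 - s') * (\<Prod>i\<in>{2..<N}. s i))" for k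
  proof -
    let ?F = "f ^^ (m * k)"
    have F: "lie_endo L ?F" by (rule lie_endo_funpow[OF f])
    have Ff: "?F (foldr (bracket L) Xs Z) = foldr (bracket L) (map ?F Xs) (?F Z)"
      if "set Xs \<subseteq> carrier L" "Z \<in> carrier L" for Xs Z
      using that by (induction Xs) (auto simp: lie_endoD(4)[OF F] foldr_bracket_closed)
    define h where "h = (\<lambda>i \<alpha>. v i \<alpha> * of_rat (UL (if i = 0 \<or> 2 \<le> i \<and> i < b then u else w) (?F (gen \<alpha>))))"
    \<comment> \<open>The two products \<open>h\<close> and \<open>h'\<close> belong to the two
      terms of the determinant of the innermost bracket; they differ only in which functional reads
      letters 0 and 1.\<close>
    define h' where "h' = (\<lambda>i \<alpha>. if i = 0 then v 0 \<alpha> * of_rat (UL w (?F (gen \<alpha>)))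
        else if i = 1 then v 1 \<alpha> * of_rat (UL u (?F (gen \<alpha>))) else h i \<alpha>)"
    have idx: "{..<N} = {0, 1} \<union> {2..<N}" using N by auto
    have split: "(\<Prod>i<N. p i) = p 0 * p 1 * (\<Prod>i\<in>{2..<N}. p i)" for p :: "nat \<Rightarrow> complex"
      unfolding idx by (subst prod.union_disjoint) auto
    have val: "(\<Prod>i<N. v i (g i)) * of_rat (MM u w (?F (word g)) (b - 2) (N - b)) = (\<Prod>i<N. h i (g i)) - (\<Prod>i<N. h' i (g i))"
      if g: "g \<in> W" for g
    proof -
      let ?G = "\<lambda>i. ?F (gen (g i))"
      have Gc: "?G i \<in> carrier L" if "i < N" for i using lie_endoD(1)[OF F gS[OF g that]] .
      have gi: "g i \<in> C i" if "i < N" for i using g that by (auto simp: W_def)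
      have g01: "gen (g 0) \<in> carrier L" "gen (g 1) \<in> carrier L" using gS[OF g] N by auto
      have g2: "set (map (\<lambda>i. gen (g i)) [2..<b]) \<subseteq> carrier L" "set (map (\<lambda>i. gen (g i)) [b..<N]) \<subseteq> carrier L"
        using gS[OF g] N by auto
      have b: "bracket L (gen (g 0)) (gen (g 1)) \<in> carrier L" by (rule L.bracket_closed[OF g01])
      have "?F (word g) = foldr (bracket L) (map ?G [2..<b]) (foldr (bracket L) (map ?G [b..<N]) (bracket L (?G 0) (?G 1)))"
        unfolding word_def Ff[OF g2(1) foldr_bracket_closed[OF g2(2) b]] Ff[OF g2(2) b] lie_endoD(4)[OF F g01]
        by (simp only: map_map o_def)
      moreover have "MM u w (foldr (bracket L) (map ?G [2..<b]) (foldr (bracket L) (map ?G [b..<N]) (bracket L (?G 0) (?G 1))))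
          (length (map ?G [2..<b])) (length (map ?G [b..<N]))
        = (\<Prod>X\<leftarrow>map ?G [2..<b]. UL u X) * ((\<Prod>Y\<leftarrow>map ?G [b..<N]. UL w Y)
          * (UL u (?G 0) * UL w (?G 1) - UL w (?G 0) * UL u (?G 1)))"
        by (rule MM_word[OF comp]) (use Gc gi van N in auto)
      moreover have "(\<Prod>X\<leftarrow>map ?G [2..<b]. UL u X) = (\<Prod>i\<in>{2..<b}. UL u (?G i))"
        "(\<Prod>Y\<leftarrow>map ?G [b..<N]. UL w Y) = (\<Prod>i\<in>{b..<N}. UL w (?G i))"
        by (simp_all add: prod.distinct_set_conv_list[symmetric] o_def)
      ultimately have mm: "MM u w (?F (word g)) (b - 2) (N - b) = (\<Prod>i\<in>{2..<b}. UL u (?G i)) * ((\<Prod>i\<in>{b..<N}. UL w (?G i))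
          * (UL u (?G 0) * UL w (?G 1) - UL w (?G 0) * UL u (?G 1)))"
        using N by simp
      have sp: "{2..<N} = {2..<b} \<union> {b..<N}" using N by auto
      have hp1: "(\<Prod>i\<in>{2..<b}. h i (g i)) = (\<Prod>i\<in>{2..<b}. v i (g i)) * of_rat (\<Prod>i\<in>{2..<b}. UL u (?G i))"
        by (simp add: h_def prod.distrib of_rat_prod)
      have "(\<Prod>i\<in>{b..<N}. h i (g i)) = (\<Prod>i\<in>{b..<N}. v i (g i) * of_rat (UL w (?G i)))"
        using N by (intro prod.cong) (auto simp: h_def)
      then have hp2: "(\<Prod>i\<in>{b..<N}. h i (g i)) = (\<Prod>i\<in>{b..<N}. v i (g i)) * of_rat (\<Prod>i\<in>{b..<N}. UL w (?G i))"
        by (simp add: prod.distrib of_rat_prod)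
      have un: "(\<Prod>i\<in>{2..<N}. p i) = (\<Prod>i\<in>{2..<b}. p i) * (\<Prod>i\<in>{b..<N}. p i)" for p :: "nat \<Rightarrow> complex"
        unfolding sp by (rule prod.union_disjoint) auto
      have hp: "(\<Prod>i\<in>{2..<N}. h i (g i)) = (\<Prod>i\<in>{2..<N}. v i (g i)) *
          (of_rat (\<Prod>i\<in>{2..<b}. UL u (?G i)) * of_rat (\<Prod>i\<in>{b..<N}. UL w (?G i)))"
        unfolding un hp1 hp2 by (simp only: mult_ac)
      have hh: "(\<Prod>i\<in>{2..<N}. h' i (g i)) = (\<Prod>i\<in>{2..<N}. h i (g i))" by (intro prod.cong) (auto simp: h'_def)
      have h01: "h 0 (g 0) = v 0 (g 0) * of_rat (UL u (?G 0))" "h 1 (g 1) = v 1 (g 1) * of_rat (UL w (?G 1))"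
        "h' 0 (g 0) = v 0 (g 0) * of_rat (UL w (?G 0))" "h' 1 (g 1) = v 1 (g 1) * of_rat (UL u (?G 1))"
        by (simp_all add: h_def h'_def)
      show ?thesis
        unfolding split mm hh hp h01 of_rat_mult of_rat_diff by (simp only: algebra_simps)
    qed
    have "sq (m * k) = (\<Sum>g\<in>W. \<Prod>i<N. h i (g i)) - (\<Sum>g\<in>W. \<Prod>i<N. h' i (g i))"
      unfolding sq_def by (simp add: val sum_subtractf)
    \<comment> \<open>A sum over all choices of a product of independent factors is a product of
      sums, each of which is an eigenvector relation for one letter.\<close>
    also have "\<dots> = (\<Prod>i<N. \<Sum>\<alpha>\<in>C i. h i \<alpha>) - (\<Prod>i<N. \<Sum>\<alpha>\<in>C i. h' i \<alpha>)"
    proof -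
      have fc: "finite (C i)" if "i \<in> {..<N}" for i using finC that by simp
      show ?thesis unfolding W_def by (simp only: prod_sum_PiE[OF finite_lessThan fc])
    qed
    also have "(\<Prod>i<N. \<Sum>\<alpha>\<in>C i. h i \<alpha>) = (\<Prod>i<N. e i) ^ k * (s 0 * s 1 * (\<Prod>i\<in>{2..<N}. s i))"
    proof -
      have "(\<Prod>i<N. \<Sum>\<alpha>\<in>C i. h i \<alpha>) = (\<Prod>i<N. e i ^ k * s i)"
        unfolding h_def using ev by (intro prod.cong) auto
      also have "\<dots> = (\<Prod>i<N. e i) ^ k * (\<Prod>i<N. s i)" by (simp add: prod.distrib prod_power_distrib)
      finally show ?thesis by (simp only: split[of s])
    qed
    also have "(\<Prod>i<N. \<Sum>\<alpha>\<in>C i. h' i \<alpha>) = (\<Prod>i<N. e i) ^ k * (s' * (\<Prod>i\<in>{2..<N}. s i))"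
    proof -
      have "(\<Prod>i\<in>{2..<N}. \<Sum>\<alpha>\<in>C i. h' i \<alpha>) = (\<Prod>i\<in>{2..<N}. e i ^ k * s i)"
      proof (rule prod.cong[OF refl])
        fix i assume i: "i \<in> {2..<N}"
        then have "(\<Sum>\<alpha>\<in>C i. h' i \<alpha>) = (\<Sum>\<alpha>\<in>C i. h i \<alpha>)" by (simp add: h'_def)
        then show "(\<Sum>\<alpha>\<in>C i. h' i \<alpha>) = e i ^ k * s i" unfolding h_def using ev[of i k] i by simp
      qed
      moreover have "(\<Sum>\<alpha>\<in>C 0. h' 0 \<alpha>) * (\<Sum>\<alpha>\<in>C 1. h' 1 \<alpha>) = (e 0 * e 1) ^ k * s'"
        using ev'[of k] by (simp add: h'_def)
      ultimately have "(\<Prod>i<N. \<Sum>\<alpha>\<in>C i. h' i \<alpha>) = (e 0 * e 1) ^ k * s' * (\<Prod>i\<in>{2..<N}. e i ^ k * s i)"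
        by (simp only: split)
      then show ?thesis
        unfolding split[of e] by (simp add: prod.distrib prod_power_distrib power_mult_distrib)
    qed
    finally show ?thesis by (simp add: algebra_simps)
  qed
  ultimately show ?thesis using geometric_orbit_sequence(2)[OF hyp int _ _ nz m] by blast
qed

end

lemma prod_list_nth: "prod_list xs = (\<Prod>i<length xs. xs ! i)"
  by (induction xs) (simp_all add: prod.lessThan_Suc_shift del: prod.lessThan_Suc)

section \<open>The diagonal blocks of an Anosov automorphism\<close>

context graph_nilpotent
begin

abbreviation "R \<equiv> coherent_rel S E"
abbreviation "\<Lambda> \<equiv> coherent_components S E"

lemma component:
  assumes "l \<in> \<Lambda>"
  shows "l \<subseteq> S" "l \<noteq> {}" "finite l"
    and "\<alpha> \<in> l \<Longrightarrow> \<beta> \<in> l \<longleftrightarrow> (\<alpha>, \<beta>) \<in> R"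
    and "l' \<in> \<Lambda> \<Longrightarrow> \<alpha> \<in> l \<Longrightarrow> \<alpha> \<in> l' \<Longrightarrow> l = l'"
proof -
  note eq = coherent_equiv[OF graph] and l = assms[unfolded coherent_components_def]
  show s: "l \<subseteq> S" using in_quotient_imp_subset[OF eq l] .
  then show "finite l" using finS finite_subset by blast
  show "l \<noteq> {}" using in_quotient_imp_non_empty[OF eq l] .
  show "\<beta> \<in> l \<longleftrightarrow> (\<alpha>, \<beta>) \<in> R" if a: "\<alpha> \<in> l"
  proof
    assume "\<beta> \<in> l"
    then show "(\<alpha>, \<beta>) \<in> R" using in_quotient_imp_in_rel[OF eq l] a by simp
  next
    assume "(\<alpha>, \<beta>) \<in> R"
    then show "\<beta> \<in> l" using in_quotient_imp_closed[OF eq l a] by simp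
  qed
  show "l = l'" if "l' \<in> \<Lambda>" "\<alpha> \<in> l" "\<alpha> \<in> l'"
    using quotient_disj[OF eq l that(1)[unfolded coherent_components_def]] that(2,3) by blast
qed

text \<open>One endpoint at a time is replaced, which is allowed unless it would hit the other
  endpoint. If \<open>\<alpha>'\<close> is \<open>\<beta>\<close>, transitivity makes
  \<open>\<alpha>\<close> coherent with \<open>\<beta>'\<close>, and a single replacement
  suffices.\<close>

lemma coherent_edge:
  assumes ab: "{\<alpha>, \<beta>} \<in> E" and a: "(\<alpha>, \<alpha>') \<in> R" and b: "(\<beta>, \<beta>') \<in> R" and ne: "\<alpha>' \<noteq> \<beta>'"
  shows "{\<alpha>', \<beta>'} \<in> E"
proof -
  have st: "{y, z} \<in> E" if "{x, z} \<in> E" "(x, y) \<in> R" "y \<noteq> z" "z \<in> S" for x y z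
  proof (cases "x = y")
    case False
    have "x \<noteq> z" using that(1) no_loop[OF graph] by auto
    then have "z \<in> S - {x, y}" using that by simp
    then show ?thesis using that by (auto simp: coherent_iff[OF graph])
  qed (use that in simp)
  have s: "\<alpha> \<in> S" "\<alpha>' \<in> S" "\<beta> \<in> S" "\<beta>' \<in> S" using a b by (auto simp: coherent_iff[OF graph])
  show ?thesis
  proof (cases "\<alpha>' = \<beta>")
    case False
    then have "{\<alpha>', \<beta>} \<in> E" using st[OF ab a] s by simp
    then have "{\<beta>, \<alpha>'} \<in> E" by (simp add: insert_commute)
    then have "{\<beta>', \<alpha>'} \<in> E" using st[OF _ b] ne s by simp
    then show ?thesis by (simp add: insert_commute)
  next
    case True
    then have "(\<alpha>, \<beta>') \<in> R" using a b coherent_trans[OF graph] by blast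
    then have "{\<beta>', \<beta>} \<in> E" using st[OF ab] ne True s by simp
    then show ?thesis using True by (simp add: insert_commute)
  qed
qed

lemma quotient_edge_elim:
  assumes "e \<in> quotient_edges S E"
  obtains l l' \<alpha> \<beta> where "e = {l, l'}" "l \<in> \<Lambda>" "l' \<in> \<Lambda>" "\<alpha> \<in> l" "\<beta> \<in> l'" "{\<alpha>, \<beta>} \<in> E"
  using assms unfolding quotient_edges_def by blast

text \<open>The inverse of \<open>f\<close> is an endomorphism too, so \<open>cf f\<close> and its
  inverse matrix both preserve commuting pairs by \<open>endo_commuting\<close>, and the
  combinatorial \<open>power_preserves_components\<close> applies.\<close>

lemma automorphism_power:
  assumes aut: "lie_automorphism L f"
  obtains m where "m > 0" "\<And>\<alpha> \<beta>. \<lbrakk>\<alpha> \<in> S; \<beta> \<in> S; cf (f ^^ m) \<beta> \<alpha> \<noteq> 0\<rbrakk>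
      \<Longrightarrow> (\<alpha>, \<beta>) \<in> R \<or> deg S E \<beta> < deg S E \<alpha>"
proof -
  have f: "lie_endo L f" and bij: "bij_betw f (carrier L) (carrier L)"
    using aut by (auto simp: lie_automorphism_def lie_endo_def)
  define g where "g = inv_into (carrier L) f"
  have fg: "f (g x) = x" "g x \<in> carrier L" if "x \<in> carrier L" for x
    using bij that unfolding g_def bij_betw_def by (metis f_inv_into_f, metis inv_into_into)
  have gf: "g (f x) = x" if "x \<in> carrier L" for x
    using bij that unfolding g_def bij_betw_def by (metis inv_into_f_f)
  have g: "lie_endo L g"
    unfolding lie_endo_def LinearCombinations.module_hom_def
  proof (intro conjI CollectI allI impI ballI)
    show "g \<in> carrier L \<rightarrow> carrier L" using fg by auto
    fix x y assume "x \<in> carrier L \<and> y \<in> carrier L"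
    then have xy: "x \<in> carrier L" "y \<in> carrier L" by auto
    have "f (g x \<oplus>\<^bsub>L\<^esub> g y) = x \<oplus>\<^bsub>L\<^esub> y" using fg xy lie_endoD(2)[OF f] by simp
    then show "g (x \<oplus>\<^bsub>L\<^esub> y) = g x \<oplus>\<^bsub>L\<^esub> g y" using gf[of "g x \<oplus>\<^bsub>L\<^esub> g y"] fg xy by simp
  next
    fix r :: rat and x assume "r \<in> carrier rat_field \<and> x \<in> carrier L"
    then have x: "x \<in> carrier L" by auto
    have "f (r \<odot>\<^bsub>L\<^esub> g x) = r \<odot>\<^bsub>L\<^esub> x" using fg x lie_endoD(3)[OF f] by simp
    then show "g (r \<odot>\<^bsub>L\<^esub> x) = r \<odot>\<^bsub>L\<^esub> g x" using gf[of "r \<odot>\<^bsub>L\<^esub> g x"] fg x by simp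
  next
    fix x y assume xy: "x \<in> carrier L" "y \<in> carrier L"
    have "f (bracket L (g x) (g y)) = bracket L x y" using fg xy lie_endoD(4)[OF f] by simp
    then show "g (bracket L x y) = bracket L (g x) (g y)"
      using gf[of "bracket L (g x) (g y)"] fg xy by (simp add: L.bracket_closed)
  qed
  have inv: "right_inverse S (cf f) (cf g)" "right_inverse S (cf g) (cf f)"
    unfolding right_inverse_def
    using cf_comp[OF f g] cf_comp[OF g f] fg gf gen_closed
    by (auto simp: cf_def UL_gen coord_def)
  have com: "preserves_commuting S E (cf f)" "preserves_commuting S E (cf g)"
    using endo_commuting[OF f] endo_commuting[OF g] by (auto simp: preserves_commuting_def)
  obtain m where "m > 0" "\<And>\<alpha> \<beta>. \<lbrakk>\<alpha> \<in> S; \<beta> \<in> S; mat_pow S (cf f) m \<beta> \<alpha> \<noteq> 0\<rbrakk>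
      \<Longrightarrow> (\<alpha>, \<beta>) \<in> R \<or> deg S E \<beta> < deg S E \<alpha>"
    using power_preserves_components[OF graph inv com] by blast
  then show thesis using that[of m] cf_funpow[OF f] by auto
qed

context
  fixes f and m :: nat
  assumes f: "lie_endo L f" and hyp: "hyperbolic L f" and int: "integer_like L f" and m: "m > 0"
    and blocks: "\<And>\<alpha> \<beta>. \<lbrakk>\<alpha> \<in> S; \<beta> \<in> S; cf (f ^^ m) \<beta> \<alpha> \<noteq> 0\<rbrakk> \<Longrightarrow> (\<alpha>, \<beta>) \<in> R \<or> deg S E \<beta> < deg S E \<alpha>"
begin

lemma cf_Suc:
  assumes "\<alpha> \<in> S"
  shows "cf (f ^^ (m * Suc k)) \<beta> \<alpha> = (\<Sum>\<gamma>\<in>S. cf (f ^^ m) \<beta> \<gamma> * cf (f ^^ (m * k)) \<gamma> \<alpha>)"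
  using cf_comp[OF lie_endo_funpow[OF f, of m] lie_endo_funpow[OF f, of "m * k"] assms]
  by (simp add: funpow_add cf_def)

lemma blocks_power:
  assumes "\<alpha> \<in> S" "\<beta> \<in> S" "cf (f ^^ (m * k)) \<beta> \<alpha> \<noteq> 0"
  shows "(\<alpha>, \<beta>) \<in> R \<or> deg S E \<beta> < deg S E \<alpha>"
  using assms
proof (induction k arbitrary: \<beta>)
  case 0
  then show ?case by (auto simp: cf_def UL_gen coord_def coherent_iff[OF graph] split: if_splits)
next
  case (Suc k)
  then obtain \<gamma> where g: "\<gamma> \<in> S" "cf (f ^^ m) \<beta> \<gamma> \<noteq> 0" "cf (f ^^ (m * k)) \<gamma> \<alpha> \<noteq> 0"
    unfolding cf_Suc[OF Suc.prems(1)] by (metis (no_types, lifting) mult_eq_0_iff sum.neutral)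
  have "(\<alpha>, \<gamma>) \<in> R \<or> deg S E \<gamma> < deg S E \<alpha>" using Suc.IH[OF Suc.prems(1) g(1,3)] .
  moreover have "(\<gamma>, \<beta>) \<in> R \<or> deg S E \<beta> < deg S E \<gamma>" using blocks[OF g(1) Suc.prems(2) g(2)] .
  ultimately show ?case
    using coherent_trans[OF graph] coherent_deg[OF graph] by (metis less_trans)
qed

definition eigenpair where
  "eigenpair l a x \<longleftrightarrow> (\<forall>\<beta>\<in>l. (\<Sum>\<alpha>\<in>l. of_rat (cf (f ^^ m) \<beta> \<alpha>) * x \<alpha>) = a * x \<beta>) \<and> (\<exists>\<beta>\<in>l. x \<beta> \<noteq> (0 :: complex))"

lemma eigenpair_power:
  assumes l: "l \<in> \<Lambda>" and x: "eigenpair l a x" and b: "\<beta> \<in> l"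
  shows "(\<Sum>\<alpha>\<in>l. x \<alpha> * of_rat (cf (f ^^ (m * k)) \<beta> \<alpha>)) = a ^ k * x \<beta>"
  using b
proof (induction k arbitrary: \<beta>)
  case 0
  have "(\<Sum>\<alpha>\<in>l. x \<alpha> * of_rat (cf (f ^^ (m * 0)) \<beta> \<alpha>)) = (\<Sum>\<alpha>\<in>l. if \<alpha> = \<beta> then x \<alpha> else 0)"
    using component(1)[OF l] by (intro sum.cong) (auto simp: cf_def UL_gen coord_def)
  also have "\<dots> = x \<beta>" using 0 component(3)[OF l] by simp
  finally show ?case by (simp only: power_0 mult_1)
next
  case (Suc k)
  have bl: "cf (f ^^ (m * Suc k)) \<beta> \<alpha> = (\<Sum>\<gamma>\<in>l. cf (f ^^ m) \<beta> \<gamma> * cf (f ^^ (m * k)) \<gamma> \<alpha>)" if a: "\<alpha> \<in> l" for \<alpha>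
  proof -
    have aS: "\<alpha> \<in> S" and bS: "\<beta> \<in> S" using a Suc.prems component(1)[OF l] by auto
    \<comment> \<open>A path that leaves \<open>l\<close> must drop to a smaller degree and, as
      degrees never rise, cannot return. So the diagonal block of a power is the power of the
      diagonal block.\<close>
    have "cf (f ^^ m) \<beta> \<gamma> * cf (f ^^ (m * k)) \<gamma> \<alpha> = 0" if g: "\<gamma> \<in> S - l" for \<gamma>
    proof (rule ccontr)
      assume n: "cf (f ^^ m) \<beta> \<gamma> * cf (f ^^ (m * k)) \<gamma> \<alpha> \<noteq> 0"
      have "(\<gamma>, \<beta>) \<in> R \<or> deg S E \<beta> < deg S E \<gamma>" using blocks[of \<gamma> \<beta>] g n bS by auto
      moreover have "(\<alpha>, \<gamma>) \<in> R \<or> deg S E \<gamma> < deg S E \<alpha>" using blocks_power[of \<alpha> \<gamma> k] g n aS by auto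
      moreover have "(\<alpha>, \<gamma>) \<notin> R" using component(4)[OF l a] g by auto
      moreover have "(\<gamma>, \<beta>) \<notin> R" using component(4)[OF l Suc.prems] g coherent_sym[OF graph] by auto
      moreover have "deg S E \<alpha> = deg S E \<beta>"
        using component(4)[OF l a] Suc.prems coherent_deg[OF graph] by blast
      ultimately show False by auto
    qed
    then show ?thesis
      unfolding cf_Suc[OF aS] using component(1)[OF l] finS by (intro sum.mono_neutral_right) auto
  qed
  have "(\<Sum>\<alpha>\<in>l. x \<alpha> * of_rat (cf (f ^^ (m * Suc k)) \<beta> \<alpha>))
      = (\<Sum>\<alpha>\<in>l. \<Sum>\<gamma>\<in>l. x \<alpha> * of_rat (cf (f ^^ m) \<beta> \<gamma> * cf (f ^^ (m * k)) \<gamma> \<alpha>))"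
    by (intro sum.cong refl) (simp only: bl of_rat_sum sum_distrib_left)
  also have "\<dots> = (\<Sum>\<gamma>\<in>l. of_rat (cf (f ^^ m) \<beta> \<gamma>) * (\<Sum>\<alpha>\<in>l. x \<alpha> * of_rat (cf (f ^^ (m * k)) \<gamma> \<alpha>)))"
    by (subst sum.swap) (simp add: of_rat_mult sum_distrib_left mult_ac)
  also have "\<dots> = (\<Sum>\<gamma>\<in>l. of_rat (cf (f ^^ m) \<beta> \<gamma>) * (a ^ k * x \<gamma>))"
    by (intro sum.cong refl) (simp only: Suc.IH)
  also have "\<dots> = a ^ k * (\<Sum>\<gamma>\<in>l. of_rat (cf (f ^^ m) \<beta> \<gamma>) * x \<gamma>)"
    by (simp add: sum_distrib_left mult_ac)
  also have "\<dots> = a ^ Suc k * x \<beta>" using x Suc.prems by (simp add: eigenpair_def)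
  finally show ?case .
qed

lemma eigenpair_form:
  assumes l: "l \<in> \<Lambda>" and x: "eigenpair l a x" and u: "\<forall>\<beta>. \<beta> \<notin> l \<longrightarrow> u \<beta> = 0"
  shows "(\<Sum>\<alpha>\<in>l. x \<alpha> * of_rat (UL u ((f ^^ (m * k)) (gen \<alpha>)))) = a ^ k * (\<Sum>\<beta>\<in>l. of_rat (u \<beta>) * x \<beta>)"
proof -
  have "UL u ((f ^^ (m * k)) (gen \<alpha>)) = (\<Sum>\<beta>\<in>l. u \<beta> * cf (f ^^ (m * k)) \<beta> \<alpha>)" if a: "\<alpha> \<in> l" for \<alpha>
  proof -
    have "(f ^^ (m * k)) (gen \<alpha>) \<in> carrier L"
      using lie_endoD(1)[OF lie_endo_funpow[OF f]] gen_closed a component(1)[OF l] by blast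
    then show ?thesis
      using UL_coord[of "(f ^^ (m * k)) (gen \<alpha>)" u] u component(1)[OF l] finS
        sum.mono_neutral_right[of S l "\<lambda>b. u b * UL (coord b) ((f ^^ (m * k)) (gen \<alpha>))"]
      by (simp add: cf_def)
  qed
  then have "(\<Sum>\<alpha>\<in>l. x \<alpha> * of_rat (UL u ((f ^^ (m * k)) (gen \<alpha>))))
      = (\<Sum>\<alpha>\<in>l. \<Sum>\<beta>\<in>l. x \<alpha> * of_rat (u \<beta> * cf (f ^^ (m * k)) \<beta> \<alpha>))"
    by (intro sum.cong refl) (simp only: of_rat_sum sum_distrib_left)
  also have "\<dots> = (\<Sum>\<beta>\<in>l. of_rat (u \<beta>) * (\<Sum>\<alpha>\<in>l. x \<alpha> * of_rat (cf (f ^^ (m * k)) \<beta> \<alpha>)))"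
    by (subst sum.swap) (simp add: of_rat_mult sum_distrib_left mult_ac)
  also have "\<dots> = (\<Sum>\<beta>\<in>l. of_rat (u \<beta>) * (a ^ k * x \<beta>))"
    by (intro sum.cong refl) (simp only: eigenpair_power[OF l x])
  finally show ?thesis by (simp add: sum_distrib_left mult_ac)
qed

text \<open>The coordinate at a vertex where \<open>x\<close> is nonzero yields a sequence that is
  geometric along the multiples of \<open>m\<close>. In this way an eigenvector of a block serves,
  although it need not be one of \<open>f ^^ m\<close>.\<close>

lemma eigenpair_spectral:
  assumes l: "l \<in> \<Lambda>" and x: "eigenpair l a x"
  shows "alg_unit a" "cmod a \<noteq> 1"
proof -
  obtain \<beta> where b: "\<beta> \<in> l" "x \<beta> \<noteq> 0" using x by (auto simp: eigenpair_def)
  define s where "s = (\<lambda>n. \<Sum>\<alpha>\<in>l. x \<alpha> * of_rat (UL (coord \<beta>) ((f ^^ n) (gen \<alpha>))))"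
  have "clin L (\<lambda>X. of_rat (UL (coord \<beta>) X))"
    by (simp add: clin_def UL_add UL_scale of_rat_add of_rat_mult)
  then have "orbit_sequence f s"
    unfolding s_def using component(1)[OF l] gen_closed
    by (intro orbit_sequence_sum orbit_sequence_functional[OF f]) auto
  moreover have "s (m * k) = a ^ k * x \<beta>" for k
    using eigenpair_power[OF l x b(1), of k] by (simp add: s_def cf_def)
  ultimately show "alg_unit a" "cmod a \<noteq> 1"
    using geometric_orbit_sequence[OF hyp int _ _ b(2) m, of s a] by auto
qed

text \<open>If all eigenvalues coincided, a power of one modulus would be 1, against hyperbolicity.
  The two distinct eigenvalues rule out one-vertex components and later provide two eigenvectors
  that are not proportional.\<close>

lemma block_eigenvalues:
  assumes l: "l \<in> \<Lambda>"
  obtains as x a0 a1 where "length as = card l" "cmod (prod_list as) = 1" "\<forall>a\<in>set as. eigenpair l a (x a)"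
    "a0 \<in> set as" "a1 \<in> set as" "a0 \<noteq> a1"
proof -
  have unit: "alg_unit a" if "\<And>\<beta>. \<beta> \<in> l \<Longrightarrow> (\<Sum>\<alpha>\<in>l. of_rat (cf (f ^^ m) \<beta> \<alpha>) * x \<alpha>) = a * x \<beta>"
    "\<exists>\<beta>\<in>l. x \<beta> \<noteq> 0" for a x
    using that by (intro eigenpair_spectral(1)[OF l, of a x]) (simp add: eigenpair_def)
  obtain as where as: "length as = card l" "cmod (prod_list as) = 1" "\<And>a. a \<in> set as \<Longrightarrow> \<exists>x. eigenpair l a x"
  proof (rule unit_block_eigenvalues[OF component(3)[OF l], of "cf (f ^^ m)"])
    fix a :: complex and x
    assume "\<And>\<beta>. \<beta> \<in> l \<Longrightarrow> (\<Sum>\<alpha>\<in>l. of_rat (cf (f ^^ m) \<beta> \<alpha>) * x \<alpha>) = a * x \<beta>" "\<exists>\<beta>\<in>l. x \<beta> \<noteq> 0"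
    then show "alg_unit a" by (rule unit)
  qed (rule that, simp_all add: eigenpair_def)
  obtain x where x: "\<forall>a\<in>set as. eigenpair l a (x a)"
    using bchoice[of "set as" "eigenpair l"] as(3) by blast
  have "as \<noteq> []" using as(1) component(2,3)[OF l] by auto
  then obtain a0 where a0: "a0 \<in> set as" by (cases as) auto
  have "\<exists>a1\<in>set as. a1 \<noteq> a0"
  proof (rule ccontr)
    assume "\<not> ?thesis"
    then have "as = replicate (length as) a0" by (simp add: replicate_eqI)
    then have "prod_list as = a0 ^ length as" by (metis prod_list_replicate)
    then have "cmod a0 ^ length as = 1" using as(2) by (simp add: norm_power)
    then have "cmod a0 = 1" using \<open>as \<noteq> []\<close> power_eq_imp_eq_base[of "cmod a0" "length as" 1] by simp
    then show False using eigenpair_spectral(2)[OF l bspec[OF x a0]] by simp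
  qed
  then obtain a1 where a1: "a1 \<in> set as" "a0 \<noteq> a1" by blast
  show thesis by (rule that[OF as(1,2) x a0 a1])
qed

lemma component_card: "l \<in> \<Lambda> \<Longrightarrow> card l > 1"
proof -
  assume l: "l \<in> \<Lambda>"
  obtain as x a0 a1 where as: "length as = card l" "cmod (prod_list as) = 1" "\<forall>a\<in>set as. eigenpair l a (x a)"
    "a0 \<in> set as" "a1 \<in> set as" "a0 \<noteq> a1"
    by (rule block_eigenvalues[OF l])
  have "card {a0, a1} \<le> card (set as)" using as(4,5) by (intro card_mono) auto
  then show ?thesis using as(1,6) card_length[of as] by simp
qed

text \<open>The word uses one eigenvector for each eigenvalue of the block, with multiplicity. All
  letters except number 1 are read by a generic form \<open>u\<close>; letter 1 is read by a
  coordinate chosen to make the innermost determinant nonzero. A component containing an edge is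
  complete, so any two functionals supported on it are compatible.\<close>

lemma loop_card:
  assumes l: "l \<in> \<Lambda>" and edge: "\<alpha>0 \<in> l" "\<beta>0 \<in> l" "{\<alpha>0, \<beta>0} \<in> E"
  shows "card l > c"
proof (rule ccontr)
  assume "\<not> card l > c"
  then have lc: "card l \<le> c" by simp
  obtain as x a0 a1 where as: "length as = card l" "cmod (prod_list as) = 1" "\<forall>a\<in>set as. eigenpair l a (x a)"
    "a0 \<in> set as" "a1 \<in> set as" "a0 \<noteq> a1"
    by (rule block_eigenvalues[OF l])
  \<comment> \<open>Two distinct eigenvalues are moved to the front: the innermost bracket of
    proportional eigenvectors would vanish.\<close>
  define es where "es = a0 # a1 # remove1 a1 (remove1 a0 as)"
  have "add_mset a1 (mset (remove1 a0 as) - {#a1#}) = mset (remove1 a0 as)"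
    using as(5) in_set_remove1[OF as(6)[symmetric], of as] by (intro insert_DiffM) (simp only: set_mset_mset)
  moreover have "add_mset a0 (mset as - {#a0#}) = mset as"
    using as(4) by (intro insert_DiffM) simp
  ultimately have ms: "mset es = mset as" by (simp add: es_def)
  have se: "set es = set as" using ms by (metis set_mset_mset)
  have len: "length es = card l" using ms as(1) by (metis size_mset)
  have "prod_list es = prod_list as" using ms by (metis prod_mset_prod_list)
  then have p1: "cmod (\<Prod>i<card l. es ! i) = 1" using as(2) len by (simp add: prod_list_nth)
  have N2: "2 \<le> card l" using len by (simp add: es_def)
  have ei: "eigenpair l (es ! i) (x (es ! i))" if "i < card l" for i
    using as(3) se len that nth_mem[of i es] by simp
  have nzu: "\<exists>\<beta>\<in>l. v \<beta> \<noteq> 0" if "v \<in> x ` set as" for v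
    using that as(3) by (auto simp: eigenpair_def)
  have "\<exists>u. (\<forall>v\<in>x ` set as. (\<Sum>\<beta>\<in>l. of_rat (u \<beta>) * v \<beta>) \<noteq> 0) \<and> (\<forall>\<beta>. \<beta> \<notin> l \<longrightarrow> u \<beta> = (0 :: rat))"
    by (rule generic_rational_form[OF component(3)[OF l] finite_imageI[OF finite_set]]) (rule nzu)
  then obtain u where u: "\<forall>v\<in>x ` set as. (\<Sum>\<beta>\<in>l. of_rat (u \<beta>) * v \<beta>) \<noteq> 0" "\<forall>\<beta>. \<beta> \<notin> l \<longrightarrow> u \<beta> = (0 :: rat)"
    by (elim exE conjE)
  define U where "U = (\<lambda>v :: 'v \<Rightarrow> complex. \<Sum>\<beta>\<in>l. of_rat (u \<beta>) * v \<beta>)"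
  have U0: "U (x a) \<noteq> 0" if "a \<in> set as" for a using u(1) that by (simp add: U_def)
  \<comment> \<open>Vanishing of all these minors would make \<open>x a1\<close> proportional to
    \<open>x a0\<close>, hence an eigenvector for both eigenvalues.\<close>
  have "\<exists>\<beta>\<in>l. U (x a0) * x a1 \<beta> \<noteq> x a0 \<beta> * U (x a1)"
  proof (rule ccontr)
    assume "\<not> ?thesis"
    then have eq: "x a1 \<beta> = U (x a1) / U (x a0) * x a0 \<beta>" if "\<beta> \<in> l" for \<beta>
      using U0[OF as(4)] that by (auto simp: field_simps)
    obtain \<beta> where b: "\<beta> \<in> l" "x a1 \<beta> \<noteq> 0" using bspec[OF as(3) as(5)] by (auto simp: eigenpair_def)
    let ?k = "U (x a1) / U (x a0)"
    have "a1 * x a1 \<beta> = (\<Sum>\<alpha>\<in>l. of_rat (cf (f ^^ m) \<beta> \<alpha>) * x a1 \<alpha>)"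
      using bspec[OF as(3) as(5)] b by (simp add: eigenpair_def)
    also have "\<dots> = (\<Sum>\<alpha>\<in>l. ?k * (of_rat (cf (f ^^ m) \<beta> \<alpha>) * x a0 \<alpha>))"
    proof (intro sum.cong refl)
      fix \<alpha> assume "\<alpha> \<in> l"
      show "of_rat (cf (f ^^ m) \<beta> \<alpha>) * x a1 \<alpha> = ?k * (of_rat (cf (f ^^ m) \<beta> \<alpha>) * x a0 \<alpha>)"
        unfolding eq[OF \<open>\<alpha> \<in> l\<close>] by (simp only: mult_ac)
    qed
    also have "\<dots> = ?k * (\<Sum>\<alpha>\<in>l. of_rat (cf (f ^^ m) \<beta> \<alpha>) * x a0 \<alpha>)"
      by (rule sum_distrib_left[symmetric])
    also have "\<dots> = ?k * (a0 * x a0 \<beta>)"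
      using bspec[OF as(3) as(4)] b by (simp add: eigenpair_def)
    also have "\<dots> = a0 * x a1 \<beta>" unfolding eq[OF b(1)] by (simp only: mult_ac)
    finally show False using b as(6) by simp
  qed
  then obtain \<beta>1 where b1: "\<beta>1 \<in> l" "U (x a0) * x a1 \<beta>1 \<noteq> x a0 \<beta>1 * U (x a1)" by blast
  have w0: "\<forall>\<beta>. \<beta> \<notin> l \<longrightarrow> coord \<beta>1 \<beta> = 0" using b1(1) by (auto simp: coord_def)
  have Wv: "(\<Sum>\<beta>\<in>l. of_rat (coord \<beta>1 \<beta>) * v \<beta>) = v \<beta>1" for v :: "'v \<Rightarrow> complex"
  proof -
    have "(\<Sum>\<beta>\<in>l. of_rat (coord \<beta>1 \<beta>) * v \<beta>) = (\<Sum>\<beta>\<in>l. if \<beta> = \<beta>1 then v \<beta> else 0)"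
      by (intro sum.cong) (auto simp: coord_def)
    then show ?thesis using b1(1) component(3)[OF l] by simp
  qed
  have comp: "compatible S E u (coord \<beta>1)"
    unfolding compatible_def
  proof (intro ballI impI)
    fix \<alpha> \<beta> assume ab: "\<alpha> \<in> S" "\<beta> \<in> S" "{\<alpha>, \<beta>} \<notin> E"
    show "u \<alpha> * coord \<beta>1 \<beta> = coord \<beta>1 \<alpha> * u \<beta>"
    proof (cases "\<alpha> \<in> l \<and> \<beta> \<in> l")
      case True
      then have "\<alpha> = \<beta>" using coherent_edge[OF edge(3), of \<alpha> \<beta>] ab(3) edge component(4)[OF l] by blast
      then show ?thesis by simp
    qed (use u(2) w0 in auto)
  qed
  have e01: "es ! 0 = a0" "es ! 1 = a1" by (simp_all add: es_def)
  define s where "s = (\<lambda>i. if i = 0 \<or> 2 \<le> i \<and> i < card l then U (x (es ! i)) else x (es ! i) \<beta>1)"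
  have "cmod (\<Prod>i<card l. es ! i) \<noteq> 1"
  proof (rule eigenvector_word[OF f hyp int m comp N2 order_refl lc, of "\<lambda>_. l" "\<lambda>i. x (es ! i)" "\<lambda>i. es ! i" s "x a0 \<beta>1 * U (x a1)"])
    show "l \<subseteq> S" using component(1)[OF l] .
    fix i k assume i: "i < card l"
    show "(\<Sum>\<alpha>\<in>l. x (es ! i) \<alpha> * of_rat (UL (if i = 0 \<or> 2 \<le> i \<and> i < card l then u else coord \<beta>1)
        ((f ^^ (m * k)) (gen \<alpha>)))) = es ! i ^ k * s i"
    proof (cases "i = 0 \<or> 2 \<le> i \<and> i < card l")
      case True
      then show ?thesis using eigenpair_form[where u = u, OF l ei[OF i] u(2), where k = k] by (simp add: s_def U_def)
    next
      case False
      then show ?thesis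
        using eigenpair_form[where u = "coord \<beta>1", OF l ei[OF i] w0, where k = k] unfolding Wv s_def by (simp only: if_False)
    qed
  next
    fix k
    have i01: "0 < card l" "1 < card l" using N2 by auto
    show "(\<Sum>\<alpha>\<in>l. x (es ! 0) \<alpha> * of_rat (UL (coord \<beta>1) ((f ^^ (m * k)) (gen \<alpha>)))) *
      (\<Sum>\<alpha>\<in>l. x (es ! 1) \<alpha> * of_rat (UL u ((f ^^ (m * k)) (gen \<alpha>)))) = (es ! 0 * es ! 1) ^ k * (x a0 \<beta>1 * U (x a1))"
      unfolding eigenpair_form[where u = "coord \<beta>1", OF l ei[OF i01(1)] w0, where k = k] Wv
        eigenpair_form[where u = u, OF l ei[OF i01(2)] u(2), where k = k]
      by (simp only: e01 U_def power_mult_distrib mult_ac)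
  next
    have "s 0 = U (x a0)" "s 1 = x a1 \<beta>1" using N2 e01 by (simp_all add: s_def)
    moreover have "s i \<noteq> 0" if "i \<in> {2..<card l}" for i
      using that U0[of "es ! i"] se len nth_mem[of i es] by (simp add: s_def)
    ultimately show "(s 0 * s 1 - x a0 \<beta>1 * U (x a1)) * (\<Prod>i\<in>{2..<card l}. s i) \<noteq> 0"
      using b1(2) by (simp add: prod_zero_iff)
  qed auto
  then show False using p1 by simp
qed

text \<open>The assumption on degrees fixes the direction of triangularity:
  \<open>f ^^ (m * k)\<close> sends no vertex of \<open>l2\<close> to anything with a component in
  \<open>l1\<close>. So \<open>u\<close>, supported on \<open>l1\<close>, vanishes on the letters
  from \<open>l2\<close>, and the second term of the innermost determinant drops out.\<close>

lemma edge_card_aux: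
  assumes l1: "l1 \<in> \<Lambda>" and l2: "l2 \<in> \<Lambda>" and ne: "l1 \<noteq> l2"
    and edge: "\<alpha>0 \<in> l1" "\<beta>0 \<in> l2" "{\<alpha>0, \<beta>0} \<in> E" and dg: "deg S E \<beta>0 \<le> deg S E \<alpha>0"
  shows "card l1 + card l2 > c"
proof (rule ccontr)
  assume "\<not> ?thesis"
  then have lc: "card l1 + card l2 \<le> c" by simp
  have disj: "l1 \<inter> l2 = {}" using component(5)[OF l1 l2] ne by blast
  obtain as1 x1 a a2 where as1: "length as1 = card l1" "cmod (prod_list as1) = 1" "\<forall>a\<in>set as1. eigenpair l1 a (x1 a)"
    "a \<in> set as1" "a2 \<in> set as1" "a \<noteq> a2"
    by (rule block_eigenvalues[OF l1])
  obtain as2 x2 a' a2' where as2: "length as2 = card l2" "cmod (prod_list as2) = 1" "\<forall>a\<in>set as2. eigenpair l2 a (x2 a)"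
    "a' \<in> set as2" "a2' \<in> set as2" "a' \<noteq> a2'"
    by (rule block_eigenvalues[OF l2])
  obtain h1 t1 where c1: "as1 = h1 # t1" using as1(4) by (cases as1) auto
  obtain h2 t2 where c2: "as2 = h2 # t2" using as2(4) by (cases as2) auto
  \<comment> \<open>The innermost bracket takes one eigenvalue from each component; then come the
    remaining ones of \<open>l1\<close>, at positions 2 up to \<open>card l1\<close>, and those of
    \<open>l2\<close>. This explains \<open>b = card l1 + 1\<close>.\<close>
  define es where "es = h1 # h2 # t1 @ t2"
  define N where "N = card l1 + card l2"
  define b where "b = card l1 + 1"
  have card1: "card l1 = Suc (length t1)" and card2: "card l2 = Suc (length t2)" using as1(1) as2(1) c1 c2 by auto
  have len: "length es = N" by (simp add: es_def N_def card1 card2)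
  have b: "2 \<le> b" "b \<le> N" "N \<le> c" using lc by (auto simp: b_def N_def card1 card2)
  have "prod_list es = prod_list as1 * prod_list as2" by (simp add: es_def c1 c2)
  then have "cmod (prod_list es) = 1" using as1(2) as2(2) by (simp add: norm_mult)
  then have p1: "cmod (\<Prod>i<N. es ! i) = 1" using len by (simp add: prod_list_nth)
  define first where "first = (\<lambda>i :: nat. i = 0 \<or> 2 \<le> i \<and> i < b)"
  have m1: "es ! i \<in> set as1" if "i < N" "first i" for i
  proof (cases "i = 0")
    case True
    then show ?thesis by (simp add: es_def c1)
  next
    case False
    then have "2 \<le> i" "i < b" using that by (auto simp: first_def)
    then obtain j where j: "i = Suc (Suc j)" "j < length t1" by (cases i; cases "i - 1") (auto simp: b_def card1)
    then show ?thesis by (simp add: es_def c1 nth_append)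
  qed
  have m2: "es ! i \<in> set as2" if "i < N" "\<not> first i" for i
  proof (cases "i = 1")
    case True
    then show ?thesis by (simp add: es_def c2)
  next
    case False
    then have "2 \<le> i" "b \<le> i" using that by (auto simp: first_def)
    then obtain j where j: "i = Suc (Suc j)" "length t1 \<le> j" by (cases i; cases "i - 1") (auto simp: b_def card1)
    then show ?thesis using that(1) by (simp add: es_def c2 nth_append N_def card1 card2)
  qed
  have nzu: "\<exists>\<beta>\<in>l1. v \<beta> \<noteq> 0" if "v \<in> x1 ` set as1" for v
    using that as1(3) by (auto simp: eigenpair_def)
  have "\<exists>u. (\<forall>v\<in>x1 ` set as1. (\<Sum>\<beta>\<in>l1. of_rat (u \<beta>) * v \<beta>) \<noteq> 0) \<and> (\<forall>\<beta>. \<beta> \<notin> l1 \<longrightarrow> u \<beta> = (0 :: rat))"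
    by (rule generic_rational_form[OF component(3)[OF l1] finite_imageI[OF finite_set]]) (rule nzu)
  then obtain u where u: "\<forall>v\<in>x1 ` set as1. (\<Sum>\<beta>\<in>l1. of_rat (u \<beta>) * v \<beta>) \<noteq> 0" "\<forall>\<beta>. \<beta> \<notin> l1 \<longrightarrow> u \<beta> = (0 :: rat)"
    by (elim exE conjE)
  have nzw: "\<exists>\<beta>\<in>l2. v \<beta> \<noteq> 0" if "v \<in> x2 ` set as2" for v
    using that as2(3) by (auto simp: eigenpair_def)
  have "\<exists>w. (\<forall>v\<in>x2 ` set as2. (\<Sum>\<beta>\<in>l2. of_rat (w \<beta>) * v \<beta>) \<noteq> 0) \<and> (\<forall>\<beta>. \<beta> \<notin> l2 \<longrightarrow> w \<beta> = (0 :: rat))"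
    by (rule generic_rational_form[OF component(3)[OF l2] finite_imageI[OF finite_set]]) (rule nzw)
  then obtain w where w: "\<forall>v\<in>x2 ` set as2. (\<Sum>\<beta>\<in>l2. of_rat (w \<beta>) * v \<beta>) \<noteq> 0" "\<forall>\<beta>. \<beta> \<notin> l2 \<longrightarrow> w \<beta> = (0 :: rat)"
    by (elim exE conjE)
  have comp: "compatible S E u w"
    unfolding compatible_def
  proof (intro ballI impI)
    fix \<alpha> \<beta> assume ab: "\<alpha> \<in> S" "\<beta> \<in> S" "{\<alpha>, \<beta>} \<notin> E"
    have no: "{x, y} \<in> E" if "x \<in> l1" "y \<in> l2" for x y
      using coherent_edge[OF edge(3), of x y] edge that component(4)[OF l1] component(4)[OF l2] disj by blast
    have 1: "\<not> (\<alpha> \<in> l1 \<and> \<beta> \<in> l2)" using no ab(3) by blast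
    have 2: "\<not> (\<beta> \<in> l1 \<and> \<alpha> \<in> l2)" using no[of \<beta> \<alpha>] ab(3) by (auto simp: insert_commute)
    have "u \<alpha> * w \<beta> = 0" using 1 u(2) w(2) by auto
    moreover have "w \<alpha> * u \<beta> = 0" using 2 u(2) w(2) by auto
    ultimately show "u \<alpha> * w \<beta> = w \<alpha> * u \<beta>" by (simp only:)
  qed
  have van: "UL u ((f ^^ (m * k)) (gen \<alpha>)) = 0" if a: "\<alpha> \<in> l2" for \<alpha> k
  proof -
    have aS: "\<alpha> \<in> S" using a component(1)[OF l2] by blast
    have "(f ^^ (m * k)) (gen \<alpha>) \<in> carrier L"
      using lie_endoD(1)[OF lie_endo_funpow[OF f]] gen_closed aS by blast
    then have "UL u ((f ^^ (m * k)) (gen \<alpha>)) = (\<Sum>\<beta>\<in>S. u \<beta> * cf (f ^^ (m * k)) \<beta> \<alpha>)"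
      unfolding cf_def by (rule UL_coord)
    also have "\<dots> = 0"
    proof (rule sum.neutral, rule ballI, rule ccontr)
      fix \<beta> assume bS: "\<beta> \<in> S" and n: "u \<beta> * cf (f ^^ (m * k)) \<beta> \<alpha> \<noteq> 0"
      have bl: "\<beta> \<in> l1" using n u(2) by force
      have "(\<alpha>, \<beta>) \<in> R \<or> deg S E \<beta> < deg S E \<alpha>" using blocks_power[OF aS bS] n by auto
      moreover have "(\<alpha>, \<beta>) \<notin> R" using component(4)[OF l2 a] bl disj by blast
      moreover have "deg S E \<beta> = deg S E \<alpha>0" "deg S E \<alpha> = deg S E \<beta>0"
        using component(4)[OF l1 bl] component(4)[OF l2 a] edge coherent_deg[OF graph] by blast+
      ultimately show False using dg by simp
    qed
    finally show ?thesis .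
  qed
  define C where "C = (\<lambda>i. if first i then l1 else l2)"
  define v where "v = (\<lambda>i. if first i then x1 (es ! i) else x2 (es ! i))"
  define s where "s = (\<lambda>i. if first i then \<Sum>\<beta>\<in>l1. of_rat (u \<beta>) * x1 (es ! i) \<beta> else \<Sum>\<beta>\<in>l2. of_rat (w \<beta>) * x2 (es ! i) \<beta>)"
  have "cmod (\<Prod>i<N. es ! i) \<noteq> 1"
  proof (rule eigenvector_word[OF f hyp int m comp b, of C v "\<lambda>i. es ! i" s 0])
    fix i assume i: "i < N"
    show "C i \<subseteq> S" using component(1)[OF l1] component(1)[OF l2] by (simp add: C_def)
    fix k
    have "(\<Sum>\<alpha>\<in>C i. v i \<alpha> * of_rat (UL (if first i then u else w)
        ((f ^^ (m * k)) (gen \<alpha>)))) = es ! i ^ k * s i"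
    proof (cases "first i")
      case True
      then show ?thesis
        using eigenpair_form[where u = u, OF l1 bspec[OF as1(3) m1[OF i True]] u(2), where k = k] by (simp add: C_def v_def s_def)
    next
      case False
      then show ?thesis
        using eigenpair_form[where u = w, OF l2 bspec[OF as2(3) m2[OF i False]] w(2), where k = k] by (simp add: C_def v_def s_def)
    qed
    then show "(\<Sum>\<alpha>\<in>C i. v i \<alpha> * of_rat (UL (if i = 0 \<or> 2 \<le> i \<and> i < b then u else w)
        ((f ^^ (m * k)) (gen \<alpha>)))) = es ! i ^ k * s i"
      by (simp only: first_def)
  next
    fix k
    have "(\<Sum>\<alpha>\<in>C 1. v 1 \<alpha> * of_rat (UL u ((f ^^ (m * k)) (gen \<alpha>)))) = 0"
      by (intro sum.neutral) (simp add: C_def first_def van)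
    then show "(\<Sum>\<alpha>\<in>C 0. v 0 \<alpha> * of_rat (UL w ((f ^^ (m * k)) (gen \<alpha>)))) *
      (\<Sum>\<alpha>\<in>C 1. v 1 \<alpha> * of_rat (UL u ((f ^^ (m * k)) (gen \<alpha>)))) = (es ! 0 * es ! 1) ^ k * 0"
      by simp
  next
    fix i \<alpha> k assume "b \<le> i" "i < N" "\<alpha> \<in> C i"
    then show "UL u ((f ^^ (m * k)) (gen \<alpha>)) = 0" using b by (intro van) (auto simp: C_def first_def split: if_splits)
  next
    have "s i \<noteq> 0" if i: "i < N" for i
    proof (cases "first i")
      case True
      then show ?thesis using bspec[OF u(1) imageI[OF m1[OF i True]]] by (simp add: s_def)
    next
      case False
      then show ?thesis using bspec[OF w(1) imageI[OF m2[OF i False]]] by (simp add: s_def)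
    qed
    then show "(s 0 * s 1 - 0) * (\<Prod>i\<in>{2..<N}. s i) \<noteq> 0" using b by (simp add: prod_zero_iff)
  qed
  then show False using p1 by simp
qed

lemma edge_card: assumes "e \<in> quotient_edges S E" shows "(\<Sum>l\<in>e. card l) > c"
proof -
  obtain l l' \<alpha> \<beta> where e: "e = {l, l'}" "l \<in> \<Lambda>" "l' \<in> \<Lambda>" "\<alpha> \<in> l" "\<beta> \<in> l'" "{\<alpha>, \<beta>} \<in> E"
    using quotient_edge_elim[OF assms] by metis
  show ?thesis
  proof (cases "l = l'")
    case True
    then show ?thesis using loop_card[OF e(2,4) _ e(6)] e by simp
  next
    case False
    have "{\<beta>, \<alpha>} \<in> E" using e(6) by (simp add: insert_commute)
    then have "card l + card l' > c"
      using edge_card_aux[OF e(2,3) False e(4,5,6)] edge_card_aux[OF e(3,2) False[symmetric] e(5,4)]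
      by (cases "deg S E \<beta> \<le> deg S E \<alpha>") auto
    then show ?thesis using e(1) False by simp
  qed
qed

end

lemma anosov_imp_conditions:
  assumes "anosov L"
  shows "(\<forall>l\<in>\<Lambda>. card l > 1) \<and> (\<forall>e\<in>quotient_edges S E. (\<Sum>l\<in>e. card l) > c)"
proof -
  obtain f where f: "lie_automorphism L f" "hyperbolic L f" "integer_like L f"
    using assms unfolding anosov_def by blast
  have endo: "lie_endo L f" using f(1) by (auto simp: lie_automorphism_def lie_endo_def)
  obtain m where m: "m > 0" "\<And>\<alpha> \<beta>. \<lbrakk>\<alpha> \<in> S; \<beta> \<in> S; cf (f ^^ m) \<beta> \<alpha> \<noteq> 0\<rbrakk>
      \<Longrightarrow> (\<alpha>, \<beta>) \<in> R \<or> deg S E \<beta> < deg S E \<alpha>"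
    using automorphism_power[OF f(1)] by metis
  show ?thesis
    using component_card[OF endo f(2,3) m] edge_card[OF endo f(2,3) m] by blast
qed

end

section \<open>Endomorphisms given on generators\<close>

fun subst_tree :: "('v \<Rightarrow> 'v magma \<Rightarrow>\<^sub>0 rat) \<Rightarrow> 'v magma \<Rightarrow> 'v magma \<Rightarrow>\<^sub>0 rat" where
  "subst_tree h (Gen \<alpha>) = h \<alpha>"
| "subst_tree h (Prod s t) = fmul (subst_tree h s) (subst_tree h t)"

definition substitute :: "('v \<Rightarrow> 'v magma \<Rightarrow>\<^sub>0 rat) \<Rightarrow> ('v magma \<Rightarrow>\<^sub>0 rat) \<Rightarrow> 'v magma \<Rightarrow>\<^sub>0 rat" where
  "substitute h p = (\<Sum>t\<in>Poly_Mapping.keys p. fscale (Poly_Mapping.lookup p t) (subst_tree h t))"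

lemma lookup_substitute: "Poly_Mapping.lookup (substitute h p) t = lin_ext (\<lambda>s. Poly_Mapping.lookup (subst_tree h s) t) p"
  by (simp add: substitute_def lin_ext_def lookup_sum)

lemma substitute_add: "substitute h (p + p') = substitute h p + substitute h p'"
  by (rule poly_mapping_eqI) (simp add: lookup_substitute lin_ext_add lookup_add)

lemma substitute_scale: "substitute h (fscale r p) = fscale r (substitute h p)"
  by (rule poly_mapping_eqI) (simp add: lookup_substitute lin_ext_scale)

lemma substitute_fgen: "substitute h (fgen \<alpha>) = h \<alpha>"
  by (rule poly_mapping_eqI) (simp add: lookup_substitute fgen_def)

lemma substitute_fmul: "substitute h (fmul p p') = fmul (substitute h p) (substitute h p')"
proof (rule fpoly_eqI)
  show "Poly_Mapping.lookup (substitute h (fmul p p')) (Gen a) = Poly_Mapping.lookup (fmul (substitute h p) (substitute h p')) (Gen a)" for a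
    by (simp add: lookup_substitute lin_ext_fmul)
  show "Poly_Mapping.lookup (substitute h (fmul p p')) (Prod s t) = Poly_Mapping.lookup (fmul (substitute h p) (substitute h p')) (Prod s t)" for s t
    by (simp add: lookup_substitute lin_ext_fmul) (simp add: lin_ext_def sum_product mult_ac)
qed

context graph_nilpotent
begin

lemma subst_tree_closed:
  assumes "\<And>\<alpha>. \<alpha> \<in> S \<Longrightarrow> h \<alpha> \<in> carrier F"
  shows "set_magma t \<subseteq> S \<Longrightarrow> subst_tree h t \<in> carrier F"
  by (induction t) (auto intro: assms fmul_closed)

lemma substitute_closed:
  assumes "\<And>\<alpha>. \<alpha> \<in> S \<Longrightarrow> h \<alpha> \<in> carrier F" "p \<in> carrier F"
  shows "substitute h p \<in> carrier F"
  unfolding substitute_def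
proof (rule F_sum)
  fix t assume "t \<in> Poly_Mapping.keys p"
  then have "set_magma t \<subseteq> S" using assms(2) by (auto simp: free_nonassoc_def)
  then show "fscale (Poly_Mapping.lookup p t) (subst_tree h t) \<in> carrier F"
    by (intro F_scale subst_tree_closed[OF assms(1)])
qed

text \<open>The polynomials killed after substitution form an ideal. It contains the Lie relators
  because \<open>L\<close> is a Lie algebra, the nonedges by hypothesis, and the long brackets
  because substitution preserves the lower central series; then the universal property
  applies.\<close>

lemma substitution_kernel:
  assumes h: "\<And>\<alpha>. \<alpha> \<in> S \<Longrightarrow> h \<alpha> \<in> carrier F"
    and ne: "\<And>\<alpha> \<beta>. \<lbrakk>\<alpha> \<in> S; \<beta> \<in> S; {\<alpha>, \<beta>} \<notin> E\<rbrakk> \<Longrightarrow> bracket L (q (h \<alpha>)) (q (h \<beta>)) = \<zero>\<^bsub>L\<^esub>"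
    and p: "p \<in> carrier F" "q p = \<zero>\<^bsub>L\<^esub>"
  shows "q (substitute h p) = \<zero>\<^bsub>L\<^esub>"
proof -
  have cl: "substitute h x \<in> carrier F" if "x \<in> carrier F" for x
    by (rule substitute_closed[OF _ that]) (rule h)
  define J where "J = {p \<in> carrier F. q (substitute h p) = \<zero>\<^bsub>L\<^esub>}"
  have qc: "q (substitute h x) \<in> carrier L" if "x \<in> carrier F" for x
    by (rule q.hom_closed[OF cl[OF that]])
  have add: "q (substitute h (x + y)) = q (substitute h x) \<oplus>\<^bsub>L\<^esub> q (substitute h y)" if "x \<in> carrier F" "y \<in> carrier F" for x y
    unfolding substitute_add by (rule q_add) (simp_all add: cl that)
  have mul: "q (substitute h (fmul x y)) = bracket L (q (substitute h x)) (q (substitute h y))" if "x \<in> carrier F" "y \<in> carrier F" for x y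
    unfolding substitute_fmul by (rule q_fmul) (simp_all add: cl that)
  have scl: "q (substitute h (fscale r x)) = r \<odot>\<^bsub>L\<^esub> q (substitute h x)" if "x \<in> carrier F" for x r
    unfolding substitute_scale by (rule q_scale) (simp add: cl that)
  have z: "q (substitute h 0) = \<zero>\<^bsub>L\<^esub>" by (simp add: substitute_def q_zero)
  have J: "bracket_ideal F J"
    unfolding bracket_ideal_def q.submodule_iff
  proof (intro conjI ballI allI)
    show "J \<subseteq> carrier F" by (auto simp: J_def)
    show "\<zero>\<^bsub>F\<^esub> \<in> J" using z F_zero by (simp add: J_def)
    show "x \<oplus>\<^bsub>F\<^esub> y \<in> J" if "x \<in> J" "y \<in> J" for x y
      using that F_add by (simp add: J_def add)
    show "r \<odot>\<^bsub>F\<^esub> x \<in> J" if "x \<in> J" for x r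
      using that F_scale by (simp add: J_def scl)
    show "bracket F x y \<in> J" if "x \<in> carrier F" "y \<in> J" for x y
      using that qc by (simp add: J_def mul fmul_closed L.bracket_zero_right)
    show "bracket F y x \<in> J" if "x \<in> carrier F" "y \<in> J" for x y
      using that qc by (simp add: J_def mul fmul_closed L.bracket_zero_left)
  qed
  have rel: "lie_relators S \<subseteq> J"
  proof
    fix x assume x: "x \<in> lie_relators S"
    have "x \<in> carrier F" using x lie_relators_carrier by blast
    moreover have "q (substitute h x) = \<zero>\<^bsub>L\<^esub>"
      using x unfolding lie_relators_def Let_def
    proof (elim UnE CollectE exE conjE)
      fix y assume "x = bracket F y y" "y \<in> carrier F"
      then show ?thesis using qc by (simp add: mul L.bracket_self)
    next
      fix y z w assume "x = bracket F y (bracket F z w) + bracket F z (bracket F w y) + bracket F w (bracket F y z)"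
        "y \<in> carrier F" "z \<in> carrier F" "w \<in> carrier F"
      then show ?thesis using qc L.jacobi[of "q (substitute h y)" "q (substitute h z)" "q (substitute h w)"]
        by (simp add: mul add fmul_closed F_add)
    qed
    ultimately show "x \<in> J" by (simp add: J_def)
  qed
  have nonedge: "fmul (fgen \<alpha>) (fgen \<beta>) \<in> J" if "\<alpha> \<in> S" "\<beta> \<in> S" "{\<alpha>, \<beta>} \<notin> E" for \<alpha> \<beta>
    using that ne[OF that] by (simp add: J_def mul substitute_fgen fgen_closed fmul_closed)
  have low: "substitute h x \<in> lower_central F (Suc n)" if "x \<in> lower_central F (Suc n)" for x n
    using that
  proof (induction n arbitrary: x)
    case 0
    then show ?case using cl by simp
  next
    case (Suc n)
    let ?N = "{y \<in> carrier F. substitute h y \<in> lower_central F (Suc (Suc n))}"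
    note sm = q.lower_central_submodule[of "Suc (Suc n)", unfolded q.submodule_iff]
    have "LinearCombinations.submodule rat_field ?N F"
      unfolding q.submodule_iff
    proof (intro conjI ballI allI)
      have "substitute h 0 = 0" by (simp add: substitute_def)
      then show "\<zero>\<^bsub>F\<^esub> \<in> ?N" using sm F_zero by simp
      show "x \<oplus>\<^bsub>F\<^esub> y \<in> ?N" if "x \<in> ?N" "y \<in> ?N" for x y
        using that F_add sm by (simp add: substitute_add)
      show "r \<odot>\<^bsub>F\<^esub> x \<in> ?N" if "x \<in> ?N" for x r
        using that F_scale sm by (simp add: substitute_scale)
    qed auto
    then have "lower_central F (Suc (Suc n)) \<subseteq> ?N"
    proof (rule q.lower_central_least[rotated])
      fix x y assume xy: "x \<in> carrier F" "y \<in> lower_central F (Suc n)"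
      have "y \<in> carrier F" using xy(2) q.lower_central_carrier by blast
      then show "bracket F x y \<in> ?N"
        using xy q.bracket_in_lower_central[of "Suc n" "substitute h x" "substitute h y"] Suc.IH[OF xy(2)] cl
        by (simp add: fmul_closed substitute_fmul)
    qed simp
    then show ?case using Suc.prems by blast
  qed
  have lc: "lower_central F (c + 1) \<subseteq> J"
  proof
    fix x assume x: "x \<in> lower_central F (c + 1)"
    have xc: "x \<in> carrier F" using x q.lower_central_carrier by blast
    have "q (substitute h x) \<in> q ` lower_central F (c + 1)" using low[of x c] x by simp
    then have "q (substitute h x) = \<zero>\<^bsub>L\<^esub>" unfolding q.lower_central_image nilpotent_lower_central by simp
    then show "x \<in> J" using xc by (simp add: J_def)
  qed
  have "p \<in> J" by (rule nproj_kernel_least[OF J rel _ lc p]) (rule nonedge)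
  then show ?thesis by (simp add: J_def)
qed

lemma substitution_endo:
  assumes h: "\<And>\<alpha>. \<alpha> \<in> S \<Longrightarrow> h \<alpha> \<in> carrier F"
    and ne: "\<And>\<alpha> \<beta>. \<lbrakk>\<alpha> \<in> S; \<beta> \<in> S; {\<alpha>, \<beta>} \<notin> E\<rbrakk> \<Longrightarrow> bracket L (q (h \<alpha>)) (q (h \<beta>)) = \<zero>\<^bsub>L\<^esub>"
  obtains f where "lie_endo L f" "\<And>\<alpha>. \<alpha> \<in> S \<Longrightarrow> f (gen \<alpha>) = q (h \<alpha>)"
proof -
  have cl: "substitute h x \<in> carrier F" if "x \<in> carrier F" for x
    by (rule substitute_closed[OF _ that]) (rule h)
  define f where "f = (\<lambda>X. q (substitute h (SOME p. p \<in> carrier F \<and> q p = X)))"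
  have fq: "f (q p) = q (substitute h p)" if p: "p \<in> carrier F" for p
  proof -
    define p' where "p' = (SOME p'. p' \<in> carrier F \<and> q p' = q p)"
    have p': "p' \<in> carrier F \<and> q p' = q p" unfolding p'_def by (rule someI[of _ p]) (simp add: p)
    have "q (substitute h (p + fscale (- 1) p')) = \<zero>\<^bsub>L\<^esub>"
    proof (rule substitution_kernel)
      show "p + fscale (- 1) p' \<in> carrier F" "q (p + fscale (- 1) p') = \<zero>\<^bsub>L\<^esub>"
        using kernel_difference[of p p'] p p' by auto
    qed (rule h ne; assumption)+
    then have "q (substitute h p) \<oplus>\<^bsub>L\<^esub> (- 1) \<odot>\<^bsub>L\<^esub> q (substitute h p') = \<zero>\<^bsub>L\<^esub>"
      using p p' by (simp add: substitute_add substitute_scale q_add q_scale cl F_scale)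
    moreover have qc: "q (substitute h p) \<in> carrier L" "q (substitute h p') \<in> carrier L"
      by (rule q.hom_closed[OF cl[OF p]], rule q.hom_closed[OF cl[OF conjunct1[OF p']]])
    ultimately have "q (substitute h p) = q (substitute h p')"
      using L.minus_equality[OF _ L.a_inv_closed[OF qc(2)] qc(1)]
      by (simp only: L.smult_minus_one[OF qc(2)] L.minus_minus[OF qc(2)])
    then show ?thesis by (simp add: f_def p'_def)
  qed
  show thesis
  proof (rule that)
    have "f x \<in> carrier L" if x: "x \<in> carrier L" for x
    proof -
      obtain p where p: "p \<in> carrier F" "x = q p" using L_elim[OF x] .
      show ?thesis using q.hom_closed[OF cl[OF p(1)]] fq[OF p(1)] p(2) by simp
    qed
    moreover have "f (x \<oplus>\<^bsub>L\<^esub> y) = f x \<oplus>\<^bsub>L\<^esub> f y \<and> f (bracket L x y) = bracket L (f x) (f y)"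
      if xy: "x \<in> carrier L" "y \<in> carrier L" for x y
    proof -
      obtain p where p: "p \<in> carrier F" "x = q p" using L_elim[OF xy(1)] .
      obtain p' where p': "p' \<in> carrier F" "y = q p'" using L_elim[OF xy(2)] .
      show ?thesis unfolding p(2) p'(2) using p(1) p'(1)
        by (simp add: q_add[symmetric] q_fmul[symmetric] fq F_add fmul_closed substitute_add substitute_fmul cl)
    qed
    moreover have "f (r \<odot>\<^bsub>L\<^esub> x) = r \<odot>\<^bsub>L\<^esub> f x" if x: "x \<in> carrier L" for x r
    proof -
      obtain p where p: "p \<in> carrier F" "x = q p" using L_elim[OF x] .
      show ?thesis unfolding p(2) using p(1)
        by (simp add: q_scale[symmetric] fq F_scale substitute_scale cl)
    qed
    ultimately show "lie_endo L f"
      by (auto simp: lie_endo_def LinearCombinations.module_hom_def)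
    show "f (gen \<alpha>) = q (h \<alpha>)" if "\<alpha> \<in> S" for \<alpha>
      unfolding gen_def fq[OF fgen_closed[OF that]] substitute_fgen ..
  qed
qed

text \<open>If an edge joined vertices of the columns of distinct \<open>\<alpha>\<close> and
  \<open>\<beta>\<close>, \<open>coherent_edge\<close> would make \<open>\<alpha>\<close> and
  \<open>\<beta>\<close> adjacent. So for nonadjacent distinct vertices all products in the minors
  over edges are zero, and for equal vertices the minors cancel.\<close>

lemma block_endo:
  assumes A: "\<And>\<alpha> \<gamma>. A \<gamma> \<alpha> \<noteq> 0 \<Longrightarrow> (\<alpha>, \<gamma>) \<in> R"
  obtains f where "lie_endo L f" "\<And>\<alpha>. \<alpha> \<in> S \<Longrightarrow> f (gen \<alpha>) = q (pvec (\<lambda>\<gamma>. A \<gamma> \<alpha>))"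
proof (rule substitution_endo[of "\<lambda>\<alpha>. pvec (\<lambda>\<gamma>. A \<gamma> \<alpha>)"])
  fix \<alpha> \<beta> assume ab: "\<alpha> \<in> S" "\<beta> \<in> S" "{\<alpha>, \<beta>} \<notin> E"
  have zero: "A \<gamma> \<alpha> * A \<delta> \<beta> = 0" if "\<alpha> \<noteq> \<beta>" "{\<gamma>, \<delta>} \<in> E" for \<gamma> \<delta>
  proof (rule ccontr)
    assume "A \<gamma> \<alpha> * A \<delta> \<beta> \<noteq> 0"
    then have "(\<gamma>, \<alpha>) \<in> R" "(\<delta>, \<beta>) \<in> R" using A coherent_sym[OF graph] by auto
    then show False using coherent_edge[OF that(2) _ _ that(1)] ab(3) by blast
  qed
  have "commuting S E (\<lambda>\<gamma>. A \<gamma> \<alpha>) (\<lambda>\<gamma>. A \<gamma> \<beta>)"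
    unfolding commuting_def
  proof (intro ballI impI)
    fix \<gamma> \<delta> assume e: "{\<gamma>, \<delta>} \<in> E"
    then have e': "{\<delta>, \<gamma>} \<in> E" by (simp add: insert_commute)
    show "A \<gamma> \<alpha> * A \<delta> \<beta> = A \<delta> \<alpha> * A \<gamma> \<beta>"
      using zero[OF _ e] zero[OF _ e'] by (cases "\<alpha> = \<beta>") auto
  qed
  then show "bracket L (q (pvec (\<lambda>\<gamma>. A \<gamma> \<alpha>))) (q (pvec (\<lambda>\<gamma>. A \<gamma> \<beta>))) = \<zero>\<^bsub>L\<^esub>"
    by (rule bracket_commuting)
qed (auto intro: pvec_closed)

end

section \<open>Right-normed words\<close>

context graph_nilpotent
begin

fun rword where
  "rword [] = \<zero>\<^bsub>L\<^esub>"
| "rword [\<alpha>] = gen \<alpha>"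
| "rword (\<alpha> # \<beta> # w) = bracket L (gen \<alpha>) (rword (\<beta> # w))"

lemma rword_Cons: "w \<noteq> [] \<Longrightarrow> rword (\<alpha> # w) = bracket L (gen \<alpha>) (rword w)"
  by (cases w) auto

lemma rword_closed: "set w \<subseteq> S \<Longrightarrow> rword w \<in> carrier L"
  by (induction w rule: rword.induct) (auto intro: gen_closed L.bracket_closed)

lemma rword_lower_central: "\<lbrakk>set w \<subseteq> S; w \<noteq> []\<rbrakk> \<Longrightarrow> rword w \<in> lower_central L (length w)"
proof (induction w rule: rword.induct)
  case (2 \<alpha>)
  then show ?case by (simp add: gen_closed)
next
  case (3 \<alpha> \<beta> w)
  have "bracket L (gen \<alpha>) (rword (\<beta> # w)) \<in> lower_central L (Suc (length (\<beta> # w)))"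
    using 3 by (intro L.bracket_in_lower_central) (auto intro: gen_closed)
  then show ?case by simp
qed simp

lemma long_rword: assumes "set w \<subseteq> S" "length w > c" shows "rword w = \<zero>\<^bsub>L\<^esub>"
proof -
  have "lower_central L (length w) \<subseteq> lower_central L (c + 1)"
    using lift_Suc_antimono_le[of "lower_central L" "c + 1" "length w", OF L.lower_central_antimono] assms(2) by simp
  moreover have "w \<noteq> []" using assms(2) by auto
  ultimately have "rword w \<in> {\<zero>\<^bsub>L\<^esub>}"
    using rword_lower_central[OF assms(1)] unfolding nilpotent_lower_central[symmetric, of S E c] by blast
  then show ?thesis by simp
qed

definition words where "words = L.span (rword ` {w. set w \<subseteq> S \<and> w \<noteq> []})"

lemma words_carrier: "rword ` {w. set w \<subseteq> S \<and> w \<noteq> []} \<subseteq> carrier L"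
  by (auto intro: rword_closed)

lemma words_submodule: "LinearCombinations.submodule rat_field words L"
  unfolding words_def by (rule L.span_submodule[OF words_carrier])

lemma
  shows words_subset: "words \<subseteq> carrier L"
    and words_zero: "\<zero>\<^bsub>L\<^esub> \<in> words"
    and words_add: "\<lbrakk>x \<in> words; y \<in> words\<rbrakk> \<Longrightarrow> x \<oplus>\<^bsub>L\<^esub> y \<in> words"
    and words_smult: "x \<in> words \<Longrightarrow> r \<odot>\<^bsub>L\<^esub> x \<in> words"
  using words_submodule unfolding L.submodule_iff by auto

lemma rword_in_words: "\<lbrakk>set w \<subseteq> S; w \<noteq> []\<rbrakk> \<Longrightarrow> rword w \<in> words"
  unfolding words_def using L.span_superset[OF words_carrier] by blast

lemma words_minimal:
  assumes "LinearCombinations.submodule rat_field N L" "\<And>w. \<lbrakk>set w \<subseteq> S; w \<noteq> []\<rbrakk> \<Longrightarrow> rword w \<in> N"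
  shows "words \<subseteq> N"
  unfolding words_def using assms by (intro L.span_minimal) auto

lemma bracket_gen_words: assumes \<alpha>: "\<alpha> \<in> S" and Y: "Y \<in> words" shows "bracket L (gen \<alpha>) Y \<in> words"
proof -
  have a: "gen \<alpha> \<in> carrier L" using \<alpha> by (rule gen_closed)
  let ?N = "{y \<in> carrier L. bracket L (gen \<alpha>) y \<in> words}"
  have "words \<subseteq> ?N"
  proof (rule words_minimal)
    show "LinearCombinations.submodule rat_field ?N L"
      unfolding L.submodule_iff
      using a words_zero words_add words_smult
      by (auto simp: L.bracket_zero_right L.bracket_add_right L.bracket_smult_right)
    show "rword w \<in> ?N" if "set w \<subseteq> S" "w \<noteq> []" for w
      using that \<alpha> rword_in_words[of "\<alpha> # w"] by (simp add: rword_Cons rword_closed)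
  qed
  then show ?thesis using Y by auto
qed

text \<open>By the Jacobi identity, bracketing with \<open>[\<alpha>, u]\<close> is the commutator
  of bracketing with \<open>\<alpha>\<close> and with the shorter word \<open>u\<close>. This is
  what makes the right-normed words span the whole algebra.\<close>

lemma bracket_rword: "\<lbrakk>set w \<subseteq> S; w \<noteq> []; Y \<in> words\<rbrakk> \<Longrightarrow> bracket L (rword w) Y \<in> words"
proof (induction w arbitrary: Y rule: rword.induct)
  case (2 \<alpha>)
  then show ?case using bracket_gen_words by simp
next
  case (3 \<alpha> \<beta> w)
  let ?u = "rword (\<beta> # w)"
  have a: "gen \<alpha> \<in> carrier L" and u: "?u \<in> carrier L" and Y: "Y \<in> carrier L"
    using 3 gen_closed rword_closed words_subset by auto
  have u_words: "bracket L ?u Z \<in> words" if "Z \<in> words" for Z using 3 that by simp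
  have a_words: "bracket L (gen \<alpha>) Z \<in> words" if "Z \<in> words" for Z using 3 that bracket_gen_words by simp
  have P: "bracket L (gen \<alpha>) (bracket L ?u Y) \<in> words" using a_words u_words 3 by blast
  have "bracket L ?u (bracket L Y (gen \<alpha>)) = (- 1) \<odot>\<^bsub>L\<^esub> bracket L ?u (bracket L (gen \<alpha>) Y)"
    using L.bracket_anticomm[OF a Y] a u Y by (simp add: L.bracket_smult_right L.bracket_closed)
  then have Q: "bracket L ?u (bracket L Y (gen \<alpha>)) \<in> words"
    using words_smult u_words a_words 3 by simp
  let ?Z = "bracket L Y (bracket L (gen \<alpha>) ?u)"
  let ?PQ = "bracket L (gen \<alpha>) (bracket L ?u Y) \<oplus>\<^bsub>L\<^esub> bracket L ?u (bracket L Y (gen \<alpha>))"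
  have PQ: "?PQ \<in> words" using words_add P Q by blast
  have Zc: "?Z \<in> carrier L" using a u Y by (simp add: L.bracket_closed)
  have "\<ominus>\<^bsub>L\<^esub> ?Z = ?PQ"
    by (rule L.minus_equality[OF L.jacobi[OF a u Y] Zc]) (use PQ words_subset in blast)
  then have "(- 1) \<odot>\<^bsub>L\<^esub> ?Z \<in> words" using PQ by (simp only: L.smult_minus_one[OF Zc])
  moreover have "bracket L (rword (\<alpha> # \<beta> # w)) Y = (- 1) \<odot>\<^bsub>L\<^esub> ?Z"
    using L.bracket_anticomm[OF Y L.bracket_closed[OF a u]] by simp
  ultimately show ?case by simp
qed simp

lemma words_carrier_eq: "words = carrier L"
proof
  have br: "bracket L X Y \<in> words" if "X \<in> words" "Y \<in> words" for X Y
  proof -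
    let ?N = "{x \<in> carrier L. bracket L x Y \<in> words}"
    have Y: "Y \<in> carrier L" using that words_subset by blast
    have "words \<subseteq> ?N"
    proof (rule words_minimal)
      show "LinearCombinations.submodule rat_field ?N L"
        unfolding L.submodule_iff
        using Y words_zero words_add words_smult
        by (auto simp: L.bracket_zero_left L.bracket_add_left L.bracket_smult_left)
      show "rword w \<in> ?N" if "set w \<subseteq> S" "w \<noteq> []" for w
        using that bracket_rword[OF that \<open>Y \<in> words\<close>] by (simp add: rword_closed)
    qed
    then show ?thesis using that by auto
  qed
  show "carrier L \<subseteq> words"
  proof
    fix X assume "X \<in> carrier L"
    then show "X \<in> words"
    proof (induction rule: L_induct)
      case (gen \<alpha>)
      then show ?case using rword_in_words[of "[\<alpha>]"] by simp
    qed (simp_all add: br words_add words_smult words_zero)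
  qed
qed (rule words_subset)

section \<open>Finite dimension and surjective endomorphisms\<close>

lemma fin_dim: "L.fin_dim"
proof -
  let ?A = "rword ` {w. set w \<subseteq> S \<and> length w \<le> c}"
  have fin: "finite ?A" using finite_lists_length_le[OF finS] by simp
  have sub: "?A \<subseteq> carrier L" by (auto intro: rword_closed)
  have "words \<subseteq> L.span ?A"
  proof (rule words_minimal[OF L.span_submodule[OF sub]])
    fix w assume w: "set w \<subseteq> S" "w \<noteq> []"
    show "rword w \<in> L.span ?A"
    proof (cases "length w \<le> c")
      case True
      then show ?thesis using L.span_superset[OF sub] w by blast
    next
      case False
      then have "rword w = \<zero>\<^bsub>L\<^esub>" using long_rword w by simp
      then show ?thesis using L.span_submodule[OF sub] unfolding L.submodule_iff by simp
    qed
  qed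
  then have "L.span ?A = carrier L" using words_carrier_eq L.span_is_subset2[OF sub] by blast
  then show ?thesis unfolding L.fin_dim_def using fin sub by blast
qed

lemma matrix_exists:
  assumes f: "f \<in> LinearCombinations.module_hom rat_field L L"
  obtains A where "matrix_of L f A"
proof -
  obtain B where B: "finite B" "L.basis B" using L.finite_basis_exists[OF fin_dim] by blast
  obtain bs where bs: "set bs = B" "distinct bs" using finite_distinct_list[OF B(1)] by blast
  have Bc: "B \<subseteq> carrier L" and sp: "L.span B = carrier L" using B(2) by (auto simp: L.basis_def)
  have ex: "\<exists>a. f x = L.lincomb a B" if "x \<in> carrier L" for x
  proof -
    have "f x \<in> L.span B" using that f unfolding sp by (auto simp: LinearCombinations.module_hom_def)
    then show ?thesis using L.finite_in_span[OF B(1) Bc] by metis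
  qed
  define a where "a = (\<lambda>x. SOME a. f x = L.lincomb a B)"
  have a: "f x = L.lincomb (a x) B" if "x \<in> carrier L" for x
    unfolding a_def by (rule someI_ex[OF ex[OF that]])
  define A where "A = Matrix.mat (length bs) (length bs) (\<lambda>(i, j). a (bs ! j) (bs ! i))"
  have "matrix_of L f A"
    unfolding matrix_of_def
  proof (intro exI[of _ bs] conjI allI impI)
    show "distinct bs" "L.basis (set bs)" "A \<in> carrier_mat (length bs) (length bs)"
      using bs B by (simp_all add: A_def)
    fix j assume j: "j < length bs"
    have img: "B = (!) bs ` {..<length bs}" using bs(1) by (auto simp: set_conv_nth)
    have inj: "inj_on ((!) bs) {..<length bs}" using bs(2) by (simp add: inj_on_nth)
    have "bs ! j \<in> carrier L" using j bs(1) Bc by auto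
    then have "f (bs ! j) = (\<Oplus>\<^bsub>L\<^esub>v\<in>B. a (bs ! j) v \<odot>\<^bsub>L\<^esub> v)"
      unfolding L.lincomb_def[symmetric] by (rule a)
    also have "\<dots> = (\<Oplus>\<^bsub>L\<^esub>i\<in>{..<length bs}. a (bs ! j) (bs ! i) \<odot>\<^bsub>L\<^esub> (bs ! i))"
      unfolding img by (rule L.finsum_reindex[OF _ inj]) (use Bc img in auto)
    also have "\<dots> = (\<Oplus>\<^bsub>L\<^esub>i\<in>{..<length bs}. A $$ (i, j) \<odot>\<^bsub>L\<^esub> (bs ! i))"
      using j Bc img by (intro L.finsum_cong') (auto simp: A_def)
    finally show "f (bs ! j) = (\<Oplus>\<^bsub>L\<^esub>i\<in>{..<length bs}. A $$ (i, j) \<odot>\<^bsub>L\<^esub> (bs ! i))" .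
  qed
  then show thesis by (rule that)
qed

text \<open>A nonzero kernel vector can be exchanged into a generating set with at most
  \<open>dim - 1\<close> further members. The images of those would generate the image, hence the
  whole space.\<close>

lemma surjective_imp_bij:
  assumes f: "f \<in> LinearCombinations.module_hom rat_field L L" and surj: "f ` carrier L = carrier L"
  shows "bij_betw f (carrier L) (carrier L)"
proof -
  have fc: "f x \<in> carrier L" if "x \<in> carrier L" for x using f that by (auto simp: LinearCombinations.module_hom_def)
  have fa: "f (x \<oplus>\<^bsub>L\<^esub> y) = f x \<oplus>\<^bsub>L\<^esub> f y" if "x \<in> carrier L" "y \<in> carrier L" for x y
    using f that by (auto simp: LinearCombinations.module_hom_def)
  have fs: "f (r \<odot>\<^bsub>L\<^esub> x) = r \<odot>\<^bsub>L\<^esub> f x" if "x \<in> carrier L" for x r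
    using f that by (auto simp: LinearCombinations.module_hom_def)
  have ker: "x = \<zero>\<^bsub>L\<^esub>" if x: "x \<in> carrier L" "f x = \<zero>\<^bsub>L\<^esub>" for x
  proof (rule ccontr)
    assume nz: "x \<noteq> \<zero>\<^bsub>L\<^esub>"
    have "a = 0" if "a \<odot>\<^bsub>L\<^esub> x = \<zero>\<^bsub>L\<^esub>" for a :: rat
    proof (rule ccontr)
      assume "a \<noteq> 0"
      then have "x = (inverse a * a) \<odot>\<^bsub>L\<^esub> x" using L.smult_one[OF x(1)] by simp
      also have "\<dots> = inverse a \<odot>\<^bsub>L\<^esub> (a \<odot>\<^bsub>L\<^esub> x)"
        using L.smult_assoc1[of "inverse a" a x] x(1) by simp
      also have "\<dots> = \<zero>\<^bsub>L\<^esub>" using L.smult_r_null[of "inverse a"] that by simp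
      finally show False using nz by simp
    qed
    then have li: "\<not> L.lin_dep {x}"
      using x(1) by (intro L.finite_lin_indpt2) (auto simp: L.lincomb_def)
    obtain B where B: "finite B" "L.basis B" using L.finite_basis_exists[OF fin_dim] by blast
    have Bc: "B \<subseteq> carrier L" and sp: "L.span B = carrier L" using B(2) by (auto simp: L.basis_def)
    obtain C where C: "finite C" "C \<subseteq> carrier L" "int (card C) \<le> int (card B) - int (card {x})" "L.span ({x} \<union> C) = carrier L"
    proof -
      have "{x} \<subseteq> L.span B" using x(1) sp by simp
      from L.replacement[OF finite.insertI[OF finite.emptyI] B(1) Bc li this]
      obtain C where "finite C" "C \<subseteq> carrier L" "int (card C) \<le> int (card B) - int (card {x})" "L.span ({x} \<union> C) = L.span B"
        by (elim exE conjE)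
      then show thesis by (intro that) (simp_all only: sp)
    qed
    have fC: "f ` C \<subseteq> carrier L" using C(2) fc by auto
    note sm = L.span_submodule[OF fC, unfolded L.submodule_iff]
    let ?N = "{v \<in> carrier L. f v \<in> L.span (f ` C)}"
    have "L.span ({x} \<union> C) \<subseteq> ?N"
    proof (rule L.span_minimal)
      have f0: "f \<zero>\<^bsub>L\<^esub> = \<zero>\<^bsub>L\<^esub>" using fs[OF L.zero_closed, of 0] fc by simp
      show "LinearCombinations.submodule rat_field ?N L"
        unfolding L.submodule_iff using sm f0 by (auto simp: fa fs)
      show "{x} \<union> C \<subseteq> ?N" using x C(2) sm L.span_superset[OF fC] by auto
    qed
    then have "f ` carrier L \<subseteq> L.span (f ` C)" unfolding C(4) by auto
    then have "L.span (f ` C) = carrier L" using surj sm by auto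
    then have "L.dim \<le> card (f ` C)" using L.gen_ge_dim[OF finite_imageI[OF C(1)] fC] by simp
    moreover have "L.dim = card B" using L.dim_basis[OF B] .
    moreover have "card (f ` C) \<le> card C" using C(1) by (rule card_image_le)
    ultimately show False using C(3) by simp
  qed
  have "inj_on f (carrier L)"
  proof (rule inj_onI)
    fix x y assume xy: "x \<in> carrier L" "y \<in> carrier L" "f x = f y"
    have c: "(- 1) \<odot>\<^bsub>L\<^esub> y \<in> carrier L" "\<ominus>\<^bsub>L\<^esub> y \<in> carrier L"
      using xy(2) by (simp_all add: L.smult_minus_one)
    have "f (x \<oplus>\<^bsub>L\<^esub> (- 1) \<odot>\<^bsub>L\<^esub> y) = f y \<oplus>\<^bsub>L\<^esub> (- 1) \<odot>\<^bsub>L\<^esub> f y"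
      by (simp only: fa[OF xy(1) c(1)] fs[OF xy(2)] xy(3))
    also have "\<dots> = \<zero>\<^bsub>L\<^esub>" using fc[OF xy(2)] by (simp only: L.smult_minus_one L.r_neg)
    finally have "x \<oplus>\<^bsub>L\<^esub> \<ominus>\<^bsub>L\<^esub> y = \<zero>\<^bsub>L\<^esub>"
      using ker[of "x \<oplus>\<^bsub>L\<^esub> (- 1) \<odot>\<^bsub>L\<^esub> y"] xy(1) c(1) L.smult_minus_one[OF xy(2)] by (simp only: L.a_closed)
    then show "x = y" using L.minus_equality[OF _ c(2) xy(1)] by (simp only: L.minus_minus[OF xy(2)])
  qed
  then show ?thesis using surj by (simp add: bij_betw_def)
qed

lemma rword_last_edge:
  "\<lbrakk>set (u @ [\<alpha>, \<beta>]) \<subseteq> S; rword (u @ [\<alpha>, \<beta>]) \<noteq> \<zero>\<^bsub>L\<^esub>\<rbrakk> \<Longrightarrow> {\<alpha>, \<beta>} \<in> E"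
proof (induction u)
  case Nil
  then show ?case using gen_nonedge[of \<alpha> \<beta>] by auto
next
  case (Cons \<gamma> u)
  then have "rword (u @ [\<alpha>, \<beta>]) \<noteq> \<zero>\<^bsub>L\<^esub>"
    using L.bracket_zero_right[OF gen_closed[of \<gamma>]] by (auto simp: rword_Cons)
  then show ?case using Cons by simp
qed

lemma clin_nonzero_rword:
  assumes \<phi>: "clin L \<phi>" and x: "x \<in> carrier L" "\<phi> x \<noteq> 0"
  obtains w where "set w \<subseteq> S" "w \<noteq> []" "\<phi> (rword w) \<noteq> 0"
proof -
  have "\<exists>w. set w \<subseteq> S \<and> w \<noteq> [] \<and> \<phi> (rword w) \<noteq> 0"
  proof (rule ccontr)
    assume "\<not> ?thesis"
    then have "\<phi> (rword w) = 0" if "set w \<subseteq> S" "w \<noteq> []" for w using that by blast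
    moreover have "LinearCombinations.submodule rat_field {x \<in> carrier L. \<phi> x = 0} L"
      using \<phi> L.clin_zero[OF \<phi>] unfolding L.submodule_iff clin_def by simp
    ultimately have "words \<subseteq> {x \<in> carrier L. \<phi> x = 0}" by (intro words_minimal) (simp_all add: rword_closed)
    then show False using x words_carrier_eq by auto
  qed
  then show thesis using that by blast
qed

end

section \<open>Commuting operators on words\<close>

text \<open>Apply the linear factors one after the other. The last nonzero function before
  annihilation is an eigenvector, and \<open>Q\<close> holds for it because every factor preserves
  \<open>Q\<close>.\<close>

lemma eigen_step:
  assumes T: "lin_op T" and closed: "\<And>\<Psi> a. Q \<Psi> \<Longrightarrow> Q (\<lambda>w. T \<Psi> w - a * \<Psi> w)"
  shows "\<lbrakk>pact T (\<Prod>a\<leftarrow>as. [:- a, 1:]) \<Psi> = (\<lambda>_. 0); \<Psi> \<noteq> (\<lambda>_. 0); Q \<Psi>\<rbrakk>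
    \<Longrightarrow> \<exists>\<Psi>' a. \<Psi>' \<noteq> (\<lambda>_. 0) \<and> Q \<Psi>' \<and> a \<in> set as \<and> T \<Psi>' = (\<lambda>w. a * \<Psi>' w)"
proof (induction as arbitrary: \<Psi>)
  case Nil
  then show ?case by (simp add: pact_1[OF T])
next
  case (Cons a as)
  let ?\<Psi> = "\<lambda>w. T \<Psi> w - a * \<Psi> w"
  show ?case
  proof (cases "?\<Psi> = (\<lambda>_. 0)")
    case True
    then have "T \<Psi> = (\<lambda>w. a * \<Psi> w)" by (simp add: fun_eq_iff)
    then show ?thesis using Cons.prems by (intro exI[of _ \<Psi>] exI[of _ a]) simp
  next
    case False
    have lin: "pact T [:- a, 1:] \<Psi> = ?\<Psi>"
      by (simp add: pact_pCons[OF T] lin_op_zero[OF T] fun_eq_iff)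
    have "pact T (\<Prod>a\<leftarrow>as. [:- a, 1:]) ?\<Psi> = pact T ((\<Prod>a\<leftarrow>as. [:- a, 1:]) * [:- a, 1:]) \<Psi>"
      unfolding pact_mult[OF T] lin ..
    also have "\<dots> = (\<lambda>_. 0)" using Cons.prems(1) by (simp only: list.map prod_list.Cons mult.commute)
    finally show ?thesis using Cons.IH[OF _ False closed[OF Cons.prems(3)]] by auto
  qed
qed

text \<open>Diagonalize one operator at a time. The invariant \<open>Q\<close> records the
  annihilating polynomials and the eigenvalue \<open>z\<close> of the composition; as all operators
  commute, it survives each step along with the eigenvalues already found. For the final eigenvector
  \<open>z\<close> can be read off as a product.\<close>

lemma simultaneous_eigenvector:
  fixes T :: "nat \<Rightarrow> ('w \<Rightarrow> complex) \<Rightarrow> 'w \<Rightarrow> complex"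
  assumes lin: "\<And>i. lin_op (T i)" and com: "\<And>i j g. T i (T j g) = T j (T i g)"
    and ann: "\<And>i. i < k \<Longrightarrow> pact (T i) (\<Prod>a\<leftarrow>as i. [:- a, 1:]) \<Phi> = (\<lambda>_. 0)"
    and nz: "\<Phi> \<noteq> (\<lambda>_. 0)" and ev: "foldr T [0..<k] \<Phi> = (\<lambda>w. z * \<Phi> w)"
  shows "\<exists>a. (\<forall>i<k. a i \<in> set (as i)) \<and> z = (\<Prod>i<k. a i)"
proof -
  define Q where "Q \<Psi> \<longleftrightarrow> (\<forall>i<k. pact (T i) (\<Prod>a\<leftarrow>as i. [:- a, 1:]) \<Psi> = (\<lambda>_. 0)) \<and>
      foldr T [0..<k] \<Psi> = (\<lambda>w. z * \<Psi> w)" for \<Psi>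
  have T_diff: "T j (\<lambda>w. g w - b * h w) = (\<lambda>w. T j g w - b * T j h w)" for j b g h
    using lin_op_add[OF lin, of j g "\<lambda>w. (- b) * h w"] lin_op_scale[OF lin, of j "- b" h] by simp
  have lin_D: "lin_op (\<lambda>g w. T n g w - b * g w)" for n b
    unfolding lin_op_def by (simp add: lin_op_add[OF lin] lin_op_scale[OF lin] algebra_simps)
  have closed: "Q (\<lambda>w. T n \<Psi> w - b * \<Psi> w)" if "Q \<Psi>" for \<Psi> n b
  proof -
    have "pact (T i) (\<Prod>a\<leftarrow>as i. [:- a, 1:]) (\<lambda>w. T n \<Psi> w - b * \<Psi> w) = (\<lambda>_. 0)" if "i < k" for i
    proof -
      have "pact (T i) (\<Prod>a\<leftarrow>as i. [:- a, 1:]) (\<lambda>w. T n \<Psi> w - b * \<Psi> w) =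
          (\<lambda>w. T n (pact (T i) (\<Prod>a\<leftarrow>as i. [:- a, 1:]) \<Psi>) w - b * pact (T i) (\<Prod>a\<leftarrow>as i. [:- a, 1:]) \<Psi> w)"
        by (rule pact_commute[where U = "\<lambda>g w. T n g w - b * g w", OF lin lin_D]) (simp only: T_diff com[of n i])
      then show ?thesis using \<open>Q \<Psi>\<close> that lin_op_zero[OF lin] by (simp add: Q_def)
    qed
    moreover have "foldr T is (\<lambda>w. T n \<Psi> w - b * \<Psi> w) = (\<lambda>w. T n (foldr T is \<Psi>) w - b * foldr T is \<Psi> w)" for "is"
      by (induction "is") (simp_all add: T_diff com[of n])
    ultimately show ?thesis
      using \<open>Q \<Psi>\<close> by (simp add: Q_def lin_op_scale[OF lin] algebra_simps)
  qed
  have "\<exists>\<Psi> a. \<Psi> \<noteq> (\<lambda>_. 0) \<and> Q \<Psi> \<and> (\<forall>i<n. a i \<in> set (as i) \<and> T i \<Psi> = (\<lambda>w. a i * \<Psi> w))" if "n \<le> k" for n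
    using that
  proof (induction n)
    case 0
    have "Q \<Phi>" using ann ev by (simp add: Q_def)
    then show ?case using nz by auto
  next
    case (Suc n)
    then obtain \<Psi> a where 1: "\<Psi> \<noteq> (\<lambda>_. 0)" "Q \<Psi>" "\<forall>i<n. a i \<in> set (as i)" "\<forall>i<n. T i \<Psi> = (\<lambda>w. a i * \<Psi> w)"
      by auto
    let ?Q = "\<lambda>\<Psi>. Q \<Psi> \<and> (\<forall>i<n. T i \<Psi> = (\<lambda>w. a i * \<Psi> w))"
    have cl: "?Q (\<lambda>w. T n \<Psi> w - b * \<Psi> w)" if "?Q \<Psi>" for \<Psi> b
    proof (intro conjI allI impI)
      show "Q (\<lambda>w. T n \<Psi> w - b * \<Psi> w)" using that closed by blast
      fix i assume "i < n"
      then have i: "T i \<Psi> = (\<lambda>w. a i * \<Psi> w)" using that by blast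
      show "T i (\<lambda>w. T n \<Psi> w - b * \<Psi> w) = (\<lambda>w. a i * (T n \<Psi> w - b * \<Psi> w))"
        by (simp only: T_diff com[of i n] i lin_op_scale[OF lin] right_diff_distrib mult.left_commute)
    qed
    have "pact (T n) (\<Prod>a\<leftarrow>as n. [:- a, 1:]) \<Psi> = (\<lambda>_. 0)" using 1(2) Suc.prems by (simp add: Q_def)
    from eigen_step[where Q = ?Q, OF lin cl this 1(1)] 1(2,4)
    obtain \<Psi>' b where 2: "\<Psi>' \<noteq> (\<lambda>_. 0)" "?Q \<Psi>'" "b \<in> set (as n)" "T n \<Psi>' = (\<lambda>w. b * \<Psi>' w)"
      by blast
    show ?case
      using 1(3) 2 by (intro exI[of _ \<Psi>'] exI[of _ "a(n := b)"]) (auto simp: less_Suc_eq)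
  qed
  then obtain \<Psi> a where *: "\<Psi> \<noteq> (\<lambda>_. 0)" "Q \<Psi>" "\<forall>i<k. a i \<in> set (as i)" "\<forall>i<k. T i \<Psi> = (\<lambda>w. a i * \<Psi> w)"
    by blast
  have "set is \<subseteq> {..<k} \<Longrightarrow> foldr T is \<Psi> = (\<lambda>w. prod_list (map a is) * \<Psi> w)" for "is"
    by (induction "is") (use *(4) in \<open>simp_all add: lin_op_scale[OF lin] mult.left_commute mult.assoc\<close>)
  from this[of "[0..<k]"] have "foldr T [0..<k] \<Psi> = (\<lambda>w. (\<Prod>i<k. a i) * \<Psi> w)"
    using prod.distinct_set_conv_list[of "[0..<k]" a] by (simp add: atLeast0LessThan)
  then have "(\<lambda>w. z * \<Psi> w) = (\<lambda>w. (\<Prod>i<k. a i) * \<Psi> w)" using *(2) by (simp add: Q_def)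
  moreover obtain w where "\<Psi> w \<noteq> 0" using *(1) by auto
  ultimately have "z = (\<Prod>i<k. a i)" by (metis mult_right_cancel)
  then show ?thesis using *(3) by blast
qed

text \<open>The transpose of \<open>A\<close> acting on letter \<open>i\<close> only. It is defined
  on functions of words because acting on one letter need not respect the relations of
  \<open>L\<close>, whereas letters of a word are independent and the slots commute.\<close>

definition slot :: "'v set \<Rightarrow> ('v \<Rightarrow> 'v \<Rightarrow> complex) \<Rightarrow> nat \<Rightarrow> ('v list \<Rightarrow> complex) \<Rightarrow> 'v list \<Rightarrow> complex" where
  "slot S A i \<Phi> w = (\<Sum>\<gamma>\<in>S. A \<gamma> (w ! i) * \<Phi> (w[i := \<gamma>]))"

lemma lin_op_slot: "lin_op (slot S A i)"
  by (simp add: lin_op_def slot_def fun_eq_iff algebra_simps sum.distrib sum_distrib_left)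

lemma slot_commute: "slot S A i (slot S A j g) = slot S A j (slot S A i g)"
proof (cases "i = j")
  case False
  then have "slot S A i (slot S A j g) w = (\<Sum>\<gamma>\<in>S. \<Sum>\<delta>\<in>S. A \<gamma> (w ! i) * (A \<delta> (w ! j) * g (w[i := \<gamma>, j := \<delta>])))" for w
    by (simp add: slot_def sum_distrib_left)
  also have "\<dots> w = (\<Sum>\<delta>\<in>S. \<Sum>\<gamma>\<in>S. A \<gamma> (w ! i) * (A \<delta> (w ! j) * g (w[i := \<gamma>, j := \<delta>])))" for w
    by (rule sum.swap)
  also have "\<dots> w = slot S A j (slot S A i g) w" for w
    using False by (simp add: slot_def sum_distrib_left list_update_swap[of i j] mult_ac)
  finally show ?thesis by (simp add: fun_eq_iff)
qed simp

lemma slot_foldr_Cons: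
  "foldr (slot S A) (map Suc is) \<Phi> (\<gamma> # w) = foldr (slot S A) is (\<lambda>w. \<Phi> (\<gamma> # w)) w"
  by (induction "is" arbitrary: w) (simp_all add: slot_def)

lemma slot_foldr_cong:
  assumes "\<And>w'. \<lbrakk>set w' \<subseteq> S; length w' = length w\<rbrakk> \<Longrightarrow> \<Phi> w' = \<Phi>' w'" "set w \<subseteq> S"
  shows "foldr (slot S A) is \<Phi> w = foldr (slot S A) is \<Phi>' w"
  using assms
proof (induction "is" arbitrary: w)
  case (Cons i "is")
  have "foldr (slot S A) is \<Phi> (w[i := \<gamma>]) = foldr (slot S A) is \<Phi>' (w[i := \<gamma>])" if "\<gamma> \<in> S" for \<gamma>
    using Cons.prems that set_update_subset_insert[of w i \<gamma>] by (intro Cons.IH) auto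
  then show ?case by (simp add: slot_def[of S A i])
qed simp

text \<open>At a word whose letter \<open>i\<close> is \<open>\<alpha>\<close>, the operator minus
  \<open>a \<alpha>\<close> gives \<open>s \<alpha>\<close> times the value at the word with that
  letter moved to \<open>\<sigma> \<alpha>\<close>. Successive factors walk along the orbit of
  \<open>\<sigma>\<close>.\<close>

lemma slot_cycle:
  fixes a s :: "'v \<Rightarrow> complex"
  assumes S: "finite S" "\<And>\<alpha>. \<alpha> \<in> S \<Longrightarrow> \<sigma> \<alpha> \<in> S"
    and A: "\<And>\<alpha> \<gamma>. \<alpha> \<in> S \<Longrightarrow> A \<gamma> \<alpha> = (if \<gamma> = \<alpha> then a \<alpha> else 0) + (if \<gamma> = \<sigma> \<alpha> then s \<alpha> else 0)"
  shows "\<lbrakk>i < length w; w ! i = \<alpha>; \<alpha> \<in> S\<rbrakk> \<Longrightarrow>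
    pact (slot S A i) (\<Prod>j<n. [:- a ((\<sigma> ^^ j) \<alpha>), 1:]) \<Phi> w =
      (\<Prod>j<n. s ((\<sigma> ^^ j) \<alpha>)) * \<Phi> (w[i := (\<sigma> ^^ n) \<alpha>])"
proof (induction n arbitrary: \<alpha> w)
  case 0
  then show ?case by (auto simp: pact_1[OF lin_op_slot])
next
  case (Suc n)
  let ?T = "slot S A i" and ?P = "\<Prod>j<n. [:- a ((\<sigma> ^^ j) (\<sigma> \<alpha>)), 1:]"
  have val: "?T \<Psi> w = a \<alpha> * \<Psi> w + s \<alpha> * \<Psi> (w[i := \<sigma> \<alpha>])" for \<Psi>
  proof -
    have "?T \<Psi> w = (\<Sum>\<gamma>\<in>S. (if \<gamma> = \<alpha> then a \<alpha> * \<Psi> (w[i := \<gamma>]) else 0) + (if \<gamma> = \<sigma> \<alpha> then s \<alpha> * \<Psi> (w[i := \<gamma>]) else 0))"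
      unfolding slot_def using Suc.prems by (intro sum.cong) (auto simp: A algebra_simps)
    also have "\<dots> = a \<alpha> * \<Psi> (w[i := \<alpha>]) + s \<alpha> * \<Psi> (w[i := \<sigma> \<alpha>])"
      using S Suc.prems(3) by (simp add: sum.distrib)
    also have "w[i := \<alpha>] = w" using Suc.prems by auto
    finally show ?thesis .
  qed
  have "(\<Prod>j<Suc n. [:- a ((\<sigma> ^^ j) \<alpha>), 1:]) = [:- a \<alpha>, 1:] * ?P"
    by (subst prod.lessThan_Suc_shift) (simp only: funpow_Suc_right o_def funpow.simps id_apply)
  then have "pact ?T (\<Prod>j<Suc n. [:- a ((\<sigma> ^^ j) \<alpha>), 1:]) \<Phi> w = pact ?T [:- a \<alpha>, 1:] (pact ?T ?P \<Phi>) w"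
    by (simp only: pact_mult[OF lin_op_slot])
  also have "\<dots> = s \<alpha> * pact ?T ?P \<Phi> (w[i := \<sigma> \<alpha>])"
    by (simp add: pact_pCons[OF lin_op_slot] lin_op_zero[OF lin_op_slot] val)
  also have "pact ?T ?P \<Phi> (w[i := \<sigma> \<alpha>]) = (\<Prod>j<n. s ((\<sigma> ^^ j) (\<sigma> \<alpha>))) * \<Phi> (w[i := \<sigma> \<alpha>, i := (\<sigma> ^^ n) (\<sigma> \<alpha>)])"
    using Suc.prems S by (intro Suc.IH) auto
  also have "s \<alpha> * \<dots> = (\<Prod>j<Suc n. s ((\<sigma> ^^ j) \<alpha>)) * \<Phi> (w[i := (\<sigma> ^^ Suc n) \<alpha>])"
    by (subst prod.lessThan_Suc_shift)
      (simp only: funpow_Suc_right o_def funpow.simps id_apply list_update_overwrite mult.assoc)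
  finally show ?case .
qed

lemma cyclic_successor:
  assumes part: "partition_on S P" and fin: "finite S"
  obtains \<sigma> where "\<And>l \<alpha>. \<lbrakk>l \<in> P; \<alpha> \<in> l\<rbrakk> \<Longrightarrow> \<sigma> \<alpha> \<in> l"
    "\<And>l \<alpha>. \<lbrakk>l \<in> P; \<alpha> \<in> l\<rbrakk> \<Longrightarrow> bij_betw (\<lambda>j. (\<sigma> ^^ j) \<alpha>) {..<card l} l"
    "\<And>l \<alpha>. \<lbrakk>l \<in> P; \<alpha> \<in> l\<rbrakk> \<Longrightarrow> (\<sigma> ^^ card l) \<alpha> = \<alpha>"
proof -
  have fl: "finite l" if "l \<in> P" for l using part fin that by (auto simp: partition_on_def intro: finite_subset)
  have "\<exists>e. bij_betw e {..<card l} l" if "l \<in> P" for l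
    using ex_bij_betw_nat_finite[OF fl[OF that]] by (simp add: atLeast0LessThan)
  then obtain e :: "'a set \<Rightarrow> nat \<Rightarrow> 'a" where e: "\<And>l. l \<in> P \<Longrightarrow> bij_betw (e l) {..<card l} l" by metis
  define blk where "blk \<alpha> = (THE l. l \<in> P \<and> \<alpha> \<in> l)" for \<alpha>
  have blk: "blk \<alpha> = l" if "l \<in> P" "\<alpha> \<in> l" for l \<alpha>
    unfolding blk_def using that part by (intro the_equality) (auto simp: partition_on_def disjoint_def)
  define \<sigma> where "\<sigma> \<alpha> = (let l = blk \<alpha> in e l (Suc (inv_into {..<card l} (e l) \<alpha>) mod card l))" for \<alpha>
  have mem: "e l i \<in> l" if "l \<in> P" "i < card l" for l i
    using e[OF that(1)] that(2) by (auto simp: bij_betw_def)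
  have s: "\<sigma> (e l i) = e l (Suc i mod card l)" if "l \<in> P" "i < card l" for l i
    using blk[OF that(1) mem[OF that]] e[OF that(1)] that(2)
    by (simp add: \<sigma>_def Let_def bij_betw_def inv_into_f_f)
  have pow: "(\<sigma> ^^ j) (e l i) = e l ((i + j) mod card l)" if "l \<in> P" "i < card l" for l i j
  proof (induction j)
    case (Suc j)
    have "(i + j) mod card l < card l" using that(2) by simp
    from s[OF that(1) this] Suc show ?case by (simp add: mod_Suc_eq)
  qed (use that in simp)
  have ex: "\<exists>i<card l. \<alpha> = e l i" if "l \<in> P" "\<alpha> \<in> l" for l \<alpha>
    using e[OF that(1)] that(2) by (auto simp: bij_betw_def)
  show thesis
  proof (rule that)
    fix l \<alpha> assume l: "l \<in> P" "\<alpha> \<in> l"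
    obtain i where i: "i < card l" "\<alpha> = e l i" using ex[OF l] by blast
    show "\<sigma> \<alpha> \<in> l" using s[OF l(1) i(1)] i mem[OF l(1), of "Suc i mod card l"] by simp
    show "(\<sigma> ^^ card l) \<alpha> = \<alpha>" using pow[OF l(1) i(1)] i by simp
    have "bij_betw (\<lambda>j. (i + j) mod card l) {..<card l} {..<card l}"
    proof -
      have "{..<card l} \<subseteq> (\<lambda>j. (i + j) mod card l) ` {..<card l}"
      proof
        fix t assume "t \<in> {..<card l}"
        then show "t \<in> (\<lambda>j. (i + j) mod card l) ` {..<card l}"
          using i(1) by (intro image_eqI[of _ _ "(card l - i + t) mod card l"]) (simp_all add: mod_add_right_eq)
      qed
      then have "inj_on (\<lambda>j. (i + j) mod card l) {..<card l}" by (intro finite_surj_inj) auto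
      moreover have "(\<lambda>j. (i + j) mod card l) ` {..<card l} \<subseteq> {..<card l}" using i(1) by auto
      ultimately show ?thesis by (simp add: bij_betw_def endo_inj_surj)
    qed
    from bij_betw_trans[OF this e[OF l(1)]]
    show "bij_betw (\<lambda>j. (\<sigma> ^^ j) \<alpha>) {..<card l} l"
      using pow[OF l(1) i(1)] i(2) by (simp add: o_def)
  qed
qed

text \<open>The polynomial has integer coefficients, and since one of the \<open>a i\<close> is 0
  its constant coefficient is the added 1.\<close>

lemma shifted_product_roots:
  fixes a :: "'v \<Rightarrow> int" and r :: "'v \<Rightarrow> real"
  assumes fin: "finite l" and i: "i \<in> l" "b \<in> l" "a b = 0"
    and eq: "(\<Prod>i\<in>l. [:- of_int (a i), 1:]) + 1 = (\<Prod>i\<in>l. [:- r i, 1:])"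
  shows "(\<Prod>i\<in>l. [:- of_int (a i), 1:]) + 1 = (\<Prod>i\<in>l. [:- complex_of_real (r i), 1:])"
    and "alg_unit (of_real (r i))"
proof -
  interpret h: map_poly_comm_ring_hom "of_real :: real \<Rightarrow> complex" by unfold_locales
  let ?p = "(\<Prod>i\<in>l. [:- of_int (a i), 1:]) + 1 :: complex poly"
  have "map_poly complex_of_real ((\<Prod>i\<in>l. [:- of_int (a i), 1:]) + 1) = ?p"
    by (simp add: h.hom_add h.hom_prod map_poly_pCons)
  moreover have "map_poly complex_of_real (\<Prod>i\<in>l. [:- r i, 1:]) = (\<Prod>i\<in>l. [:- complex_of_real (r i), 1:])"
    by (simp add: h.hom_prod map_poly_pCons)
  ultimately show p: "?p = (\<Prod>i\<in>l. [:- complex_of_real (r i), 1:])" using eq by simp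
  have int: "?p = map_poly of_int ((\<Prod>i\<in>l. [:- a i, 1:]) + 1)"
    by (simp add: of_int_poly_hom.hom_add of_int_poly_hom.hom_prod map_poly_pCons)
  show "alg_unit (of_real (r i))"
  proof (rule alg_unit_root_monic_int)
    show "coeff ?p n \<in> \<int>" for n unfolding int by (simp add: coeff_map_poly)
    show "lead_coeff ?p = 1" unfolding p by (simp add: lead_coeff_prod)
    have "poly ?p 0 = 1" using i(2,3) fin by (auto simp: poly_prod prod_zero_iff)
    then show "coeff ?p 0 \<in> {1, - 1}" by (simp add: poly_0_coeff_0)
    show "poly ?p (of_real (r i)) = 0" unfolding p using i(1) fin by (auto simp: poly_prod prod_zero_iff)
  qed
qed

context graph_nilpotent
begin

lemma components_partition: "partition_on S \<Lambda>"
  unfolding coherent_components_def by (rule partition_on_quotient[OF coherent_equiv[OF graph]])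

lemma in_component: assumes "\<alpha> \<in> S" obtains l where "l \<in> \<Lambda>" "\<alpha> \<in> l"
  using components_partition assms by (auto simp: partition_on_def)

lemma clin_q_pvec:
  assumes \<phi>: "clin L \<phi>"
  shows "\<phi> (q (pvec x)) = (\<Sum>\<alpha>\<in>S. of_rat (x \<alpha>) * \<phi> (gen \<alpha>))"
proof -
  have single: "Poly_Mapping.single (Gen \<alpha>) (x \<alpha>) = fscale (x \<alpha>) (fgen \<alpha>)" for \<alpha> :: 'v
    by (rule poly_mapping_eqI) (simp add: fgen_def lookup_single when_def)
  have val: "\<phi> (q (Poly_Mapping.single (Gen \<alpha>) (x \<alpha>))) = of_rat (x \<alpha>) * \<phi> (gen \<alpha>)" if "\<alpha> \<in> S" for \<alpha>
    unfolding single q_scale[OF fgen_closed[OF that]] gen_def[symmetric]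
    using \<phi> gen_closed[OF that] by (simp add: clin_def)
  have "I \<subseteq> S \<Longrightarrow> \<phi> (q (\<Sum>\<alpha>\<in>I. Poly_Mapping.single (Gen \<alpha>) (x \<alpha>))) =
      (\<Sum>\<alpha>\<in>I. of_rat (x \<alpha>) * \<phi> (gen \<alpha>))" for I
  proof (induction I rule: infinite_finite_induct)
    case (insert \<alpha> I)
    have c1: "Poly_Mapping.single (Gen \<alpha>) (x \<alpha>) \<in> carrier F" using insert.prems by (intro single_closed) simp
    have c2: "(\<Sum>\<alpha>\<in>I. Poly_Mapping.single (Gen \<alpha>) (x \<alpha>)) \<in> carrier F"
      using insert.prems by (intro F_sum single_closed) auto
    have "\<phi> (q (\<Sum>\<alpha>\<in>insert \<alpha> I. Poly_Mapping.single (Gen \<alpha>) (x \<alpha>))) =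
        \<phi> (q (Poly_Mapping.single (Gen \<alpha>) (x \<alpha>)) \<oplus>\<^bsub>L\<^esub> q (\<Sum>\<alpha>\<in>I. Poly_Mapping.single (Gen \<alpha>) (x \<alpha>)))"
      using insert.hyps by (simp add: q_add[OF c1 c2])
    also have "\<dots> = \<phi> (q (Poly_Mapping.single (Gen \<alpha>) (x \<alpha>))) + \<phi> (q (\<Sum>\<alpha>\<in>I. Poly_Mapping.single (Gen \<alpha>) (x \<alpha>)))"
      using \<phi> q.hom_closed[OF c1] q.hom_closed[OF c2] by (simp add: clin_def)
    finally show ?case using insert val[of \<alpha>] by simp
  qed (simp_all add: q_zero L.clin_zero[OF \<phi>])
  then show ?thesis unfolding pvec_def by simp
qed

lemma clin_bracket_right: "\<lbrakk>clin L \<phi>; x \<in> carrier L\<rbrakk> \<Longrightarrow> clin L (\<lambda>y. \<phi> (bracket L x y))"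
  by (simp add: clin_def L.bracket_add_right L.bracket_smult_right L.bracket_closed)

lemma clin_bracket_left: "\<lbrakk>clin L \<phi>; x \<in> carrier L\<rbrakk> \<Longrightarrow> clin L (\<lambda>y. \<phi> (bracket L y x))"
  by (simp add: clin_def L.bracket_add_left L.bracket_smult_left L.bracket_closed)

text \<open>\<open>f\<close> acts on every letter of a word, so on functions
  \<open>\<phi> (rword w)\<close> it is the composition of all slots. The induction needs arbitrary
  \<open>\<phi>\<close>: stripping the first letter replaces \<open>\<phi>\<close> by its
  composition with the bracket by a vertex.\<close>

lemma endo_rword:
  assumes f: "lie_endo L f" and fg: "\<And>\<alpha>. \<alpha> \<in> S \<Longrightarrow> f (gen \<alpha>) = q (pvec (\<lambda>\<gamma>. A \<gamma> \<alpha>))"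
  shows "\<lbrakk>clin L \<phi>; set w \<subseteq> S; w \<noteq> []\<rbrakk> \<Longrightarrow>
    \<phi> (f (rword w)) = foldr (slot S (\<lambda>\<gamma> \<alpha>. of_rat (A \<gamma> \<alpha>))) [0..<length w] (\<lambda>w. \<phi> (rword w)) w"
proof (induction w arbitrary: \<phi> rule: rword.induct)
  case (2 \<alpha>)
  then show ?case by (simp add: fg clin_q_pvec slot_def)
next
  case (3 \<alpha> \<beta> w)
  let ?T = "slot S (\<lambda>\<gamma> \<alpha>. of_rat (A \<gamma> \<alpha>))" and ?w = "\<beta> # w" and ?\<Phi> = "\<lambda>w. \<phi> (rword w)"
  have \<alpha>: "\<alpha> \<in> S" and w: "set ?w \<subseteq> S" using 3 by auto
  have uc: "rword ?w \<in> carrier L" using rword_closed[OF w] .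
  have fu: "f (rword ?w) \<in> carrier L" using lie_endoD(1)[OF f uc] .
  have step: "\<phi> (bracket L (gen \<gamma>) (f (rword ?w))) = foldr ?T (map Suc [0..<length ?w]) ?\<Phi> (\<gamma> # ?w)"
    if \<gamma>: "\<gamma> \<in> S" for \<gamma>
  proof -
    have "\<phi> (bracket L (gen \<gamma>) (f (rword ?w))) =
        foldr ?T [0..<length ?w] (\<lambda>w. \<phi> (bracket L (gen \<gamma>) (rword w))) ?w"
      by (rule "3.IH"[OF clin_bracket_right[OF "3.prems"(1) gen_closed[OF \<gamma>]] w]) simp
    also have "\<dots> = foldr ?T [0..<length ?w] (\<lambda>w. ?\<Phi> (\<gamma> # w)) ?w"
    proof (rule slot_foldr_cong[OF _ w])
      fix v :: "'v list" assume "length v = length ?w"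
      then have v: "v \<noteq> []" by auto
      show "\<phi> (bracket L (gen \<gamma>) (rword v)) = \<phi> (rword (\<gamma> # v))" by (simp only: rword_Cons[OF v])
    qed
    also have "\<dots> = foldr ?T (map Suc [0..<length ?w]) ?\<Phi> (\<gamma> # ?w)"
      by (rule slot_foldr_Cons[symmetric])
    finally show ?thesis .
  qed
  have "f (rword (\<alpha> # ?w)) = bracket L (q (pvec (\<lambda>\<gamma>. A \<gamma> \<alpha>))) (f (rword ?w))"
    using lie_endoD(4)[OF f gen_closed[OF \<alpha>] uc] fg[OF \<alpha>] by simp
  then have "\<phi> (f (rword (\<alpha> # ?w))) = (\<Sum>\<gamma>\<in>S. of_rat (A \<gamma> \<alpha>) * \<phi> (bracket L (gen \<gamma>) (f (rword ?w))))"
    using clin_q_pvec[OF clin_bracket_left[OF "3.prems"(1) fu]] by simp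
  also have "\<dots> = (\<Sum>\<gamma>\<in>S. of_rat (A \<gamma> \<alpha>) * foldr ?T (map Suc [0..<length ?w]) ?\<Phi> (\<gamma> # ?w))"
    by (intro sum.cong refl) (simp only: step)
  also have "\<dots> = foldr ?T (0 # map Suc [0..<length ?w]) ?\<Phi> (\<alpha> # ?w)"
    unfolding foldr.simps o_def slot_def[of S _ 0] by simp
  also have "0 # map Suc [0..<length ?w] = [0..<length (\<alpha> # ?w)]"
    using upt_conv_Cons[of 0 "length (\<alpha> # ?w)"] by (simp only: map_Suc_upt length_Cons zero_less_Suc)
  finally show ?case .
qed simp

end

section \<open>A hyperbolic automorphism\<close>

locale companion_data = graph_nilpotent S E c for S :: "'v set" and E c +
  fixes a :: "'v \<Rightarrow> int" and r :: "'v \<Rightarrow> real" and b :: "'v set \<Rightarrow> 'v" and \<sigma> :: "'v \<Rightarrow> 'v"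
  assumes big: "\<forall>l\<in>\<Lambda>. card l > 1"
    and edges: "\<forall>e\<in>quotient_edges S E. (\<Sum>l\<in>e. card l) > c"
    and b: "\<And>l. l \<in> \<Lambda> \<Longrightarrow> b l \<in> l \<and> a (b l) = 0"
    and r: "\<And>l. l \<in> \<Lambda> \<Longrightarrow> (\<Prod>i\<in>l. [:- of_int (a i), 1:]) + 1 = (\<Prod>i\<in>l. [:- r i, 1:])"
    and indep: "\<And>e l i j. \<lbrakk>(\<Sum>i\<in>S. e i) \<le> c; \<bar>\<Prod>i\<in>S. r i ^ e i\<bar> = 1; l \<in> \<Lambda>; i \<in> l; j \<in> l\<rbrakk>
           \<Longrightarrow> (e i :: nat) = e j"
    and \<sigma>: "\<And>l \<alpha>. \<lbrakk>l \<in> \<Lambda>; \<alpha> \<in> l\<rbrakk> \<Longrightarrow> \<sigma> \<alpha> \<in> l"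
    and \<sigma>_bij: "\<And>l \<alpha>. \<lbrakk>l \<in> \<Lambda>; \<alpha> \<in> l\<rbrakk> \<Longrightarrow> bij_betw (\<lambda>j. (\<sigma> ^^ j) \<alpha>) {..<card l} l"
    and \<sigma>_card: "\<And>l \<alpha>. \<lbrakk>l \<in> \<Lambda>; \<alpha> \<in> l\<rbrakk> \<Longrightarrow> (\<sigma> ^^ card l) \<alpha> = \<alpha>"
begin

text \<open>On a component \<open>v\<^sub>1, \<dots>, v\<^sub>n = b l\<close>, numbered cyclically by \<open>\<sigma>\<close>, the matrix is
  \<open>v\<^sub>j \<mapsto> a(v\<^sub>j) v\<^sub>j + v\<^sub>j\<^sub>+\<^sub>1\<close> for \<open>j < n\<close> and \<open>v\<^sub>n \<mapsto> - v\<^sub>1\<close>. Going once around the cycle shows that it is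
  annihilated by \<open>\<Prod>(x - a(v\<^sub>j)) + 1\<close>, the polynomial with the roots \<open>r(v\<^sub>j)\<close>.\<close>

definition sgn_at :: "'v \<Rightarrow> rat" where "sgn_at \<alpha> = (if \<alpha> \<in> b ` \<Lambda> then - 1 else 1)"

definition companion :: "'v \<Rightarrow> 'v \<Rightarrow> rat" where
  "companion \<gamma> \<alpha> = (if \<alpha> \<in> S then (if \<gamma> = \<alpha> then of_int (a \<alpha>) else 0) + (if \<gamma> = \<sigma> \<alpha> then sgn_at \<alpha> else 0) else 0)"

lemma successor_closed: assumes "\<alpha> \<in> S" shows "\<sigma> \<alpha> \<in> S"
proof -
  obtain l where l: "l \<in> \<Lambda>" "\<alpha> \<in> l" using in_component[OF assms] .
  show ?thesis using \<sigma>[OF l] component(1)[OF l(1)] by blast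
qed

lemma companion_support: assumes "companion \<gamma> \<alpha> \<noteq> 0" shows "(\<alpha>, \<gamma>) \<in> R"
proof -
  have S: "\<alpha> \<in> S" using assms by (auto simp: companion_def split: if_splits)
  obtain l where l: "l \<in> \<Lambda>" "\<alpha> \<in> l" using in_component[OF S] .
  have "\<gamma> \<in> l" using assms l \<sigma>[OF l] by (auto simp: companion_def split: if_splits)
  then show ?thesis using component(4)[OF l] by simp
qed

lemma sgn_at_iff: assumes l: "l \<in> \<Lambda>" "\<alpha> \<in> l" shows "sgn_at \<alpha> = (if \<alpha> = b l then - 1 else 1)"
proof -
  have "\<alpha> \<in> b ` \<Lambda> \<longleftrightarrow> \<alpha> = b l"
  proof
    assume "\<alpha> \<in> b ` \<Lambda>"
    then obtain l' where l': "l' \<in> \<Lambda>" "\<alpha> = b l'" by blast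
    then have "\<alpha> \<in> l'" using b[OF l'(1)] by simp
    then show "\<alpha> = b l" using component(5)[OF l(1) l'(1) l(2)] l'(2) by simp
  qed (use l in blast)
  then show ?thesis by (simp add: sgn_at_def)
qed

lemma q_companion:
  assumes "\<alpha> \<in> S"
  shows "q (pvec (\<lambda>\<gamma>. companion \<gamma> \<alpha>)) = of_int (a \<alpha>) \<odot>\<^bsub>L\<^esub> gen \<alpha> \<oplus>\<^bsub>L\<^esub> sgn_at \<alpha> \<odot>\<^bsub>L\<^esub> gen (\<sigma> \<alpha>)"
proof -
  have "pvec (\<lambda>\<gamma>. companion \<gamma> \<alpha>) = (\<Sum>\<gamma>\<in>S. (if \<gamma> = \<alpha> then fscale (of_int (a \<alpha>)) (fgen \<gamma>) else 0)
      + (if \<gamma> = \<sigma> \<alpha> then fscale (sgn_at \<alpha>) (fgen \<gamma>) else 0))"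
    unfolding pvec_def
    by (intro sum.cong refl poly_mapping_eqI)
      (use assms in \<open>auto simp: companion_def lookup_add fgen_def lookup_single when_def\<close>)
  also have "\<dots> = fscale (of_int (a \<alpha>)) (fgen \<alpha>) + fscale (sgn_at \<alpha>) (fgen (\<sigma> \<alpha>))"
    using finS assms successor_closed[OF assms] by (simp add: sum.distrib)
  finally have "pvec (\<lambda>\<gamma>. companion \<gamma> \<alpha>) = fscale (of_int (a \<alpha>)) (fgen \<alpha>) + fscale (sgn_at \<alpha>) (fgen (\<sigma> \<alpha>))" .
  then show ?thesis
    using assms successor_closed[OF assms] by (simp add: q_add F_scale q_scale fgen_closed gen_def)
qed

context
  fixes f
  assumes f: "lie_endo L f" and fg: "\<And>\<alpha>. \<alpha> \<in> S \<Longrightarrow> f (gen \<alpha>) = q (pvec (\<lambda>\<gamma>. companion \<gamma> \<alpha>))"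
begin

lemma
  shows image_add: "\<lbrakk>x \<in> f ` carrier L; y \<in> f ` carrier L\<rbrakk> \<Longrightarrow> x \<oplus>\<^bsub>L\<^esub> y \<in> f ` carrier L"
    and image_smult: "x \<in> f ` carrier L \<Longrightarrow> k \<odot>\<^bsub>L\<^esub> x \<in> f ` carrier L"
    and image_bracket: "\<lbrakk>x \<in> f ` carrier L; y \<in> f ` carrier L\<rbrakk> \<Longrightarrow> bracket L x y \<in> f ` carrier L"
proof -
  assume "x \<in> f ` carrier L" "y \<in> f ` carrier L"
  then obtain x' y' where 1: "x = f x'" "x' \<in> carrier L" "y = f y'" "y' \<in> carrier L" by blast
  have "f (x' \<oplus>\<^bsub>L\<^esub> y') = x \<oplus>\<^bsub>L\<^esub> y" "f (bracket L x' y') = bracket L x y"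
    using lie_endoD(2,4)[OF f 1(2,4)] 1 by simp_all
  then show "x \<oplus>\<^bsub>L\<^esub> y \<in> f ` carrier L" "bracket L x y \<in> f ` carrier L"
    using 1 L.a_closed[OF 1(2,4)] L.bracket_closed[OF 1(2,4)] by (metis imageI)+
next
  assume "x \<in> f ` carrier L"
  then obtain x' where 1: "x = f x'" "x' \<in> carrier L" by blast
  have "f (k \<odot>\<^bsub>L\<^esub> x') = k \<odot>\<^bsub>L\<^esub> x" using lie_endoD(3)[OF f 1(2)] 1 by simp
  moreover have "k \<odot>\<^bsub>L\<^esub> x' \<in> carrier L" using 1(2) by (intro L.smult_closed) simp_all
  ultimately show "k \<odot>\<^bsub>L\<^esub> x \<in> f ` carrier L" by (metis imageI)
qed

text \<open>Solve the defining equation of \<open>companion\<close> for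
  \<open>gen (\<sigma> \<alpha>)\<close>, whose coefficient is a sign. The alternative
  \<open>a \<alpha> = 0\<close> starts the chain at \<open>b l\<close>.\<close>

lemma image_successor:
  assumes \<alpha>: "\<alpha> \<in> S" and i: "gen \<alpha> \<in> f ` carrier L \<or> a \<alpha> = 0"
  shows "gen (\<sigma> \<alpha>) \<in> f ` carrier L"
proof -
  have g: "gen \<alpha> \<in> carrier L" "gen (\<sigma> \<alpha>) \<in> carrier L" using gen_closed[OF \<alpha>] gen_closed[OF successor_closed[OF \<alpha>]] by simp_all
  let ?x = "of_int (a \<alpha>) \<odot>\<^bsub>L\<^esub> gen \<alpha>" and ?y = "sgn_at \<alpha> \<odot>\<^bsub>L\<^esub> gen (\<sigma> \<alpha>)"
  have c: "?x \<in> carrier L" "?y \<in> carrier L" using g by (auto intro!: L.smult_closed)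
  have fim: "?x \<oplus>\<^bsub>L\<^esub> ?y \<in> f ` carrier L" using fg[OF \<alpha>] q_companion[OF \<alpha>] g(1) by (metis imageI)
  have z: "\<zero>\<^bsub>L\<^esub> \<in> f ` carrier L" using image_smult[OF fim, of 0] c by simp
  have "?x \<in> f ` carrier L"
  proof (cases "a \<alpha> = 0")
    case True
    then show ?thesis using z g(1) by simp
  next
    case False
    then show ?thesis using i image_smult by blast
  qed
  then have "(- 1) \<odot>\<^bsub>L\<^esub> ?x \<in> f ` carrier L" by (rule image_smult)
  then have "(- 1) \<odot>\<^bsub>L\<^esub> ?x \<oplus>\<^bsub>L\<^esub> (?x \<oplus>\<^bsub>L\<^esub> ?y) \<in> f ` carrier L" using image_add fim by blast
  also have "(- 1) \<odot>\<^bsub>L\<^esub> ?x \<oplus>\<^bsub>L\<^esub> (?x \<oplus>\<^bsub>L\<^esub> ?y) = ?y"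
    using c by (simp only: L.smult_minus_one L.r_neg1)
  finally have "sgn_at \<alpha> \<odot>\<^bsub>L\<^esub> ?y \<in> f ` carrier L" by (rule image_smult)
  also have "sgn_at \<alpha> \<odot>\<^bsub>L\<^esub> ?y = (sgn_at \<alpha> * sgn_at \<alpha>) \<odot>\<^bsub>L\<^esub> gen (\<sigma> \<alpha>)"
    using L.smult_assoc1[of "sgn_at \<alpha>" "sgn_at \<alpha>" "gen (\<sigma> \<alpha>)"] g(2) by simp
  also have "\<dots> = gen (\<sigma> \<alpha>)" using L.smult_one[OF g(2)] by (simp add: sgn_at_def)
  finally show ?thesis .
qed

lemma companion_surjective: "f ` carrier L = carrier L"
proof
  show "f ` carrier L \<subseteq> carrier L" using lie_endoD(1)[OF f] by blast
  show "carrier L \<subseteq> f ` carrier L"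
  proof
    fix X assume "X \<in> carrier L"
    then show "X \<in> f ` carrier L"
    proof (induction rule: L_induct)
      case (gen \<alpha>)
      obtain l where l: "l \<in> \<Lambda>" "\<alpha> \<in> l" using in_component[OF gen] .
      have bl: "b l \<in> l" "a (b l) = 0" using b[OF l(1)] by auto
      have mem: "(\<sigma> ^^ j) (b l) \<in> l" for j
        by (induction j) (use bl \<sigma>[OF l(1)] in auto)
      have im: "gen ((\<sigma> ^^ Suc j) (b l)) \<in> f ` carrier L" for j
      proof (induction j)
        case 0
        show ?case using image_successor[of "b l"] bl component(1)[OF l(1)] by auto
      next
        case (Suc j)
        then show ?case using image_successor[of "(\<sigma> ^^ Suc j) (b l)"] mem[of "Suc j"] component(1)[OF l(1)] by auto
      qed
      obtain j where j: "\<alpha> = (\<sigma> ^^ j) (b l)" using \<sigma>_bij[OF l(1) bl(1)] l(2) by (auto simp: bij_betw_def)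
      show ?case
      proof (cases j)
        \<comment> \<open>The starting point \<open>b l\<close> itself is only reached after a
          complete turn.\<close>
        case 0
        have "card l > 0" using component(2,3)[OF l(1)] by (simp add: card_gt_0_iff)
        then have "\<alpha> = (\<sigma> ^^ Suc (card l - 1)) (b l)" using \<sigma>_card[OF l(1) bl(1)] j 0 by simp
        then show ?thesis using im by metis
      next
        case (Suc n)
        then show ?thesis using im j by metis
      qed
    next
      case zero
      have "f \<zero>\<^bsub>L\<^esub> \<in> f ` carrier L" by (rule imageI) simp
      moreover have "f \<zero>\<^bsub>L\<^esub> = \<zero>\<^bsub>L\<^esub>"
        using lie_endoD(3)[OF f L.zero_closed, of 0] lie_endoD(1)[OF f L.zero_closed] by simp
      ultimately show ?case by simp
    qed (simp_all add: image_add image_smult image_bracket)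
  qed
qed

text \<open>An eigenvalue \<open>z\<close> gives a functional \<open>\<phi>\<close> and a word with
  \<open>\<phi> (rword w) \<noteq> 0\<close>. On functions of words \<open>f\<close> is the
  composition of the slots, and each slot is annihilated by the polynomial whose roots are the
  \<open>r \<beta>\<close> of the component of its letter. A simultaneous eigenvector then writes
  \<open>z\<close> with one root per letter.\<close>

lemma companion_eigenvalue:
  assumes M: "matrix_of L f M" and ev: "eigenvalue (map_mat of_rat M :: complex mat) z"
  shows "\<exists>w \<beta>. set w \<subseteq> S \<and> w \<noteq> [] \<and> length w \<le> c \<and> (\<forall>i<length w. (w ! i, \<beta> i) \<in> R) \<and>
    z = (\<Prod>i<length w. of_real (r (\<beta> i))) \<and> (\<forall>u \<alpha> \<gamma>. w = u @ [\<alpha>, \<gamma>] \<longrightarrow> {\<alpha>, \<gamma>} \<in> E)"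
proof -
  have fh: "f \<in> LinearCombinations.module_hom rat_field L L" using f by (simp add: lie_endo_def)
  obtain \<phi> x where \<phi>: "clin L \<phi>" and x: "x \<in> carrier L" "\<phi> x \<noteq> 0"
    and eig: "\<forall>x\<in>carrier L. \<phi> (f x) = z * \<phi> x"
  proof (rule L.eigenvalue_functional[OF fh M ev])
    fix \<phi> x assume 1: "clin L \<phi>" "x \<in> carrier L" "\<phi> x \<noteq> 0"
      and 2: "\<And>x. x \<in> carrier L \<Longrightarrow> \<phi> (f x) = z * \<phi> x"
    have "\<forall>x\<in>carrier L. \<phi> (f x) = z * \<phi> x" by (rule ballI) (rule 2)
    then show thesis by (rule that[OF 1])
  qed
  obtain w where w: "set w \<subseteq> S" "w \<noteq> []" "\<phi> (rword w) \<noteq> 0" by (rule clin_nonzero_rword[OF \<phi> x])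
  have nzw: "rword w \<noteq> \<zero>\<^bsub>L\<^esub>" using w(3) L.clin_zero[OF \<phi>] by auto
  have len: "length w \<le> c" using long_rword[OF w(1)] nzw by (meson not_le)
  define k where "k = length w"
  \<comment> \<open>The annihilating polynomial of slot \<open>i\<close> depends on the component of
    the letter there. Restriction to words letterwise coherent with \<open>w\<close> fixes these
    components, and it commutes with the slots because \<open>companion\<close> stays within
    components.\<close>
  define X where "X = {v. length v = k \<and> (\<forall>i<k. (w ! i, v ! i) \<in> R)}"
  define res :: "('v list \<Rightarrow> complex) \<Rightarrow> 'v list \<Rightarrow> complex" where "res = (\<lambda>\<Psi> v. if v \<in> X then \<Psi> v else 0)"
  define Ac :: "'v \<Rightarrow> 'v \<Rightarrow> complex" where "Ac = (\<lambda>\<gamma> \<alpha>. of_rat (companion \<gamma> \<alpha>))"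
  define T where "T = slot S Ac"
  define \<Phi> where "\<Phi> = (\<lambda>w. \<phi> (rword w))"
  have linT: "lin_op (T i)" for i unfolding T_def by (rule lin_op_slot)
  have lin_res: "lin_op res" by (auto simp: lin_op_def res_def fun_eq_iff)
  have wS: "w ! i \<in> S" if "i < k" for i using w(1) that nth_mem[of i w] by (auto simp: k_def)
  have XS: "set v \<subseteq> S" if "v \<in> X" for v
    using that by (auto simp: X_def in_set_conv_nth coherent_iff[OF graph])
  have wX: "w \<in> X" using wS by (auto simp: X_def k_def coherent_iff[OF graph])
  have res_T: "res (T i \<Psi>) = T i (res \<Psi>)" if i: "i < k" for i \<Psi>
  proof
    fix v
    have iff: "v[i := \<gamma>] \<in> X \<longleftrightarrow> v \<in> X" if "companion \<gamma> (v ! i) \<noteq> 0" for \<gamma>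
    proof -
      note 1 = companion_support[OF that]
      have "(w ! i, v ! i) \<in> R \<longleftrightarrow> (w ! i, \<gamma>) \<in> R"
        using 1 coherent_trans[OF graph] coherent_sym[OF graph] by blast
      then have "(w ! j, v[i := \<gamma>] ! j) \<in> R \<longleftrightarrow> (w ! j, v ! j) \<in> R" if "j < length v" for j
        using that by (cases "j = i") simp_all
      then show ?thesis by (auto simp: X_def)
    qed
    have "Ac \<gamma> (v ! i) * res \<Psi> (v[i := \<gamma>]) = (if v \<in> X then Ac \<gamma> (v ! i) * \<Psi> (v[i := \<gamma>]) else 0)" for \<gamma>
      using iff[of \<gamma>] by (cases "companion \<gamma> (v ! i) = 0") (simp_all add: Ac_def res_def)
    then show "res (T i \<Psi>) v = T i (res \<Psi>) v"
      by (simp add: T_def slot_def res_def)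
  qed
  define comp where "comp = (\<lambda>i. SOME l. l \<in> \<Lambda> \<and> w ! i \<in> l)"
  have comp: "comp i \<in> \<Lambda> \<and> w ! i \<in> comp i" if "i < k" for i
    unfolding comp_def using in_component[OF wS[OF that]] by (metis (mono_tags, lifting) someI_ex)
  define bs where "bs = (\<lambda>i. SOME bs. set bs = comp i \<and> distinct bs)"
  have bs: "set (bs i) = comp i \<and> distinct (bs i)" if "i < k" for i
    unfolding bs_def using finite_distinct_list[OF component(3)[OF conjunct1[OF comp[OF that]]]] by (rule someI_ex)
  have "\<exists>as. (\<forall>i<k. as i \<in> set (map (\<lambda>\<beta>. complex_of_real (r \<beta>)) (bs i))) \<and> z = (\<Prod>i<k. as i)"
  proof (rule simultaneous_eigenvector[of T k _ "res \<Phi>" z])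
    show "lin_op (T i)" for i by (rule linT)
    show "T i (T j g) = T j (T i g)" for i j g unfolding T_def by (rule slot_commute)
    show "res \<Phi> \<noteq> (\<lambda>_. 0)" using wX w(3) by (auto simp: res_def \<Phi>_def fun_eq_iff)
    show "pact (T i) (\<Prod>a\<leftarrow>map (\<lambda>\<beta>. complex_of_real (r \<beta>)) (bs i). [:- a, 1:]) (res \<Phi>) = (\<lambda>_. 0)" if i: "i < k" for i
    proof -
      define l where "l = comp i"
      have l: "l \<in> \<Lambda>" "w ! i \<in> l" using comp[OF i] by (auto simp: l_def)
      let ?P = "\<Prod>\<beta>\<in>l. [:- complex_of_int (a \<beta>), 1:]"
      have "(\<Prod>a\<leftarrow>map (\<lambda>\<beta>. complex_of_real (r \<beta>)) (bs i). [:- a, 1:]) = (\<Prod>\<beta>\<in>l. [:- complex_of_real (r \<beta>), 1:])"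
        using bs[OF i] prod.distinct_set_conv_list[of "bs i" "\<lambda>\<beta>. [:- complex_of_real (r \<beta>), 1:]"]
        by (simp add: l_def o_def)
      also have "\<dots> = ?P + 1"
        by (rule shifted_product_roots(1)[OF component(3)[OF l(1)] l(2) conjunct1[OF b[OF l(1)]] conjunct2[OF b[OF l(1)]] r[OF l(1)], symmetric])
      finally have P: "(\<Prod>a\<leftarrow>map (\<lambda>\<beta>. complex_of_real (r \<beta>)) (bs i). [:- a, 1:]) = ?P + 1" .
      have zero: "pact (T i) (?P + 1) \<Phi> v = 0" if v: "v \<in> X" for v
      proof -
        have vi: "i < length v" "v ! i \<in> l" "v ! i \<in> S"
          using v i component(4)[OF l] component(1)[OF l(1)] by (auto simp: X_def)
        let ?s = "\<lambda>\<alpha>. of_rat (sgn_at \<alpha>) :: complex"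
        have bij: "bij_betw (\<lambda>j. (\<sigma> ^^ j) (v ! i)) {..<card l} l" using \<sigma>_bij[OF l(1) vi(2)] .
        have "?P = (\<Prod>j<card l. [:- complex_of_int (a ((\<sigma> ^^ j) (v ! i))), 1:])"
          by (rule prod.reindex_bij_betw[OF bij, symmetric])
        then have "pact (T i) ?P \<Phi> v = (\<Prod>j<card l. ?s ((\<sigma> ^^ j) (v ! i))) * \<Phi> (v[i := (\<sigma> ^^ card l) (v ! i)])"
          unfolding T_def
          using slot_cycle[where \<sigma> = \<sigma> and a = "\<lambda>\<alpha>. complex_of_int (a \<alpha>)" and s = ?s and A = Ac and S = S
              and i = i and w = v and \<alpha> = "v ! i" and n = "card l" and \<Phi> = \<Phi>]
            finS successor_closed vi
          by (simp add: Ac_def companion_def of_rat_add)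
        \<comment> \<open>A full turn returns the letter to its place and meets \<open>b l\<close>
          exactly once, so the unperturbed product acts as -1 and the added 1 cancels it.\<close>
        also have "(\<Prod>j<card l. ?s ((\<sigma> ^^ j) (v ! i))) = (\<Prod>\<beta>\<in>l. ?s \<beta>)"
          by (rule prod.reindex_bij_betw[OF bij])
        also have "\<dots> = (\<Prod>\<beta>\<in>l. if \<beta> = b l then - 1 else 1)"
          by (intro prod.cong refl) (simp add: sgn_at_iff[OF l(1)] of_rat_minus)
        also have "\<dots> = - 1" using component(3)[OF l(1)] b[OF l(1)] by simp
        also have "v[i := (\<sigma> ^^ card l) (v ! i)] = v" using \<sigma>_card[OF l(1) vi(2)] by simp
        finally show ?thesis by (simp add: pact_add[OF linT] pact_1[OF linT])
      qed
      have "pact (T i) (?P + 1) (res \<Phi>) = res (pact (T i) (?P + 1) \<Phi>)"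
        by (rule pact_commute[OF linT lin_res res_T[OF i]])
      also have "\<dots> = (\<lambda>_. 0)" using zero by (auto simp: res_def)
      finally show ?thesis unfolding P .
    qed
    have ind: "set is \<subseteq> {..<k} \<Longrightarrow> foldr T is (res \<Phi>) = res (foldr T is \<Phi>)" for "is"
      by (induction "is") (simp_all add: res_T)
    have "foldr T [0..<k] (res \<Phi>) = res (foldr T [0..<k] \<Phi>)" by (rule ind) auto
    moreover have "foldr T [0..<k] \<Phi> v = z * \<Phi> v" if v: "v \<in> X" for v
    proof -
      have lv: "length v = k" "v \<noteq> []" using v w(2) by (auto simp: X_def k_def)
      have "foldr T [0..<k] \<Phi> v = \<phi> (f (rword v))"
        using endo_rword[where A = companion, OF f fg \<phi> XS[OF v] lv(2)] unfolding T_def Ac_def \<Phi>_def lv(1) by simp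
      also have "\<dots> = z * \<Phi> v" unfolding \<Phi>_def by (rule bspec[OF eig rword_closed[OF XS[OF v]]])
      finally show ?thesis .
    qed
    ultimately show "foldr T [0..<k] (res \<Phi>) = (\<lambda>v. z * res \<Phi> v)" by (auto simp: res_def)
  qed
  then obtain as where as: "\<forall>i<k. as i \<in> set (map (\<lambda>\<beta>. complex_of_real (r \<beta>)) (bs i))" "z = (\<Prod>i<k. as i)"
    by blast
  have "\<forall>i. \<exists>\<beta>. i < k \<longrightarrow> \<beta> \<in> comp i \<and> as i = of_real (r \<beta>)"
    using as(1) bs by fastforce
  then obtain \<beta> where \<beta>: "\<And>i. i < k \<Longrightarrow> \<beta> i \<in> comp i \<and> as i = of_real (r (\<beta> i))" by metis
  show ?thesis
  proof (intro exI[of _ w] exI[of _ \<beta>] conjI allI impI)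
    show "set w \<subseteq> S" "w \<noteq> []" "length w \<le> c" by fact+
    show "(w ! i, \<beta> i) \<in> R" if "i < length w" for i
      using \<beta>[of i] comp[of i] component(4)[of "comp i" "w ! i" "\<beta> i"] that by (simp add: k_def)
    show "z = (\<Prod>i<length w. of_real (r (\<beta> i)))"
      unfolding as(2) k_def using \<beta> by (intro prod.cong) (simp_all add: k_def)
    show "{\<alpha>, \<gamma>} \<in> E" if "w = u @ [\<alpha>, \<gamma>]" for u \<alpha> \<gamma>
      using rword_last_edge[of u \<alpha> \<gamma>] w(1) nzw unfolding that by simp
  qed
qed

lemma root_alg_unit: assumes "\<beta> \<in> S" shows "alg_unit (of_real (r \<beta>))"
proof -
  obtain l where l: "l \<in> \<Lambda>" "\<beta> \<in> l" using in_component[OF assms] .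
  show ?thesis
    by (rule shifted_product_roots(2)[OF component(3)[OF l(1)] l(2) conjunct1[OF b[OF l(1)]] conjunct2[OF b[OF l(1)]] r[OF l(1)]])
qed

lemma companion_integer_like: assumes M: "matrix_of L f M" shows "integer_like L f"
proof -
  obtain n where Mc: "M \<in> carrier_mat n n" using M unfolding matrix_of_def by blast
  have monic: "lead_coeff (char_poly M) = 1" using degree_monic_char_poly[OF Mc] by simp
  have roots: "alg_unit z" if z: "poly (map_poly of_rat (char_poly M)) z = 0" for z :: complex
  proof -
    have Mc': "map_mat of_rat M \<in> carrier_mat n n" using Mc by simp
    have "poly (char_poly (map_mat of_rat M)) z = 0" using z by (simp only: of_rat_hom.char_poly_hom[OF Mc])
    then have "eigenvalue (map_mat of_rat M) z" using eigenvalue_root_char_poly[OF Mc'] by blast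
    from companion_eigenvalue[OF M this] obtain w \<beta>
      where \<beta>: "\<forall>i<length w. (w ! i, \<beta> i) \<in> R" and z: "z = (\<Prod>i<length w. of_real (r (\<beta> i)))"
      by blast
    show ?thesis unfolding z
      by (rule alg_unit_prod, rule root_alg_unit) (use \<beta> in \<open>auto simp: coherent_iff[OF graph]\<close>)
  qed
  show ?thesis unfolding integer_like_def
    using M rat_poly_unit_roots[OF monic roots] by blast
qed

lemma companion_hyperbolic: assumes M: "matrix_of L f M" shows "hyperbolic L f"
  unfolding hyperbolic_def
proof (intro exI[of _ M] conjI M allI impI notI)
  fix z :: complex assume ev: "eigenvalue (map_mat of_rat M) z" and z1: "cmod z = 1"
  from companion_eigenvalue[OF M ev] obtain w \<beta>
    where w: "set w \<subseteq> S" "w \<noteq> []" "length w \<le> c" and \<beta>: "\<forall>i<length w. (w ! i, \<beta> i) \<in> R"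
      and z: "z = (\<Prod>i<length w. of_real (r (\<beta> i)))"
      and last: "\<forall>u \<alpha> \<gamma>. w = u @ [\<alpha>, \<gamma>] \<longrightarrow> {\<alpha>, \<gamma>} \<in> E"
    by blast
  let ?k = "length w"
  define e where "e \<alpha> = card {i \<in> {..<?k}. \<beta> i = \<alpha>}" for \<alpha>
  have \<beta>S: "\<beta> ` {..<?k} \<subseteq> S" using \<beta> by (auto simp: coherent_iff[OF graph])
  have sum_e: "(\<Sum>\<alpha>\<in>S. e \<alpha>) = ?k"
    using sum.group[OF finite_lessThan finS \<beta>S, of "\<lambda>_. 1 :: nat"] by (simp add: e_def)
  have "(\<Prod>\<alpha>\<in>S. r \<alpha> ^ e \<alpha>) = (\<Prod>\<alpha>\<in>S. \<Prod>i\<in>{i \<in> {..<?k}. \<beta> i = \<alpha>}. r (\<beta> i))"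
    by (intro prod.cong refl) (simp add: e_def)
  also have "\<dots> = (\<Prod>i<?k. r (\<beta> i))" by (rule prod.group[OF finite_lessThan finS \<beta>S])
  finally have "z = of_real (\<Prod>\<alpha>\<in>S. r \<alpha> ^ e \<alpha>)" using z by simp
  then have abs1: "\<bar>\<Prod>\<alpha>\<in>S. r \<alpha> ^ e \<alpha>\<bar> = 1" using z1 by (simp only: norm_of_real)
  have const: "e \<alpha> = e \<alpha>'" if "l \<in> \<Lambda>" "\<alpha> \<in> l" "\<alpha>' \<in> l" for l \<alpha> \<alpha>'
    using sum_e w(3) by (intro indep[OF _ abs1 that]) simp
  \<comment> \<open>The exponents are constant on a component and positive at one of its vertices,
    so every vertex of a component met by \<open>w\<close> is used up.\<close>
  have cover: "1 \<le> e \<alpha>" if i: "i < ?k" and l: "l \<in> \<Lambda>" "w ! i \<in> l" and \<alpha>: "\<alpha> \<in> l" for i l \<alpha>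
  proof -
    have "\<beta> i \<in> l" using component(4)[OF l] \<beta> i by blast
    then have "e \<alpha> = e (\<beta> i)" by (rule const[OF l(1) \<alpha>])
    moreover have "e (\<beta> i) > 0" unfolding e_def card_gt_0_iff using i by auto
    ultimately show ?thesis by simp
  qed
  have bound: "card Y \<le> ?k" if Y: "Y \<subseteq> S" "\<And>\<alpha>. \<alpha> \<in> Y \<Longrightarrow> 1 \<le> e \<alpha>" for Y
  proof -
    have "card Y = (\<Sum>\<alpha>\<in>Y. 1)" by simp
    also have "\<dots> \<le> (\<Sum>\<alpha>\<in>Y. e \<alpha>)" by (rule sum_mono) (rule Y(2))
    also have "\<dots> \<le> (\<Sum>\<alpha>\<in>S. e \<alpha>)" using finS Y(1) by (intro sum_mono2) auto
    finally show ?thesis using sum_e by simp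
  qed
  have in_comp: "\<exists>l\<in>\<Lambda>. w ! i \<in> l" if "i < ?k" for i
    using in_component[of "w ! i"] w(1) nth_mem[OF that] by blast
  show False
  proof (cases "?k = 1")
    case True
    then obtain l where l: "l \<in> \<Lambda>" "w ! 0 \<in> l" using in_comp[of 0] by auto
    \<comment> \<open>A single letter involves no edge; here it is the condition
      \<open>card l > 1\<close> that is contradicted.\<close>
    have "card l \<le> ?k" by (rule bound[OF component(1)[OF l(1)]]) (use cover[OF _ l] True in simp)
    then show False using big l(1) True by auto
  next
    case False
    then have k2: "2 \<le> ?k" using w(2) by (cases w) (auto simp: Suc_le_eq)
    define i j where "i = ?k - 2" and "j = ?k - 1"
    have ij: "i < ?k" "j < ?k" "j = Suc i" "?k = Suc j" using k2 by (auto simp: i_def j_def)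
    have "w = take i w @ [w ! i, w ! j]"
      using ij by (metis Cons_nth_drop_Suc append_take_drop_id drop_all le_refl)
    then have edge: "{w ! i, w ! j} \<in> E" using last by blast
    obtain l where l: "l \<in> \<Lambda>" "w ! i \<in> l" using in_comp[OF ij(1)] by blast
    obtain l' where l': "l' \<in> \<Lambda>" "w ! j \<in> l'" using in_comp[OF ij(2)] by blast
    have "{l, l'} \<in> quotient_edges S E" unfolding quotient_edges_def using l l' edge by blast
    then have gt: "(\<Sum>l\<in>{l, l'}. card l) > c" using edges by blast
    \<comment> \<open>For a loop the set \<open>{l, l'}\<close> has one element, and both sides are
      \<open>card l\<close>.\<close>
    have "(\<Sum>l\<in>{l, l'}. card l) = card (l \<union> l')"
    proof (cases "l = l'")
      case False
      then have "l \<inter> l' = {}" using component(5)[OF l(1) l'(1)] by blast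
      then show ?thesis using False component(3)[OF l(1)] component(3)[OF l'(1)] by (simp add: card_Un_disjoint)
    qed simp
    moreover have "card (l \<union> l') \<le> ?k"
    proof (rule bound)
      show "l \<union> l' \<subseteq> S" using component(1)[OF l(1)] component(1)[OF l'(1)] by blast
      show "1 \<le> e \<alpha>" if "\<alpha> \<in> l \<union> l'" for \<alpha>
        using that cover[OF ij(1) l, of \<alpha>] cover[OF ij(2) l', of \<alpha>] by blast
    qed
    ultimately show False using gt w(3) by simp
  qed
qed

lemma companion_anosov: "anosov L"
proof -
  have fh: "f \<in> LinearCombinations.module_hom rat_field L L" using f by (simp add: lie_endo_def)
  obtain M where M: "matrix_of L f M" by (rule matrix_exists[OF fh])
  have "lie_automorphism L f"
    using f surjective_imp_bij[OF fh companion_surjective] by (simp add: lie_automorphism_def lie_endo_def)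
  then show ?thesis
    unfolding anosov_def
    using nilpotent_lie_algebra fin_dim companion_hyperbolic[OF M] companion_integer_like[OF M] by blast
qed

end

end

lemma (in graph_nilpotent) conditions_imp_anosov:
  assumes big: "\<forall>l\<in>\<Lambda>. card l > 1" and edges: "\<forall>e\<in>quotient_edges S E. (\<Sum>l\<in>e. card l) > c"
  shows "anosov L"
proof (rule multiplicatively_independent_units[OF finS components_partition, of c])
  show "card l > 1" if "l \<in> \<Lambda>" for l using big that by blast
  fix a :: "'v \<Rightarrow> int" and r :: "'v \<Rightarrow> real" and b
  assume b: "\<And>l. l \<in> \<Lambda> \<Longrightarrow> b l \<in> l \<and> a (b l) = 0"
    and r: "\<And>l. l \<in> \<Lambda> \<Longrightarrow> (\<Prod>i\<in>l. [:- of_int (a i), 1:]) + 1 = (\<Prod>i\<in>l. [:- r i, 1:])"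
    and indep: "\<And>e l i j. \<lbrakk>(\<Sum>i\<in>S. e i) \<le> c; \<bar>\<Prod>i\<in>S. r i ^ e i\<bar> = 1; l \<in> \<Lambda>; i \<in> l; j \<in> l\<rbrakk>
       \<Longrightarrow> (e i :: nat) = e j"
  show ?thesis
  proof (rule cyclic_successor[OF components_partition finS])
    fix \<sigma> assume \<sigma>: "\<And>l \<alpha>. \<lbrakk>l \<in> \<Lambda>; \<alpha> \<in> l\<rbrakk> \<Longrightarrow> \<sigma> \<alpha> \<in> l"
      and bij: "\<And>l \<alpha>. \<lbrakk>l \<in> \<Lambda>; \<alpha> \<in> l\<rbrakk> \<Longrightarrow> bij_betw (\<lambda>j. (\<sigma> ^^ j) \<alpha>) {..<card l} l"
      and per: "\<And>l \<alpha>. \<lbrakk>l \<in> \<Lambda>; \<alpha> \<in> l\<rbrakk> \<Longrightarrow> (\<sigma> ^^ card l) \<alpha> = \<alpha>"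
    interpret companion_data S E c a r b \<sigma>
      by (intro companion_data.intro companion_data_axioms.intro graph_nilpotent_axioms)
        (fact big edges b r indep \<sigma> bij per)+
    show ?thesis
    proof (rule block_endo[of companion])
      show "(\<alpha>, \<gamma>) \<in> R" if "companion \<gamma> \<alpha> \<noteq> 0" for \<alpha> \<gamma> by (rule companion_support[OF that])
      fix f assume f: "lie_endo L f" and fg: "\<And>\<alpha>. \<alpha> \<in> S \<Longrightarrow> f (gen \<alpha>) = q (pvec (\<lambda>\<gamma>. companion \<gamma> \<alpha>))"
      show ?thesis by (rule companion_anosov[OF f]) (rule fg)
    qed
  qed
qed

theorem corollary4p8:
  fixes S :: "'v set" and E :: "'v set set" and c :: nat
  assumes "simple_graph S E" and "c > 1"
  shows "anosov (nilpotent_graph_lie S E c) \<longleftrightarrow>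
           (\<forall>l\<in>coherent_components S E. card l > 1) \<and>
           (\<forall>e\<in>quotient_edges S E. (\<Sum>l\<in>e. card l) > c)"
proof -
  interpret graph_nilpotent S E c using assms by unfold_locales
  show ?thesis using anosov_imp_conditions conditions_imp_anosov by blast
qed

end
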